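(* Let $n\ge 1$. For each $1\le i\le n$ and every $\lambda=(\lambda_1:\lambda_2)\in\mathbb{P}^1(\mathbb{C})$, the open relativistic Toda Hamiltonian $H_i$ (expanded in cluster coordinates) equals the cluster character of the module $M_i^\lambda$: $$H_i = CC(M_i^\lambda)\quad\text{in } \mathbb{C}[x_1^{\pm1},\dots,x_{2n}^{\pm1}].$$
   Context: **The quiver with potential.** $Q_n$ has vertices $1,\dots,2n$ and arrows: two arrows $a_i,b_i:2i-1\to 2i$ for $1\le i\le n$; $\ell_i:2i\to 2i-3$ for $2\le i\le n$; $r_i:2i\to 2i+1$ for $1\le i\le n-1$. Paths are composed right to left. The potential is $W_n=\sum_{i=1}^{n-1}(a_i\ell_{i+1}b_{i+1}r_i-b_i\ell_{i+1}a_{i+1}r_i)$. The Jacobian algebra $J=J(Q_n,W_n)$ is the completed path algebra modulo the closed ideal generated by all cyclic derivatives of $W_n$; these are $\ell_{i+1}b_{i+1}r_i-r_{i-1}b_{i-1}\ell_i$, $r_{i-1}a_{i-1}\ell_i-\ell_{i+1}a_{i+1}r_i$, $b_ir_{i-1}a_{i-1}-a_ir_{i-1}b_{i-1}$, $a_i\ell_{i+1}b_{i+1}-b_i\ell_{i+1}a_{i+1}$ (terms containing nonexistent arrows are $0$). Modules are finite-dimensional left $J$-modules, i.e. representations of $Q_n$ satisfying these relations. $P_v$ and $I_v$ denote the projective cover and injective envelope of the simple module at vertex $v$; $P_v$ is spanned by classes of paths with source $v$, and $(P_v)_w$ by those ending at $w$. **The modules.** For $\lambda=(\lambda_1:\lambda_2)\in\mathbb{P}^1$,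 $M_i^\lambda$ is the cokernel of the map $P_{2i}\to P_{2i-1}$ sending the generator of $P_{2i}$ to $\lambda_1a_i+\lambda_2b_i\in(P_{2i-1})_{2i}$. **Cluster characters.** Let $Q_{ij}$ be the number of arrows $i\to j$ minus the number of arrows $j\to i$ in $Q_n$, and $y_i=\prod_{j}x_j^{Q_{ij}}$. For a $J$-module $M$ with minimal injective copresentation $0\to M\to\bigoplus_jI_j^{\oplus b_j}\to\bigoplus_jI_j^{\oplus a_j}$, put $x^{-\mathrm{coind}\,M}=\prod_jx_j^{a_j-b_j}$. Then $$CC(M)=x^{-\mathrm{coind}\,M}\sum_{e\in\mathbb{N}^{2n}}\chi(\mathrm{Gr}_eM)\,y^e,$$ where $\mathrm{Gr}_eM$ is the quiver Grassmannian of subrepresentations of dimension vector $e$, $\chi$ is the topological Euler characteristic, and $y^e=\prod_jy_j^{e_j}$. **The Hamiltonians.** The open relativistic Toda system has phase space $SL_{n+1}^{c,c}/\mathrm{Ad}\,H$, where $c=s_1\cdots s_n$, $SL_{n+1}^{c,c}=B_+\dot cB_+\cap B_-\dot cB_-$, and $H$ is the diagonal torus; its Hamiltonians $H_1,\dots,H_n$ are the restrictions of the characters of the fundamental representations $\bigwedge^k\mathbb{C}^{n+1}$. In the cluster chart used here a point is represented by the matrix $$g=E_1\,y_1^{\omega_1^\vee}F_1\,y_2^{\omega_1^\vee}E_2\,y_3^{\omega_2^\vee}F_2\,y_4^{\omega_2^\vee}\cdots E_n\,y_{2n-1}^{\omega_n^\vee}F_n\,y_{2n}^{\omega_n^\vee},$$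 where $E_i$ (resp. $F_i$) is the $(n+1)\times(n+1)$ identity matrix plus the matrix unit in position $(i,i+1)$ (resp. $(i+1,i)$), and $y^{\omega_i^\vee}=y^{-i/(n+1)}\,\mathrm{diag}(y,\dots,y,1,\dots,1)$ with $i$ entries equal to $y$. After substituting $y_i=\prod_jx_j^{Q_{ij}}$, the total scalar prefactor $\prod_i(y_{2i-1}y_{2i})^{-i/(n+1)}$ is taken to be the monomial $x_{2n-1}x_{2n}^{-1}$ (exponents in $x$ computed linearly). Thus $H_k=(x_{2n-1}x_{2n}^{-1})^k\,\mathrm{tr}\bigwedge^k(g')\in\mathbb{C}[x_1^{\pm1},\dots,x_{2n}^{\pm1}]$, where $g'$ is the product $g$ with every factor $y^{\omega_i^\vee}$ replaced by $\mathrm{diag}(y,\dots,y,1,\dots,1)$ ($i$ entries $y$). *)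

theory Defs
  imports
    "HOL-Homology.Homology"
    "HOL-Algebra.QuotRing"
    "HOL-Library.Poly_Mapping"
    "Graph_Theory.Arc_Walk"
    "Jordan_Normal_Form.VS_Connect"
    "Jordan_Normal_Form.DL_Submatrix"
begin

hide_const (open) Multiset.mult Polynomial.smult Modules.module

section \<open>Completed path algebras and Jacobian algebras\<close>

text \<open>
  A quiver is a multi-digraph. A path is a pair \<open>(u, p)\<close> of its source \<open>u\<close> and its list of arrows
  \<open>p\<close> in the order in which they are traversed; \<open>(u, [])\<close> is the trivial path at \<open>u\<close>.
  Written right to left, \<open>(u, [x, y, z])\<close> is the path \<open>z y x\<close>.
\<close>

type_synonym ('v, 'e) quiver = "('v, 'e) pre_digraph"
type_synonym ('v, 'e) qpath = "'v \<times> 'e list"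

abbreviation qpath_end :: "('v, 'e) quiver \<Rightarrow> 'v \<Rightarrow> 'e list \<Rightarrow> 'v" where
  "qpath_end Q u p \<equiv> last (pre_digraph.awalk_verts Q u p)"

definition qpaths :: "('v, 'e) quiver \<Rightarrow> ('v, 'e) qpath set" where
  "qpaths Q = {(u, p). \<exists>v. pre_digraph.awalk Q u p v}"

text \<open>
  Elements of the completed path algebra are formal (possibly infinite) linear combinations of
  paths. The product \<open>f \<otimes> g\<close> is right-to-left composition: first a path of \<open>g\<close>, then one of \<open>f\<close>.
\<close>

definition complete_path_algebra :: "('v, 'e) quiver \<Rightarrow> (('v, 'e) qpath \<Rightarrow> complex) ring" where
  "complete_path_algebra Q =
     \<lparr> carrier = {f. \<forall>x. x \<notin> qpaths Q \<longrightarrow> f x = 0},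
       mult = (\<lambda>f g (u, r). \<Sum>k\<le>length r.
                 f (qpath_end Q u (take k r), drop k r) * g (u, take k r)),
       one = (\<lambda>(u, p). if u \<in> verts Q \<and> p = [] then 1 else 0),
       zero = (\<lambda>x. 0),
       add = (\<lambda>f g x. f x + g x) \<rparr>"

definition path_elem :: "'v \<Rightarrow> 'e list \<Rightarrow> ('v, 'e) qpath \<Rightarrow> complex" where
  "path_elem u p = (\<lambda>x. if x = (u, p) then 1 else 0)"

definition vertex_elem :: "'v \<Rightarrow> ('v, 'e) qpath \<Rightarrow> complex" where
  "vertex_elem v = path_elem v []"

definition arrow_elem :: "('v, 'e) quiver \<Rightarrow> 'e \<Rightarrow> ('v, 'e) qpath \<Rightarrow> complex" where
  "arrow_elem Q \<alpha> = path_elem (tail Q \<alpha>) [\<alpha>]"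

text \<open>
  \<open>\<partial>\<^sub>\<alpha>\<close> sends a cycle to the sum, over the occurrences of \<open>\<alpha>\<close> in it, of the path obtained by
  starting right after that occurrence and going once around to just before it. Hence the
  coefficient of \<open>p\<close> in \<open>\<partial>\<^sub>\<alpha> W\<close> collects the coefficients in \<open>W\<close> of all cycles
  \<open>p\<^sub>2 @ [\<alpha>] @ p\<^sub>1\<close> with \<open>p = p\<^sub>1 @ p\<^sub>2\<close>.
\<close>

definition cyclic_derivative ::
  "('v, 'e) quiver \<Rightarrow> (('v, 'e) qpath \<Rightarrow> complex) \<Rightarrow> 'e \<Rightarrow> ('v, 'e) qpath \<Rightarrow> complex" where
  "cyclic_derivative Q W \<alpha> = (\<lambda>(u, p).
     if u = head Q \<alpha>
     then \<Sum>m\<le>length p. W (qpath_end Q u (take m p), drop m p @ [\<alpha>] @ take m p)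
     else 0)"

text \<open>Closure in the topology with basis of neighbourhoods of zero the powers of the arrow ideal.\<close>

definition arrow_adic_closure ::
  "('v, 'e) quiver \<Rightarrow> (('v, 'e) qpath \<Rightarrow> complex) set \<Rightarrow> (('v, 'e) qpath \<Rightarrow> complex) set" where
  "arrow_adic_closure Q S =
     {f \<in> carrier (complete_path_algebra Q).
        \<forall>N. \<exists>g\<in>S. \<forall>u p. length p < N \<longrightarrow> f (u, p) = g (u, p)}"

definition jacobian_ideal ::
  "('v, 'e) quiver \<Rightarrow> (('v, 'e) qpath \<Rightarrow> complex) \<Rightarrow> (('v, 'e) qpath \<Rightarrow> complex) set" where
  "jacobian_ideal Q W =
     arrow_adic_closure Q (genideal (complete_path_algebra Q) (cyclic_derivative Q W ` arcs Q))"

definition jacobian_algebra ::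
  "('v, 'e) quiver \<Rightarrow> (('v, 'e) qpath \<Rightarrow> complex) \<Rightarrow> (('v, 'e) qpath \<Rightarrow> complex) set ring" where
  "jacobian_algebra Q W = complete_path_algebra Q Quot jacobian_ideal Q W"

definition jacobian_class ::
  "('v, 'e) quiver \<Rightarrow> (('v, 'e) qpath \<Rightarrow> complex) \<Rightarrow> (('v, 'e) qpath \<Rightarrow> complex) \<Rightarrow>
     (('v, 'e) qpath \<Rightarrow> complex) set" where
  "jacobian_class Q W f = jacobian_ideal Q W +>\<^bsub>complete_path_algebra Q\<^esub> f"


section \<open>Representations and modules\<close>

text \<open>
  The fields \<open>mult\<close> and \<open>one\<close> that the record type \<open>module\<close> inherits from \<open>ring\<close> play no role for
  vector spaces; below they are filled with arbitrary values.
\<close>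

record ('a, 'v, 'e) quiver_rep =
  rep_space :: "'v \<Rightarrow> (complex, 'a) module"
  rep_map :: "'e \<Rightarrow> 'a \<Rightarrow> 'a"

definition representation :: "('v, 'e) quiver \<Rightarrow> ('a, 'v, 'e) quiver_rep \<Rightarrow> bool" where
  "representation Q M \<longleftrightarrow>
     (\<forall>v\<in>verts Q. vectorspace class_ring (rep_space M v)) \<and>
     (\<forall>\<alpha>\<in>arcs Q. rep_map M \<alpha> \<in>
        module_hom class_ring (rep_space M (tail Q \<alpha>)) (rep_space M (head Q \<alpha>)))"

text \<open>
  \<open>\<rho>\<close> is required to be a finite linear combination of paths, as are the cyclic derivatives of a
  polynomial potential. \<open>fold (rep_map M) p\<close> is the action of the path \<open>p\<close>.
\<close>

definition satisfies_relation ::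
  "('v, 'e) quiver \<Rightarrow> ('a, 'v, 'e) quiver_rep \<Rightarrow> (('v, 'e) qpath \<Rightarrow> complex) \<Rightarrow> bool" where
  "satisfies_relation Q M \<rho> \<longleftrightarrow>
     (\<forall>u\<in>verts Q. \<forall>v\<in>verts Q. \<forall>x\<in>carrier (rep_space M u).
        (\<Oplus>\<^bsub>rep_space M v\<^esub>p\<in>{p. pre_digraph.awalk Q u p v \<and> \<rho> (u, p) \<noteq> 0}.
           \<rho> (u, p) \<odot>\<^bsub>rep_space M v\<^esub> fold (rep_map M) p x) = \<zero>\<^bsub>rep_space M v\<^esub>)"

definition jacobian_module ::
  "('v, 'e) quiver \<Rightarrow> (('v, 'e) qpath \<Rightarrow> complex) \<Rightarrow> ('a, 'v, 'e) quiver_rep \<Rightarrow> bool" where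
  "jacobian_module Q W M \<longleftrightarrow>
     representation Q M \<and>
     (\<forall>v\<in>verts Q. vectorspace.fin_dim class_ring (rep_space M v)) \<and>
     (\<forall>\<alpha>\<in>arcs Q. satisfies_relation Q M (cyclic_derivative Q W \<alpha>))"

definition rep_hom ::
  "('v, 'e) quiver \<Rightarrow> ('a, 'v, 'e) quiver_rep \<Rightarrow> ('b, 'v, 'e) quiver_rep \<Rightarrow> ('v \<Rightarrow> 'a \<Rightarrow> 'b) set" where
  "rep_hom Q M N =
     {h. (\<forall>v\<in>verts Q. h v \<in> module_hom class_ring (rep_space M v) (rep_space N v)) \<and>
         (\<forall>\<alpha>\<in>arcs Q. \<forall>x\<in>carrier (rep_space M (tail Q \<alpha>)).
            h (head Q \<alpha>) (rep_map M \<alpha> x) = rep_map N \<alpha> (h (tail Q \<alpha>) x))}"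

definition rep_mono ::
  "('v, 'e) quiver \<Rightarrow> ('a, 'v, 'e) quiver_rep \<Rightarrow> ('b, 'v, 'e) quiver_rep \<Rightarrow> ('v \<Rightarrow> 'a \<Rightarrow> 'b) set" where
  "rep_mono Q M N =
     {h \<in> rep_hom Q M N. \<forall>v\<in>verts Q. inj_on (h v) (carrier (rep_space M v))}"

definition rep_image :: "('a, 'v, 'e) quiver_rep \<Rightarrow> ('v \<Rightarrow> 'a \<Rightarrow> 'b) \<Rightarrow> 'v \<Rightarrow> 'b set" where
  "rep_image M h v = h v ` carrier (rep_space M v)"

definition subrep :: "('v, 'e) quiver \<Rightarrow> ('a, 'v, 'e) quiver_rep \<Rightarrow> ('v \<Rightarrow> 'a set) \<Rightarrow> bool" where
  "subrep Q M U \<longleftrightarrow>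
     (\<forall>v\<in>verts Q. VectorSpace.subspace class_ring (U v) (rep_space M v)) \<and>
     (\<forall>\<alpha>\<in>arcs Q. rep_map M \<alpha> ` U (tail Q \<alpha>) \<subseteq> U (head Q \<alpha>))"

definition quotient_rep ::
  "('v, 'e) quiver \<Rightarrow> ('a, 'v, 'e) quiver_rep \<Rightarrow> ('v \<Rightarrow> 'a set) \<Rightarrow> ('a set, 'v, 'e) quiver_rep" where
  "quotient_rep Q M U =
     \<lparr> rep_space = (\<lambda>v.
         \<lparr> carrier = a_rcosets\<^bsub>rep_space M v\<^esub> (U v),
           mult = (\<lambda>X Y. U v), one = U v, zero = U v,
           add = set_add (rep_space M v),
           smult = (\<lambda>c X. set_add (rep_space M v) (U v) ((\<lambda>x. c \<odot>\<^bsub>rep_space M v\<^esub> x) ` X)) \<rparr>),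
       rep_map = (\<lambda>\<alpha> X. set_add (rep_space M (head Q \<alpha>)) (U (head Q \<alpha>)) (rep_map M \<alpha> ` X)) \<rparr>"

definition rep_cokernel ::
  "('v, 'e) quiver \<Rightarrow> ('a, 'v, 'e) quiver_rep \<Rightarrow> ('b, 'v, 'e) quiver_rep \<Rightarrow> ('v \<Rightarrow> 'a \<Rightarrow> 'b) \<Rightarrow>
     ('b set, 'v, 'e) quiver_rep" where
  "rep_cokernel Q M N h = quotient_rep Q N (rep_image M h)"

definition rep_sum :: "'s set \<Rightarrow> ('s \<Rightarrow> ('a, 'v, 'e) quiver_rep) \<Rightarrow> ('s \<Rightarrow> 'a, 'v, 'e) quiver_rep" where
  "rep_sum S F =
     \<lparr> rep_space = (\<lambda>v.
         \<lparr> carrier = (\<Pi>\<^sub>E s\<in>S. carrier (rep_space (F s) v)),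
           mult = (\<lambda>x y. \<lambda>s\<in>S. \<zero>\<^bsub>rep_space (F s) v\<^esub>),
           one = (\<lambda>s\<in>S. \<zero>\<^bsub>rep_space (F s) v\<^esub>),
           zero = (\<lambda>s\<in>S. \<zero>\<^bsub>rep_space (F s) v\<^esub>),
           add = (\<lambda>x y. \<lambda>s\<in>S. x s \<oplus>\<^bsub>rep_space (F s) v\<^esub> y s),
           smult = (\<lambda>c x. \<lambda>s\<in>S. c \<odot>\<^bsub>rep_space (F s) v\<^esub> x s) \<rparr>),
       rep_map = (\<lambda>\<alpha> x. \<lambda>s\<in>S. rep_map (F s) \<alpha> (x s)) \<rparr>"

definition simple_rep :: "'v \<Rightarrow> (complex, 'v, 'e) quiver_rep" where
  "simple_rep v =
     \<lparr> rep_space = (\<lambda>w.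
         \<lparr> carrier = (if w = v then UNIV else {0}), mult = (\<lambda>x y. 0), one = 0, zero = 0,
           add = (+), smult = (*) \<rparr>),
       rep_map = (\<lambda>\<alpha> x. 0) \<rparr>"

text \<open>
  The projective cover \<open>P\<^sub>v = J e\<^sub>v\<close>, with \<open>(P\<^sub>v)\<^sub>w = e\<^sub>w J e\<^sub>v\<close>. A scalar \<open>c\<close> acts through \<open>c \<cdot> 1 \<in> J\<close>.
\<close>

definition projective_rep ::
  "('v, 'e) quiver \<Rightarrow> (('v, 'e) qpath \<Rightarrow> complex) \<Rightarrow> 'v \<Rightarrow>
     ((('v, 'e) qpath \<Rightarrow> complex) set, 'v, 'e) quiver_rep" where
  "projective_rep Q W v =
     (let J = jacobian_algebra Q W; cl = jacobian_class Q W in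
     \<lparr> rep_space = (\<lambda>w.
         \<lparr> carrier = {cl (vertex_elem w) \<otimes>\<^bsub>J\<^esub> X \<otimes>\<^bsub>J\<^esub> cl (vertex_elem v) | X. X \<in> carrier J},
           mult = mult J, one = one J, zero = zero J, add = add J,
           smult = (\<lambda>c X. cl (\<lambda>x. c * one (complete_path_algebra Q) x) \<otimes>\<^bsub>J\<^esub> X) \<rparr>),
       rep_map = (\<lambda>\<alpha> X. cl (arrow_elem Q \<alpha>) \<otimes>\<^bsub>J\<^esub> X) \<rparr>)"


section \<open>Injective envelopes and injective copresentations\<close>

text \<open>
  Injectivity is a statement about all finite-dimensional modules. Up to isomorphism all of them
  have their spaces carried by subsets of the following type.
\<close>

type_synonym univ = "nat \<Rightarrow> complex"

definition injective_module ::
  "('v, 'e) quiver \<Rightarrow> (('v, 'e) qpath \<Rightarrow> complex) \<Rightarrow> (univ, 'v, 'e) quiver_rep \<Rightarrow> bool" where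
  "injective_module Q W I \<longleftrightarrow>
     jacobian_module Q W I \<and>
     (\<forall>(X :: (univ, 'v, 'e) quiver_rep) (Y :: (univ, 'v, 'e) quiver_rep).
        jacobian_module Q W X \<and> jacobian_module Q W Y \<longrightarrow>
        (\<forall>f\<in>rep_mono Q X Y. \<forall>g\<in>rep_hom Q X I. \<exists>h\<in>rep_hom Q Y I.
           \<forall>v\<in>verts Q. \<forall>x\<in>carrier (rep_space X v). h v (f v x) = g v x))"

definition essential_subrep ::
  "('v, 'e) quiver \<Rightarrow> ('a, 'v, 'e) quiver_rep \<Rightarrow> ('v \<Rightarrow> 'a set) \<Rightarrow> bool" where
  "essential_subrep Q M U \<longleftrightarrow>
     subrep Q M U \<and>
     (\<forall>V. subrep Q M V \<and> (\<exists>v\<in>verts Q. V v \<noteq> {\<zero>\<^bsub>rep_space M v\<^esub>}) \<longrightarrow>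
          (\<exists>v\<in>verts Q. U v \<inter> V v \<noteq> {\<zero>\<^bsub>rep_space M v\<^esub>}))"

definition is_injective_envelope ::
  "('v, 'e) quiver \<Rightarrow> (('v, 'e) qpath \<Rightarrow> complex) \<Rightarrow>
     ('a, 'v, 'e) quiver_rep \<Rightarrow> (univ, 'v, 'e) quiver_rep \<Rightarrow> bool" where
  "is_injective_envelope Q W M I \<longleftrightarrow>
     injective_module Q W I \<and> (\<exists>f\<in>rep_mono Q M I. essential_subrep Q I (rep_image M f))"

definition rep_multisum ::
  "('v, 'e) quiver \<Rightarrow> ('v \<Rightarrow> ('a, 'v, 'e) quiver_rep) \<Rightarrow> ('v \<Rightarrow> nat) \<Rightarrow>
     ('v \<times> nat \<Rightarrow> 'a, 'v, 'e) quiver_rep" where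
  "rep_multisum Q I m = rep_sum {(j, k). j \<in> verts Q \<and> k < m j} (\<lambda>(j, k). I j)"

text \<open>
  There is an exact sequence \<open>0 \<rightarrow> M \<rightarrow> \<Oplus>\<^sub>j I\<^sub>j\<^bsup>b j\<^esup> \<rightarrow> \<Oplus>\<^sub>j I\<^sub>j\<^bsup>a j\<^esup>\<close> in which the first term is an injective
  envelope of \<open>M\<close> and the second one an injective envelope of the cokernel of \<open>M \<rightarrow> \<Oplus>\<^sub>j I\<^sub>j\<^bsup>b j\<^esup>\<close>,
  i.e. of the image of the second map.
\<close>

definition minimal_injective_copresentation ::
  "('v, 'e) quiver \<Rightarrow> (('v, 'e) qpath \<Rightarrow> complex) \<Rightarrow>
     ('a, 'v, 'e) quiver_rep \<Rightarrow> ('v \<Rightarrow> nat) \<Rightarrow> ('v \<Rightarrow> nat) \<Rightarrow> bool" where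
  "minimal_injective_copresentation Q W M b a \<longleftrightarrow>
     (\<exists>I f g.
        (\<forall>j\<in>verts Q. is_injective_envelope Q W (simple_rep j) (I j)) \<and>
        f \<in> rep_mono Q M (rep_multisum Q I b) \<and>
        g \<in> rep_hom Q (rep_multisum Q I b) (rep_multisum Q I a) \<and>
        (\<forall>v\<in>verts Q. {x \<in> carrier (rep_space (rep_multisum Q I b) v).
             g v x = \<zero>\<^bsub>rep_space (rep_multisum Q I a) v\<^esub>} = rep_image M f v) \<and>
        essential_subrep Q (rep_multisum Q I b) (rep_image M f) \<and>
        essential_subrep Q (rep_multisum Q I a) (rep_image (rep_multisum Q I b) g))"

definition neg_coind ::
  "('v, 'e) quiver \<Rightarrow> (('v, 'e) qpath \<Rightarrow> complex) \<Rightarrow> ('a, 'v, 'e) quiver_rep \<Rightarrow> 'v \<Rightarrow>\<^sub>0 int" where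
  "neg_coind Q W M =
     (THE d. \<exists>b a. minimal_injective_copresentation Q W M b a \<and>
        d = (\<Sum>j\<in>verts Q. Poly_Mapping.single j (int (a j) - int (b j))))"


section \<open>Topological Euler characteristic\<close>

definition independent_in :: "('a, 'b) monoid_scheme \<Rightarrow> 'a set \<Rightarrow> bool" where
  "independent_in G S \<longleftrightarrow>
     (\<forall>c :: 'a \<Rightarrow> int. (\<Otimes>\<^bsub>G\<^esub>s\<in>S. s [^]\<^bsub>G\<^esub> c s) = \<one>\<^bsub>G\<^esub> \<longrightarrow> (\<forall>s\<in>S. c s = 0))"

definition abelian_rank :: "('a, 'b) monoid_scheme \<Rightarrow> nat" where
  "abelian_rank G = Sup {card S | S. finite S \<and> S \<subseteq> carrier G \<and> independent_in G S}"

definition betti :: "nat \<Rightarrow> 'a topology \<Rightarrow> nat" where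
  "betti p X = abelian_rank (homology_group (int p) X)"

definition euler_characteristic :: "'a topology \<Rightarrow> int" where
  "euler_characteristic X = (\<Sum>p\<in>{p. betti p X \<noteq> 0}. (-1) ^ p * int (betti p X))"


section \<open>Quiver Grassmannians\<close>

text \<open>
  The canonical topology of a finite-dimensional complex vector space: the finest one for which all
  linear maps from the spaces \<open>\<complex>\<^sup>m\<close> are continuous.
\<close>

definition vs_topology :: "(complex, 'a) module \<Rightarrow> 'a topology" where
  "vs_topology V = topology (\<lambda>S. S \<subseteq> carrier V \<and>
     (\<forall>m. \<forall>x\<in>{..<m::nat} \<rightarrow> carrier V.
        openin (product_topology (\<lambda>i. euclidean) {..<m})
          {c \<in> {..<m} \<rightarrow>\<^sub>E UNIV. (\<Oplus>\<^bsub>V\<^esub>i\<in>{..<m}. c i \<odot>\<^bsub>V\<^esub> x i) \<in> S}))"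

lemma istopology_vs_topology:
  "istopology (\<lambda>S. S \<subseteq> carrier V \<and>
     (\<forall>m. \<forall>x\<in>{..<m::nat} \<rightarrow> carrier V.
        openin (product_topology (\<lambda>i. euclidean) {..<m})
          {c \<in> {..<m} \<rightarrow>\<^sub>E (UNIV :: complex set). (\<Oplus>\<^bsub>V\<^esub>i\<in>{..<m}. c i \<odot>\<^bsub>V\<^esub> x i) \<in> S}))"
  (is "istopology (\<lambda>S. _ \<and> (\<forall>m. \<forall>x\<in>_ m. ?P m x S))")
proof -
  have 1: "openin X {c \<in> A. h c \<in> S \<inter> T}"
    if "openin X {c \<in> A. h c \<in> S}" "openin X {c \<in> A. h c \<in> T}"
    for X :: "(nat \<Rightarrow> complex) topology" and A and h :: "(nat \<Rightarrow> complex) \<Rightarrow> 'a" and S T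
    using openin_Int[OF that] by (rule back_subst[where P = "openin X"]) auto
  have 2: "openin X {c \<in> A. h c \<in> \<Union>\<K>}" if "\<And>S. S \<in> \<K> \<Longrightarrow> openin X {c \<in> A. h c \<in> S}"
    for X :: "(nat \<Rightarrow> complex) topology" and A and h :: "(nat \<Rightarrow> complex) \<Rightarrow> 'a" and \<K>
  proof -
    have "{c \<in> A. h c \<in> \<Union>\<K>} = \<Union>((\<lambda>S. {c \<in> A. h c \<in> S}) ` \<K>)" by auto
    then show ?thesis using that by (auto intro: openin_Union)
  qed
  show ?thesis
    unfolding istopology_def
  proof (intro conjI allI impI ballI)
    fix S T
    assume S: "S \<subseteq> carrier V \<and> (\<forall>m. \<forall>x\<in>{..<m} \<rightarrow> carrier V. ?P m x S)"
      and T: "T \<subseteq> carrier V \<and> (\<forall>m. \<forall>x\<in>{..<m} \<rightarrow> carrier V. ?P m x T)"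
    then show "S \<inter> T \<subseteq> carrier V" by blast
    fix m x assume x: "x \<in> {..<m::nat} \<rightarrow> carrier V"
    show "?P m x (S \<inter> T)"
      by (rule 1[OF S[THEN conjunct2, rule_format, OF x] T[THEN conjunct2, rule_format, OF x]])
  next
    fix \<K>
    assume K: "\<forall>S\<in>\<K>. S \<subseteq> carrier V \<and> (\<forall>m. \<forall>x\<in>{..<m} \<rightarrow> carrier V. ?P m x S)"
    then show "\<Union>\<K> \<subseteq> carrier V" by blast
    fix m x assume x: "x \<in> {..<m::nat} \<rightarrow> carrier V"
    show "?P m x (\<Union>\<K>)"
      by (rule 2[OF K[rule_format, THEN conjunct2, rule_format, OF _ x]])
  qed
qed

lemma openin_vs_topology:
  "openin (vs_topology V) S \<longleftrightarrow> S \<subseteq> carrier V \<and>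
     (\<forall>m. \<forall>x\<in>{..<m::nat} \<rightarrow> carrier V.
        openin (product_topology (\<lambda>i. euclidean) {..<m})
          {c \<in> {..<m} \<rightarrow>\<^sub>E UNIV. (\<Oplus>\<^bsub>V\<^esub>i\<in>{..<m}. c i \<odot>\<^bsub>V\<^esub> x i) \<in> S})"
  unfolding vs_topology_def topology_inverse'[OF istopology_vs_topology] by (rule refl)

definition frames :: "(complex, 'a) module \<Rightarrow> nat \<Rightarrow> (nat \<Rightarrow> 'a) set" where
  "frames V k = {B \<in> {..<k} \<rightarrow>\<^sub>E carrier V.
     inj_on B {..<k} \<and> \<not> module.lin_dep class_ring V (B ` {..<k})}"

definition frame_topology :: "(complex, 'a) module \<Rightarrow> nat \<Rightarrow> (nat \<Rightarrow> 'a) topology" where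
  "frame_topology V k =
     subtopology (product_topology (\<lambda>i. vs_topology V) {..<k}) (frames V k)"

definition grassmannian :: "(complex, 'a) module \<Rightarrow> nat \<Rightarrow> 'a set set" where
  "grassmannian V k =
     {U. VectorSpace.subspace class_ring U V \<and>
         vectorspace.fin_dim class_ring (V\<lparr>carrier := U\<rparr>) \<and>
         vectorspace.dim class_ring (V\<lparr>carrier := U\<rparr>) = k}"

text \<open>The quotient topology with respect to the map sending a frame to the subspace it spans.\<close>

definition grassmannian_topology :: "(complex, 'a) module \<Rightarrow> nat \<Rightarrow> 'a set topology" where
  "grassmannian_topology V k = topology (\<lambda>S. S \<subseteq> grassmannian V k \<and>
     openin (frame_topology V k)
       {B \<in> frames V k. LinearCombinations.module.span class_ring V (B ` {..<k}) \<in> S})"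

lemma istopology_grassmannian_topology:
  "istopology (\<lambda>S. S \<subseteq> grassmannian V k \<and>
     openin (frame_topology V k)
       {B \<in> frames V k. LinearCombinations.module.span class_ring V (B ` {..<k}) \<in> S})"
  (is "istopology (\<lambda>S. _ \<and> ?P S)")
proof -
  have 1: "openin X {c \<in> A. h c \<in> S \<inter> T}"
    if "openin X {c \<in> A. h c \<in> S}" "openin X {c \<in> A. h c \<in> T}"
    for X :: "(nat \<Rightarrow> 'a) topology" and A and h :: "(nat \<Rightarrow> 'a) \<Rightarrow> 'a set" and S T
    using openin_Int[OF that] by (rule back_subst[where P = "openin X"]) auto
  have 2: "openin X {c \<in> A. h c \<in> \<Union>\<K>}" if "\<And>S. S \<in> \<K> \<Longrightarrow> openin X {c \<in> A. h c \<in> S}"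
    for X :: "(nat \<Rightarrow> 'a) topology" and A and h :: "(nat \<Rightarrow> 'a) \<Rightarrow> 'a set" and \<K>
  proof -
    have "{c \<in> A. h c \<in> \<Union>\<K>} = \<Union>((\<lambda>S. {c \<in> A. h c \<in> S}) ` \<K>)" by auto
    then show ?thesis using that by (auto intro: openin_Union)
  qed
  show ?thesis
    unfolding istopology_def
  proof (intro conjI allI impI ballI)
    fix S T
    assume S: "S \<subseteq> grassmannian V k \<and> ?P S" and T: "T \<subseteq> grassmannian V k \<and> ?P T"
    then show "S \<inter> T \<subseteq> grassmannian V k" by blast
    show "?P (S \<inter> T)" by (rule 1[OF S[THEN conjunct2] T[THEN conjunct2]])
  next
    fix \<K>
    assume K: "\<forall>S\<in>\<K>. S \<subseteq> grassmannian V k \<and> ?P S"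
    then show "\<Union>\<K> \<subseteq> grassmannian V k" by blast
    show "?P (\<Union>\<K>)" by (rule 2[OF K[rule_format, THEN conjunct2]])
  qed
qed

lemma openin_grassmannian_topology:
  "openin (grassmannian_topology V k) S \<longleftrightarrow> S \<subseteq> grassmannian V k \<and>
     openin (frame_topology V k)
       {B \<in> frames V k. LinearCombinations.module.span class_ring V (B ` {..<k}) \<in> S}"
  unfolding grassmannian_topology_def topology_inverse'[OF istopology_grassmannian_topology] by (rule refl)

definition quiver_grassmannian ::
  "('v, 'e) quiver \<Rightarrow> ('a, 'v, 'e) quiver_rep \<Rightarrow> ('v \<Rightarrow> nat) \<Rightarrow> ('v \<Rightarrow> 'a set) set" where
  "quiver_grassmannian Q M e =
     {U \<in> (\<Pi>\<^sub>E v\<in>verts Q. grassmannian (rep_space M v) (e v)). subrep Q M U}"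

definition quiver_grassmannian_topology ::
  "('v, 'e) quiver \<Rightarrow> ('a, 'v, 'e) quiver_rep \<Rightarrow> ('v \<Rightarrow> nat) \<Rightarrow> ('v \<Rightarrow> 'a set) topology" where
  "quiver_grassmannian_topology Q M e =
     subtopology
       (product_topology (\<lambda>v. grassmannian_topology (rep_space M v) (e v)) (verts Q))
       (quiver_grassmannian Q M e)"


section \<open>Cluster characters\<close>

text \<open>
  Laurent polynomials in variables indexed by \<open>'v\<close>: the group ring of the free abelian group on \<open>'v\<close>.
\<close>

type_synonym 'v laurent = "('v \<Rightarrow>\<^sub>0 int) \<Rightarrow>\<^sub>0 complex"

definition laurent_monomial :: "('v \<Rightarrow>\<^sub>0 int) \<Rightarrow> 'v laurent" where
  "laurent_monomial d = Poly_Mapping.single d 1"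

definition exchange_number :: "('v, 'e) quiver \<Rightarrow> 'v \<Rightarrow> 'v \<Rightarrow> int" where
  "exchange_number Q i j =
     int (card {\<alpha> \<in> arcs Q. tail Q \<alpha> = i \<and> head Q \<alpha> = j}) -
     int (card {\<alpha> \<in> arcs Q. tail Q \<alpha> = j \<and> head Q \<alpha> = i})"

definition y_variable :: "('v, 'e) quiver \<Rightarrow> 'v \<Rightarrow> 'v laurent" where
  "y_variable Q i =
     laurent_monomial (\<Sum>j\<in>verts Q. Poly_Mapping.single j (exchange_number Q i j))"

text \<open>
  Dimension vectors \<open>e\<close> with empty quiver Grassmannian contribute \<open>\<chi>(\<emptyset>) = 0\<close>; leaving them out makes
  the sum finite.
\<close>

definition cluster_character ::
  "('v, 'e) quiver \<Rightarrow> (('v, 'e) qpath \<Rightarrow> complex) \<Rightarrow> ('a, 'v, 'e) quiver_rep \<Rightarrow> 'v laurent" where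
  "cluster_character Q W M =
     laurent_monomial (neg_coind Q W M) *
     (\<Sum>e\<in>{e \<in> verts Q \<rightarrow>\<^sub>E UNIV. quiver_grassmannian Q M e \<noteq> {}}.
        of_int (euler_characteristic (quiver_grassmannian_topology Q M e)) *
        (\<Prod>j\<in>verts Q. y_variable Q j ^ e j))"


section \<open>The quiver with potential of the open relativistic Toda system\<close>

datatype toda_arrow = Arrow_a nat | Arrow_b nat | Arrow_l nat | Arrow_r nat

fun toda_tail :: "toda_arrow \<Rightarrow> nat" where
  "toda_tail (Arrow_a i) = 2 * i - 1"
| "toda_tail (Arrow_b i) = 2 * i - 1"
| "toda_tail (Arrow_l i) = 2 * i"
| "toda_tail (Arrow_r i) = 2 * i"

fun toda_head :: "toda_arrow \<Rightarrow> nat" where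
  "toda_head (Arrow_a i) = 2 * i"
| "toda_head (Arrow_b i) = 2 * i"
| "toda_head (Arrow_l i) = 2 * i - 3"
| "toda_head (Arrow_r i) = 2 * i + 1"

definition toda_quiver :: "nat \<Rightarrow> (nat, toda_arrow) quiver" where
  "toda_quiver n =
     \<lparr> verts = {1..2 * n},
       arcs = Arrow_a ` {1..n} \<union> Arrow_b ` {1..n} \<union> Arrow_l ` {2..n} \<union> Arrow_r ` {1..<n},
       tail = toda_tail,
       head = toda_head \<rparr>"

text \<open>
  The cycle \<open>a\<^sub>i \<ell>\<^sub>i\<^sub>+\<^sub>1 b\<^sub>i\<^sub>+\<^sub>1 r\<^sub>i\<close> (right to left) starts and ends at \<open>2 i\<close>, as does the one with \<open>a\<close>
  and \<open>b\<close> interchanged.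
\<close>

definition toda_potential :: "nat \<Rightarrow> (nat, toda_arrow) qpath \<Rightarrow> complex" where
  "toda_potential n = (\<lambda>x. \<Sum>i\<in>{1..<n}.
     path_elem (2 * i) [Arrow_r i, Arrow_b (i + 1), Arrow_l (i + 1), Arrow_a i] x -
     path_elem (2 * i) [Arrow_r i, Arrow_a (i + 1), Arrow_l (i + 1), Arrow_b i] x)"

abbreviation toda_algebra :: "nat \<Rightarrow> ((nat, toda_arrow) qpath \<Rightarrow> complex) set ring" where
  "toda_algebra n \<equiv> jacobian_algebra (toda_quiver n) (toda_potential n)"

abbreviation toda_projective ::
  "nat \<Rightarrow> nat \<Rightarrow> (((nat, toda_arrow) qpath \<Rightarrow> complex) set, nat, toda_arrow) quiver_rep" where
  "toda_projective n \<equiv> projective_rep (toda_quiver n) (toda_potential n)"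

definition toda_linear_form ::
  "nat \<Rightarrow> nat \<Rightarrow> complex \<Rightarrow> complex \<Rightarrow> ((nat, toda_arrow) qpath \<Rightarrow> complex) set" where
  "toda_linear_form n i l1 l2 =
     jacobian_class (toda_quiver n) (toda_potential n)
       (\<lambda>x. l1 * arrow_elem (toda_quiver n) (Arrow_a i) x +
            l2 * arrow_elem (toda_quiver n) (Arrow_b i) x)"

text \<open>
  The homomorphism of left modules \<open>J e\<^sub>2\<^sub>i \<rightarrow> J e\<^sub>2\<^sub>i\<^sub>-\<^sub>1\<close> sending the generator \<open>e\<^sub>2\<^sub>i\<close> to
  \<open>z = \<lambda>\<^sub>1 a\<^sub>i + \<lambda>\<^sub>2 b\<^sub>i\<close> is right multiplication by \<open>z\<close>.
\<close>

definition toda_module ::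
  "nat \<Rightarrow> nat \<Rightarrow> complex \<Rightarrow> complex \<Rightarrow>
     (((nat, toda_arrow) qpath \<Rightarrow> complex) set set, nat, toda_arrow) quiver_rep" where
  "toda_module n i l1 l2 =
     rep_cokernel (toda_quiver n) (toda_projective n (2 * i)) (toda_projective n (2 * i - 1))
       (\<lambda>v X. X \<otimes>\<^bsub>toda_algebra n\<^esub> toda_linear_form n i l1 l2)"


section \<open>The open relativistic Toda Hamiltonians\<close>

text \<open>
  Rows and columns are numbered from 0, so the matrix unit in position \<open>(i, i + 1)\<close> sits at
  \<open>(i - 1, i)\<close>.
\<close>

definition toda_E :: "nat \<Rightarrow> nat \<Rightarrow> nat laurent mat" where
  "toda_E n i = Matrix.mat (n + 1) (n + 1)
     (\<lambda>(r, c). if r = c \<or> (r = i - 1 \<and> c = i) then 1 else 0)"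

definition toda_F :: "nat \<Rightarrow> nat \<Rightarrow> nat laurent mat" where
  "toda_F n i = Matrix.mat (n + 1) (n + 1)
     (\<lambda>(r, c). if r = c \<or> (r = i \<and> c = i - 1) then 1 else 0)"

definition toda_D :: "nat \<Rightarrow> nat \<Rightarrow> nat laurent \<Rightarrow> nat laurent mat" where
  "toda_D n i y = Matrix.mat (n + 1) (n + 1)
     (\<lambda>(r, c). if r = c then (if r < i then y else 1) else 0)"

definition toda_matrix :: "nat \<Rightarrow> nat laurent mat" where
  "toda_matrix n =
     foldr (*)
       (map (\<lambda>i. toda_E n i * toda_D n i (y_variable (toda_quiver n) (2 * i - 1)) *
                 toda_F n i * toda_D n i (y_variable (toda_quiver n) (2 * i))) [1..<n + 1])
       (1\<^sub>m (n + 1))"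

text \<open>
  The matrix of \<open>\<And>\<^sup>k g\<close> in the standard basis of the exterior power, indexed by the \<open>k\<close>-element
  subsets \<open>S\<close> of the set of indices, has the minors of \<open>g\<close> as entries.
\<close>

definition exterior_power_entry :: "'a::comm_ring_1 mat \<Rightarrow> nat set \<Rightarrow> nat set \<Rightarrow> 'a" where
  "exterior_power_entry g S T = Determinant.det (submatrix g S T)"

definition trace_exterior_power :: "nat \<Rightarrow> 'a::comm_ring_1 mat \<Rightarrow> 'a" where
  "trace_exterior_power k g =
     (\<Sum>S\<in>{S. S \<subseteq> {..<dim_row g} \<and> card S = k}. exterior_power_entry g S S)"

text \<open>
  The matrix \<open>g\<close> in \<open>SL\<^sub>n\<^sub>+\<^sub>1\<close> representing a point of the cluster chart is \<open>toda_matrix n\<close> times the scalar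
  \<open>\<Prod>\<^sub>i (y\<^sub>2\<^sub>i\<^sub>-\<^sub>1 y\<^sub>2\<^sub>i)\<close> to the powers \<open>-i / (n + 1)\<close>; expressed in the \<open>x\<^sub>j\<close> with exponents computed linearly,
  this scalar is the monomial below.
\<close>

definition toda_prefactor :: "nat \<Rightarrow> nat laurent" where
  "toda_prefactor n =
     laurent_monomial (Poly_Mapping.single (2 * n - 1) 1 - Poly_Mapping.single (2 * n) 1)"

definition toda_hamiltonian :: "nat \<Rightarrow> nat \<Rightarrow> nat laurent" where
  "toda_hamiltonian n k = toda_prefactor n ^ k * trace_exterior_power k (toda_matrix n)"

end

theory Submission
 imports Defs "HOL-Library.Countable"
begin

text \<open>
  The trace of an exterior power is expanded over subsets by the Cauchy--Binet formula: every elementary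
  factor is bidiagonal, so the trace is a sum over pairs of a subset and a choice at each odd level.
  On the other side, the module is realised by explicit strips of lattice points at each vertex, the maps a and b
  being (up to a change of basis adapted to the parameter) the identity and a shift.  The dimension vectors for
  which a submodule exists are cut out by interlacing inequalities, and for each of them the Grassmannian is a single
  point.  The interlacing inequalities biject with the subsets and choices of the trace expansion, and the
  scalar prefactor matches the coindex read off an explicit minimal injective copresentation.
\<close>

text \<open>The factors are multiplied on from the left in order of decreasing index. What has been
  collected never mixes the first coordinates, so a new factor scales each principal minor and no
  other minors occur.

  Modules, injectives and the Jacobian algebra need the same calculus of paths: steps between levels
  move to the front and letters of adjacent levels commute. It is proved once, for any function on
  paths that respects the relations. It also shows that paths of length \<open>2 * n\<close> or more
  vanish, so the completion is handled by truncation.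

  The main obstacle is the coindex, a definite description over all copresentations with arbitrary
  envelopes. For any module containing the model, the vectors whose arrow images all lie in the
  model are determined: correcting such a vector to a socle vector meets one obstruction, a scalar
  at vertex \<open>2 * (n + 1 - i) - 1\<close>. This scalar gives both the exactness of the explicit
  copresentation and the uniqueness of the multiplicities.

  Submodules are rigid because going down a level and up again acts on a strip as one nilpotent
  Jordan block, whose invariant subspaces form a chain.\<close>

abbreviation (input) eqv :: "bool => bool => bool" (infixr "<=>" 25) where "A <=> B == (A = B)"
abbreviation "tq == toda_quiver"
abbreviation "tp == toda_potential"
abbreviation "spc M v == carrier (rep_space M v)"


section \<open>Principal minors under row operations\<close>

text \<open>Entries come from a function of row and column instead of a matrix, so that a row
  operation is a function update; \<open>pick S\<close> is the increasing enumeration of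
  \<open>S\<close> that \<open>submatrix\<close> uses.\<close>

definition minor :: "nat set => (nat => nat => 'a :: comm_ring_1) => 'a" where
 "minor S v = Determinant.det (Matrix.mat (card S) (card S) (%(a, b). v (pick S a) (pick S b)))"

lemma bij_betw_pick:
 assumes "finite S" shows "bij_betw (pick S) {0..<card S} S"
proof -
 have inj: "inj_on (pick S) {0..<card S}"
  by (rule inj_onI) (metis atLeastLessThan_iff linorder_neqE_nat nat_less_le pick_mono_le)
 have sub: "pick S ` {0..<card S} \<subseteq> S" by (auto simp: pick_in_set_le)
 have "pick S ` {0..<card S} = S"
  by (rule card_subset_eq[OF assms sub]) (simp add: card_image[OF inj])
 then show ?thesis using inj by (simp add: bij_betw_def)
qed

lemma pick_surjE:
 assumes "finite S" "r \<in> S"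
 obtains k where "k < card S" "pick S k = r"
proof -
 have "r \<in> pick S ` {0..<card S}"
  using bij_betw_imp_surj_on[OF bij_betw_pick[OF assms(1)]] assms(2) by simp
 then show thesis using that by auto
qed

lemma minor_leibniz:
 "minor S v = (\<Sum>p\<in>{p. p permutes {0..<card S}}.
  signof p * (\<Prod>a\<in>{0..<card S}. v (pick S a) (pick S (p a))))"
proof -
 have "(\<Prod>a = 0..<card S. Matrix.mat (card S) (card S) (%(a, b). v (pick S a) (pick S b)) $$ (a, p a)) =
   (\<Prod>a\<in>{0..<card S}. v (pick S a) (pick S (p a)))" if "p permutes {0..<card S}" for p
 proof (rule prod.cong[OF refl])
  fix a assume a: "a \<in> {0..<card S}"
  then have "p a \<in> {0..<card S}" using permutes_in_image[OF that] by blast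
  then show "Matrix.mat (card S) (card S) (%(a, b). v (pick S a) (pick S b)) $$ (a, p a) =
    v (pick S a) (pick S (p a))" using a by simp
 qed
 then show ?thesis unfolding minor_def
  by (subst det_def'[of _ "card S"]) (auto intro!: sum.cong)
qed

lemma minor_cong:
 assumes "!!r c. r \<in> S ==> c \<in> S ==> v r c = w r c"
 shows "minor S v = minor S w"
 unfolding minor_def
 by (rule arg_cong[of _ _ Determinant.det], rule eq_matI) (auto simp: assms pick_in_set_le)

lemma minor_scale:
 assumes "finite S"
 shows "minor S (%r c. f r * v r c) = (\<Prod>r\<in>S. f r) * minor S v"
 unfolding minor_leibniz prod.distrib sum_distrib_left
 using prod.reindex_bij_betw[OF bij_betw_pick[OF assms], of f]
 by (simp add: mult.left_commute)

lemma minor_row_linear: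
 assumes "finite S" "r \<in> S"
 shows "minor S (v(r := (%c. x * a c + y * b c))) = x * minor S (v(r := a)) + y * minor S (v(r := b))"
proof -
 obtain k where k: "k \<in> {0..<card S}" "pick S k = r"
  using pick_surjE[OF assms(1,2)] by (metis atLeastLessThan_iff zero_le)
 have ne: "pick S a ~= r" if "a \<in> {0..<card S} - {k}" for a
  using inj_onD[OF bij_betw_imp_inj_on[OF bij_betw_pick[OF assms(1)]], of a k] that k by auto
 \<comment> \<open>Only the factor at position \<open>k\<close> reads row \<open>r\<close>;
   isolating it makes each Leibniz term linear in that row.\<close>
 have split: "(\<Prod>a\<in>{0..<card S}. (v(r := u)) (pick S a) (pick S (p a))) =
   u (pick S (p k)) * (\<Prod>a\<in>{0..<card S} - {k}. v (pick S a) (pick S (p a)))" for u p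
  using k ne by (subst prod.remove[OF _ k(1)]) (auto intro!: prod.cong)
 show ?thesis unfolding minor_leibniz split sum_distrib_left sum.distrib[symmetric]
  by (intro sum.cong refl) (simp add: algebra_simps)
qed

lemma minor_zero_column:
 assumes "finite S" "c \<in> S" "!!r. r \<in> S ==> v r c = 0"
 shows "minor S v = 0"
 unfolding minor_leibniz
proof (rule sum.neutral, rule ballI)
 fix p assume "p \<in> {p. p permutes {0..<card S}}"
 then have p: "p permutes {0..<card S}" by simp
 obtain k where k: "k \<in> {0..<card S}" "pick S k = c"
  using pick_surjE[OF assms(1,2)] by (metis atLeastLessThan_iff zero_le)
 obtain a where a: "p a = k" using permutes_surj[OF p] by (metis surjD)
 then have a': "a \<in> {0..<card S}" using k permutes_in_image[OF p, of a] by simp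
 then have "v (pick S a) (pick S (p a)) = 0"
  using assms(3) k a by (simp add: pick_in_set_le)
 then have "(\<Prod>a\<in>{0..<card S}. v (pick S a) (pick S (p a))) = 0"
  using a' by (intro prod_zero) auto
 then show "signof p * (\<Prod>a\<in>{0..<card S}. v (pick S a) (pick S (p a))) = 0" by simp
qed

lemma minor_identical_rows:
 assumes "finite S" "r \<in> S" "s \<in> S" "r ~= s" "!!c. c \<in> S ==> v r c = v s c"
 shows "minor S v = 0"
proof -
 obtain j where j: "j < card S" "pick S j = r" by (rule pick_surjE[OF assms(1,2)])
 obtain k where k: "k < card S" "pick S k = s" by (rule pick_surjE[OF assms(1,3)])
 show ?thesis unfolding minor_def
  by (rule det_identical_rows[of _ "card S" j k])
   (use assms j k in \<open>auto intro!: eq_vecI simp: pick_in_set_le\<close>)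
qed

lemma minor_one:
 assumes "finite S" shows "minor S (%r c. if r = c then 1 else 0) = 1"
proof -
 have "Matrix.mat (card S) (card S) (%(a, b). if pick S a = pick S b then 1 else 0 :: 'a) = 1\<^sub>m (card S)"
  using inj_onD[OF bij_betw_imp_inj_on[OF bij_betw_pick[OF assms]]] by (intro eq_matI) auto
 then show ?thesis by (simp add: minor_def)
qed

lemma exterior_power_entry_eq_minor:
 assumes "A \<in> carrier_mat n n" "S \<subseteq> {..<n}"
 shows "exterior_power_entry A S S = minor S (%r c. A $$ (r, c))"
proof -
 have "{i. i < n & i \<in> S} = S" using assms(2) by auto
 then show ?thesis using assms(1)
  by (simp add: exterior_power_entry_def submatrix_def minor_def)
qed

section \<open>Principal minors of the Toda matrix\<close>

text \<open>
 The shape of a product of the factors with indices greater than \<open>m\<close>: they do not mix the first \<open>m\<close>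
 coordinates with the others.
\<close>

definition diagonal_upto :: "nat => nat => 'a :: comm_ring_1 mat => bool" where
 "diagonal_upto m n A <=>
  (\<forall>r\<le>n. \<forall>c\<le>n. r ~= c --> r < m \<or> c < m --> A $$ (r, c) = 0)"

definition toda_factor :: "nat => nat laurent => nat laurent => nat => nat laurent mat" where
 "toda_factor n y z m = toda_E n m * toda_D n m y * toda_F n m * toda_D n m z"

lemma toda_carrier [simp]:
 "toda_E n m \<in> carrier_mat (n + 1) (n + 1)" "toda_F n m \<in> carrier_mat (n + 1) (n + 1)"
 "toda_D n m y \<in> carrier_mat (n + 1) (n + 1)"
 by (simp_all add: toda_E_def toda_F_def toda_D_def)

lemma toda_factor_carrier: "toda_factor n y z m \<in> carrier_mat (n + 1) (n + 1)"
 unfolding toda_factor_def by (intro mult_carrier_mat[of _ _ "n + 1"] toda_carrier)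

text \<open>The factors D, F and E have at most two nonzero entries in each row, at \<open>r\<close>
  and \<open>r'\<close>. A missing second entry is covered by \<open>y = 0\<close>, which allows
  \<open>r' = r\<close>.\<close>

lemma mat_mult_row:
 fixes A :: "'a :: comm_ring_1 mat"
 assumes A: "A \<in> carrier_mat N N" and r: "r < N" "c < N" "r' < N" "r ~= r' \<or> y = 0"
  and B: "B \<in> carrier_mat N N" "!!j. j < N ==> B $$ (r, j) = (if j = r then x else if j = r' then y else 0)"
 shows "(B * A) $$ (r, c) = x * A $$ (r, c) + y * A $$ (r', c)"
proof -
 have "(B * A) $$ (r, c) = (\<Sum>j<N. B $$ (r, j) * A $$ (j, c))"
  using A B r by (auto simp: scalar_prod_def lessThan_atLeast0)
 also have "... = (\<Sum>j<N. (if j = r then x * A $$ (j, c) else 0) + (if j = r' then y * A $$ (j, c) else 0))"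
  using r(4) by (intro sum.cong refl) (auto simp: B(2))
 also have "... = x * A $$ (r, c) + y * A $$ (r', c)"
  using r by (simp add: sum.distrib)
 finally show ?thesis .
qed

lemma toda_D_mult:
 assumes "A \<in> carrier_mat (n + 1) (n + 1)" "r \<le> n" "c \<le> n"
 shows "(toda_D n m y * A) $$ (r, c) = (if r < m then y * A $$ (r, c) else A $$ (r, c))"
 using mat_mult_row[OF assms(1), of r c r 0 "toda_D n m y" "if r < m then y else 1"] assms
 by (auto simp: toda_D_def)

lemma toda_F_mult:
 assumes "A \<in> carrier_mat (n + 1) (n + 1)" "r \<le> n" "c \<le> n" "1 \<le> m" "m \<le> n"
 shows "(toda_F n m * A) $$ (r, c) = A $$ (r, c) + (if r = m then A $$ (m - 1, c) else 0)"
 using mat_mult_row[OF assms(1), of r c "m - 1" "if r = m then 1 else 0" "toda_F n m" 1] assms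
 by (auto simp: toda_F_def)

lemma toda_E_mult:
 assumes "A \<in> carrier_mat (n + 1) (n + 1)" "r \<le> n" "c \<le> n" "1 \<le> m" "m \<le> n"
 shows "(toda_E n m * A) $$ (r, c) = A $$ (r, c) + (if r = m - 1 then A $$ (m, c) else 0)"
 using mat_mult_row[OF assms(1), of r c m "if r = m - 1 then 1 else 0" "toda_E n m" 1] assms
 by (auto simp: toda_E_def)

text \<open>Applying D(z), F, D(y), E in turn, only rows \<open>m - 1\<close> and \<open>m\<close>
  are combined. The coefficient \<open>y * z + z\<close> collects the direct entry of row
  \<open>m - 1\<close> and the one that F carries down to row \<open>m\<close> and E brings
  back.\<close>

lemma toda_factor_mult:
 assumes A: "A \<in> carrier_mat (n + 1) (n + 1)" and rc: "r \<le> n" "c \<le> n" and m: "1 \<le> m" "m \<le> n"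
 shows "(toda_factor n y z m * A) $$ (r, c) =
  (if r < m - 1 then y * z * A $$ (r, c)
  else if r = m - 1 then (y * z + z) * A $$ (m - 1, c) + A $$ (m, c)
  else if r = m then z * A $$ (m - 1, c) + A $$ (m, c)
  else A $$ (r, c))"
proof -
 let ?E = "toda_E n m" and ?F = "toda_F n m" and ?D = "toda_D n m"
 define B1 where "B1 = ?D z * A"
 define B2 where "B2 = ?F * B1"
 define B3 where "B3 = ?D y * B2"
 have c1: "B1 \<in> carrier_mat (n + 1) (n + 1)" "B2 \<in> carrier_mat (n + 1) (n + 1)"
  "B3 \<in> carrier_mat (n + 1) (n + 1)"
  unfolding B1_def B2_def B3_def by (intro mult_carrier_mat[of _ _ "n + 1"] toda_carrier A)+
 have e1: "B1 $$ (s, c) = (if s < m then z * A $$ (s, c) else A $$ (s, c))" if "s \<le> n" for s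
  unfolding B1_def by (rule toda_D_mult[OF A that rc(2)])
 have e2: "B2 $$ (s, c) = B1 $$ (s, c) + (if s = m then B1 $$ (m - 1, c) else 0)" if "s \<le> n" for s
  unfolding B2_def by (rule toda_F_mult[OF c1(1) that rc(2) m])
 have e3: "B3 $$ (s, c) = (if s < m then y * B2 $$ (s, c) else B2 $$ (s, c))" if "s \<le> n" for s
  unfolding B3_def by (rule toda_D_mult[OF c1(2) that rc(2)])
 have e4: "(?E * B3) $$ (r, c) = B3 $$ (r, c) + (if r = m - 1 then B3 $$ (m, c) else 0)"
  by (rule toda_E_mult[OF c1(3) rc m])
 have "toda_factor n y z m * A = ?E * (?D y * (?F * (?D z * A)))"
 proof -
  have "toda_factor n y z m * A = ?E * ?D y * ?F * (?D z * A)"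
   unfolding toda_factor_def
   by (rule assoc_mult_mat[of _ "n + 1" "n + 1" _ "n + 1" _ "n + 1"]) (intro mult_carrier_mat[of _ _ "n + 1"] toda_carrier A)+
  also have "... = ?E * ?D y * (?F * (?D z * A))"
   by (rule assoc_mult_mat[of _ "n + 1" "n + 1" _ "n + 1" _ "n + 1"]) (intro mult_carrier_mat[of _ _ "n + 1"] toda_carrier A)+
  also have "... = ?E * (?D y * (?F * (?D z * A)))"
   by (rule assoc_mult_mat[of _ "n + 1" "n + 1" _ "n + 1" _ "n + 1"]) (intro mult_carrier_mat[of _ _ "n + 1"] toda_carrier A)+
  finally show ?thesis .
 qed
 then have eq: "(toda_factor n y z m * A) $$ (r, c) = (?E * B3) $$ (r, c)"
  by (simp only: B1_def B2_def B3_def)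
 have "m - 1 \<le> n" "m - 1 < m" "m - 1 ~= m" using m by simp_all
 then show ?thesis unfolding eq e4 using rc(1) m by (auto simp: e1 e2 e3 algebra_simps)
qed

lemma diagonal_upto_toda_factor:
 assumes A: "A \<in> carrier_mat (n + 1) (n + 1)" and m: "1 \<le> m" "m \<le> n" and d: "diagonal_upto m n A"
 shows "diagonal_upto (m - 1) n (toda_factor n y z m * A)"
proof -
 have z: "A $$ (r, c) = 0" if "r \<le> n" "c \<le> n" "r ~= c" "r < m \<or> c < m" for r c
  using d that unfolding diagonal_upto_def by blast
 have "(toda_factor n y z m * A) $$ (r, c) = 0"
  if "r \<le> n" "c \<le> n" "r ~= c" "r < m - 1 \<or> c < m - 1" for r c
 proof -
  have zr: "A $$ (r, c) = 0" by (rule z) (use that in auto)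
  show ?thesis
  proof (cases "c < m - 1")
   case True
   then have "A $$ (m - 1, c) = 0" "A $$ (m, c) = 0" by (intro z; use that m in auto)+
   then show ?thesis unfolding toda_factor_mult[OF A that(1,2) m] using zr by simp
  next
   case False
   then show ?thesis unfolding toda_factor_mult[OF A that(1,2) m] using zr that(4) by simp
  qed
 qed
 then show ?thesis by (simp add: diagonal_upto_def)
qed

text \<open>Each index of \<open>S\<close> below \<open>m\<close> contributes a factor
  \<open>y * z\<close>, except that \<open>m - 1\<close> contributes \<open>(y + 1) * z\<close> when
  \<open>m\<close> is not in \<open>S\<close>, because of the part that F and E carry down and back.
  The subtraction in the exponent is exact there for \<open>m\<close> at least 1, since
  \<open>m - 1\<close> is counted.\<close>

definition toda_weight :: "nat set => 'a => 'a => nat => 'a :: comm_ring_1" where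
 "toda_weight S y z m =
  (if m - 1 \<in> S & m \<notin> S then (y + 1) * y ^ (card (S \<inter> {..<m}) - 1) else y ^ card (S \<inter> {..<m})) *
  z ^ card (S \<inter> {..<m})"

text \<open>Rows \<open>m - 1\<close> and \<open>m\<close> are the only ones combined, and
  \<open>A\<close> is diagonal in the first \<open>m\<close> coordinates. So a row from outside
  \<open>S\<close> contributes zero, and minors with different row and column sets, which a general
  product would require, do not appear.\<close>

lemma minor_toda_factor:
 assumes A: "A \<in> carrier_mat (n + 1) (n + 1)" and m: "1 \<le> m" "m \<le> n" and d: "diagonal_upto m n A"
  and S: "S \<subseteq> {..<n + 1}"
 shows "minor S (%r c. (toda_factor n y z m * A) $$ (r, c)) =
  toda_weight S y z m * minor S (%r c. A $$ (r, c))"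
proof -
 have fS: "finite S" using S finite_subset by blast
 define a where "a = (%r c. A $$ (r, c))"
 have z: "a r c = 0" if "r \<le> n" "c \<le> n" "r ~= c" "r < m \<or> c < m" for r c
  using d that unfolding diagonal_upto_def a_def by blast
 define f where "f = (%r. if r < m - 1 then y * z else 1)"
 define p where "p = (%c. (y * z + z) * a (m - 1) c + 1 * a m c)"
 define q where "q = (%c. z * a (m - 1) c + 1 * a m c)"
 define N where "N = card (S \<inter> {..<m - 1})"
 have le: "r \<le> n" if "r \<in> S" for r using S that by auto
 have eq: "minor S (%r c. (toda_factor n y z m * A) $$ (r, c)) =
   minor S (%r c. f r * ((a(m := q))(m - 1 := p)) r c)"
  by (rule minor_cong)
   (use le m in \<open>auto simp: toda_factor_mult[OF A _ _ m] f_def p_def q_def a_def\<close>)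
 have prod: "(\<Prod>r\<in>S. f r) = (y * z) ^ N"
 proof -
  have "(\<Prod>r\<in>S. f r) = (\<Prod>r\<in>S \<inter> {..<m - 1}. y * z)"
   unfolding f_def by (subst prod.inter_restrict[OF fS]) (auto intro!: prod.cong)
  then show ?thesis by (simp add: N_def)
 qed
 have lt: "{..<m} = insert (m - 1) {..<m - 1}" using m by auto
 have card: "card (S \<inter> {..<m}) = (if m - 1 \<in> S then N + 1 else N)"
  unfolding N_def lt using fS by (auto simp: Int_insert_right)
 have mm: "m - 1 ~= m" "m - 1 < m" using m by auto
 have E: "minor S ((a(m := q))(m - 1 := p)) =
   (if m - 1 \<in> S then if m \<in> S then y * z else (y + 1) * z else 1) * minor S a"
 proof (cases "m - 1 \<in> S")
  case m1: True
  \<comment> \<open>With row \<open>m\<close> of \<open>A\<close> in place of row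
    \<open>m - 1\<close>, column \<open>m - 1\<close> vanishes: that row has a zero there, and so
    does every other row of \<open>S\<close>.\<close>
  have red: "minor S ((b)(m - 1 := (%c. a m c))) = 0"
   if "m \<notin> S" "!!r c. r \<in> S ==> r ~= m - 1 ==> b r c = a r c" for b
  proof (rule minor_zero_column[OF fS m1])
   fix r assume r: "r \<in> S"
   show "((b)(m - 1 := (%c. a m c))) r (m - 1) = 0"
    using that(2)[OF r, of "m - 1"] z[of r "m - 1"] z[of m "m - 1"] le[OF r] m by auto
  qed
  show ?thesis
  proof (cases "m \<in> S")
   case True
   \<comment> \<open>Subtracting the new row \<open>m\<close> from the new row \<open>m - 1\<close>
     leaves \<open>y * z\<close> times the old row \<open>m - 1\<close>.\<close>
   have "p = (%c. (y * z) * a (m - 1) c + 1 * q c)" by (auto simp: p_def q_def algebra_simps)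
   then have "minor S ((a(m := q))(m - 1 := p)) =
     y * z * minor S ((a(m := q))(m - 1 := a (m - 1))) + 1 * minor S ((a(m := q))(m - 1 := q))"
    using minor_row_linear[OF fS m1, of "a(m := q)" "y * z" "a (m - 1)" 1 q] by simp
   also have "minor S ((a(m := q))(m - 1 := q)) = 0"
    by (rule minor_identical_rows[OF fS m1 True]) (use mm in auto)
   also have "(a(m := q))(m - 1 := a (m - 1)) = a(m := q)" using mm by (auto simp: fun_eq_iff)
   also have "minor S (a(m := q)) = z * minor S (a(m := a (m - 1))) + 1 * minor S (a(m := a m))"
    unfolding q_def by (rule minor_row_linear[OF fS True])
   also have "minor S (a(m := a (m - 1))) = 0"
    by (rule minor_identical_rows[OF fS m1 True]) (use mm in auto)
   finally show ?thesis using m1 True by (simp add: fun_upd_def)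
  next
   case False
   have "minor S ((a(m := q))(m - 1 := p)) = (y * z + z) * minor S ((a(m := q))(m - 1 := a (m - 1))) +
     1 * minor S ((a(m := q))(m - 1 := a m))"
    unfolding p_def by (rule minor_row_linear[OF fS m1])
   also have "minor S ((a(m := q))(m - 1 := a m)) = 0"
    by (rule red[OF False]) (use False in auto)
   also have "minor S ((a(m := q))(m - 1 := a (m - 1))) = minor S a"
    by (rule minor_cong) (use False in auto)
   finally show ?thesis using m1 False by (simp add: algebra_simps fun_upd_def)
  qed
 next
  case m1: False
  have "minor S ((a(m := q))(m - 1 := p)) = minor S a"
  proof (rule minor_cong)
   fix r c assume rc: "r \<in> S" "c \<in> S"
   \<comment> \<open>Row \<open>m - 1\<close> is diagonal and its diagonal column is outside
     \<open>S\<close>, so the term that F adds to row \<open>m\<close> vanishes.\<close>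
   have "a (m - 1) c = 0" using z[of "m - 1" c] le[OF rc(2)] m rc m1 by force
   then show "((a(m := q))(m - 1 := p)) r c = a r c" using rc m1 by (auto simp: q_def)
  qed
  then show ?thesis using m1 by simp
 qed
 show ?thesis
  unfolding eq minor_scale[OF fS, of f "(a(m := q))(m - 1 := p)"] prod E toda_weight_def card a_def[symmetric]
  by (auto simp: power_mult_distrib algebra_simps)
qed

lemma minor_toda_matrix:
 assumes S: "S \<subseteq> {..<n + 1}"
 shows "minor S (%r c. toda_matrix n $$ (r, c)) =
  (\<Prod>m = 1..n. toda_weight S (y_variable (tq n) (2 * m - 1)) (y_variable (tq n) (2 * m)) m)"
  and "toda_matrix n \<in> carrier_mat (n + 1) (n + 1)"
proof -
 let ?X = "%m. toda_factor n (y_variable (tq n) (2 * m - 1)) (y_variable (tq n) (2 * m)) m"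
 let ?w = "%m. toda_weight S (y_variable (tq n) (2 * m - 1)) (y_variable (tq n) (2 * m)) m"
 \<comment> \<open>\<open>P m\<close> collects the factors of index above \<open>m\<close>; the
   downward induction starts from the identity matrix, which is diagonal throughout.\<close>
 define P where "P m = foldr (*) (map ?X [m + 1..<n + 1]) (1\<^sub>m (n + 1))" for m
 have fS: "finite S" using S finite_subset by blast
 have "P m \<in> carrier_mat (n + 1) (n + 1) & diagonal_upto m n (P m) &
   minor S (%r c. P m $$ (r, c)) = (\<Prod>k = m + 1..n. ?w k)" if "m \<le> n" for m
  using that
 proof (induction rule: inc_induct)
  case base
  have "minor S (%r c. (1\<^sub>m (n + 1) :: nat laurent mat) $$ (r, c)) =
    minor S (%r c. if r = c then 1 else 0)"
  proof (rule minor_cong)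
   fix r c assume "r \<in> S" "c \<in> S"
   then have "r < n + 1" "c < n + 1" using S by auto
   then show "(1\<^sub>m (n + 1) :: nat laurent mat) $$ (r, c) = (if r = c then 1 else 0)" by simp
  qed
  then show ?case using minor_one[OF fS] by (simp add: P_def diagonal_upto_def)
 next
  case (step m)
  have P: "P m = ?X (Suc m) * P (Suc m)"
   using step.hyps by (simp add: P_def upt_conv_Cons del: upt_Suc)
  have iv: "{m + 1..n} = insert (m + 1) {Suc m + 1..n}" using step.hyps by auto
  have m: "1 \<le> Suc m" "Suc m \<le> n" using step.hyps by auto
  have IH: "P (Suc m) \<in> carrier_mat (n + 1) (n + 1)" "diagonal_upto (Suc m) n (P (Suc m))"
   "minor S (%r c. P (Suc m) $$ (r, c)) = (\<Prod>k = Suc m + 1..n. ?w k)"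
   using step.IH by blast+
  have "(\<Prod>k = m + 1..n. ?w k) = ?w (Suc m) * (\<Prod>k = Suc m + 1..n. ?w k)"
   unfolding iv by (subst prod.insert) auto
  moreover have "diagonal_upto m n (P m)"
   using diagonal_upto_toda_factor[OF IH(1) m IH(2)] unfolding P by simp
  ultimately show ?case
   using mult_carrier_mat[OF toda_factor_carrier IH(1)] minor_toda_factor[OF IH(1) m IH(2) S] IH(3)
   unfolding P by metis
 qed
 from this[of 0] have "P 0 \<in> carrier_mat (n + 1) (n + 1)"
  "minor S (%r c. P 0 $$ (r, c)) = (\<Prod>k = 1..n. ?w k)" by simp_all
 moreover have "P 0 = toda_matrix n"
  by (simp add: P_def toda_matrix_def toda_factor_def)
 ultimately show "minor S (%r c. toda_matrix n $$ (r, c)) = (\<Prod>m = 1..n. ?w m)"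
  "toda_matrix n \<in> carrier_mat (n + 1) (n + 1)" by simp_all
qed

lemma trace_exterior_power_toda:
 "trace_exterior_power k (toda_matrix n) =
  (\<Sum>S\<in>{S. S \<subseteq> {..<n + 1} & card S = k}. \<Prod>m = 1..n.
   toda_weight S (y_variable (tq n) (2 * m - 1)) (y_variable (tq n) (2 * m)) m)"
proof -
 have c: "toda_matrix n \<in> carrier_mat (n + 1) (n + 1)" by (rule minor_toda_matrix(2)[of "{}"]) simp
 then have "dim_row (toda_matrix n) = n + 1" by simp
 then show ?thesis unfolding trace_exterior_power_def
  by (intro sum.cong)
   (auto simp: exterior_power_entry_eq_minor[OF c] minor_toda_matrix(1) simp del: One_nat_def)
qed

section \<open>Euler characteristic of one-point quiver Grassmannians\<close>

lemma abelian_rank_integer: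
 assumes H: "comm_group H" and h: "h \<in> iso H integer_group"
 shows "abelian_rank H = 1"
proof -
 interpret H: comm_group H by (rule H)
 interpret h: group_hom H integer_group h
  using h by (simp add: group_hom_def group_hom_axioms_def iso_def H.is_group)
 have hb: "bij_betw h (carrier H) UNIV" using h by (simp add: iso_def integer_group_def)
 have hi: "x = y" if "h x = h y" "x \<in> carrier H" "y \<in> carrier H" for x y
  using hb that by (auto simp: bij_betw_def inj_on_def)
 have fp: "h (\<Otimes>\<^bsub>H\<^esub>s\<in>S. s [^]\<^bsub>H\<^esub> c s) = (\<Sum>s\<in>S. c s * h s)"
  if "finite S" "S \<subseteq> carrier H" for S and c :: "'a => int"
  using that
 proof (induction S)
  case (insert x S)
  have "(\<Otimes>\<^bsub>H\<^esub>s\<in>insert x S. s [^]\<^bsub>H\<^esub> c s) = x [^]\<^bsub>H\<^esub> c x \<otimes>\<^bsub>H\<^esub> (\<Otimes>\<^bsub>H\<^esub>s\<in>S. s [^]\<^bsub>H\<^esub> c s)"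
   using insert by (intro H.finprod_insert) auto
  moreover have "(\<Otimes>\<^bsub>H\<^esub>s\<in>S. s [^]\<^bsub>H\<^esub> c s) \<in> carrier H" using insert by (intro H.finprod_closed) auto
  ultimately show ?case using insert by (simp add: h.hom_int_pow)
 qed simp
 have ind: "independent_in H S <=> (ALL c. (\<Sum>s\<in>S. c s * h s) = 0 --> (\<forall>s\<in>S. c s = 0))"
  if S: "finite S" "S \<subseteq> carrier H" for S
 proof -
  have "(\<Otimes>\<^bsub>H\<^esub>s\<in>S. s [^]\<^bsub>H\<^esub> c s) = \<one>\<^bsub>H\<^esub> <=> (\<Sum>s\<in>S. c s * h s) = 0" for c :: "'a => int"
  proof -
   have "(\<Otimes>\<^bsub>H\<^esub>s\<in>S. s [^]\<^bsub>H\<^esub> c s) \<in> carrier H" using S by (intro H.finprod_closed) auto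
   then show ?thesis using hi[of "\<Otimes>\<^bsub>H\<^esub>s\<in>S. s [^]\<^bsub>H\<^esub> c s" "\<one>\<^bsub>H\<^esub>"] h.hom_one fp[OF S, of c] by auto
  qed
  then show ?thesis by (simp add: independent_in_def)
 qed
 have le: "card S \<le> 1" if S: "finite S" "S \<subseteq> carrier H" and i: "independent_in H S" for S
 proof -
  have "s = t" if "s \<in> S" "t \<in> S" for s t
  proof (rule ccontr)
   assume st: "s ~= t"
   \<comment> \<open>The coefficients \<open>h t\<close> of \<open>s\<close> and
     \<open>- h s\<close> of \<open>t\<close> give a relation between two distinct elements.
     Independence would make both values 0, which injectivity of \<open>h\<close> excludes.\<close>
   define c where "c = (%x. if x = s then h t else if x = t then - h s else 0)"
   have "(\<Sum>x\<in>S. c x * h x) = (\<Sum>x\<in>{s, t}. c x * h x)"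
    using that S by (intro sum.mono_neutral_right) (auto simp: c_def)
   also have "... = 0" using st by (simp add: c_def)
   finally have z: "c x = 0" if "x \<in> S" for x using i that unfolding ind[OF S] by blast
   have "h t = 0" "h s = 0" using z[of s] z[of t] \<open>s \<in> S\<close> \<open>t \<in> S\<close> st by (auto simp: c_def)
   then show False using hi[of s t] that S st by auto
  qed
  then show ?thesis using S(1) by (simp add: card_le_Suc0_iff_eq)
 qed
 obtain g where g: "g \<in> carrier H" "h g = 1" using hb by (metis UNIV_I bij_betwE bij_betw_def imageE)
 have "independent_in H {g}" using g ind[of "{g}"] by simp
 then have "1 \<in> {card S | S. finite S & S \<subseteq> carrier H & independent_in H S}"
  using g by (intro CollectI exI[of _ "{g}"]) simp
 then show ?thesis unfolding abelian_rank_def using le by (intro cSup_eq_maximum) auto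
qed

lemma abelian_rank_trivial:
 assumes G: "comm_group G" and t: "trivial_group G"
 shows "abelian_rank G = 0"
proof -
 interpret comm_group G by (rule G)
 have c: "carrier G = {\<one>\<^bsub>G\<^esub>}" using t by (simp add: trivial_group_def)
 have e: "S = {}" if S: "S \<subseteq> carrier G" "independent_in G S" for S
 proof (rule ccontr)
  assume "S ~= {}"
  then have "S = {\<one>\<^bsub>G\<^esub>}" using S(1) c by auto
  then show False using S(2)[unfolded independent_in_def, rule_format, of "%_. 1" "\<one>\<^bsub>G\<^esub>"] by simp
 qed
 have "card S = 0" if "S \<subseteq> carrier G" "independent_in G S" for S unfolding e[OF that] by simp
 moreover have "independent_in G {}" by (simp add: independent_in_def)
 then have "0 \<in> {card S | S. finite S & S \<subseteq> carrier G & independent_in G S}"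
  by (intro CollectI exI[of _ "{}"]) simp
 ultimately show ?thesis unfolding abelian_rank_def by (intro cSup_eq_maximum) auto
qed

text \<open>The homology of a one-point space is infinite cyclic in degree 0 and trivial in all
  others, by the dimension axiom. The quiver Grassmannians below turn out to be single points, so
  this evaluates every coefficient of the cluster character.\<close>

lemma euler_characteristic_point:
 assumes X: "topspace X = {a}"
 shows "euler_characteristic X = 1"
proof -
 have b: "betti p X = (if p = 0 then 1 else 0)" for p
 proof (cases "p = 0")
  case True
  have "homology_group 0 X \<cong> integer_group" using homology_coefficients[OF X] .
  then obtain h where "h \<in> iso (homology_group 0 X) integer_group" by (auto simp: is_iso_def)
  then show ?thesis using True abelian_rank_integer[of "homology_group 0 X" h] by (simp add: betti_def)
 next
  case False
  then show ?thesis using abelian_rank_trivial[of "homology_group (int p) X"]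
    homology_dimension_axiom[OF X, of "int p"] by (simp add: betti_def)
 qed
 have "{p. betti p X ~= 0} = {0}" by (auto simp: b)
 then show ?thesis by (simp add: euler_characteristic_def b)
qed

text \<open>The topology is given through its open sets, so its underlying set is known once the
  whole carrier is seen to be open; this holds because linear combinations stay in the
  carrier.\<close>

lemma topspace_vs_topology:
 assumes V: "vectorspace class_ring V"
 shows "topspace (vs_topology V) = carrier V"
proof
 interpret V: vectorspace class_ring V by (rule V)
 show "topspace (vs_topology V) \<subseteq> carrier V"
  by (auto simp: topspace_def openin_vs_topology)
 have "openin (vs_topology V) (carrier V)" unfolding openin_vs_topology
 proof (intro conjI allI ballI order_refl)
  fix m and x :: "nat => 'a" assume x: "x \<in> {..<m} \<rightarrow> carrier V"
  have "(\<Oplus>\<^bsub>V\<^esub>i\<in>{..<m}. c i \<odot>\<^bsub>V\<^esub> x i) \<in> carrier V" for c :: "nat => complex"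
   using x by (intro V.finsum_closed) (auto simp: Pi_iff intro!: V.smult_closed)
  then have "{c \<in> {..<m} \<rightarrow>\<^sub>E UNIV. (\<Oplus>\<^bsub>V\<^esub>i\<in>{..<m}. c i \<odot>\<^bsub>V\<^esub> x i) \<in> carrier V} =
    topspace (product_topology (%i. euclidean :: complex topology) {..<m})"
   by simp
  then show "openin (product_topology (%i. euclidean) {..<m})
    {c \<in> {..<m} \<rightarrow>\<^sub>E (UNIV :: complex set). (\<Oplus>\<^bsub>V\<^esub>i\<in>{..<m}. c i \<odot>\<^bsub>V\<^esub> x i) \<in> carrier V}"
   by (metis openin_topspace)
 qed
 then show "carrier V \<subseteq> topspace (vs_topology V)" by (rule openin_subset)
qed

text \<open>The frame is a basis of its span. This makes the map from frames to subspaces land in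
  \<open>grassmannian V k\<close>, hence the whole Grassmannian open in the quotient
  topology.\<close>

lemma span_frame_in_grassmannian:
 assumes V: "vectorspace class_ring V" and B: "B \<in> frames V k"
 shows "LinearCombinations.module.span class_ring V (B ` {..<k}) \<in> grassmannian V k"
proof -
 interpret V: vectorspace class_ring V by (rule V)
 let ?B = "B ` {..<k}" and ?U = "V.span (B ` {..<k})"
 have BV: "?B \<subseteq> carrier V" and li: "~ V.lin_dep ?B" and inj: "inj_on B {..<k}"
  using B by (auto simp: frames_def)
 have sub: "VectorSpace.subspace class_ring ?U V" by (rule V.span_is_subspace[OF BV])
 then have sm: "submodule class_ring ?U V" by (simp add: VectorSpace.subspace_def)
 have BU: "?B \<subseteq> ?U" by (rule V.in_own_span[OF BV])
 interpret U: vectorspace class_ring "V.vs ?U" by (rule V.subspace_is_vs[OF sub])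
 have g: "U.gen_set ?B" using V.span_li_not_depend(1)[OF BU sm] by simp
 have "~ U.lin_dep ?B" using V.span_li_not_depend(2)[OF BU sm] li by simp
 then have b: "U.basis ?B" using g BU by (simp add: U.basis_def)
 have "U.dim = k" using U.dim_basis[OF _ b] card_image[OF inj] by simp
 moreover have "U.fin_dim" unfolding U.fin_dim_def using g BU by (intro exI[of _ ?B]) auto
 ultimately show ?thesis using sub by (simp add: grassmannian_def)
qed

lemma topspace_grassmannian_topology:
 assumes V: "vectorspace class_ring V"
 shows "topspace (grassmannian_topology V k) = grassmannian V k"
proof
 show "topspace (grassmannian_topology V k) \<subseteq> grassmannian V k"
  by (auto simp: topspace_def openin_grassmannian_topology)
 have "{B \<in> frames V k. LinearCombinations.module.span class_ring V (B ` {..<k}) \<in> grassmannian V k} =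
   topspace (frame_topology V k)"
  using span_frame_in_grassmannian[OF V]
  by (auto simp: frame_topology_def topspace_subtopology topspace_vs_topology[OF V] frames_def)
 then have "openin (grassmannian_topology V k) (grassmannian V k)"
  unfolding openin_grassmannian_topology by (metis openin_topspace order_refl)
 then show "grassmannian V k \<subseteq> topspace (grassmannian_topology V k)" by (rule openin_subset)
qed

lemma topspace_quiver_grassmannian:
 assumes "!!v. v \<in> verts Q ==> vectorspace class_ring (rep_space M v)"
 shows "topspace (quiver_grassmannian_topology Q M e) = quiver_grassmannian Q M e"
proof -
 have "(\<Pi>\<^sub>E v\<in>verts Q. topspace (grassmannian_topology (rep_space M v) (e v))) =
   (\<Pi>\<^sub>E v\<in>verts Q. grassmannian (rep_space M v) (e v))"
  by (rule PiE_cong) (rule topspace_grassmannian_topology[OF assms])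
 then show ?thesis
  unfolding quiver_grassmannian_topology_def topspace_subtopology topspace_product_topology
  by (auto simp: quiver_grassmannian_def)
qed

lemma linear_bij_dim:
 fixes V :: "(complex, 'a) module" and W :: "(complex, 'b) module"
 assumes V: "vectorspace class_ring V" and W: "vectorspace class_ring W"
  and T: "T \<in> module_hom class_ring V W" and b: "bij_betw T (carrier V) (carrier W)"
  and fd: "vectorspace.fin_dim class_ring V"
 shows "vectorspace.fin_dim class_ring W" "vectorspace.dim class_ring W = vectorspace.dim class_ring V"
proof -
 interpret linear_map class_ring V W T
  using V W T by (simp add: linear_map_def mod_hom_def mod_hom_axioms_def vectorspace.axioms)
 have s: "T ` carrier V = carrier W" and i: "inj_on T (carrier V)" using b by (auto simp: bij_betw_def)
 show "vectorspace.fin_dim class_ring W" by (rule rank_nullity_main(2)[OF fd s])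
 show "vectorspace.dim class_ring W = vectorspace.dim class_ring V" by (rule dim_eq[OF fd i s, symmetric])
qed

section \<open>The completed path algebra and its closed ideals\<close>

lemma path_mult_apply:
 "(f \<otimes>\<^bsub>complete_path_algebra Q\<^esub> g) (u, r) =
  (\<Sum>k\<le>length r. f (qpath_end Q u (take k r), drop k r) * g (u, take k r))"
 by (simp add: complete_path_algebra_def)

lemma path_algebra_simps:
 "carrier (complete_path_algebra Q) = {f. ALL x. x \<notin> qpaths Q --> f x = 0}"
 "\<one>\<^bsub>complete_path_algebra Q\<^esub> = (%(u, p). if u \<in> verts Q & p = [] then 1 else 0)"
 "\<zero>\<^bsub>complete_path_algebra Q\<^esub> = (%x. 0)"
 "f \<oplus>\<^bsub>complete_path_algebra Q\<^esub> g = (%x. f x + g x)"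
 by (simp_all add: complete_path_algebra_def)

text \<open>Both sides sum over the ways of cutting a path in three; \<open>t i j\<close> is the
  term whose first two pieces have lengths \<open>i\<close> and \<open>j\<close>.\<close>

lemma path_mult_assoc:
 fixes Q :: "('v, 'e) quiver"
 shows "f \<otimes>\<^bsub>complete_path_algebra Q\<^esub> g \<otimes>\<^bsub>complete_path_algebra Q\<^esub> h =
 f \<otimes>\<^bsub>complete_path_algebra Q\<^esub> (g \<otimes>\<^bsub>complete_path_algebra Q\<^esub> h)"
proof (rule ext, clarify)
 fix u :: 'v and r :: "'e list"
 let ?e = "qpath_end Q"
 let ?n = "length r"
 have e: "?e (?e u p) q = ?e u (p @ q)" for p q
  by (simp add: pre_digraph.awalk_verts_conv)
 define t where "t i j = f (?e u (take (i + j) r), drop (i + j) r) *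
   (g (?e u (take i r), take j (drop i r)) * h (u, take i r))" for i j
 have "(f \<otimes>\<^bsub>complete_path_algebra Q\<^esub> g \<otimes>\<^bsub>complete_path_algebra Q\<^esub> h) (u, r) =
   (\<Sum>i\<le>?n. \<Sum>j\<le>?n - i. t i j)"
  unfolding path_mult_apply sum_distrib_right
  by (intro sum.cong refl)
   (simp_all add: t_def e flip: take_add, simp_all add: ac_simps)
 also have "... = (\<Sum>(i, j)\<in>{(i, j). i + j \<le> ?n}. t i j)"
  by (subst sum.Sigma) (auto intro!: sum.cong)
 also have "... = (\<Sum>k\<le>?n. \<Sum>i\<le>k. t i (k - i))"
  by (rule sum.triangle_reindex_eq)
 also have "... = (f \<otimes>\<^bsub>complete_path_algebra Q\<^esub> (g \<otimes>\<^bsub>complete_path_algebra Q\<^esub> h)) (u, r)"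
  unfolding path_mult_apply sum_distrib_left
 proof (rule sum.cong[OF refl])
  fix k assume k: "k \<in> {..?n}"
  show "(\<Sum>i\<le>k. t i (k - i)) =
    (\<Sum>i\<le>length (take k r). f (?e u (take k r), drop k r) *
     (g (?e u (take i (take k r)), drop i (take k r)) * h (u, take i (take k r))))"
   using k by (intro sum.cong) (auto simp: t_def drop_take min.absorb2)
 qed
 finally show "(f \<otimes>\<^bsub>complete_path_algebra Q\<^esub> g \<otimes>\<^bsub>complete_path_algebra Q\<^esub> h) (u, r) =
   (f \<otimes>\<^bsub>complete_path_algebra Q\<^esub> (g \<otimes>\<^bsub>complete_path_algebra Q\<^esub> h)) (u, r)" .
qed

context wf_digraph
begin

lemma qpaths_iff: "(u, p) \<in> qpaths G <=> awalk u p (awlast u p)"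
 unfolding qpaths_def by auto

lemma path_mult_closed:
 assumes "f \<in> carrier (complete_path_algebra G)" "g \<in> carrier (complete_path_algebra G)"
 shows "f \<otimes>\<^bsub>complete_path_algebra G\<^esub> g \<in> carrier (complete_path_algebra G)"
proof -
 have "(f \<otimes>\<^bsub>complete_path_algebra G\<^esub> g) (u, r) = 0" if "(u, r) \<notin> qpaths G" for u r
  unfolding path_mult_apply
 proof (rule sum.neutral, rule ballI)
  fix k
  have "~ ((u, take k r) \<in> qpaths G & (awlast u (take k r), drop k r) \<in> qpaths G)"
   using that awalk_append_iff[of u "take k r" "drop k r" "awlast u r"]
    awlast_append[of u "take k r" "drop k r"]
   by (auto simp: qpaths_iff)
  then show "f (awlast u (take k r), drop k r) * g (u, take k r) = 0"
   using assms by (auto simp: path_algebra_simps)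
 qed
 then show ?thesis by (auto simp: path_algebra_simps)
qed

lemma ring_complete_path_algebra: "ring (complete_path_algebra G)"
proof (rule ringI)
 show "abelian_group (complete_path_algebra G)"
 proof (rule abelian_groupI)
  fix x assume "x \<in> carrier (complete_path_algebra G)"
  then show "\<exists>y\<in>carrier (complete_path_algebra G).
    y \<oplus>\<^bsub>complete_path_algebra G\<^esub> x = \<zero>\<^bsub>complete_path_algebra G\<^esub>"
   by (intro bexI[of _ "%p. - x p"]) (auto simp: path_algebra_simps)
 qed (auto simp: path_algebra_simps)
 show "Group.monoid (complete_path_algebra G)"
 proof (rule Group.monoidI)
  fix f assume f: "f \<in> carrier (complete_path_algebra G)"
  have "(\<one>\<^bsub>complete_path_algebra G\<^esub> \<otimes>\<^bsub>complete_path_algebra G\<^esub> f) (u, r) = f (u, r)" for u r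
  proof -
   have "(\<one>\<^bsub>complete_path_algebra G\<^esub> \<otimes>\<^bsub>complete_path_algebra G\<^esub> f) (u, r) =
     (\<Sum>k\<le>length r. if k = length r then f (u, r) else 0)"
    unfolding path_mult_apply
   proof (rule sum.cong[OF refl])
    fix k assume "k \<in> {..length r}"
    moreover have "f (u, r) = 0" if "awlast u r \<notin> verts G"
     using f that by (auto simp: path_algebra_simps qpaths_iff)
    ultimately show "\<one>\<^bsub>complete_path_algebra G\<^esub> (awlast u (take k r), drop k r) * f (u, take k r) =
      (if k = length r then f (u, r) else 0)"
     by (auto simp: path_algebra_simps)
   qed
   then show ?thesis by simp
  qed
  then show "\<one>\<^bsub>complete_path_algebra G\<^esub> \<otimes>\<^bsub>complete_path_algebra G\<^esub> f = f" by auto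
  have "(f \<otimes>\<^bsub>complete_path_algebra G\<^esub> \<one>\<^bsub>complete_path_algebra G\<^esub>) (u, r) = f (u, r)" for u r
  proof -
   have "(f \<otimes>\<^bsub>complete_path_algebra G\<^esub> \<one>\<^bsub>complete_path_algebra G\<^esub>) (u, r) =
     (\<Sum>k\<le>length r. if k = 0 then f (u, r) else 0)"
    unfolding path_mult_apply
   proof (rule sum.cong[OF refl])
    fix k assume "k \<in> {..length r}"
    moreover have "f (u, r) = 0" if "u \<notin> verts G"
     using f that by (auto simp: path_algebra_simps qpaths_iff awalk_def)
    ultimately show "f (awlast u (take k r), drop k r) * \<one>\<^bsub>complete_path_algebra G\<^esub> (u, take k r) =
      (if k = 0 then f (u, r) else 0)"
     by (auto simp: path_algebra_simps)
   qed
   then show ?thesis by simp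
  qed
  then show "f \<otimes>\<^bsub>complete_path_algebra G\<^esub> \<one>\<^bsub>complete_path_algebra G\<^esub> = f" by auto
 qed (auto simp: path_mult_closed path_mult_assoc, auto simp: path_algebra_simps qpaths_iff awalk_Nil_iff)
qed (auto simp: fun_eq_iff path_mult_apply path_algebra_simps sum.distrib algebra_simps)

lemma cyclic_derivative_closed:
 assumes "W \<in> carrier (complete_path_algebra G)" "al \<in> arcs G"
 shows "cyclic_derivative G W al \<in> carrier (complete_path_algebra G)"
proof -
 have "cyclic_derivative G W al (u, p) = 0" if "(u, p) \<notin> qpaths G" for u p
 proof (cases "u = head G al")
  case True
  have "W (awlast u (take m p), drop m p @ [al] @ take m p) = 0" for m
  proof -
   \<comment> \<open>Were the rotated list a path, then cutting it at \<open>al\<close> and joining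
     the two pieces in the other order would make \<open>p\<close> a path.\<close>
   have "(awlast u (take m p), drop m p @ [al] @ take m p) \<notin> qpaths G"
   proof
    assume "(awlast u (take m p), drop m p @ [al] @ take m p) \<in> qpaths G"
    then obtain x where "awalk (awlast u (take m p)) (drop m p @ [al] @ take m p) x"
     unfolding qpaths_iff by blast
    then have a: "awalk (awlast u (take m p)) (drop m p) (tail G al)"
     and b: "awalk (head G al) (take m p) x"
     unfolding awalk_append_iff by (auto simp: awalk_Cons_iff)
    have "awalk u (take m p) (awlast u (take m p))" using b True by auto
    then have "awalk u (take m p @ drop m p) (tail G al)"
     using a by (rule awalk_appendI)
    then show False using that by (auto simp: qpaths_iff)
   qed
   then show ?thesis using assms by (auto simp: path_algebra_simps)
  qed
  then show ?thesis unfolding cyclic_derivative_def by (simp only: prod.case) simp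
 qed (simp add: cyclic_derivative_def)
 then show ?thesis by (auto simp: path_algebra_simps)
qed

lemma additive_subgroup_complete_path_algebraI:
 assumes "I \<subseteq> carrier (complete_path_algebra G)" "(%x. 0) \<in> I"
  "!!f g. f \<in> I ==> g \<in> I ==> (%x. f x + g x) \<in> I" "!!f. f \<in> I ==> (%x. - f x) \<in> I"
 shows "subgroup I (add_monoid (complete_path_algebra G))"
proof -
 interpret ring "complete_path_algebra G" by (rule ring_complete_path_algebra)
 have inv: "\<ominus>\<^bsub>complete_path_algebra G\<^esub> f = (%x. - f x)" if "f \<in> carrier (complete_path_algebra G)" for f
  using that by (intro minus_equality) (auto simp: path_algebra_simps)
 show ?thesis
  using assms inv
  by (intro add.subgroupI) (auto simp: path_algebra_simps a_inv_def)
qed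

text \<open>The coefficient of a product at a path of length below \<open>N\<close> involves only
  coefficients at paths of length below \<open>N\<close>, so an approximation of one factor gives
  one of the product.\<close>

lemma ideal_arrow_adic_closure:
 assumes "ideal I (complete_path_algebra G)"
 shows "ideal (arrow_adic_closure G I) (complete_path_algebra G)"
proof -
 interpret R: ring "complete_path_algebra G" by (rule ring_complete_path_algebra)
 interpret I: ideal I "complete_path_algebra G" by (rule assms)
 let ?C = "arrow_adic_closure G I"
 show ?thesis
 proof (rule idealI[OF ring_complete_path_algebra additive_subgroup_complete_path_algebraI])
  show "?C \<subseteq> carrier (complete_path_algebra G)" by (auto simp: arrow_adic_closure_def)
  show "(%x. 0) \<in> ?C"
   using I.zero_closed R.zero_closed unfolding arrow_adic_closure_def path_algebra_simps(3) by auto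
 next
  fix f g assume f: "f \<in> ?C" and g: "g \<in> ?C"
  have "\<exists>h\<in>I. ALL u p. length p < N --> f (u, p) + g (u, p) = h (u, p)" for N
  proof -
   obtain f' where "f' \<in> I" "ALL u p. length p < N --> f (u, p) = f' (u, p)"
    using f unfolding arrow_adic_closure_def by blast
   moreover obtain g' where "g' \<in> I" "ALL u p. length p < N --> g (u, p) = g' (u, p)"
    using g unfolding arrow_adic_closure_def by blast
   ultimately show ?thesis
    using I.a_closed[of f' g'] by (intro bexI[of _ "%x. f' x + g' x"]) (auto simp: path_algebra_simps)
  qed
  then show "(%x. f x + g x) \<in> ?C"
   using f g by (auto simp: arrow_adic_closure_def path_algebra_simps)
 next
  fix f assume f: "f \<in> ?C"
  have "\<exists>h\<in>I. ALL u p. length p < N --> - f (u, p) = h (u, p)" for N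
  proof -
   obtain f' where f': "f' \<in> I" "ALL u p. length p < N --> f (u, p) = f' (u, p)"
    using f unfolding arrow_adic_closure_def by blast
   have "\<ominus>\<^bsub>complete_path_algebra G\<^esub> f' = (%x. - f' x)"
    using I.Icarr[OF f'(1)] by (intro R.minus_equality) (auto simp: path_algebra_simps)
   then show ?thesis
    using I.a_inv_closed[OF f'(1)] f'(2) by (intro bexI[of _ "%x. - f' x"]) auto
  qed
  then show "(%x. - f x) \<in> ?C"
   using f by (auto simp: arrow_adic_closure_def path_algebra_simps)
 next
  fix f g assume f: "f \<in> ?C" and g: "g \<in> carrier (complete_path_algebra G)"
  have fc: "f \<in> carrier (complete_path_algebra G)" using f by (simp add: arrow_adic_closure_def)
  have "\<exists>h\<in>I. ALL u p. length p < N --> f (u, p) = h (u, p)" for N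
   using f unfolding arrow_adic_closure_def by blast
  then obtain F where F: "!!N. F N \<in> I" "!!N u p. length p < N ==> f (u, p) = F N (u, p)"
   by metis
  have eq: "(g \<otimes>\<^bsub>complete_path_algebra G\<^esub> f) (u, p) = (g \<otimes>\<^bsub>complete_path_algebra G\<^esub> F N) (u, p)"
   "(f \<otimes>\<^bsub>complete_path_algebra G\<^esub> g) (u, p) = (F N \<otimes>\<^bsub>complete_path_algebra G\<^esub> g) (u, p)"
   if "length p < N" for u p N
   unfolding path_mult_apply using that by (auto intro!: sum.cong simp: F(2))
  show "g \<otimes>\<^bsub>complete_path_algebra G\<^esub> f \<in> ?C"
   using I.I_l_closed[OF F(1) g] R.m_closed[OF g fc] eq(1)
   unfolding arrow_adic_closure_def by blast
  show "f \<otimes>\<^bsub>complete_path_algebra G\<^esub> g \<in> ?C"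
   using I.I_r_closed[OF F(1) g] R.m_closed[OF fc g] eq(2)
   unfolding arrow_adic_closure_def by blast
 qed
qed

lemma ideal_jacobian_ideal:
 assumes "W \<in> carrier (complete_path_algebra G)"
 shows "ideal (jacobian_ideal G W) (complete_path_algebra G)"
 unfolding jacobian_ideal_def
 using cyclic_derivative_closed[OF assms]
 by (intro ideal_arrow_adic_closure ring.genideal_ideal[OF ring_complete_path_algebra]) auto

end

section \<open>The Toda quiver and its relations\<close>

abbreviation toda_awalk :: "nat => nat => toda_arrow list => nat => bool" where
 "toda_awalk n \<equiv> pre_digraph.awalk (tq n)"

lemma toda_quiver_simps [simp]:
 "verts (tq n) = {1..2 * n}"
 "tail (tq n) = toda_tail"
 "head (tq n) = toda_head"
 by (simp_all add: toda_quiver_def)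

lemma arcs_toda_quiver [simp]:
 "Arrow_a j \<in> arcs (tq n) <=> 1 \<le> j & j \<le> n"
 "Arrow_b j \<in> arcs (tq n) <=> 1 \<le> j & j \<le> n"
 "Arrow_l j \<in> arcs (tq n) <=> 2 \<le> j & j \<le> n"
 "Arrow_r j \<in> arcs (tq n) <=> 1 \<le> j & j < n"
 by (auto simp: toda_quiver_def)

lemma finite_arcs_toda_quiver [simp]: "finite (arcs (tq n))"
 by (simp add: toda_quiver_def)

lemma wf_digraph_toda_quiver: "wf_digraph (tq n)"
proof
 fix e assume e: "e \<in> arcs (tq n)"
 show "tail (tq n) e \<in> verts (tq n)"
  using e by (cases e) auto
 show "head (tq n) e \<in> verts (tq n)"
  using e by (cases e) auto
qed

lemmas toda_awalk_Nil_iff = wf_digraph.awalk_Nil_iff[OF wf_digraph_toda_quiver]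
lemmas toda_awalk_Cons_iff =
 wf_digraph.awalk_Cons_iff[OF wf_digraph_toda_quiver, unfolded toda_quiver_simps]
lemmas toda_awalk_simps = toda_awalk_Nil_iff toda_awalk_Cons_iff

lemma toda_awalk_append_iff:
 "toda_awalk n u (p @ q) v <=> (EX w. toda_awalk n u p w & toda_awalk n w q v)"
 by (induction p arbitrary: u)
  (auto simp: toda_awalk_simps dest: wf_digraph.awalk_hd_in_verts[OF wf_digraph_toda_quiver])

lemma toda_awalk_verts:
 assumes "toda_awalk n u p v" shows "u \<in> {1..2 * n}" "v \<in> {1..2 * n}"
 using wf_digraph.awalk_hd_in_verts[OF wf_digraph_toda_quiver assms]
  wf_digraph.awalk_last_in_verts[OF wf_digraph_toda_quiver assms] by simp_all

lemma toda_awalk_end: "toda_awalk n u p v ==> qpath_end (tq n) u p = v"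
 by (rule wf_digraph.awlast_if_cas[OF wf_digraph_toda_quiver]) (simp add: pre_digraph.awalk_def)

lemma toda_awalk_unique: "toda_awalk n u p v ==> toda_awalk n u p w ==> v = w"
 using toda_awalk_end by blast

lemma qpaths_toda_iff: "(u, p) \<in> qpaths (tq n) <=> (EX v. toda_awalk n u p v)"
 by (simp add: qpaths_def)

lemma toda_potential_apply:
 "toda_potential n (v, xs) =
  (case xs of [Arrow_r i, y, z, w] =>
    if v = 2 * i & 1 \<le> i & i < n then
     of_bool (y = Arrow_b (i + 1) & z = Arrow_l (i + 1) & w = Arrow_a i) -
     of_bool (y = Arrow_a (i + 1) & z = Arrow_l (i + 1) & w = Arrow_b i)
    else 0
   | _ => 0)"
proof -
 have *: "toda_potential n (v, xs) =
   (\<Sum>i\<in>{1..<n}. of_bool (v = 2 * i & xs = [Arrow_r i, Arrow_b (i + 1), Arrow_l (i + 1), Arrow_a i]) -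
    of_bool (v = 2 * i & xs = [Arrow_r i, Arrow_a (i + 1), Arrow_l (i + 1), Arrow_b i]))"
  by (simp add: toda_potential_def path_elem_def of_bool_def)
 show ?thesis
 proof (cases "EX i y z w. xs = [Arrow_r i, y, z, w]")
  case True
  then obtain i y z w where xs: "xs = [Arrow_r i, y, z, w]" by blast
  have E: "toda_potential n (v, xs) =
    (\<Sum>k\<in>{1..<n}. if k = i then (if v = 2 * i then
     of_bool (y = Arrow_b (i + 1) & z = Arrow_l (i + 1) & w = Arrow_a i) -
     of_bool (y = Arrow_a (i + 1) & z = Arrow_l (i + 1) & w = Arrow_b i) else 0) else 0)"
   unfolding * by (intro sum.cong refl) (auto simp: xs)
  show ?thesis unfolding E by (auto simp: xs)
 next
  case False
  then have "toda_potential n (v, xs) = 0" unfolding * by (intro sum.neutral) auto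
  then show ?thesis using False by (auto split: list.splits toda_arrow.splits)
 qed
qed

lemma toda_potential_length: "length xs ~= 4 ==> toda_potential n (v, xs) = 0"
 unfolding toda_potential_apply by (auto split: list.splits toda_arrow.splits)

lemma toda_potential_simps [simp]:
 "toda_potential n (v, [Arrow_r i, y, z, w]) = (if v = 2 * i & 1 \<le> i & i < n & z = Arrow_l (i + 1) then
  (if y = Arrow_b (i + 1) & w = Arrow_a i then 1
   else if y = Arrow_a (i + 1) & w = Arrow_b i then -1 else 0) else 0)"
 "toda_potential n (v, [Arrow_a i, y, z, w]) = 0"
 "toda_potential n (v, [Arrow_b i, y, z, w]) = 0"
 "toda_potential n (v, [Arrow_l i, y, z, w]) = 0"
 by (simp_all add: toda_potential_apply)

lemma toda_potential_closed: "toda_potential n \<in> carrier (complete_path_algebra (tq n))"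
proof -
 have "toda_potential n (v, xs) = 0" if "(v, xs) \<notin> qpaths (tq n)" for v xs
  using that unfolding toda_potential_apply qpaths_toda_iff
  by (auto split: list.splits toda_arrow.splits simp: of_bool_def toda_awalk_simps)
 then show ?thesis by (auto simp: path_algebra_simps)
qed

text \<open>Two pairs of a coefficient and a path; the cyclic derivative with respect to the arrow
  is the first term minus the second. At the ends of the quiver a list of nonexistent arrows is
  still recorded, with coefficient 0.\<close>

fun toda_rel :: "nat => toda_arrow => (complex \<times> toda_arrow list) \<times> (complex \<times> toda_arrow list)" where
 "toda_rel n (Arrow_a j) =
  ((of_bool (j < n), [Arrow_r j, Arrow_b (j + 1), Arrow_l (j + 1)]),
   (of_bool (1 < j), [Arrow_l j, Arrow_b (j - 1), Arrow_r (j - 1)]))"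
| "toda_rel n (Arrow_b j) =
  ((of_bool (1 < j), [Arrow_l j, Arrow_a (j - 1), Arrow_r (j - 1)]),
   (of_bool (j < n), [Arrow_r j, Arrow_a (j + 1), Arrow_l (j + 1)]))"
| "toda_rel n (Arrow_l j) =
  ((1, [Arrow_a (j - 1), Arrow_r (j - 1), Arrow_b j]),
   (1, [Arrow_b (j - 1), Arrow_r (j - 1), Arrow_a j]))"
| "toda_rel n (Arrow_r j) =
  ((1, [Arrow_b (j + 1), Arrow_l (j + 1), Arrow_a j]),
   (1, [Arrow_a (j + 1), Arrow_l (j + 1), Arrow_b j]))"

text \<open>Together with the next lemma for the middle places and the simplification rules for the
  first place, this covers the four rotations that occur in a cyclic derivative.\<close>

lemma toda_potential_last:
 "toda_potential n (v, [x, y, z, Arrow_a j]) =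
  of_bool (v = 2 * j & 1 \<le> j & j < n & x = Arrow_r j & y = Arrow_b (j + 1) & z = Arrow_l (j + 1))"
 "toda_potential n (v, [x, y, z, Arrow_b j]) =
  - of_bool (v = 2 * j & 1 \<le> j & j < n & x = Arrow_r j & y = Arrow_a (j + 1) & z = Arrow_l (j + 1))"
 "toda_potential n (v, [x, y, z, Arrow_l j]) = 0"
 "toda_potential n (v, [x, y, z, Arrow_r j]) = 0"
 by (cases x; auto)+

lemma toda_potential_rot:
 "toda_potential n (v, [x, y, Arrow_a j, z]) = 0"
 "toda_potential n (v, [x, y, Arrow_b j, z]) = 0"
 "toda_potential n (v, [x, y, Arrow_r j, z]) = 0"
 "toda_potential n (v, [x, y, Arrow_l j, z]) =
  of_bool (2 \<le> j & j \<le> n & v = 2 * (j - 1) & x = Arrow_r (j - 1)) *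
  (of_bool (y = Arrow_b j & z = Arrow_a (j - 1)) - of_bool (y = Arrow_a j & z = Arrow_b (j - 1)))"
 "toda_potential n (v, [x, Arrow_a j, y, z]) =
  - of_bool (2 \<le> j & j \<le> n & v = 2 * (j - 1) & x = Arrow_r (j - 1) & y = Arrow_l j & z = Arrow_b (j - 1))"
 "toda_potential n (v, [x, Arrow_b j, y, z]) =
  of_bool (2 \<le> j & j \<le> n & v = 2 * (j - 1) & x = Arrow_r (j - 1) & y = Arrow_l j & z = Arrow_a (j - 1))"
 "toda_potential n (v, [x, Arrow_l j, y, z]) = 0"
 "toda_potential n (v, [x, Arrow_r j, y, z]) = 0"
proof -
 have *: "2 \<le> j & j \<le> n & v = 2 * (j - 1) & x = Arrow_r (j - 1) <=>
   (EX k. 1 \<le> k & k < n & v = 2 * k & x = Arrow_r k & j = k + 1)" for x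
  by (auto simp: le_Suc_eq intro!: exI[of _ "j - 1"])
 show "toda_potential n (v, [x, y, Arrow_l j, z]) =
  of_bool (2 \<le> j & j \<le> n & v = 2 * (j - 1) & x = Arrow_r (j - 1)) *
  (of_bool (y = Arrow_b j & z = Arrow_a (j - 1)) - of_bool (y = Arrow_a j & z = Arrow_b (j - 1)))"
  unfolding * by (cases x) (auto simp: of_bool_def)
 show "toda_potential n (v, [x, Arrow_a j, y, z]) =
  - of_bool (2 \<le> j & j \<le> n & v = 2 * (j - 1) & x = Arrow_r (j - 1) & y = Arrow_l j & z = Arrow_b (j - 1))"
  "toda_potential n (v, [x, Arrow_b j, y, z]) =
  of_bool (2 \<le> j & j \<le> n & v = 2 * (j - 1) & x = Arrow_r (j - 1) & y = Arrow_l j & z = Arrow_a (j - 1))"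
  by (cases x; cases j; auto simp: of_bool_def)+
qed (cases x; simp)+

lemma atMost_3: "{..3::nat} = {0, 1, 2, 3}" by auto

text \<open>All cycles of the potential have length 4, so the derivative lives on paths of length 3.
  Its coefficient there is a sum of four values of the potential, one for each place at which the
  arrow can be inserted.\<close>

lemma cyclic_derivative_toda:
 assumes "al \<in> arcs (tq n)" "toda_rel n al = ((s, p), (t, q))"
 shows "cyclic_derivative (tq n) (tp n) al =
  (%x. s * path_elem (toda_head al) p x - t * path_elem (toda_head al) q x)"
proof (rule ext, clarify)
 fix u xs
 have len: "length p = 3" "length q = 3" using assms(2) by (cases al; auto)+
 show "cyclic_derivative (tq n) (tp n) al (u, xs) =
   s * path_elem (toda_head al) p (u, xs) - t * path_elem (toda_head al) q (u, xs)"
 proof (cases "u = toda_head al & length xs = 3")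
  case False
  have "toda_potential n (v, drop m xs @ [al] @ take m xs) = 0"
   if "m \<le> length xs" "length xs ~= 3" for v m
   using that by (intro toda_potential_length) simp
  then show ?thesis using False len
   by (auto simp: cyclic_derivative_def path_elem_def)
 next
  case True
  then obtain x y z where xs: "xs = [x, y, z]"
   by (auto simp: numeral_3_eq_3 length_Suc_conv)
  let ?S = "%al. toda_potential n (u, [x, y, z, al]) + toda_potential n (toda_head x, [y, z, al, x]) +
    toda_potential n (toda_head y, [z, al, x, y]) + toda_potential n (toda_head z, [al, x, y, z])"
  have "cyclic_derivative (tq n) (tp n) al (u, xs) = ?S al"
   using True by (simp add: cyclic_derivative_def xs atMost_3 numeral_3_eq_3 pre_digraph.awalk_verts_conv)
  also have "... = s * path_elem (toda_head al) p (u, xs) - t * path_elem (toda_head al) q (u, xs)"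
  proof (cases al)
   case (Arrow_a j)
   have j: "1 \<le> j & j \<le> n"
    using assms(1) Arrow_a by auto
   have u: "u = toda_head (Arrow_a j)" using True Arrow_a by simp
   have "?S (Arrow_a j) = of_bool (j < n & x = Arrow_r j & y = Arrow_b (j + 1) & z = Arrow_l (j + 1)) -
     of_bool (1 < j & x = Arrow_l j & y = Arrow_b (j - 1) & z = Arrow_r (j - 1))"
    unfolding u toda_potential_last toda_potential_rot toda_potential_simps
    using j by (auto simp: of_bool_def)
   also have "... = s * path_elem (toda_head al) p (u, xs) - t * path_elem (toda_head al) q (u, xs)"
    using assms(2) u j unfolding xs Arrow_a by (auto simp: path_elem_def of_bool_def)
   finally show ?thesis unfolding Arrow_a .
  next
   case (Arrow_b j)
   have j: "1 \<le> j & j \<le> n"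
    using assms(1) Arrow_b by auto
   have u: "u = toda_head (Arrow_b j)" using True Arrow_b by simp
   have "?S (Arrow_b j) = of_bool (1 < j & x = Arrow_l j & y = Arrow_a (j - 1) & z = Arrow_r (j - 1)) -
     of_bool (j < n & x = Arrow_r j & y = Arrow_a (j + 1) & z = Arrow_l (j + 1))"
    unfolding u toda_potential_last toda_potential_rot toda_potential_simps
    using j by (auto simp: of_bool_def)
   also have "... = s * path_elem (toda_head al) p (u, xs) - t * path_elem (toda_head al) q (u, xs)"
    using assms(2) u j unfolding xs Arrow_b by (auto simp: path_elem_def of_bool_def)
   finally show ?thesis unfolding Arrow_b .
  next
   case (Arrow_l j)
   have j: "2 \<le> j & j \<le> n"
    using assms(1) Arrow_l by auto
   have u: "u = toda_head (Arrow_l j)" using True Arrow_l by simp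
   have "?S (Arrow_l j) = of_bool (x = Arrow_a (j - 1) & y = Arrow_r (j - 1) & z = Arrow_b j) -
     of_bool (x = Arrow_b (j - 1) & y = Arrow_r (j - 1) & z = Arrow_a j)"
    unfolding u toda_potential_last toda_potential_rot toda_potential_simps
    using j by (auto simp: of_bool_def)
   also have "... = s * path_elem (toda_head al) p (u, xs) - t * path_elem (toda_head al) q (u, xs)"
    using assms(2) u j unfolding xs Arrow_l by (auto simp: path_elem_def of_bool_def)
   finally show ?thesis unfolding Arrow_l .
  next
   case (Arrow_r j)
   have j: "1 \<le> j & j < n"
    using assms(1) Arrow_r by auto
   have u: "u = toda_head (Arrow_r j)" using True Arrow_r by simp
   have "?S (Arrow_r j) = of_bool (x = Arrow_b (j + 1) & y = Arrow_l (j + 1) & z = Arrow_a j) -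
     of_bool (x = Arrow_a (j + 1) & y = Arrow_l (j + 1) & z = Arrow_b j)"
    unfolding u toda_potential_last toda_potential_rot toda_potential_simps
    using j by (auto simp: of_bool_def)
   also have "... = s * path_elem (toda_head al) p (u, xs) - t * path_elem (toda_head al) q (u, xs)"
    using assms(2) u j unfolding xs Arrow_r by (auto simp: path_elem_def of_bool_def)
   finally show ?thesis unfolding Arrow_r .
  qed
  finally show ?thesis .
 qed
qed

declare One_nat_def [simp del]

section \<open>Normal forms of paths modulo the relations\<close>

text \<open>Renaming the arrows makes the relations uniform. A letter leads from
  \<open>2 * j - 1\<close> to \<open>2 * j\<close> within level \<open>j\<close>, with
  \<open>True\<close> for \<open>Arrow_b\<close>; a step changes the level, with \<open>True\<close>
  for upwards. Letters and steps alternate along every path.\<close>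

definition letter :: "bool => nat => toda_arrow" where
 "letter x j = (if x then Arrow_b j else Arrow_a j)"

definition step :: "bool => nat => toda_arrow" where
 "step d j = (if d then Arrow_r j else Arrow_l j)"

definition next_level :: "bool => nat => nat" where
 "next_level d j = (if d then j + 1 else j - 1)"

definition can_step :: "nat => bool => nat => bool" where
 "can_step n d j <=> (if d then j < n else 1 < j)"

text \<open>How many steps in direction \<open>d\<close> fit between level \<open>j\<close> and the
  end of the quiver.\<close>

definition room :: "nat => bool => nat => nat" where
 "room n d j = (if d then n - j else j - 1)"

definition steps :: "bool => toda_arrow list => nat" where
 "steps d p = length (filter (%al. EX k. al = step d k) p)"

definition letters :: "toda_arrow list => bool set" where
 "letters p = {x. EX k. letter x k \<in> set p}"

lemma letter_eq_iff [simp]: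
 "letter x j = letter y k <=> x = y & j = k" "letter x j ~= step d k" "step d k ~= letter x j"
 "step d j = step e k <=> d = e & j = k"
 by (auto simp: letter_def step_def)

lemma steps_simps [simp]:
 "steps d [] = 0" "steps d (letter x j # p) = steps d p"
 "steps d (step e j # p) = (if d = e then Suc (steps d p) else steps d p)"
 "steps d (p @ q) = steps d p + steps d q"
 by (auto simp: steps_def)

lemma letters_simps [simp]:
 "letters [] = {}" "letters (letter x j # p) = insert x (letters p)"
 "letters (step d j # p) = letters p" "letters (p @ q) = letters p \<union> letters q"
 by (auto simp: letters_def)

lemma next_level_next_level [simp]: "can_step n d j ==> next_level (~ d) (next_level d j) = j"
 by (auto simp: next_level_def can_step_def)

lemma can_step_next_level: "can_step n d j ==> 1 \<le> j ==> j \<le> n ==> can_step n (~ d) (next_level d j)"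
 by (auto simp: next_level_def can_step_def)

lemma next_level_range: "can_step n d j ==> 1 \<le> j ==> j \<le> n ==> 1 \<le> next_level d j & next_level d j \<le> n"
 by (auto simp: next_level_def can_step_def split: if_splits)

lemma toda_arrow_simps [simp]:
 "letter x j \<in> arcs (tq n) <=> 1 \<le> j & j \<le> n"
 "step d j \<in> arcs (tq n) <=> 1 \<le> j & j \<le> n & can_step n d j"
 "toda_tail (letter x j) = 2 * j - 1" "toda_head (letter x j) = 2 * j"
 "toda_tail (step d j) = 2 * j"
 by (auto simp: letter_def step_def can_step_def)

lemma toda_head_step: "1 \<le> j ==> toda_head (step d j) = 2 * next_level d j - 1"
 by (auto simp: step_def next_level_def)

lemma awalk_odd_ConsE:
 assumes "toda_awalk n (2 * j - 1) (al # q) v" "1 \<le> j"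
 obtains x where "al = letter x j" "j \<le> n" "toda_awalk n (2 * j) q v"
proof (cases al)
 case (Arrow_a k)
 then have "k = j" using assms by (auto simp: toda_awalk_simps)
 then show thesis using that[of False] assms Arrow_a by (auto simp: letter_def toda_awalk_simps)
next
 case (Arrow_b k)
 then have "k = j" using assms by (auto simp: toda_awalk_simps)
 then show thesis using that[of True] assms Arrow_b by (auto simp: letter_def toda_awalk_simps)
next
 case (Arrow_l k)
 then have "2 * k = 2 * j - 1" using assms(1) by (simp add: toda_awalk_simps)
 then have False using assms(2) by presburger
 then show thesis ..
next
 case (Arrow_r k)
 then have "2 * k = 2 * j - 1" using assms(1) by (simp add: toda_awalk_simps)
 then have False using assms(2) by presburger
 then show thesis ..
qed

lemma awalk_even_ConsE:
 assumes "toda_awalk n (2 * j) (al # q) v"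
 obtains d where "al = step d j" "1 \<le> j" "j \<le> n" "can_step n d j"
  "toda_awalk n (2 * next_level d j - 1) q v"
proof (cases al)
 case (Arrow_r k)
 with assms have j: "k = j" "1 \<le> j" "j < n" "toda_awalk n (2 * j + 1) q v"
  by (auto simp: toda_awalk_simps)
 have "2 * next_level True j - 1 = 2 * j + 1" by (simp add: next_level_def)
 then show thesis using that[of True] Arrow_r j
  by (simp add: step_def can_step_def)
next
 case (Arrow_l k)
 have "2 * j - 3 = 2 * (j - 1) - 1" by simp
 then show thesis using that[of False] assms Arrow_l
  by (auto simp: step_def can_step_def next_level_def toda_awalk_simps)
next
 case (Arrow_a k)
 then have "1 \<le> k" "2 * k - 1 = 2 * j" using assms by (auto simp: toda_awalk_simps)
 then have False by presburger
 then show thesis ..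
next
 case (Arrow_b k)
 then have "1 \<le> k" "2 * k - 1 = 2 * j" using assms by (auto simp: toda_awalk_simps)
 then have False by presburger
 then show thesis ..
qed

lemma awalk_letterI:
 "1 \<le> j ==> j \<le> n ==> toda_awalk n (2 * j) q v ==> toda_awalk n (2 * j - 1) (letter x j # q) v"
 by (auto simp: toda_awalk_simps)

lemma awalk_stepI:
 "1 \<le> j ==> j \<le> n ==> can_step n d j ==> toda_awalk n (2 * next_level d j - 1) q v ==>
 toda_awalk n (2 * j) (step d j # q) v"
 by (auto simp: toda_awalk_simps toda_head_step)

lemma vertex_cases:
 fixes u :: nat
 assumes "u \<in> {1..2 * n}"
 obtains j where "u = 2 * j - 1" "1 \<le> j" "j \<le> n" | j where "u = 2 * j" "1 \<le> j" "j \<le> n"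
proof (cases "even u")
 case True
 then show thesis using that(2)[of "u div 2"] assms by auto
next
 case False
 then show thesis using that(1)[of "(u + 1) div 2"] assms by (auto elim!: oddE)
qed

text \<open>
 A function of paths is compatible with the relations of the Jacobian algebra if it takes equal
 values on the two terms of a relation, with the value \<open>z\<close> in place of a term that is missing
 because it would leave the quiver.
\<close>

definition compatible :: "nat => nat => (toda_arrow list => 'b) => 'b => bool" where
 "compatible n u F z <=> (ALL al s p t q p1 p2 v. al \<in> arcs (tq n) --> toda_rel n al = ((s, p), (t, q)) -->
  toda_awalk n u p1 (toda_head al) --> toda_awalk n (toda_tail al) p2 v -->
  (if s = 0 then z else F (p1 @ p @ p2)) = (if t = 0 then z else F (p1 @ q @ p2)))"

text \<open>Inductions along a path remove arrows from its front; the induction hypothesis is then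
  applied to \<open>F\<close> with the removed prefix fixed.\<close>

lemma compatible_prefix:
 assumes "compatible n u F z" "toda_awalk n u p w"
 shows "compatible n w (%q. F (p @ q)) z"
 unfolding compatible_def
proof (intro allI impI)
 fix al s p' t q p1 p2 v
 assume "al \<in> arcs (tq n)" "toda_rel n al = ((s, p'), (t, q))"
  "toda_awalk n w p1 (toda_head al)" "toda_awalk n (toda_tail al) p2 v"
 then show "(if s = 0 then z else F (p @ p1 @ p' @ p2)) = (if t = 0 then z else F (p @ p1 @ q @ p2))"
  using assms(1)[unfolded compatible_def, rule_format, of al s p' t q "p @ p1" p2 v] assms(2)
  by (metis append.assoc toda_awalk_append_iff)
qed

text \<open>This is the relation of the other letter at level \<open>j\<close>: the derivative with
  respect to \<open>letter (~ x) j\<close> compares the two ways of leaving level \<open>j\<close>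
  and coming back, both of which read \<open>x\<close> at the neighbouring level.\<close>

lemma compatible_swap:
 assumes F: "compatible n u F z" and j: "1 \<le> j" "j \<le> n"
  and p1: "toda_awalk n u p1 (2 * j)" and p2: "toda_awalk n (2 * j - 1) p2 v"
 shows "(if can_step n d j then F (p1 @ step d j # letter x (next_level d j) #
      step (~ d) (next_level d j) # p2) else z) =
    (if can_step n (~ d) j then F (p1 @ step (~ d) j # letter x (next_level (~ d) j) #
      step d (next_level (~ d) j) # p2) else z)"
proof -
 obtain s p t q where r: "toda_rel n (letter (~ x) j) = ((s, p), (t, q))"
  by (cases "toda_rel n (letter (~ x) j)") auto
 have "(if s = 0 then z else F (p1 @ p @ p2)) = (if t = 0 then z else F (p1 @ q @ p2))"
  using F[unfolded compatible_def, rule_format, of "letter (~ x) j" s p t q p1 p2 v] r j p1 p2 by simp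
 then show ?thesis using r
  by (cases x; cases d)
   (auto simp: letter_def step_def can_step_def next_level_def of_bool_def split: if_splits)
qed

text \<open>This is the relation of the arrow that steps back from \<open>next_level d j\<close> to
  \<open>j\<close>; its two terms differ by exchanging the letters on either side of the
  step.\<close>

lemma compatible_commute:
 assumes F: "compatible n u F z" and j: "1 \<le> j" "j \<le> n" and d: "can_step n d j"
  and p1: "toda_awalk n u p1 (2 * j - 1)" and p2: "toda_awalk n (2 * next_level d j) p2 v"
 shows "F (p1 @ letter x j # step d j # letter y (next_level d j) # p2) =
    F (p1 @ letter y j # step d j # letter x (next_level d j) # p2)"
proof -
 let ?al = "step (~ d) (next_level d j)"
 have arc: "?al \<in> arcs (tq n)" "toda_head ?al = 2 * j - 1" "toda_tail ?al = 2 * next_level d j"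
  using next_level_range[OF d j] can_step_next_level[OF d j] d by (auto simp: toda_head_step)
 obtain s p t q where r: "toda_rel n ?al = ((s, p), (t, q))"
  by (cases "toda_rel n ?al") auto
 have "(if s = 0 then z else F (p1 @ p @ p2)) = (if t = 0 then z else F (p1 @ q @ p2))"
  using F[unfolded compatible_def, rule_format, OF arc(1) r, of p1 p2 v] p1 p2 arc by simp
 then show ?thesis using r d
  by (cases x; cases y; cases d)
   (auto simp: letter_def step_def can_step_def next_level_def)
qed

text \<open>If the path starts with the opposite step, it reaches a level from which direction
  \<open>d\<close> leads back to \<open>j\<close>. By induction the part after the next letter can
  be made to start with such a step, and the swap relation exchanges the two steps. If
  \<open>d\<close> is impossible at \<open>j\<close>, the same relation yields
  \<open>z\<close>.\<close>

lemma bring_step_to_front: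
 assumes "compatible n (2 * j) F z" "toda_awalk n (2 * j) p v" "1 \<le> steps d p"
 shows "if can_step n d j then \<exists>p'. toda_awalk n (2 * j) (step d j # p') v & F p = F (step d j # p') &
   Suc (length p') = length p & (ALL e. steps e (step d j # p') = steps e p) & letters p' = letters p
  else F p = z"
 using assms
proof (induction "length p" arbitrary: p j F rule: less_induct)
 case less
 then obtain al q where p: "p = al # q" by (cases p) auto
 with less.prems obtain e where e: "al = step e j" and j: "1 \<le> j" "j \<le> n" "can_step n e j"
  and q: "toda_awalk n (2 * next_level e j - 1) q v"
  by (auto elim: awalk_even_ConsE)
 show ?case
 proof (cases "e = d")
  case True
  then show ?thesis using p e j less.prems by auto
 next
  case False
  then have ed: "e = (~ d)" by auto
  define k where "k = next_level e j"
  have k: "1 \<le> k" "k \<le> n" using next_level_range[of n e j] j by (auto simp: k_def)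
  from less.prems(3) p e ed obtain \<beta> q1 where "q = \<beta> # q1" by (cases q) auto
  with q k obtain x where x: "q = letter x k # q1" and q1: "toda_awalk n (2 * k) q1 v"
   by (auto simp: k_def elim: awalk_odd_ConsE)
  have pre: "toda_awalk n (2 * j) [step e j, letter x k] (2 * k)"
   using j k by (intro awalk_stepI) (auto simp: k_def toda_awalk_simps)
  have dk: "can_step n d k" using can_step_next_level[of n e j] j ed by (simp add: k_def)
  have nk: "next_level d k = j" using next_level_next_level[of n e j] j ed by (simp add: k_def)
  have "EX q2. toda_awalk n (2 * k) (step d k # q2) v &
    F ([step e j, letter x k] @ q1) = F ([step e j, letter x k] @ step d k # q2) &
    Suc (length q2) = length q1 & (ALL e. steps e (step d k # q2) = steps e q1) & letters q2 = letters q1"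
   using less.hyps[of q1 k "%r. F ([step e j, letter x k] @ r)"] dk q1 less.prems(3) p e x ed
    compatible_prefix[OF less.prems(1) pre] by auto
  then obtain q2 where q2: "toda_awalk n (2 * k) (step d k # q2) v"
   "F p = F (step e j # letter x k # step d k # q2)"
   "Suc (length q2) = length q1" "!!e. steps e (step d k # q2) = steps e q1" "letters q2 = letters q1"
   using p e x by auto
  have q2': "toda_awalk n (2 * j - 1) q2 v"
   using q2(1) k dk nk by (simp add: toda_awalk_simps toda_head_step)
  have Fp: "F p = (if can_step n d j then F (step d j # letter x (next_level d j) #
      step (~ d) (next_level d j) # q2) else z)"
   using compatible_swap[OF less.prems(1) j(1,2) _ q2', of "[]" d x] j ed nk q2(2)
   by (auto simp: k_def toda_awalk_simps split: if_splits)
  show ?thesis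
  proof (cases "can_step n d j")
   case True
   let ?p' = "letter x (next_level d j) # step (~ d) (next_level d j) # q2"
   have "toda_awalk n (2 * j) (step d j # ?p') v"
    using j True next_level_range[OF True j(1,2)] can_step_next_level[OF True j(1,2)] q2'
    by (intro awalk_stepI awalk_letterI) auto
   moreover have "F p = F (step d j # ?p')" using Fp True by simp
   moreover have "Suc (length ?p') = length p" using q2(3) p x by simp
   moreover have "steps f (step d j # ?p') = steps f p" for f
    using q2(4)[of f] p e x ed by (simp split: if_splits)
   moreover have "letters ?p' = letters p" using q2(5) p e x by simp
   ultimately show ?thesis using True by (simp only: if_True) blast
  qed (simp add: Fp)
 qed
qed

definition level :: "nat => nat" where
 "level u = (u + 1) div 2"

lemma level_simps [simp]: "level (2 * j) = j" "1 \<le> j ==> level (2 * j - 1) = j"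
 by (auto simp: level_def)

text \<open>The steps in direction \<open>d\<close> are moved to the front one after another until
  the end of the quiver is reached, where the next one gives \<open>z\<close>.\<close>

lemma compatible_null:
 assumes "compatible n u F z" "toda_awalk n u p v" "room n d (level u) < steps d p"
 shows "F p = z"
 using assms
proof (induction "length p" arbitrary: p u F rule: less_induct)
 case less
 show ?case
 proof (rule vertex_cases[OF toda_awalk_verts(1)[OF less.prems(2)]])
  fix j assume u: "u = 2 * j - 1" and j: "1 \<le> j" "j \<le> n"
  from less.prems obtain al q where p: "p = al # q" by (cases p) auto
  with less.prems u j obtain x where x: "al = letter x j" and q: "toda_awalk n (2 * j) q v"
   by (auto elim: awalk_odd_ConsE)
  have "toda_awalk n u [letter x j] (2 * j)" using j u by (auto simp: toda_awalk_simps)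
  from less.hyps[OF _ compatible_prefix[OF less.prems(1) this] q] p x u j less.prems(3)
  show ?thesis by simp
 next
  fix j assume u: "u = 2 * j" and j: "1 \<le> j" "j \<le> n"
  have front: "if can_step n d j then \<exists>p'. toda_awalk n (2 * j) (step d j # p') v &
    F p = F (step d j # p') & Suc (length p') = length p &
    (ALL e. steps e (step d j # p') = steps e p) & letters p' = letters p
   else F p = z"
   using bring_step_to_front[of n j F z p v d] less.prems u by simp
  show ?thesis
  proof (cases "can_step n d j")
   case True
   with front obtain p' where p': "toda_awalk n (2 * j) (step d j # p') v"
    "F p = F (step d j # p')" "Suc (length p') = length p" "ALL e. steps e (step d j # p') = steps e p"
    by metis
   have aw: "toda_awalk n u [step d j] (2 * next_level d j - 1)"
    using j u True next_level_range[OF True j] by (auto simp: toda_awalk_simps toda_head_step)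
   have "F ([step d j] @ p') = z"
   proof (rule less.hyps[OF _ compatible_prefix[OF less.prems(1) aw]])
    show "toda_awalk n (2 * next_level d j - 1) p' v"
     using p'(1) j by (simp add: toda_awalk_simps toda_head_step)
    show "room n d (level (2 * next_level d j - 1)) < steps d p'"
     using next_level_range[OF True j] True less.prems(3) p'(4)[rule_format, of d] u
     by (auto simp: room_def next_level_def can_step_def split: if_splits)
   qed (use p' in simp)
   then show ?thesis using p' by simp
  next
   case False
   then show ?thesis using front by simp
  qed
 qed
qed

text \<open>Letters and steps alternate, and from an odd vertex one letter precedes the first
  step.\<close>

lemma length_awalk_le:
 assumes "toda_awalk n u p v"
 shows "length p \<le> 2 * (steps True p + steps False p) + (if odd u then 1 else 0)"
 using assms
proof (induction p arbitrary: u)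
 case (Cons al q)
 show ?case
 proof (rule vertex_cases[OF toda_awalk_verts(1)[OF Cons.prems]])
  fix j assume u: "u = 2 * j - 1" and j: "1 \<le> j" "j \<le> n"
  with Cons.prems obtain x where "al = letter x j" "toda_awalk n (2 * j) q v"
   by (auto elim: awalk_odd_ConsE)
  with Cons.IH[of "2 * j"] show ?thesis using u j by simp
 next
  fix j assume u: "u = 2 * j" and j: "1 \<le> j" "j \<le> n"
  with Cons.prems obtain d where "al = step d j" "toda_awalk n (2 * next_level d j - 1) q v"
   by (auto elim: awalk_even_ConsE)
  with Cons.IH[of "2 * next_level d j - 1"] show ?thesis using u j by (cases d) (auto split: if_splits)
 qed
qed simp

text \<open>The rooms in the two directions add up to \<open>n - 1\<close>, so a path whose value is
  not \<open>z\<close> has length at most \<open>2 * n - 1\<close>. Behind this is the finite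
  dimension of the Jacobian algebra.\<close>

lemma compatible_long:
 assumes "compatible n u F z" "toda_awalk n u p v" "2 * n \<le> length p"
 shows "F p = z"
proof (rule ccontr)
 assume "F p ~= z"
 then have "steps d p \<le> room n d (level u)" for d
  using compatible_null[OF assms(1,2)] by (meson not_le)
 from this[of True] this[of False]
 have "steps True p \<le> n - level u" "steps False p \<le> level u - 1" by (auto simp: room_def)
 moreover have "1 \<le> level u" "level u \<le> n"
  using toda_awalk_verts(1)[OF assms(2)] by (auto simp: level_def)
 ultimately show False
  using length_awalk_le[OF assms(2)] assms(3) by (auto split: if_splits)
qed

text \<open>Once a single kind of letter is used, moving the same steps to the front of both paths
  leaves nothing else to distinguish them: the class is fixed by the end points and the numbers of
  steps.\<close>

lemma compatible_eq:
 assumes "compatible n u F z" "toda_awalk n u p v" "toda_awalk n u q v"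
  and "letters p \<subseteq> {x}" "letters q \<subseteq> {x}" "!!d. steps d p = steps d q"
 shows "F p = F q"
 using assms
proof (induction "length p" arbitrary: p q u F rule: less_induct)
 case less
 show ?case
 proof (rule vertex_cases[OF toda_awalk_verts(1)[OF less.prems(2)]])
  fix j assume u: "u = 2 * j - 1" and j: "1 \<le> j" "j \<le> n"
  \<comment> \<open>A nontrivial path from an odd vertex to itself begins with a letter and must
    then take a step.\<close>
  have no_loop: "r = []" if "toda_awalk n (2 * j - 1) r (2 * j - 1)" "!!d. steps d r = 0" for r
  proof (rule ccontr)
   assume "r ~= []"
   then obtain al r' where r: "r = al # r'" by (cases r) auto
   with that j obtain y where y: "al = letter y j" "toda_awalk n (2 * j) r' (2 * j - 1)"
    by (auto elim: awalk_odd_ConsE)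
   have "2 * j ~= 2 * j - 1" using j by simp
   then have "r' ~= []" using y(2) by (auto simp: toda_awalk_simps)
   then obtain \<beta> r'' where "r' = \<beta> # r''" by (cases r') auto
   with y obtain d where "r' = step d j # r''" by (auto elim: awalk_even_ConsE)
   then show False using that(2)[of d] r y by simp
  qed
  show ?thesis
  proof (cases p)
   case Nil
   then show ?thesis using less.prems u no_loop[of q] by (auto simp: toda_awalk_simps)
  next
   case (Cons al p')
   with less.prems u j obtain y where y: "al = letter y j" and p': "toda_awalk n (2 * j) p' v"
    by (auto elim: awalk_odd_ConsE)
   have "q ~= []"
   proof
    assume "q = []"
    then have "p = []" using less.prems u no_loop[of p] by (auto simp: toda_awalk_simps)
    then show False using Cons by simp
   qed
   then obtain \<beta> q' where q: "q = \<beta> # q'" by (cases q) auto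
   with less.prems u j obtain w where w: "\<beta> = letter w j" and q': "toda_awalk n (2 * j) q' v"
    by (auto elim: awalk_odd_ConsE)
   have yw: "y = x" "w = x" using less.prems(4,5) Cons y q w by auto
   have aw: "toda_awalk n u [letter x j] (2 * j)" using j u by (auto simp: toda_awalk_simps)
   have "F ([letter x j] @ p') = F ([letter x j] @ q')"
   proof (rule less.hyps[OF _ compatible_prefix[OF less.prems(1) aw] p' q'])
    show "steps d p' = steps d q'" for d using less.prems(6)[of d] Cons y q w by simp
   qed (use less.prems Cons q y w in auto)
   then show ?thesis using Cons q y w yw by simp
  qed
 next
  fix j assume u: "u = 2 * j" and j: "1 \<le> j" "j \<le> n"
  show ?thesis
  proof (cases "EX d. 1 \<le> steps d p")
   case True
   then obtain d where d: "1 \<le> steps d p" by blast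
   then have d': "1 \<le> steps d q" using less.prems(6) by simp
   note fp = bring_step_to_front[of n j F z p v d] and fq = bring_step_to_front[of n j F z q v d]
   show ?thesis
   proof (cases "can_step n d j")
    case True
    obtain p' where p': "toda_awalk n (2 * j) (step d j # p') v"
     "F p = F (step d j # p')" "Suc (length p') = length p"
     "!!e. steps e (step d j # p') = steps e p" "letters p' = letters p"
     using True fp[OF less.prems(1,2)[unfolded u] d] by metis
    obtain q' where q': "toda_awalk n (2 * j) (step d j # q') v"
     "F q = F (step d j # q')" "!!e. steps e (step d j # q') = steps e q" "letters q' = letters q"
     using True fq[OF less.prems(1,3)[unfolded u] d'] by metis
    have aw: "toda_awalk n u [step d j] (2 * next_level d j - 1)"
     using j u True next_level_range[OF True j] by (auto simp: toda_awalk_simps toda_head_step)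
    have "F ([step d j] @ p') = F ([step d j] @ q')"
    proof (rule less.hyps[OF _ compatible_prefix[OF less.prems(1) aw]])
     show "toda_awalk n (2 * next_level d j - 1) p' v" "toda_awalk n (2 * next_level d j - 1) q' v"
      using p'(1) q'(1) j by (simp_all add: toda_awalk_simps toda_head_step)
     show "steps e p' = steps e q'" for e
      using p'(4)[of e] q'(3)[of e] less.prems(6)[of e] by (auto split: if_splits)
    qed (use p' q' less.prems in auto)
    then show ?thesis using p' q' by simp
   next
    case False
    then show ?thesis
     using fp[OF less.prems(1,2)[unfolded u] d] fq[OF less.prems(1,3)[unfolded u] d'] by simp
   qed
  next
   case False
   have "r = []" if "toda_awalk n (2 * j) r v" "!!d. steps d r = 0" for r
   proof (cases r)
    case (Cons al r')
    with that obtain d where "r = step d j # r'" by (auto elim: awalk_even_ConsE)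
    then show ?thesis using that(2)[of d] by simp
   qed simp
   then have "p = []" "q = []" using False less.prems u by (auto simp: not_le)
   then show ?thesis by simp
  qed
 qed
qed

section \<open>Vector spaces of functions\<close>

text \<open>The concrete vector spaces below are sets of functions with pointwise operations, so
  that being a subspace reduces to \<open>lin_closed\<close> and linearity to pointwise
  identities.\<close>

definition fun_space :: "('k => complex) set => (complex, 'k => complex) module" where
 "fun_space A = \<lparr> carrier = A, mult = (%x y. (%_. 0)), one = (%_. 0), zero = (%_. 0),
  add = (%x y k. x k + y k), smult = (%c x k. c * x k) \<rparr>"

lemma fun_space_simps [simp]:
 "carrier (fun_space A) = A" "zero (fun_space A) = (%_. 0)"
 "add (fun_space A) = (%x y k. x k + y k)" "module.smult (fun_space A) = (%c x k. c * x k)"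
 "(fun_space A)\<lparr>carrier := B\<rparr> = fun_space B"
 by (simp_all add: fun_space_def)

definition lin_closed :: "('k => complex) set => bool" where
 "lin_closed A <=> (%_. 0) \<in> A & (\<forall>x\<in>A. \<forall>y\<in>A. (%k. x k + y k) \<in> A) &
  (ALL c. \<forall>x\<in>A. (%k. c * x k) \<in> A)"

lemma lin_closedD:
 assumes "lin_closed A"
 shows "(%_. 0) \<in> A" "x \<in> A ==> y \<in> A ==> (%k. x k + y k) \<in> A" "x \<in> A ==> (%k. c * x k) \<in> A"
 using assms unfolding lin_closed_def by blast+

lemma vectorspace_fun_space:
 assumes "lin_closed A" shows "vectorspace class_ring (fun_space A)"
proof (rule vs_criteria)
 show "\<forall>v\<in>carrier (fun_space A). \<exists>w\<in>carrier (fun_space A).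
   v \<oplus>\<^bsub>fun_space A\<^esub> w = \<zero>\<^bsub>fun_space A\<^esub>"
 proof
  fix v assume "v \<in> carrier (fun_space A)"
  then have "(%k. -1 * v k) \<in> A" by (intro lin_closedD(3)[OF assms]) simp
  then show "\<exists>w\<in>carrier (fun_space A). v \<oplus>\<^bsub>fun_space A\<^esub> w = \<zero>\<^bsub>fun_space A\<^esub>"
   by (intro bexI[of _ "%k. -1 * v k"]) auto
 qed
qed (use assms in \<open>auto simp: class_field lin_closed_def algebra_simps\<close>)

lemma lin_closed_sum:
 assumes "lin_closed A" "finite S" "!!s. s \<in> S ==> g s \<in> A"
 shows "(%k. \<Sum>s\<in>S. g s k) \<in> A"
 using assms(2,3) by (induction rule: finite_induct) (use assms(1) in \<open>auto simp: lin_closed_def\<close>)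

lemma finsum_fun_space:
 assumes "lin_closed A" "finite S" "!!s. s \<in> S ==> g s \<in> A"
 shows "finsum (fun_space A) g S = (%k. \<Sum>s\<in>S. g s k)"
proof -
 interpret vectorspace class_ring "fun_space A" by (rule vectorspace_fun_space) fact
 show ?thesis using assms(2,3)
  by (induction rule: finite_induct) (auto simp: Pi_iff)
qed

lemma lin_closed_diff:
 assumes "lin_closed A" "x \<in> A" "y \<in> A" shows "(%k. x k - c * y k) \<in> A"
proof -
 have "(%k. x k + - c * y k) \<in> A"
  by (intro lin_closedD(2)[OF assms(1,2)] lin_closedD(3)[OF assms(1,3)])
 then show ?thesis by simp
qed

text \<open>Elimination on the support: a vector that is nonzero at \<open>k\<close> clears this
  coordinate in all others, which then fall into the smaller space \<open>A'\<close>.\<close>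

lemma lin_closed_finitely_generated:
 assumes "finite K" "lin_closed A" "!!x k. x \<in> A ==> k \<notin> K ==> x k = 0"
 shows "EX B. finite B & B \<subseteq> A & (\<forall>x\<in>A. EX c. x = (%k. \<Sum>b\<in>B. c b * b k))"
 using assms
proof (induction arbitrary: A rule: finite_induct)
 case empty
 then show ?case by (intro exI[of _ "{}"]) auto
next
 case (insert k K)
 define A' where "A' = {x \<in> A. x k = 0}"
 have cl: "lin_closed A'" using insert.prems(1) unfolding lin_closed_def A'_def by auto
 have z: "x j = 0" if "x \<in> A'" "j \<notin> K" for x j
  using insert.prems(2)[of x j] that by (cases "j = k") (auto simp: A'_def)
 have "EX B. finite B & B \<subseteq> A' & (\<forall>x\<in>A'. EX c. x = (%k. \<Sum>b\<in>B. c b * b k))"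
  using cl z by (rule insert.IH)
 then obtain B where "finite B & B \<subseteq> A' & (\<forall>x\<in>A'. EX c. x = (%k. \<Sum>b\<in>B. c b * b k))" ..
 then have B: "finite B" "B \<subseteq> A'" "!!x. x \<in> A' ==> EX c. x = (%k. \<Sum>b\<in>B. c b * b k)"
  by simp_all
 show ?case
 proof (cases "\<exists>g\<in>A. g k ~= 0")
  case True
  then obtain g where g: "g \<in> A" "g k ~= 0" by blast
  have gB: "g \<notin> B" using g B(2) by (auto simp: A'_def)
  have "EX c. x = (%j. \<Sum>b\<in>insert g B. c b * b j)" if x: "x \<in> A" for x
  proof -
   have "(%j. x j - (x k / g k) * g j) \<in> A'"
    unfolding A'_def using g(2)
    by (intro CollectI conjI lin_closed_diff[OF insert.prems(1) x g(1)]) simp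
   then obtain c where c: "(%j. x j - (x k / g k) * g j) = (%j. \<Sum>b\<in>B. c b * b j)"
    using B(3) by fast
   have "x = (%j. \<Sum>b\<in>insert g B. (c(g := x k / g k)) b * b j)"
   proof
    fix j
    have "(\<Sum>b\<in>B. (c(g := x k / g k)) b * b j) = (\<Sum>b\<in>B. c b * b j)"
     using gB by (intro sum.cong) auto
    then show "x j = (\<Sum>b\<in>insert g B. (c(g := x k / g k)) b * b j)"
     using fun_cong[OF c, of j] gB B(1) by (simp add: diff_eq_eq add.commute)
   qed
   then show ?thesis by (rule exI[of _ "c(g := x k / g k)"])
  qed
  then show ?thesis using B(1,2) g(1)
   by (intro exI[of _ "insert g B"] conjI ballI) (auto simp: A'_def)
 next
  case False
  then have "A' = A" by (auto simp: A'_def)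
  then show ?thesis using B by (intro exI[of _ B]) auto
 qed
qed

lemma fin_dim_fun_space:
 assumes "finite K" "lin_closed A" "!!x k. x \<in> A ==> k \<notin> K ==> x k = 0"
 shows "vectorspace.fin_dim class_ring (fun_space A)"
proof -
 interpret vectorspace class_ring "fun_space A" by (rule vectorspace_fun_space) fact
 have "EX B. finite B & B \<subseteq> A & (\<forall>x\<in>A. EX c. x = (%k. \<Sum>b\<in>B. c b * b k))"
  using assms by (rule lin_closed_finitely_generated)
 then obtain B where "finite B & B \<subseteq> A & (\<forall>x\<in>A. EX c. x = (%k. \<Sum>b\<in>B. c b * b k))" ..
 then have B: "finite B" "B \<subseteq> A" "!!x. x \<in> A ==> EX c. x = (%k. \<Sum>b\<in>B. c b * b k)"
  by simp_all
 have "x \<in> span B" if x: "x \<in> A" for x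
 proof -
  from B(3)[OF x] obtain c where "x = (%k. \<Sum>b\<in>B. c b * b k)" by blast
  then have "x = lincomb c B"
   using finsum_fun_space[OF assms(2) B(1), of "%b k. c b * b k"] lin_closedD(3)[OF assms(2)] B(2)
   by (simp add: lincomb_def subset_iff)
  then show ?thesis using B(1) unfolding span_def by auto
 qed
 then have "span B = carrier (fun_space A)"
  using B span_is_subset2[of B] by auto
 then show ?thesis unfolding fin_dim_def using B by auto
qed

definition unit_fun :: "'k => 'k => complex" where
 "unit_fun k = (%j. if j = k then 1 else 0)"

lemma dim_fun_space_support:
 fixes K :: "'k set"
 assumes "finite K"
 shows "vectorspace.fin_dim class_ring (fun_space {x. ALL k. x k ~= 0 --> k \<in> K})"
  and "vectorspace.dim class_ring (fun_space {x. ALL k. x k ~= 0 --> k \<in> K}) = card K"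
proof -
 let ?A = "{x :: 'k => complex. ALL k. x k ~= 0 --> k \<in> K}"
 have A: "lin_closed ?A" by (auto simp: lin_closed_def) (metis add_0)
 show fd: "vectorspace.fin_dim class_ring (fun_space ?A)"
  by (rule fin_dim_fun_space[OF assms A]) auto
 interpret vectorspace class_ring "fun_space ?A" by (rule vectorspace_fun_space) fact
 have inj: "inj_on unit_fun K" by (auto simp: inj_on_def unit_fun_def fun_eq_iff split: if_splits)
 have sub: "unit_fun ` K \<subseteq> ?A" by (auto simp: unit_fun_def split: if_splits)
 have lc: "lincomb c (unit_fun ` K) = (%j. if j \<in> K then c (unit_fun j) else 0)" for c
 proof
  fix j
  have mem: "(%j. c v * v j) \<in> ?A" if "v \<in> unit_fun ` K" for v
   by (rule lin_closedD(3)[OF A]) (use sub that in blast)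
  have "lincomb c (unit_fun ` K) j = (\<Sum>k\<in>K. c (unit_fun k) * unit_fun k j)"
   using finsum_fun_space[OF A finite_imageI[OF assms, of unit_fun], of "%v j. c v * v j", OF mem]
   by (simp add: lincomb_def sum.reindex[OF inj])
  also have "... = (\<Sum>k\<in>K. if k = j then c (unit_fun k) else 0)"
   by (intro sum.cong) (auto simp: unit_fun_def)
  finally show "lincomb c (unit_fun ` K) j = (if j \<in> K then c (unit_fun j) else 0)"
   using assms by simp
 qed
 have "basis (unit_fun ` K)"
  unfolding basis_def
 proof (intro conjI)
  show "lin_indpt (unit_fun ` K)"
  proof (rule finite_lin_indpt2)
   fix a assume "lincomb a (unit_fun ` K) = \<zero>\<^bsub>fun_space ?A\<^esub>"
   then have eq: "(%j. if j \<in> K then a (unit_fun j) else 0) = (%_. 0)" unfolding lc by simp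
   have "a (unit_fun j) = 0" if "j \<in> K" for j using fun_cong[OF eq, of j] that by simp
   then show "\<forall>v\<in>unit_fun ` K. a v = \<zero>\<^bsub>class_ring\<^esub>" by auto
  qed (use assms sub in auto)
  have "x \<in> span (unit_fun ` K)" if "x \<in> ?A" for x
  proof -
   have "x = lincomb (%v. x (the_inv_into K unit_fun v)) (unit_fun ` K)"
    unfolding lc
   proof
    fix j show "x j = (if j \<in> K then x (the_inv_into K unit_fun (unit_fun j)) else 0)"
     using that the_inv_into_f_f[OF inj, of j] by (cases "j \<in> K") auto
   qed
   moreover have "(%v. x (the_inv_into K unit_fun v)) \<in> unit_fun ` K \<rightarrow> carrier class_ring" by simp
   ultimately show ?thesis using assms unfolding span_def by blast
  qed
  then show "span (unit_fun ` K) = carrier (fun_space ?A)"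
   using span_is_subset2[of "unit_fun ` K"] sub by auto
 qed (use sub in simp)
 from dim_basis[OF _ this] assms inj show "dim = card K" by (simp add: card_image)
qed

lemma subspace_fun_space_iff:
 assumes "lin_closed A"
 shows "VectorSpace.subspace class_ring B (fun_space A) <=> B \<subseteq> A & lin_closed B"
 using vectorspace_fun_space[OF assms] vectorspace.axioms(1)[OF vectorspace_fun_space[OF assms]]
 unfolding VectorSpace.subspace_def submodule_def lin_closed_def by (auto simp: class_ring_simps)

lemma module_hom_fun_space_iff:
 "f \<in> module_hom class_ring (fun_space A) (fun_space B) <=>
  f \<in> A \<rightarrow> B & (\<forall>x\<in>A. \<forall>y\<in>A. f (%k. x k + y k) = (%k. f x k + f y k)) &
  (ALL c. \<forall>x\<in>A. f (%k. c * x k) = (%k. c * f x k))"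
 by (auto simp: module_hom_def class_ring_simps)

section \<open>Representations as modules over the Jacobian algebra\<close>

lemma module_hom_compose:
 "f \<in> module_hom R A B ==> g \<in> module_hom R B C ==> (%x. g (f x)) \<in> module_hom R A C"
 by (auto simp: module_hom_def Pi_iff)

lemma module_hom_zero:
 assumes "vectorspace K V" "vectorspace K W" "f \<in> module_hom K V W"
 shows "f \<zero>\<^bsub>V\<^esub> = \<zero>\<^bsub>W\<^esub>"
proof -
 interpret linear_map K V W f
  using assms by (simp add: linear_map_def mod_hom_def mod_hom_axioms_def vectorspace.axioms)
 show ?thesis by simp
qed

lemma fold_rep_map:
 assumes "representation (tq n) X" "toda_awalk n u p v"
 shows "fold (rep_map X) p \<in> module_hom class_ring (rep_space X u) (rep_space X v)"
 using assms(2)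
proof (induction p arbitrary: u)
 case Nil
 then show ?case by (auto simp: toda_awalk_simps module_hom_def)
next
 case (Cons al p)
 then have a: "al \<in> arcs (tq n)" "u = toda_tail al" "toda_awalk n (toda_head al) p v"
  by (auto simp: toda_awalk_simps)
 have "rep_map X al \<in> module_hom class_ring (rep_space X u) (rep_space X (toda_head al))"
  using assms(1) a unfolding representation_def by auto
 from module_hom_compose[OF this Cons.IH[OF a(3)]] show ?case by (simp add: comp_def)
qed

lemma fold_rep_map_closed:
 assumes "representation (tq n) X" "toda_awalk n u p v" "x \<in> spc X u"
 shows "fold (rep_map X) p x \<in> spc X v"
 using module_hom_closed[OF fold_rep_map[OF assms(1,2)]] assms(3) by blast

text \<open>The relations as equalities between the actions of two paths, free of signs and sums,
  with the zero vector for a missing term. Dimensions may be infinite.\<close>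

definition toda_rep :: "nat => ('a, nat, toda_arrow) quiver_rep => bool" where
 "toda_rep n X <=> representation (tq n) X &
  (ALL al s p t q x. al \<in> arcs (tq n) --> toda_rel n al = ((s, p), (t, q)) -->
    x \<in> spc X (toda_head al) -->
    (if s = 0 then zero (rep_space X (toda_tail al)) else fold (rep_map X) p x) =
    (if t = 0 then zero (rep_space X (toda_tail al)) else fold (rep_map X) q x))"

lemma toda_rel_facts:
 assumes "al \<in> arcs (tq n)" "toda_rel n al = ((s, p), (t, q))"
 shows "s \<in> {0, 1}" "t \<in> {0, 1}" "p ~= q"
  "s ~= 0 ==> toda_awalk n (toda_head al) p (toda_tail al)"
  "t ~= 0 ==> toda_awalk n (toda_head al) q (toda_tail al)"
proof -
 have "s \<in> {0, 1} & t \<in> {0, 1} & p ~= q &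
   (s ~= 0 --> toda_awalk n (toda_head al) p (toda_tail al)) &
   (t ~= 0 --> toda_awalk n (toda_head al) q (toda_tail al))"
 proof (cases al)
  case (Arrow_a j)
  have st: "s = of_bool (j < n)" "p = [Arrow_r j, Arrow_b (j + 1), Arrow_l (j + 1)]"
   "t = of_bool (1 < j)" "q = [Arrow_l j, Arrow_b (j - 1), Arrow_r (j - 1)]" "1 \<le> j & j \<le> n"
   using assms Arrow_a by simp_all
  have "j < n ==> toda_awalk n (2 * j) p (2 * j - 1)" "1 < j ==> toda_awalk n (2 * j) q (2 * j - 1)"
   unfolding st(2,4)
   unfolding toda_awalk_simps toda_tail.simps toda_head.simps arcs_toda_quiver toda_quiver_simps atLeastAtMost_iff
   using st(5) by presburger+
  then show ?thesis using st Arrow_a by simp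
 next
  case (Arrow_b j)
  have st: "s = of_bool (1 < j)" "p = [Arrow_l j, Arrow_a (j - 1), Arrow_r (j - 1)]"
   "t = of_bool (j < n)" "q = [Arrow_r j, Arrow_a (j + 1), Arrow_l (j + 1)]" "1 \<le> j & j \<le> n"
   using assms Arrow_b by simp_all
  have "j < n ==> toda_awalk n (2 * j) q (2 * j - 1)" "1 < j ==> toda_awalk n (2 * j) p (2 * j - 1)"
   unfolding st(2,4)
   unfolding toda_awalk_simps toda_tail.simps toda_head.simps arcs_toda_quiver toda_quiver_simps atLeastAtMost_iff
   using st(5) by presburger+
  then show ?thesis using st Arrow_b by simp
 next
  case (Arrow_l j)
  have st: "s = 1" "p = [Arrow_a (j - 1), Arrow_r (j - 1), Arrow_b j]"
   "t = 1" "q = [Arrow_b (j - 1), Arrow_r (j - 1), Arrow_a j]" "2 \<le> j & j \<le> n"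
   using assms Arrow_l by simp_all
  have "toda_awalk n (2 * j - 3) p (2 * j)" "toda_awalk n (2 * j - 3) q (2 * j)"
   unfolding st(2,4)
   unfolding toda_awalk_simps toda_tail.simps toda_head.simps arcs_toda_quiver toda_quiver_simps atLeastAtMost_iff
   using st(5) by presburger+
  then show ?thesis using st Arrow_l by simp
 next
  case (Arrow_r j)
  have st: "s = 1" "p = [Arrow_b (j + 1), Arrow_l (j + 1), Arrow_a j]"
   "t = 1" "q = [Arrow_a (j + 1), Arrow_l (j + 1), Arrow_b j]" "1 \<le> j & j < n"
   using assms Arrow_r by simp_all
  have "toda_awalk n (2 * j + 1) p (2 * j)" "toda_awalk n (2 * j + 1) q (2 * j)"
   unfolding st(2,4)
   unfolding toda_awalk_simps toda_tail.simps toda_head.simps arcs_toda_quiver toda_quiver_simps atLeastAtMost_iff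
   using st(5) by presburger+
  then show ?thesis using st Arrow_r by simp
 qed
 then show "s \<in> {0, 1}" "t \<in> {0, 1}" "p ~= q"
  "s ~= 0 ==> toda_awalk n (toda_head al) p (toda_tail al)"
  "t ~= 0 ==> toda_awalk n (toda_head al) q (toda_tail al)" by auto
qed

lemma (in vectorspace) sum_neg_eq_zero_iff:
 assumes "x \<in> carrier V" "y \<in> carrier V"
 shows "x \<oplus>\<^bsub>V\<^esub> (\<ominus>\<^bsub>K\<^esub> \<one>\<^bsub>K\<^esub>) \<odot>\<^bsub>V\<^esub> y = \<zero>\<^bsub>V\<^esub> <=> x = y"
 using assms by (metis M.add.inv_closed M.minus_other_side a_minus_def smult_minus_1)

text \<open>A path of the relation runs from the head of the arrow to its tail, so for any other
  pair of vertices the sum is empty. For this pair it has one summand for each nonzero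
  coefficient.\<close>

lemma satisfies_relation_iff:
 assumes X: "representation (tq n) X"
  and al: "al \<in> arcs (tq n)" "toda_rel n al = ((s, p), (t, q))"
 shows "satisfies_relation (tq n) X (cyclic_derivative (tq n) (tp n) al) <=>
  (\<forall>x\<in>spc X (toda_head al).
    (if s = 0 then zero (rep_space X (toda_tail al)) else fold (rep_map X) p x) =
    (if t = 0 then zero (rep_space X (toda_tail al)) else fold (rep_map X) q x))" (is "_ <=> ?R")
proof -
 note r = toda_rel_facts[OF al]
 let ?h = "toda_head al" and ?t = "toda_tail al"
 define \<rho> where "\<rho> = (%x. s * path_elem (toda_head al) p x - t * path_elem (toda_head al) q x)"
 let ?S = "%u v x. \<Oplus>\<^bsub>rep_space X v\<^esub>p\<in>{p. toda_awalk n u p v & \<rho> (u, p) ~= 0}.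
     \<rho> (u, p) \<odot>\<^bsub>rep_space X v\<^esub> fold (rep_map X) p x"
 have verts: "?h \<in> {1..2*n}" "?t \<in> {1..2*n}"
  using wf_digraph.head_in_verts[OF wf_digraph_toda_quiver al(1)]
   wf_digraph.tail_in_verts[OF wf_digraph_toda_quiver al(1)] by simp_all
 interpret V: vectorspace class_ring "rep_space X ?t"
  using X verts by (auto simp: representation_def)
 have triv: "?S u v x = zero (rep_space X v)"
  if "v \<in> {1..2*n}" "u ~= ?h \<or> v ~= ?t" for u v x
 proof -
  interpret W: vectorspace class_ring "rep_space X v"
   using X that by (auto simp: representation_def)
  have "{p. toda_awalk n u p v & \<rho> (u, p) ~= 0} = {}"
   using that r(4,5) by (auto simp: \<rho>_def path_elem_def dest: toda_awalk_unique)
  then show ?thesis by (simp only: W.finsum_empty)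
 qed
 have main: "?S ?h ?t x = zero (rep_space X ?t) <=>
   (if s = 0 then zero (rep_space X ?t) else fold (rep_map X) p x) =
   (if t = 0 then zero (rep_space X ?t) else fold (rep_map X) q x)"
  if x: "x \<in> spc X ?h" for x
 proof -
  have cl: "s ~= 0 ==> fold (rep_map X) p x \<in> spc X ?t"
   "t ~= 0 ==> fold (rep_map X) q x \<in> spc X ?t"
   using fold_rep_map_closed[OF X _ x] r(4,5) by blast+
  have set: "{p. toda_awalk n ?h p ?t & \<rho> (?h, p) ~= 0} =
    (if s = 0 then {} else {p}) \<union> (if t = 0 then {} else {q})"
   using r by (auto simp: \<rho>_def path_elem_def split: if_splits)
  have one: "1 \<odot>\<^bsub>rep_space X ?t\<^esub> y = y" if "y \<in> spc X ?t" for y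
   using V.smult_one[OF that] by simp
  have zz: "(-1) \<odot>\<^bsub>rep_space X ?t\<^esub> y = zero (rep_space X ?t) <=> y = zero (rep_space X ?t)"
   if "y \<in> spc X ?t" for y
   using V.sum_neg_eq_zero_iff[of "zero (rep_space X ?t)" y] that by (auto simp: class_ring_simps)
  have mm: "fold (rep_map X) p x \<oplus>\<^bsub>rep_space X ?t\<^esub> (-1) \<odot>\<^bsub>rep_space X ?t\<^esub> (fold (rep_map X) q x)
    = zero (rep_space X ?t) <=> fold (rep_map X) p x = fold (rep_map X) q x"
   if "s ~= 0" "t ~= 0"
   using V.sum_neg_eq_zero_iff[OF cl(1)[OF that(1)] cl(2)[OF that(2)]] by (simp add: class_ring_simps)
  consider "s = 0" "t = 0" | "s = 1" "t = 0" | "s = 0" "t = 1" | "s = 1" "t = 1" using r by auto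
  then show ?thesis
  proof cases
   case 4
   have "?S ?h ?t x = (\<rho> (?h, p)) \<odot>\<^bsub>rep_space X ?t\<^esub> (fold (rep_map X) p x) \<oplus>\<^bsub>rep_space X ?t\<^esub>
     (\<rho> (?h, q)) \<odot>\<^bsub>rep_space X ?t\<^esub> (fold (rep_map X) q x)"
    unfolding set using 4 r(3) cl by (simp add: V.finsum_insert Pi_iff class_ring_simps V.a_comm)
   then show ?thesis using 4 mm one cl r(3) by (simp add: \<rho>_def path_elem_def)
  qed (unfold set, use cl r(3) one zz in \<open>auto simp: \<rho>_def path_elem_def Pi_iff\<close>)
 qed
 show ?thesis
  unfolding satisfies_relation_def cyclic_derivative_toda[OF al] \<rho>_def[symmetric] toda_quiver_simps
 proof (intro iffI ballI)
  fix x assume x: "x \<in> spc X ?h"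
   and "\<forall>u\<in>{1..2*n}. \<forall>v\<in>{1..2*n}. \<forall>x\<in>spc X u. ?S u v x = zero (rep_space X v)"
  then have "?S ?h ?t x = zero (rep_space X ?t)" using verts by blast
  then show "(if s = 0 then zero (rep_space X ?t) else fold (rep_map X) p x) =
    (if t = 0 then zero (rep_space X ?t) else fold (rep_map X) q x)"
   by (rule main[OF x, THEN iffD1])
 next
  fix u v x assume R: ?R and v: "v \<in> {1..2*n}" and x: "x \<in> spc X u"
  show "?S u v x = zero (rep_space X v)"
  proof (cases "u = ?h & v = ?t")
   case True
   then show ?thesis using R main[of x] x by blast
  next
   case False
   then show ?thesis using triv[OF v, of u] by blast
  qed
 qed
qed

lemma jacobian_module_iff:
 "jacobian_module (tq n) (tp n) X <=>
  toda_rep n X & (\<forall>v\<in>{1..2 * n}. vectorspace.fin_dim class_ring (rep_space X v))"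
proof -
 have "(\<forall>al\<in>arcs (tq n). satisfies_relation (tq n) X
   (cyclic_derivative (tq n) (tp n) al)) <=> toda_rep n X"
  if "representation (tq n) X"
 proof
  assume "\<forall>al\<in>arcs (tq n). satisfies_relation (tq n) X
   (cyclic_derivative (tq n) (tp n) al)"
  then show "toda_rep n X"
   using satisfies_relation_iff[OF that] that unfolding toda_rep_def by simp
 next
  assume X: "toda_rep n X"
  show "\<forall>al\<in>arcs (tq n). satisfies_relation (tq n) X
   (cyclic_derivative (tq n) (tp n) al)"
  proof
   fix al assume al: "al \<in> arcs (tq n)"
   obtain s p t q where r: "toda_rel n al = ((s, p), (t, q))"
    by (cases "toda_rel n al") auto
   show "satisfies_relation (tq n) X
     (cyclic_derivative (tq n) (tp n) al)"
    using X al r unfolding satisfies_relation_iff[OF that al r] toda_rep_def by blast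
  qed
 qed
 moreover have "toda_rep n X ==> representation (tq n) X" by (simp add: toda_rep_def)
 ultimately show ?thesis unfolding jacobian_module_def toda_quiver_simps by blast
qed

text \<open>The images of a fixed vector under paths form a function to which the path calculus
  applies. Paths that do not end at \<open>v\<close> are sent to zero, so that all values lie in one
  space.\<close>

lemma toda_rep_compatible:
 assumes X: "toda_rep n X" and x: "x \<in> spc X u" and v: "v \<in> {1..2*n}"
 shows "compatible n u (%p. if toda_awalk n u p v then fold (rep_map X) p x else zero (rep_space X v))
  (zero (rep_space X v))"
 unfolding compatible_def
proof (intro allI impI)
 fix al s p t q p1 p2 w
 assume al: "al \<in> arcs (tq n)" "toda_rel n al = ((s, p), (t, q))"
  and p1: "toda_awalk n u p1 (toda_head al)" and p2: "toda_awalk n (toda_tail al) p2 w"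
 note r = toda_rel_facts[OF al]
 have R: "representation (tq n) X" using X by (simp add: toda_rep_def)
 have aw: "s ~= 0 ==> toda_awalk n u (p1 @ p @ p2) w" "t ~= 0 ==> toda_awalk n u (p1 @ q @ p2) w"
  using p1 p2 r(4,5) by (auto simp: toda_awalk_append_iff)
 show "(if s = 0 then zero (rep_space X v) else
    if toda_awalk n u (p1 @ p @ p2) v then fold (rep_map X) (p1 @ p @ p2) x else zero (rep_space X v)) =
   (if t = 0 then zero (rep_space X v) else
    if toda_awalk n u (p1 @ q @ p2) v then fold (rep_map X) (p1 @ q @ p2) x else zero (rep_space X v))"
 proof (cases "v = w")
  case True
  let ?y = "fold (rep_map X) p1 x"
  have y: "?y \<in> spc X (toda_head al)"
   using fold_rep_map_closed[OF R p1 x] .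
  have eq: "(if s = 0 then zero (rep_space X (toda_tail al)) else fold (rep_map X) p ?y) =
    (if t = 0 then zero (rep_space X (toda_tail al)) else fold (rep_map X) q ?y)"
   using X al y unfolding toda_rep_def by blast
  have "vectorspace class_ring (rep_space X v)" "vectorspace class_ring (rep_space X (toda_tail al))"
   using R v toda_awalk_verts[OF p2] by (auto simp: representation_def)
  then have z: "fold (rep_map X) p2 (zero (rep_space X (toda_tail al))) = zero (rep_space X v)"
   using module_hom_zero fold_rep_map[OF R p2] True by blast
  show ?thesis using arg_cong[OF eq, of "fold (rep_map X) p2"] aw True z
   by (simp add: if_distrib[of "fold (rep_map X) p2"] split: if_splits)
 next
  case False
  then show ?thesis using aw by (auto dest: toda_awalk_unique)
 qed
qed

lemma toda_rep_long:
 assumes "toda_rep n X" "x \<in> spc X u" "toda_awalk n u p v" "2 * n \<le> length p"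
 shows "fold (rep_map X) p x = zero (rep_space X v)"
 using compatible_long[OF toda_rep_compatible[OF assms(1,2) toda_awalk_verts(2)[OF assms(3)]] assms(3,4)]
  assms(3) by simp

section \<open>The strip model of the module\<close>

text \<open>Encoding paths by numbers turns functions on paths into elements of \<open>univ\<close>,
  the type over which injectivity is quantified.\<close>

instance toda_arrow :: countable
 by countable_datatype

text \<open>Position \<open>p\<close> at level \<open>j\<close> stands for the paths from the
  generator at level \<open>i\<close> with \<open>i - p\<close> steps down and \<open>j - p\<close>
  steps up. At most \<open>i - 1\<close> steps down and \<open>n - i\<close> steps up survive, which
  together give \<open>lo n i j < p\<close>; nonnegative numbers of steps bound \<open>p\<close> by
  \<open>i\<close> and \<open>j\<close>.\<close>

definition lo :: "nat => nat => nat => nat" where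
 "lo n i j = i + j - (n + 1)"

definition strip :: "nat => nat => nat => univ set" where
 "strip n i j = {\<phi>. ALL p. \<phi> p ~= 0 --> p \<in> {lo n i j<..min i j}}"

text \<open>Letters act by the scalars \<open>l2\<close> and \<open>- l1\<close>, so that the
  combination of the two with coefficients \<open>l1\<close> and \<open>l2\<close> acts as zero, as
  it must in the cokernel. A step up keeps the position and a step down lowers it by one; positions
  up to \<open>lo\<close> of the new level are cut off.\<close>

fun model_map :: "nat => nat => complex => complex => toda_arrow => univ => univ" where
 "model_map n i l1 l2 (Arrow_a j) \<phi> = (%p. l2 * \<phi> p)"
| "model_map n i l1 l2 (Arrow_b j) \<phi> = (%p. - l1 * \<phi> p)"
| "model_map n i l1 l2 (Arrow_r j) \<phi> = (%p. if lo n i (j + 1) < p then \<phi> p else 0)"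
| "model_map n i l1 l2 (Arrow_l j) \<phi> = (%p. if lo n i (j - 1) < p then \<phi> (p + 1) else 0)"

definition model :: "nat => nat => complex => complex => (univ, nat, toda_arrow) quiver_rep" where
 "model n i l1 l2 = \<lparr> rep_space = (%v. fun_space (strip n i (level v))),
  rep_map = model_map n i l1 l2 \<rparr>"

lemma model_simps [simp]:
 "rep_space (model n i l1 l2) v = fun_space (strip n i (level v))"
 "rep_map (model n i l1 l2) = model_map n i l1 l2"
 by (simp_all add: model_def)

lemma lin_closed_strip: "lin_closed (strip n i j)"
 by (auto simp: lin_closed_def strip_def) (metis add.right_neutral)+

lemma stripD: "\<phi> \<in> strip n i j ==> \<phi> p ~= 0 ==> lo n i j < p & p \<le> i & p \<le> j"
 by (simp add: strip_def)

lemma stripI: "(!!p. \<phi> p ~= 0 ==> lo n i j < p & p \<le> i & p \<le> j) ==> \<phi> \<in> strip n i j"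
 by (simp add: strip_def)

lemma level_odd: "level (2 * j + 1) = j + 1" "2 \<le> j ==> level (2 * j - 3) = j - 1"
 "1 \<le> j ==> level (2 * j - 1) = j"
 by (auto simp: level_def)

lemma model_map_closed:
 assumes "al \<in> arcs (tq n)" "\<phi> \<in> strip n i (level (toda_tail al))"
 shows "model_map n i l1 l2 al \<phi> \<in> strip n i (level (toda_head al))"
proof (cases al)
 case (Arrow_a j)
 then have j: "1 \<le> j" using assms(1) by simp
 have "\<phi> \<in> strip n i j" using assms(2) Arrow_a j by simp
 then show ?thesis using Arrow_a by (auto intro!: stripI dest!: stripD)
next
 case (Arrow_b j)
 then have j: "1 \<le> j" using assms(1) by simp
 have "\<phi> \<in> strip n i j" using assms(2) Arrow_b j by simp
 then show ?thesis using Arrow_b by (auto intro!: stripI dest!: stripD)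
next
 case (Arrow_l j)
 then have j: "2 \<le> j" using assms(1) by simp
 have f: "\<phi> \<in> strip n i j" using assms(2) Arrow_l j by simp
 have "model_map n i l1 l2 al \<phi> \<in> strip n i (j - 1)"
  by (rule stripI) (use stripD[OF f] Arrow_l j in \<open>fastforce split: if_splits\<close>)
 then show ?thesis using Arrow_l j level_odd(2)[OF j] by simp
next
 case (Arrow_r j)
 then have j: "1 \<le> j" using assms(1) by simp
 have f: "\<phi> \<in> strip n i j" using assms(2) Arrow_r j by simp
 have "model_map n i l1 l2 al \<phi> \<in> strip n i (j + 1)"
  by (rule stripI) (use stripD[OF f] Arrow_r j in \<open>fastforce split: if_splits\<close>)
 then show ?thesis using Arrow_r j level_odd(1)[of j] by simp
qed

lemma representation_model: "representation (tq n) (model n i l1 l2)"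
 unfolding representation_def
proof (intro conjI ballI)
 fix v show "vectorspace class_ring (rep_space (model n i l1 l2) v)"
  by (simp add: vectorspace_fun_space lin_closed_strip)
next
 fix al assume al: "al \<in> arcs (tq n)"
 have "model_map n i l1 l2 al (%k. x k + y k) = (%k. model_map n i l1 l2 al x k + model_map n i l1 l2 al y k)"
  "model_map n i l1 l2 al (%k. c * x k) = (%k. c * model_map n i l1 l2 al x k)" for x y c
  by (cases al; auto simp: algebra_simps)+
 then show "rep_map (model n i l1 l2) al \<in> module_hom class_ring
   (rep_space (model n i l1 l2) (tail (tq n) al)) (rep_space (model n i l1 l2) (head (tq n) al))"
  using model_map_closed[OF al] by (simp add: module_hom_fun_space_iff)
qed

text \<open>The relations of the steps hold because letters are scalars. In those of the letters
  both ways around lower the position by one. Where one way leaves the quiver, the strip has a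
  single position and the other way gives zero as well.\<close>

lemma toda_rep_model: "toda_rep n (model n i l1 l2)"
 unfolding toda_rep_def
proof (intro conjI representation_model allI impI)
 fix al s p t q x
 assume al: "al \<in> arcs (tq n)" "toda_rel n al = ((s, p), (t, q))"
  and x: "x \<in> spc (model n i l1 l2) (toda_head al)"
 let ?M = "model_map n i l1 l2"
 have "(if s = 0 then (%_. 0) else fold ?M p x) = (if t = 0 then (%_. 0) else fold ?M q x)"
 proof (cases al)
  case (Arrow_a j)
  then have j: "1 \<le> j" "j \<le> n" using al by simp_all
  have x': "x \<in> strip n i j" using x Arrow_a by simp
  show ?thesis
  proof
   fix k
   have "lo n i (j + 1) < k + 1" "lo n i (j - 1) < k" if "lo n i j < k"
    using that by (auto simp: lo_def)
   moreover have "x (k + 1) = 0" if "lo n i j < k" "~ j < n \<or> ~ 1 < j"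
    using stripD[OF x', of "k + 1"] that j by (cases "x (k + 1) = 0") (auto simp: lo_def)
   ultimately show "(if s = 0 then (%_. 0) else fold ?M p x) k = (if t = 0 then (%_. 0) else fold ?M q x) k"
    using al(2) Arrow_a j by (auto simp: of_bool_def One_nat_def[symmetric] split: if_splits)
  qed
 next
  case (Arrow_b j)
  then have j: "1 \<le> j" "j \<le> n" using al by simp_all
  have x': "x \<in> strip n i j" using x Arrow_b by simp
  show ?thesis
  proof
   fix k
   have "lo n i (j + 1) < k + 1" "lo n i (j - 1) < k" if "lo n i j < k"
    using that by (auto simp: lo_def)
   moreover have "x (k + 1) = 0" if "lo n i j < k" "~ j < n \<or> ~ 1 < j"
    using stripD[OF x', of "k + 1"] that j by (cases "x (k + 1) = 0") (auto simp: lo_def)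
   ultimately show "(if s = 0 then (%_. 0) else fold ?M p x) k = (if t = 0 then (%_. 0) else fold ?M q x) k"
    using al(2) Arrow_b j by (auto simp: of_bool_def One_nat_def[symmetric] split: if_splits)
  qed
 qed (use al(2) in \<open>auto simp: fun_eq_iff\<close>)
 then show "(if s = 0 then zero (rep_space (model n i l1 l2) (toda_tail al)) else fold (rep_map (model n i l1 l2)) p x) =
   (if t = 0 then zero (rep_space (model n i l1 l2) (toda_tail al)) else fold (rep_map (model n i l1 l2)) q x)"
  by (simp only: model_simps fun_space_simps)
qed

lemma jacobian_module_model: "jacobian_module (tq n) (tp n) (model n i l1 l2)"
 unfolding jacobian_module_iff using toda_rep_model
 by (simp add: strip_def dim_fun_space_support(1) del: greaterThanAtMost_iff)

section \<open>Indecomposable injectives as functionals on paths\<close>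

text \<open>This is the dual of the paths from \<open>w\<close> to \<open>v\<close> modulo the
  relations: a functional that respects the relations, stored at the codes of the paths. An arrow
  acts by evaluating at the path with the arrow put in front.\<close>

definition inj_space :: "nat => nat => nat => univ set" where
 "inj_space n v w = {\<phi>. (ALL k. \<phi> k ~= 0 --> (EX p. k = to_nat p & toda_awalk n w p v)) &
  compatible n w (%p. \<phi> (to_nat p)) 0}"

definition inj_rep :: "nat => nat => (univ, nat, toda_arrow) quiver_rep" where
 "inj_rep n v = \<lparr> rep_space = (%w. fun_space (inj_space n v w)),
  rep_map = (%al \<phi> k. if k \<in> range (to_nat :: toda_arrow list => nat) then \<phi> (to_nat (al # from_nat k)) else 0) \<rparr>"

lemma inj_rep_space [simp]: "rep_space (inj_rep n v) w = fun_space (inj_space n v w)"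
 by (simp add: inj_rep_def)

lemma inj_rep_map [simp]: "rep_map (inj_rep n v) al \<phi> (to_nat p) = \<phi> (to_nat (al # p))"
 by (simp add: inj_rep_def)

lemma inj_rep_map_outside: "k \<notin> range (to_nat :: toda_arrow list => nat) ==> rep_map (inj_rep n v) al \<phi> k = 0"
 by (simp add: inj_rep_def)

lemma fold_inj_rep_map: "fold (rep_map (inj_rep n v)) p \<phi> (to_nat q) = \<phi> (to_nat (p @ q))"
 by (induction p arbitrary: \<phi>) auto

lemma inj_spaceD:
 assumes "\<phi> \<in> inj_space n v w"
 shows "\<phi> (to_nat p) ~= 0 ==> toda_awalk n w p v"
  and "k \<notin> range (to_nat :: toda_arrow list => nat) ==> \<phi> k = 0"
  and "compatible n w (%p. \<phi> (to_nat p)) 0"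
proof -
 have *: "EX p. k = to_nat p & toda_awalk n w p v" if "\<phi> k ~= 0" for k
  using assms that by (simp add: inj_space_def)
 show "toda_awalk n w p v" if "\<phi> (to_nat p) ~= 0" using *[OF that] by auto
 show "\<phi> k = 0" if "k \<notin> range (to_nat :: toda_arrow list => nat)" using *[of k] that by auto
 show "compatible n w (%p. \<phi> (to_nat p)) 0" using assms by (simp add: inj_space_def)
qed

lemma inj_spaceI:
 assumes "!!p. \<phi> (to_nat p) ~= 0 ==> toda_awalk n w p v"
  and "!!k. k \<notin> range (to_nat :: toda_arrow list => nat) ==> \<phi> k = 0"
  and "compatible n w (%p. \<phi> (to_nat p)) 0"
 shows "\<phi> \<in> inj_space n v w"
proof -
 have "EX p. k = to_nat p & toda_awalk n w p v" if "\<phi> k ~= 0" for k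
 proof -
  have "k \<in> range (to_nat :: toda_arrow list => nat)" using assms(2)[of k] that by blast
  then obtain p where "k = to_nat (p :: toda_arrow list)" by blast
  then show ?thesis using assms(1)[of p] that by blast
 qed
 then show ?thesis using assms(3) by (simp add: inj_space_def)
qed

lemma inj_space_eqI:
 assumes "\<phi> \<in> inj_space n v w" "\<psi> \<in> inj_space n v' w'"
  "!!p. \<phi> (to_nat (p :: toda_arrow list)) = \<psi> (to_nat p)"
 shows "\<phi> = \<psi>"
proof
 fix k show "\<phi> k = \<psi> k"
 proof (cases "k \<in> range (to_nat :: toda_arrow list => nat)")
  case True
  then show ?thesis using assms(3) by auto
 next
  case False
  then show ?thesis using inj_spaceD(2)[OF assms(1)] inj_spaceD(2)[OF assms(2)] by simp
 qed
qed

lemma inj_space_long: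
 fixes p :: "toda_arrow list"
 assumes "\<phi> \<in> inj_space n v w" "2 * n \<le> length p"
 shows "\<phi> (to_nat p) = 0"
proof (rule ccontr)
 assume nz: "\<phi> (to_nat p) ~= 0"
 with compatible_long[OF inj_spaceD(3)[OF assms(1)] inj_spaceD(1)[OF assms(1) nz] assms(2)]
 show False by simp
qed

lemma compatible_lin:
 fixes F G :: "toda_arrow list => complex"
 assumes "compatible n u F 0" "compatible n u G 0"
 shows "compatible n u (%p. F p + G p) 0" "compatible n u (%p. c * F p) 0" "compatible n u (%p. 0 :: complex) 0"
 unfolding compatible_def
proof -
 have "(if s = 0 then 0 else F (p1 @ p @ p2) + G (p1 @ p @ p2)) =
   (if t = 0 then 0 else F (p1 @ q @ p2) + G (p1 @ q @ p2)) &
   (if s = 0 then 0 else c * F (p1 @ p @ p2)) = (if t = 0 then 0 else c * F (p1 @ q @ p2))"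
  if "al \<in> arcs (tq n)" "toda_rel n al = ((s, p), (t, q))"
   "toda_awalk n u p1 (toda_head al)" "toda_awalk n (toda_tail al) p2 v" for al s p t q p1 p2 v
  using assms(1)[unfolded compatible_def, rule_format, OF that]
   assms(2)[unfolded compatible_def, rule_format, OF that]
  by (cases "s = 0"; cases "t = 0") simp_all
 then show "ALL al s p t q p1 p2 v. al \<in> arcs (tq n) --> toda_rel n al = ((s, p), (t, q)) -->
  toda_awalk n u p1 (toda_head al) --> toda_awalk n (toda_tail al) p2 v -->
  (if s = 0 then 0 else F (p1 @ p @ p2) + G (p1 @ p @ p2)) =
  (if t = 0 then 0 else F (p1 @ q @ p2) + G (p1 @ q @ p2))"
  "ALL al s p t q p1 p2 v. al \<in> arcs (tq n) --> toda_rel n al = ((s, p), (t, q)) -->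
  toda_awalk n u p1 (toda_head al) --> toda_awalk n (toda_tail al) p2 v -->
  (if s = 0 then 0 else c * F (p1 @ p @ p2)) = (if t = 0 then 0 else c * F (p1 @ q @ p2))"
  by (intro allI impI; simp)+
qed simp

lemma compatible_zero: "compatible n u (%p. z) z"
 by (simp add: compatible_def)

lemma lin_closed_inj_space: "lin_closed (inj_space n v w)"
 unfolding lin_closed_def
proof (intro conjI ballI allI)
 show "(%_. 0) \<in> inj_space n v w" by (rule inj_spaceI) (auto intro: compatible_zero)
 fix x y assume x: "x \<in> inj_space n v w" and y: "y \<in> inj_space n v w"
 show "(%k. x k + y k) \<in> inj_space n v w"
 proof (rule inj_spaceI)
  show "toda_awalk n w p v" if "x (to_nat p) + y (to_nat p) ~= 0" for p
   using that inj_spaceD(1)[OF x, of p] inj_spaceD(1)[OF y, of p] by (cases "x (to_nat p) = 0") auto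
  show "compatible n w (%p. x (to_nat p) + y (to_nat p)) 0"
   by (rule compatible_lin(1)) (use inj_spaceD(3)[OF x] inj_spaceD(3)[OF y] in auto)
 qed (use inj_spaceD(2)[OF x] inj_spaceD(2)[OF y] in simp)
next
 fix c x assume x: "x \<in> inj_space n v w"
 show "(%k. c * x k) \<in> inj_space n v w"
 proof (rule inj_spaceI)
  show "toda_awalk n w p v" if "c * x (to_nat p) ~= 0" for p
   using that inj_spaceD(1)[OF x, of p] by auto
  show "compatible n w (%p. c * x (to_nat p)) 0"
   by (rule compatible_lin(2)) (use inj_spaceD(3)[OF x] in auto)
 qed (use inj_spaceD(2)[OF x] in simp)
qed

lemma inj_rep_map_closed:
 assumes al: "al \<in> arcs (tq n)" and \<phi>: "\<phi> \<in> inj_space n v (toda_tail al)"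
 shows "rep_map (inj_rep n v) al \<phi> \<in> inj_space n v (toda_head al)"
proof (rule inj_spaceI)
 show "toda_awalk n (toda_head al) p v" if "rep_map (inj_rep n v) al \<phi> (to_nat p) ~= 0" for p
  using inj_spaceD(1)[OF \<phi>, of "al # p"] that by (simp add: toda_awalk_simps)
 have "toda_awalk n (toda_tail al) [al] (toda_head al)"
  using al wf_digraph.head_in_verts[OF wf_digraph_toda_quiver al] by (simp add: toda_awalk_simps)
 from compatible_prefix[OF inj_spaceD(3)[OF \<phi>] this]
 show "compatible n (toda_head al) (%p. rep_map (inj_rep n v) al \<phi> (to_nat p)) 0" by simp
qed (simp add: inj_rep_map_outside)

lemma inj_rep_map_add: "rep_map (inj_rep n v) al (%k. x k + y k) =
  (%k. rep_map (inj_rep n v) al x k + rep_map (inj_rep n v) al y k)"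
 "rep_map (inj_rep n v) al (%k. c * x k) = (%k. c * rep_map (inj_rep n v) al x k)"
 by (simp_all add: inj_rep_def fun_eq_iff)

lemma representation_inj_rep: "representation (tq n) (inj_rep n v)"
 unfolding representation_def
 by (auto simp: vectorspace_fun_space lin_closed_inj_space module_hom_fun_space_iff inj_rep_map_add
   intro!: inj_rep_map_closed)

lemma toda_rep_inj_rep: "toda_rep n (inj_rep n v)"
 unfolding toda_rep_def
proof (intro conjI representation_inj_rep allI impI)
 fix al s p t q x
 assume al: "al \<in> arcs (tq n)" "toda_rel n al = ((s, p), (t, q))"
  and x: "x \<in> spc (inj_rep n v) (toda_head al)"
 let ?M = "rep_map (inj_rep n v)"
 note r = toda_rel_facts[OF al]
 have x': "x \<in> inj_space n v (toda_head al)" using x by simp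
 have h: "toda_awalk n (toda_head al) [] (toda_head al)"
  using wf_digraph.head_in_verts[OF wf_digraph_toda_quiver al(1)] by (simp add: toda_awalk_simps)
 let ?l = "if s = 0 then (%_. 0) else fold ?M p x" and ?r = "if t = 0 then (%_. 0) else fold ?M q x"
 have z: "(%_. 0) \<in> inj_space n v (toda_tail al)" by (rule lin_closedD(1)[OF lin_closed_inj_space])
 have l: "?l \<in> inj_space n v (toda_tail al)" and r': "?r \<in> inj_space n v (toda_tail al)"
  using fold_rep_map_closed[OF representation_inj_rep r(4) x]
   fold_rep_map_closed[OF representation_inj_rep r(5) x] z by simp_all
 have "?l = ?r"
 proof (rule inj_space_eqI[OF l r'])
  fix p2 :: "toda_arrow list"
  show "?l (to_nat p2) = ?r (to_nat p2)"
  proof (cases "toda_awalk n (toda_tail al) p2 v")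
   case True
   have "(if s = 0 then 0 else x (to_nat ([] @ p @ p2))) = (if t = 0 then 0 else x (to_nat ([] @ q @ p2)))"
    by (rule inj_spaceD(3)[OF x', unfolded compatible_def, rule_format, OF al h True])
   then show ?thesis by (simp add: fold_inj_rep_map split: if_splits)
  next
   case False
   then show ?thesis using inj_spaceD(1)[OF l, of p2] inj_spaceD(1)[OF r', of p2] by metis
  qed
 qed
 then show "(if s = 0 then zero (rep_space (inj_rep n v) (toda_tail al)) else fold ?M p x) =
   (if t = 0 then zero (rep_space (inj_rep n v) (toda_tail al)) else fold ?M q x)"
  by (simp only: inj_rep_space fun_space_simps)
qed

lemma finite_short_paths: "finite {p. set p \<subseteq> arcs (tq n) & length p < k}"
 by (rule finite_subset[OF _ finite_lists_length_le[OF finite_arcs_toda_quiver, of n k]]) auto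

lemma fin_dim_inj_space: "vectorspace.fin_dim class_ring (fun_space (inj_space n v w))"
proof (rule fin_dim_fun_space[OF finite_imageI[OF finite_short_paths[of n "2 * n"]] lin_closed_inj_space])
 fix x and k :: nat
 assume x: "x \<in> inj_space n v w"
  and k: "k \<notin> to_nat ` {p. set p \<subseteq> arcs (tq n) & length p < 2 * n}"
 show "x k = 0"
 proof (rule ccontr)
  assume "x k ~= 0"
  then obtain p where p: "k = to_nat p" "toda_awalk n w p v"
   using x unfolding inj_space_def by blast
  have "length p < 2 * n" using inj_space_long[OF x, of p] p \<open>x k ~= 0\<close> by (cases "2 * n \<le> length p") auto
  moreover have "set p \<subseteq> arcs (tq n)" using p(2) by (simp add: pre_digraph.awalk_def)
  ultimately show False using k p by blast
 qed
qed

lemma jacobian_module_inj_rep: "jacobian_module (tq n) (tp n) (inj_rep n v)"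
 unfolding jacobian_module_iff using toda_rep_inj_rep fin_dim_inj_space by simp

text \<open>The functional dual to the trivial path at \<open>v\<close>; it spans the socle.\<close>

definition inj_socle :: univ where
 "inj_socle = (%k. if k = to_nat ([] :: toda_arrow list) then 1 else 0)"

lemma inj_socle_apply [simp]: "inj_socle (to_nat (p :: toda_arrow list)) = (if p = [] then 1 else 0)"
 by (simp add: inj_socle_def)

lemma toda_rel_length:
 "toda_rel n al = ((s, p), (t, q)) ==> length p = 3" "toda_rel n al = ((s, p), (t, q)) ==> length q = 3"
 by (cases al; auto)+

text \<open>Both terms of a relation are paths of length 3, so only values at paths of at least this
  length are compared.\<close>

lemma compatible_short:
 assumes "!!p. 3 \<le> length p ==> F p = z"
 shows "compatible n u F z"
 unfolding compatible_def
proof (intro allI impI)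
 fix al s p t q p1 p2 v
 assume r: "toda_rel n al = ((s, p), (t, q))"
 have "F (p1 @ p @ p2) = z" "F (p1 @ q @ p2) = z"
  by (rule assms, simp add: toda_rel_length[OF r])+
 then show "(if s = 0 then z else F (p1 @ p @ p2)) = (if t = 0 then z else F (p1 @ q @ p2))" by simp
qed

lemma inj_socle_in:
 assumes "v \<in> {1..2 * n}" shows "inj_socle \<in> inj_space n v v"
proof (rule inj_spaceI)
 show "toda_awalk n v p v" if "inj_socle (to_nat p) ~= 0" for p
  using that assms by (auto simp: toda_awalk_simps split: if_splits)
 show "inj_socle k = 0" if "k \<notin> range (to_nat :: toda_arrow list => nat)" for k
  using that by (auto simp: inj_socle_def)
 show "compatible n v (%p. inj_socle (to_nat p)) 0"
  by (rule compatible_short) auto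
qed

text \<open>Acting by a longest path on which \<open>\<phi>\<close> does not vanish turns it into a
  nonzero multiple of \<open>inj_socle\<close>, since every proper extension of that path gives
  zero.\<close>

lemma inj_rep_subrep_socle:
 assumes V: "subrep (tq n) (inj_rep n v) V" and w: "w \<in> {1..2 * n}"
  and \<phi>: "\<phi> \<in> V w" "\<phi> ~= (%_. 0)"
 shows "inj_socle \<in> V v"
proof -
 have sub: "V u \<subseteq> inj_space n v u" "lin_closed (V u)" if "u \<in> {1..2 * n}" for u
  using V that by (auto simp: subrep_def subspace_fun_space_iff lin_closed_inj_space)
 have \<phi>w: "\<phi> \<in> inj_space n v w" using sub(1)[OF w] \<phi>(1) by blast
 let ?P = "%p. \<phi> (to_nat (p :: toda_arrow list)) ~= 0"
 obtain k where k: "\<phi> k ~= 0" using \<phi>(2) by auto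
 then obtain p0 where p0: "?P p0" using inj_spaceD(2)[OF \<phi>w, of k] by blast
 have bound: "length p < 2 * n" if "?P p" for p
  using inj_space_long[OF \<phi>w, of p] that by (cases "2 * n \<le> length p") auto
 obtain p where p: "?P p" "!!q. ?P q ==> length q \<le> length p"
  using ex_has_greatest_nat[of ?P p0 length "2 * n"] p0 bound by (metis less_imp_le)
 have aw: "toda_awalk n w p v" by (rule inj_spaceD(1)[OF \<phi>w p(1)])
 have mem: "fold (rep_map (inj_rep n v)) q x \<in> V u'" if "toda_awalk n u q u'" "x \<in> V u" for q x u u'
  using that
 proof (induction q arbitrary: u x)
  case (Cons al q)
  then have a: "al \<in> arcs (tq n)" "u = toda_tail al" "toda_awalk n (toda_head al) q u'"
   by (auto simp: toda_awalk_simps)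
  have "rep_map (inj_rep n v) al x \<in> V (toda_head al)"
   using V a Cons.prems(2) unfolding subrep_def by auto
  from Cons.IH[OF a(3) this] show ?case by simp
 qed (auto simp: toda_awalk_simps)
 let ?y = "fold (rep_map (inj_rep n v)) p \<phi>"
 have y: "?y \<in> V v" by (rule mem[OF aw \<phi>(1)])
 have vv: "v \<in> {1..2 * n}" using toda_awalk_verts(2)[OF aw] .
 have "?y (to_nat q) = \<phi> (to_nat p) * inj_socle (to_nat q)" for q :: "toda_arrow list"
  using p(2)[of "p @ q"] by (cases "q = []") (auto simp: fold_inj_rep_map)
 then have "?y = (%k. \<phi> (to_nat p) * inj_socle k)"
  using sub(1)[OF vv] y
  by (intro inj_space_eqI[of _ n v v _ v v] lin_closedD(3)[OF lin_closed_inj_space] inj_socle_in vv) auto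
 then have "(%k. inverse (\<phi> (to_nat p)) * ?y k) = inj_socle" using p(1) by auto
 moreover have "(%k. inverse (\<phi> (to_nat p)) * ?y k) \<in> V v"
  by (rule lin_closedD(3)[OF sub(2)[OF vv] y])
 ultimately show ?thesis by simp
qed

section \<open>Dimension vectors, Laurent monomials and the prefactor\<close>

text \<open>A submodule fills each strip from the bottom, so at a vertex of level \<open>m\<close>
  the offset \<open>lo n i m\<close> plus the dimension is the highest position occupied. Letters
  and steps up keep positions, steps down lower them by one; each inequality is stability under one
  kind of arrow or the upper bound of the strip.\<close>

definition admissible :: "nat => nat => (nat => nat) => bool" where
 "admissible n i e <=> (ALL m. 1 \<le> m & m \<le> n --> e (2 * m - 1) \<le> e (2 * m) & lo n i m + e (2 * m) \<le> i & lo n i m + e (2 * m) \<le> m &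
  (m < n --> lo n i m + e (2 * m) \<le> lo n i (m + 1) + e (2 * m + 1) &
    lo n i (m + 1) + e (2 * m + 2) \<le> lo n i m + e (2 * m - 1) + 1))"


text \<open>Exponents are recorded as plain functions, so that an identity of monomials becomes an
  identity of integer-valued functions.\<close>

definition monomial_at :: "nat laurent => (nat => int) => bool" where
 "monomial_at L f <=> (EX d. L = laurent_monomial d & Poly_Mapping.lookup d = f)"

lemma monomial_at_unique: "monomial_at L f ==> monomial_at L' f ==> L = L'"
 unfolding monomial_at_def by (metis poly_mapping_eqI)

lemma monomial_at_laurent: "monomial_at (laurent_monomial d) (Poly_Mapping.lookup d)"
 by (auto simp: monomial_at_def)

lemma monomial_at_mult: "monomial_at L f ==> monomial_at L' g ==> monomial_at (L * L') (%v. f v + g v)"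
 unfolding monomial_at_def
proof (elim exE conjE)
 fix d d' assume "L = laurent_monomial d" "Poly_Mapping.lookup d = f" "L' = laurent_monomial d'" "Poly_Mapping.lookup d' = g"
 then show "EX d. L * L' = laurent_monomial d & Poly_Mapping.lookup d = (%v. f v + g v)"
  by (intro exI[of _ "d + d'"]) (auto simp: laurent_monomial_def Poly_Mapping.mult_single lookup_add fun_eq_iff)
qed

lemma monomial_at_one: "monomial_at 1 (%v. 0)"
 unfolding monomial_at_def by (intro exI[of _ 0]) (auto simp: laurent_monomial_def)

lemma monomial_at_power: "monomial_at L f ==> monomial_at (L ^ k) (%v. int k * f v)"
proof (induction k)
 case 0
 then show ?case using monomial_at_one by simp
next
 case (Suc k)
 then show ?case using monomial_at_mult[of L f "L ^ k" "%v. int k * f v"] by (simp add: algebra_simps)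
qed

lemma monomial_at_prod:
 assumes "finite A" "!!a. a \<in> A ==> monomial_at (L a) (f a)"
 shows "monomial_at (\<Prod>a\<in>A. L a) (%v. \<Sum>a\<in>A. f a v)"
 using assms
proof (induction A rule: finite_induct)
 case empty
 then show ?case using monomial_at_one by simp
next
 case (insert x A)
 then show ?case using monomial_at_mult[of "L x" "f x" "prod L A"] by simp
qed

lemma monomial_at_y_variable:
 "monomial_at (y_variable (tq n) u) (%v. if v \<in> {1..2*n} then exchange_number (tq n) u v else 0)"
proof -
 have look: "Poly_Mapping.lookup (\<Sum>j\<in>A. Poly_Mapping.single j (f j)) v = (if v \<in> A then f v else 0)"
  if "finite A" for A and f :: "nat => int" and v
  using that by (induction A rule: finite_induct) (auto simp: lookup_add lookup_single when_def)
 show ?thesis unfolding y_variable_def monomial_at_def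
  by (intro exI conjI, rule refl) (simp add: fun_eq_iff look)
qed

lemma toda_arrow_counts:
 assumes m: "1 \<le> m" "m \<le> n"
 shows "card {al \<in> arcs (tq n). tail (tq n) al = 2 * m - 1 & head (tq n) al = v} = (if v = 2 * m then 2 else 0)"
  and "card {al \<in> arcs (tq n). tail (tq n) al = v & head (tq n) al = 2 * m} = (if v = 2 * m - 1 then 2 else 0)"
  and "card {al \<in> arcs (tq n). tail (tq n) al = 2 * m & head (tq n) al = v} =
   of_bool (2 \<le> m & v = 2 * m - 3) + of_bool (m < n & v = 2 * m + 1)"
  and "card {al \<in> arcs (tq n). tail (tq n) al = v & head (tq n) al = 2 * m - 1} =
   of_bool (m < n & v = 2 * m + 2) + of_bool (2 \<le> m & v = 2 * m - 2)"
proof -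
 have p: "1 \<le> k ==> 2 * k - 1 ~= 2 * j" "1 \<le> k ==> 2 * j ~= 2 * k - 1" for k j :: nat by presburger+
 have odd: "1 \<le> k ==> 2 * k - 1 = 2 * m - 1 <=> k = m" for k using m by auto
 have l': "2 \<le> k ==> 2 * k - 3 ~= 2 * j" "2 * k + 1 ~= 2 * j" for k j :: nat by presburger+
 have "{al \<in> arcs (tq n). toda_tail al = 2 * m - 1 & toda_head al = v} =
   (if v = 2 * m then {Arrow_a m, Arrow_b m} else {})" (is "?L = ?R")
 proof (rule Set.set_eqI)
  fix al show "al \<in> ?L <=> al \<in> ?R"
  proof (cases al)
   case (Arrow_a k)
   then show ?thesis using m odd[of k] by auto
  next
   case (Arrow_b k)
   then show ?thesis using m odd[of k] by auto
  next
   case (Arrow_l k)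
   then show ?thesis using m p(2)[of m k] by auto
  next
   case (Arrow_r k)
   then show ?thesis using m p(2)[of m k] by auto
  qed
 qed
 then show "card {al \<in> arcs (tq n). tail (tq n) al = 2 * m - 1 & head (tq n) al = v} = (if v = 2 * m then 2 else 0)"
  by simp
 have "{al \<in> arcs (tq n). toda_tail al = v & toda_head al = 2 * m} =
   (if v = 2 * m - 1 then {Arrow_a m, Arrow_b m} else {})" (is "?L = ?R")
 proof (rule Set.set_eqI)
  fix al show "al \<in> ?L <=> al \<in> ?R"
  proof (cases al)
   case (Arrow_a k)
   then show ?thesis using m  by auto
  next
   case (Arrow_b k)
   then show ?thesis using m  by auto
  next
   case (Arrow_l k)
   then show ?thesis using m l'(1)[of k m] by auto
  next
   case (Arrow_r k)
   then show ?thesis using m l'(2)[of k m] by auto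
  qed
 qed
 then show "card {al \<in> arcs (tq n). tail (tq n) al = v & head (tq n) al = 2 * m} = (if v = 2 * m - 1 then 2 else 0)"
  by simp
 have mem_if: "x \<in> (if P then A else {}) <=> P & x \<in> A" for x :: toda_arrow and P A by simp
 have dbl: "2 * k = 2 * j <=> k = j" for k j :: nat by simp
 have "{al \<in> arcs (tq n). toda_tail al = 2 * m & toda_head al = v} =
   (if 2 \<le> m & v = 2 * m - 3 then {Arrow_l m} else {}) \<union> (if m < n & v = 2 * m + 1 then {Arrow_r m} else {})" (is "?L = ?R")
 proof (rule Set.set_eqI)
  fix al show "al \<in> ?L <=> al \<in> ?R"
  proof (cases al)
   case (Arrow_a k)
   have "Arrow_a k \<in> ?L <=> (1 \<le> k & k \<le> n & 2 * k - 1 = 2 * m & 2 * k = v)"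
    unfolding mem_Collect_eq arcs_toda_quiver toda_tail.simps toda_head.simps by blast
   moreover have "Arrow_a k \<in> ?R <=> False"
    unfolding Un_iff mem_if singleton_iff by (simp only: toda_arrow.inject toda_arrow.distinct simp_thms conj_assoc)
   moreover have "(1 \<le> k & k \<le> n & 2 * k - 1 = 2 * m & 2 * k = v) <=> False" using p(1)[of k m] by blast
   ultimately show ?thesis unfolding Arrow_a by blast
  next
   case (Arrow_b k)
   have "Arrow_b k \<in> ?L <=> (1 \<le> k & k \<le> n & 2 * k - 1 = 2 * m & 2 * k = v)"
    unfolding mem_Collect_eq arcs_toda_quiver toda_tail.simps toda_head.simps by blast
   moreover have "Arrow_b k \<in> ?R <=> False"
    unfolding Un_iff mem_if singleton_iff by (simp only: toda_arrow.inject toda_arrow.distinct simp_thms conj_assoc)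
   moreover have "(1 \<le> k & k \<le> n & 2 * k - 1 = 2 * m & 2 * k = v) <=> False" using p(1)[of k m] by blast
   ultimately show ?thesis unfolding Arrow_b by blast
  next
   case (Arrow_l k)
   have "Arrow_l k \<in> ?L <=> (2 \<le> k & k \<le> n & 2 * k = 2 * m & 2 * k - 3 = v)"
    unfolding mem_Collect_eq arcs_toda_quiver toda_tail.simps toda_head.simps by blast
   moreover have "Arrow_l k \<in> ?R <=> (2 \<le> m & v = 2 * m - 3 & k = m)"
    unfolding Un_iff mem_if singleton_iff by (simp only: toda_arrow.inject toda_arrow.distinct simp_thms conj_assoc)
   moreover have "(2 \<le> k & k \<le> n & 2 * k = 2 * m & 2 * k - 3 = v) <=> (2 \<le> m & v = 2 * m - 3 & k = m)" unfolding dbl using m by blast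
   ultimately show ?thesis unfolding Arrow_l by blast
  next
   case (Arrow_r k)
   have "Arrow_r k \<in> ?L <=> (1 \<le> k & k < n & 2 * k = 2 * m & 2 * k + 1 = v)"
    unfolding mem_Collect_eq arcs_toda_quiver toda_tail.simps toda_head.simps by blast
   moreover have "Arrow_r k \<in> ?R <=> (m < n & v = 2 * m + 1 & k = m)"
    unfolding Un_iff mem_if singleton_iff by (simp only: toda_arrow.inject toda_arrow.distinct simp_thms conj_assoc)
   moreover have "(1 \<le> k & k < n & 2 * k = 2 * m & 2 * k + 1 = v) <=> (m < n & v = 2 * m + 1 & k = m)" unfolding dbl using m by blast
   ultimately show ?thesis unfolding Arrow_r by blast
  qed
 qed
 then show "card {al \<in> arcs (tq n). tail (tq n) al = 2 * m & head (tq n) al = v} =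
   of_bool (2 \<le> m & v = 2 * m - 3) + of_bool (m < n & v = 2 * m + 1)"
  by (simp add: of_bool_def)
 have "{al \<in> arcs (tq n). toda_tail al = v & toda_head al = 2 * m - 1} =
   (if m < n & v = 2 * m + 2 then {Arrow_l (m + 1)} else {}) \<union> (if 2 \<le> m & v = 2 * m - 2 then {Arrow_r (m - 1)} else {})" (is "?L = ?R")
 proof (rule Set.set_eqI)
  fix al show "al \<in> ?L <=> al \<in> ?R"
  proof (cases al)
   case (Arrow_a k)
   have "Arrow_a k \<in> ?L <=> (1 \<le> k & k \<le> n & 2 * k - 1 = v & 2 * k = 2 * m - 1)"
    unfolding mem_Collect_eq arcs_toda_quiver toda_tail.simps toda_head.simps by blast
   moreover have "Arrow_a k \<in> ?R <=> False"
    unfolding Un_iff mem_if singleton_iff by (simp only: toda_arrow.inject toda_arrow.distinct simp_thms conj_assoc)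
   moreover have "(1 \<le> k & k \<le> n & 2 * k - 1 = v & 2 * k = 2 * m - 1) <=> False" using p(2)[of m k] m by blast
   ultimately show ?thesis unfolding Arrow_a by blast
  next
   case (Arrow_b k)
   have "Arrow_b k \<in> ?L <=> (1 \<le> k & k \<le> n & 2 * k - 1 = v & 2 * k = 2 * m - 1)"
    unfolding mem_Collect_eq arcs_toda_quiver toda_tail.simps toda_head.simps by blast
   moreover have "Arrow_b k \<in> ?R <=> False"
    unfolding Un_iff mem_if singleton_iff by (simp only: toda_arrow.inject toda_arrow.distinct simp_thms conj_assoc)
   moreover have "(1 \<le> k & k \<le> n & 2 * k - 1 = v & 2 * k = 2 * m - 1) <=> False" using p(2)[of m k] m by blast
   ultimately show ?thesis unfolding Arrow_b by blast
  next
   case (Arrow_l k)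
   have "Arrow_l k \<in> ?L <=> (2 \<le> k & k \<le> n & 2 * k = v & 2 * k - 3 = 2 * m - 1)"
    unfolding mem_Collect_eq arcs_toda_quiver toda_tail.simps toda_head.simps by blast
   moreover have "Arrow_l k \<in> ?R <=> (m < n & v = 2 * m + 2 & k = m + 1)"
    unfolding Un_iff mem_if singleton_iff by (simp only: toda_arrow.inject toda_arrow.distinct simp_thms conj_assoc)
   moreover have "(2 \<le> k & k \<le> n & 2 * k = v & 2 * k - 3 = 2 * m - 1) <=> (m < n & v = 2 * m + 2 & k = m + 1)" using m by (intro iffI; elim conjE; intro conjI; linarith)
   ultimately show ?thesis unfolding Arrow_l by blast
  next
   case (Arrow_r k)
   have "Arrow_r k \<in> ?L <=> (1 \<le> k & k < n & 2 * k = v & 2 * k + 1 = 2 * m - 1)"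
    unfolding mem_Collect_eq arcs_toda_quiver toda_tail.simps toda_head.simps by blast
   moreover have "Arrow_r k \<in> ?R <=> (2 \<le> m & v = 2 * m - 2 & k = m - 1)"
    unfolding Un_iff mem_if singleton_iff by (simp only: toda_arrow.inject toda_arrow.distinct simp_thms conj_assoc)
   moreover have "(1 \<le> k & k < n & 2 * k = v & 2 * k + 1 = 2 * m - 1) <=> (2 \<le> m & v = 2 * m - 2 & k = m - 1)" using m by (intro iffI; elim conjE; intro conjI; linarith)
   ultimately show ?thesis unfolding Arrow_r by blast
  qed
 qed
 then show "card {al \<in> arcs (tq n). tail (tq n) al = v & head (tq n) al = 2 * m - 1} =
   of_bool (m < n & v = 2 * m + 2) + of_bool (2 \<le> m & v = 2 * m - 2)"
  by (simp add: of_bool_def)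
qed

text \<open>The exponents of the quotient of the two variables of level \<open>m\<close>. The value
  0 outside the quiver lets the second-difference formula hold at both ends.\<close>

definition level_exponent :: "nat => nat => nat => int" where
 "level_exponent n m v = (if 1 \<le> m & m \<le> n then of_bool (v = 2 * m - 1) - of_bool (v = 2 * m) else 0)"

text \<open>The double arrow inside level \<open>m\<close> contributes -2 and the single arrows to
  and from the adjacent levels contribute 1 each: the product of the two \<open>y\<close> variables
  of a level is a discrete Laplacian of the level exponents.\<close>

lemma monomial_at_level:
 assumes m: "1 \<le> m" "m \<le> n"
 shows "monomial_at (y_variable (tq n) (2 * m - 1) * y_variable (tq n) (2 * m))
  (%v. level_exponent n (m - 1) v - 2 * level_exponent n m v + level_exponent n (m + 1) v)"
proof -
 have "(if v \<in> {1..2*n} then exchange_number (tq n) (2 * m - 1) v else 0) +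
   (if v \<in> {1..2*n} then exchange_number (tq n) (2 * m) v else 0) =
   level_exponent n (m - 1) v - 2 * level_exponent n m v + level_exponent n (m + 1) v" for v
 proof -
  \<comment> \<open>Indicators of the vertices from \<open>2 * m - 3\<close> to
    \<open>2 * m + 2\<close>, the only ones involved in the exponents at level
    \<open>m\<close>.\<close>
  define a3 a2 a1 b0 b1 b2 :: int where "a3 = of_bool (2 \<le> m & v = 2 * m - 3)" "a2 = of_bool (2 \<le> m & v = 2 * m - 2)"
   and "a1 = of_bool (v = 2 * m - 1)" "b0 = of_bool (v = 2 * m)"
   and "b1 = of_bool (m < n & v = 2 * m + 1)" "b2 = of_bool (m < n & v = 2 * m + 2)"
  note defs = this
  have "2 * (m - 1) - 1 = 2 * m - 3" "2 * (m - 1) = 2 * m - 2" "1 \<le> m - 1 & m - 1 \<le> n <=> 2 \<le> m"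
   "2 * (m + 1) - 1 = 2 * m + 1" "2 * (m + 1) = 2 * m + 2" "1 \<le> m + 1 & m + 1 \<le> n <=> m < n"
   using m by auto
  then have lev: "level_exponent n (m - 1) v = a3 - a2" "level_exponent n m v = a1 - b0" "level_exponent n (m + 1) v = b1 - b2"
   unfolding level_exponent_def defs using m by (simp_all only: of_bool_conj) simp_all
  have ex: "exchange_number (tq n) (2 * m - 1) v = 2 * b0 - (b2 + a2)"
   "exchange_number (tq n) (2 * m) v = a3 + b1 - 2 * a1"
   unfolding exchange_number_def toda_arrow_counts[OF m] defs by simp_all
  show ?thesis
  proof (cases "v \<in> {1..2*n}")
   case True
   then show ?thesis unfolding lev ex by simp
  next
   case False
   then have "a3 = 0" "a2 = 0" "a1 = 0" "b0 = 0" "b1 = 0" "b2 = 0" using m unfolding defs by auto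
   then show ?thesis unfolding lev if_not_P[OF False] by simp
  qed
 qed
 then show ?thesis
  using monomial_at_mult[OF monomial_at_y_variable[of n "2 * m - 1"] monomial_at_y_variable[of n "2 * m"]] by simp
qed

text \<open>Summation by parts: \<open>lo n i\<close> is piecewise linear in the level with its only
  kink at \<open>n + 1 - i\<close>, so its second difference is 1 there and 0 elsewhere. The last
  two terms are the boundary terms at \<open>M\<close>.\<close>

lemma level_exponent_sum:
 assumes i: "1 \<le> i" "i \<le> n" and M: "M \<le> n"
 shows "(\<Sum>m=1..M. int (lo n i m) * (level_exponent n (m - 1) v - 2 * level_exponent n m v + level_exponent n (m + 1) v)) =
  (if n + 1 - i \<le> M then level_exponent n (n + 1 - i) v else 0) + int (lo n i M) * level_exponent n (M + 1) v
   - int (lo n i (M + 1)) * level_exponent n M v"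
 using M
proof (induction M)
 case 0
 have "lo n i 0 = 0" using i by (simp add: lo_def)
 then show ?case using i by (simp add: level_exponent_def)
next
 case (Suc M)
 have e: "int (lo n i M) - 2 * int (lo n i (M + 1)) + int (lo n i (M + 2)) = (if M + 1 = n + 1 - i then 1 else 0)"
  using i by (auto simp: lo_def)
 let ?z = "%m. level_exponent n m v"
 let ?F = "%m. int (lo n i m) * (?z (m - 1) - 2 * ?z m + ?z (m + 1))"
 let ?t = "n + 1 - i"
 define a b c z0 z1 z2 where "a = int (lo n i M)" "b = int (lo n i (M + 1))" "c = int (lo n i (M + 2))"
  and "z0 = ?z M" "z1 = ?z (M + 1)" "z2 = ?z (M + 2)"
 note defs = this
 have s: "Suc M = M + 1" "M + 1 - 1 = M" "M + 1 + 1 = M + 2" by simp_all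
 have IH: "(\<Sum>m=1..M. ?F m) = (if ?t \<le> M then ?z ?t else 0) + a * z1 - b * z0"
  using Suc unfolding defs by simp
 have "(\<Sum>m=1..Suc M. ?F m) = (\<Sum>m=1..M. ?F m) + ?F (Suc M)" by simp
 also have "?F (Suc M) = b * (z0 - 2 * z1 + z2)" unfolding s defs ..
 also have "(\<Sum>m=1..M. ?F m) + b * (z0 - 2 * z1 + z2) = (if ?t \<le> M then ?z ?t else 0) + (a - 2 * b + c) * z1 + b * z2 - c * z1"
  unfolding IH by (simp add: algebra_simps)
 also have "(if ?t \<le> M then ?z ?t else 0) + (a - 2 * b + c) * z1 = (if ?t \<le> M + 1 then ?z ?t else 0)"
 proof (cases "M + 1 = ?t")
  case True
  then have "a - 2 * b + c = 1" "?z ?t = z1" using e unfolding defs by simp_all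
  then show ?thesis using True by simp
 next
  case False
  then have "a - 2 * b + c = 0" using e unfolding defs by simp
  moreover have "?t \<le> M + 1 <=> ?t \<le> M" using False by arith
  ultimately show ?thesis by simp
 qed
 finally show ?case unfolding s defs .
qed

text \<open>At \<open>M = n\<close> the boundary term is \<open>- i\<close> times the exponent of
  level \<open>n\<close>, which the \<open>i\<close>-th power of the prefactor cancels. What remains
  is the kink at \<open>n + 1 - i\<close>, and this is the monomial of the coindex.\<close>

lemma prefactor_identity:
 assumes i: "1 \<le> i" "i \<le> n"
 shows "toda_prefactor n ^ i *
   (\<Prod>m=1..n. (y_variable (tq n) (2 * m - 1) * y_variable (tq n) (2 * m)) ^ lo n i m) =
  laurent_monomial (Poly_Mapping.single (2 * (n + 1 - i) - 1) 1 - Poly_Mapping.single (2 * (n + 1 - i)) 1)"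
proof (rule monomial_at_unique)
 let ?z = "level_exponent n"
 have pre: "monomial_at (laurent_monomial (Poly_Mapping.single (2 * k - 1) 1 - Poly_Mapping.single (2 * k) 1)) (?z k)"
  if "1 \<le> k" "k \<le> n" for k
 proof -
  have "Poly_Mapping.lookup (Poly_Mapping.single (2 * k - 1) 1 - Poly_Mapping.single (2 * k) 1) = ?z k"
   using that by (auto simp: fun_eq_iff lookup_minus lookup_single level_exponent_def when_def of_bool_def)
  then show ?thesis using monomial_at_laurent by metis
 qed
 show "monomial_at (laurent_monomial (Poly_Mapping.single (2 * (n + 1 - i) - 1) 1 - Poly_Mapping.single (2 * (n + 1 - i)) 1)) (?z (n + 1 - i))"
  by (rule pre) (use i in auto)
 have 1: "monomial_at (toda_prefactor n ^ i) (%v. int i * ?z n v)"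
  unfolding toda_prefactor_def by (rule monomial_at_power[OF pre]) (use i in auto)
 have "monomial_at (\<Prod>m=1..n. (y_variable (tq n) (2 * m - 1) * y_variable (tq n) (2 * m)) ^ lo n i m)
   (%v. \<Sum>m=1..n. int (lo n i m) * (?z (m - 1) v - 2 * ?z m v + ?z (m + 1) v))"
  by (rule monomial_at_prod) (auto intro!: monomial_at_power monomial_at_level)
 from monomial_at_mult[OF 1 this] have
  "monomial_at (toda_prefactor n ^ i *
   (\<Prod>m=1..n. (y_variable (tq n) (2 * m - 1) * y_variable (tq n) (2 * m)) ^ lo n i m))
   (%v. int i * ?z n v + (\<Sum>m=1..n. int (lo n i m) * (?z (m - 1) v - 2 * ?z m v + ?z (m + 1) v)))" .
 moreover have "int i * ?z n v + (\<Sum>m=1..n. int (lo n i m) * (?z (m - 1) v - 2 * ?z m v + ?z (m + 1) v)) = ?z (n + 1 - i) v" for v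
 proof -
  have "lo n i (n + 1) = i" "?z (n + 1) v = 0" by (simp_all add: lo_def level_exponent_def)
  then show ?thesis unfolding level_exponent_sum[OF i order_refl] using i by simp
 qed
 ultimately show "monomial_at (toda_prefactor n ^ i *
   (\<Prod>m=1..n. (y_variable (tq n) (2 * m - 1) * y_variable (tq n) (2 * m)) ^ lo n i m)) (?z (n + 1 - i))"
  by simp
qed

section \<open>Subsets with choices and interlacing sequences\<close>

abbreviation "subset_count S m \<equiv> card (S \<inter> {..<m :: nat})"

text \<open>The exponents of \<open>y\<close> in \<open>toda_weight\<close>: two of them where the
  factor \<open>y + 1\<close> appears, one otherwise.\<close>

definition odd_choices :: "nat set => nat => nat set" where
 "odd_choices S m = (if m - 1 \<in> S & m \<notin> S then {subset_count S m, subset_count S m - 1} else {subset_count S m})"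

lemma subset_count_step:
 assumes "finite S"
 shows "subset_count S (m + 1) = subset_count S m + (if m \<in> S then 1 else 0)"
proof -
 have "S \<inter> {..<m + 1} = S \<inter> {..<m} \<union> (if m \<in> S then {m} else {})"
  unfolding Suc_eq_plus1[symmetric] by (auto simp: less_Suc_eq)
 then show ?thesis using assms by auto
qed

text \<open>At most \<open>n + 1 - m\<close> elements of \<open>S\<close> lie at or above
  \<open>m\<close>. This lower bound for the count is \<open>lo n i m\<close>, the lower end of the
  strip.\<close>

lemma subset_count_bounds:
 assumes S: "S \<subseteq> {..<n + 1}" "card S = i" and m: "m \<le> n + 1"
 shows "subset_count S m \<le> m" "subset_count S m \<le> i" "i \<le> subset_count S m + (n + 1 - m)"
proof -
 have f: "finite S" using S(1) finite_subset by blast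
 show "subset_count S m \<le> m" using card_mono[of "{..<m}" "S \<inter> {..<m}"] by simp
 show "subset_count S m \<le> i" using card_mono[OF f, of "S \<inter> {..<m}"] S(2) by simp
 have "S = (S \<inter> {..<m}) \<union> (S \<inter> {m..<n + 1})" using S(1) by auto
 then have "i \<le> subset_count S m + card (S \<inter> {m..<n + 1})" using card_Un_le S(2) by metis
 moreover have "card (S \<inter> {m..<n + 1}) \<le> n + 1 - m" using card_mono[of "{m..<n + 1}" "S \<inter> {m..<n + 1}"] by simp
 ultimately show "i \<le> subset_count S m + (n + 1 - m)" by simp
qed

lemma toda_weight_choices:
 assumes f: "finite S" and m: "1 \<le> m"
 shows "toda_weight S y z m = (\<Sum>k\<in>odd_choices S m. y ^ k * z ^ subset_count S m)"
proof (cases "m - 1 \<in> S & m \<notin> S")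
 case True
 then have "m - 1 \<in> S \<inter> {..<m}" using m by simp
 then have p: "0 < subset_count S m" using f by (auto simp: card_gt_0_iff)
 then obtain k where "subset_count S m = Suc k" by (rule gr0_implies_Suc[THEN exE])
 then show ?thesis using True by (simp add: toda_weight_def odd_choices_def algebra_simps)
next
 case False
 then show ?thesis by (auto simp: toda_weight_def odd_choices_def)
qed

text \<open>Let \<open>N m\<close> and \<open>F m\<close> be the highest positions at the vertices
  \<open>2 * m\<close> and \<open>2 * m - 1\<close>. Interlacing makes \<open>N\<close> the counting
  function of a subset of size \<open>i\<close>, and it leaves for \<open>F m\<close> the value
  \<open>N m\<close>, or also \<open>N m - 1\<close> when \<open>N\<close> has just jumped and does
  not jump next.\<close>

lemma subset_choice_sum:
 fixes Y Z :: "nat => 'a :: comm_ring_1"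
 assumes i: "1 \<le> i" "i \<le> n"
 shows "(\<Sum>(S, f)\<in>Sigma {S. S \<subseteq> {..<n + 1} & card S = i} (%S. PiE {1..n} (odd_choices S)).
   \<Prod>m=1..n. Y m ^ f m * Z m ^ subset_count S m) =
  (\<Sum>e\<in>{e \<in> {1..2*n} \<rightarrow>\<^sub>E UNIV. admissible n i e}. \<Prod>m=1..n. Y m ^ (lo n i m + e (2 * m - 1)) * Z m ^ (lo n i m + e (2 * m)))"
proof -
 define SS where "SS = {S. S \<subseteq> {..<n + 1} & card S = i}"
 define C where "C = (%S. PiE {1..n} (odd_choices S))"
 define E where "E = {e \<in> {1..2*n} \<rightarrow>\<^sub>E (UNIV :: nat set). admissible n i e}"
 define l where "l = lo n i"
 \<comment> \<open>The values 0 and \<open>i\<close> added at the two ends are those of the counting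
   function of a subset of size \<open>i\<close>.\<close>
 define N where "N e m = (if m = 0 then 0 else if m \<le> n then l m + e (2 * m) else i)" for e :: "nat => nat" and m
 define F where "F e m = l m + e (2 * m - 1)" for e :: "nat => nat" and m
 \<comment> \<open>The subset is recovered as the set of jumps of \<open>N\<close>.\<close>
 define T where "T e = {m. m \<le> n & N e (m + 1) = N e m + 1}" for e
 define G where "G e = (\<lambda>m\<in>{1..n}. F e m)" for e
 define J where "J S f = (\<lambda>v\<in>{1..2*n}. if even v then subset_count S (v div 2) - l (v div 2) else f ((v + 1) div 2) - l ((v + 1) div 2))"
  for S and f :: "nat => nat"
 have N0: "N e 0 = 0" and Nm: "1 \<le> m ==> m \<le> n ==> N e m = l m + e (2 * m)" and Nn: "N e (n + 1) = i" for e m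
  by (simp_all add: N_def)
 have ln: "i \<le> l n + 1" using i by (simp_all add: l_def lo_def)
 have fS: "finite S" if "S \<in> SS" for S using that finite_subset unfolding SS_def by blast
 have step: "subset_count S (m + 1) = subset_count S m + (if m \<in> S then 1 else 0)" if "S \<in> SS" for S m
  by (rule subset_count_step[OF fS[OF that]])
 have bd: "subset_count S m \<le> m" "subset_count S m \<le> i" "i \<le> subset_count S m + (n + 1 - m)" if "S \<in> SS" "m \<le> n + 1" for S m
  using subset_count_bounds[of S n i m] that unfolding SS_def by blast+
 have top: "subset_count S (n + 1) = i" if "S \<in> SS" for S using that unfolding SS_def by (simp add: inf_absorb1)
 have lS: "l m \<le> subset_count S m" if S: "S \<in> SS" and m: "1 \<le> m" "m \<le> n" for S m
  using bd(3)[OF S, of m] m unfolding l_def lo_def by linarith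
 \<comment> \<open>Bounds for a permitted exponent \<open>k\<close>; the last one ensures that
   subtracting \<open>lo\<close> in \<open>J\<close> does not truncate.\<close>
 have ch: "k \<le> subset_count S m" "subset_count S (m + 1) \<le> k + 1" "subset_count S (m - 1) \<le> k" "l m \<le> k"
  if S: "S \<in> SS" and m: "1 \<le> m" "m \<le> n" and k: "k \<in> odd_choices S m" for S m k
 proof -
  have s1: "subset_count S m = subset_count S (m - 1) + (if m - 1 \<in> S then 1 else 0)"
   using step[OF S, of "m - 1"] m by simp
  have "k \<le> b & c \<le> k + 1 & a \<le> k"
   if "b = a + (if P then 1 else 0)" "c = b + (if Q then 1 else 0)" "k \<in> (if P & ~ Q then {b, b - 1} else {b})"
   for a b c k :: nat and P Q using that by (cases P; cases Q) auto
  from this[OF s1 step[OF S] k[unfolded odd_choices_def]]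
  have c: "k \<le> subset_count S m & subset_count S (m + 1) \<le> k + 1 & subset_count S (m - 1) \<le> k" .
  then show "k \<le> subset_count S m" "subset_count S (m + 1) \<le> k + 1" "subset_count S (m - 1) \<le> k" by blast+
  have "i \<le> subset_count S (m + 1) + (n + 1 - (m + 1))" using bd(3)[OF S, of "m + 1"] m by linarith
  then show "l m \<le> k" using c m unfolding l_def lo_def by linarith
 qed
 have J1: "J S f (2 * m) = subset_count S m - l m" and J2: "J S f (2 * m - 1) = f m - l m" if m: "1 \<le> m" "m \<le> n" for S f m
 proof -
  have "odd (2 * m - 1)" "(2 * m - 1 + 1) div 2 = m" "2 * m - 1 \<in> {1..2*n}" using m by auto
  then show "J S f (2 * m - 1) = f m - l m" unfolding J_def by simp
  show "J S f (2 * m) = subset_count S m - l m" unfolding J_def using m by simp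
 qed
 have NJ: "N (J S f) m = subset_count S m" if S: "S \<in> SS" and m: "m \<le> n + 1" for S f m
 proof -
  have "m = 0 \<or> m = n + 1 \<or> 1 \<le> m & m \<le> n" using m by linarith
  then consider "m = 0" | "m = n + 1" | "1 \<le> m" "m \<le> n" by blast
  then show ?thesis
  proof cases
   case 1
   then show ?thesis using N0 by simp
  next
   case 2
   then show ?thesis using Nn top[OF S] by simp
  next
   case 3
   show ?thesis unfolding Nm[OF 3] J1[OF 3] using lS[OF S 3] by simp
  qed
 qed
 have FJ: "F (J S f) m = f m" if "S \<in> SS" "f \<in> C S" "1 \<le> m" "m \<le> n" for S f m
 proof -
  have "f m \<in> odd_choices S m" using that unfolding C_def by auto
  from ch(4)[OF that(1,3,4) this] show ?thesis unfolding F_def J2[OF that(3,4)] by simp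
 qed
 \<comment> \<open>In terms of \<open>N\<close> and \<open>F\<close> the offsets \<open>lo\<close>
   disappear and plain interlacing remains.\<close>
 have adm_iff: "admissible n i e <=> (ALL m. 1 \<le> m & m \<le> n --> F e m \<le> N e m & N e m \<le> i & N e m \<le> m &
   (m < n --> N e m \<le> F e (m + 1) & N e (m + 1) \<le> F e m + 1))" for e
 proof -
  have x: "2 * (m + 1) - 1 = 2 * m + 1" "2 * (m + 1) = 2 * m + 2" for m :: nat by simp_all
  have y: "N e (m + 1) = l (m + 1) + e (2 * m + 2)" "F e (m + 1) = l (m + 1) + e (2 * m + 1)" if "m < n" for m
  proof -
   have "1 \<le> m + 1" "m + 1 \<le> n" using that by linarith+
   then show "N e (m + 1) = l (m + 1) + e (2 * m + 2)" using Nm[of "m + 1" e] unfolding x(2) by blast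
   show "F e (m + 1) = l (m + 1) + e (2 * m + 1)" unfolding F_def x(1) ..
  qed
  show ?thesis unfolding admissible_def l_def[symmetric]
  proof (intro all_cong1 imp_cong refl)
   fix m assume m: "1 \<le> m & m \<le> n"
   have z: "N e m = l m + e (2 * m)" "F e m = l m + e (2 * m - 1)" using Nm m unfolding F_def by blast+
   show "(e (2 * m - 1) \<le> e (2 * m) & l m + e (2 * m) \<le> i & l m + e (2 * m) \<le> m &
     (m < n --> l m + e (2 * m) \<le> l (m + 1) + e (2 * m + 1) & l (m + 1) + e (2 * m + 2) \<le> l m + e (2 * m - 1) + 1)) =
    (F e m \<le> N e m & N e m \<le> i & N e m \<le> m & (m < n --> N e m \<le> F e (m + 1) & N e (m + 1) \<le> F e m + 1))"
   proof (cases "m < n")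
    case True
    show ?thesis unfolding z y[OF True] by (simp only: nat_add_left_cancel_le)
   next
    case False
    then show ?thesis unfolding z by (simp only: nat_add_left_cancel_le simp_thms)
   qed
  qed
 qed
 \<comment> \<open>The inequalities extend to the missing neighbours: \<open>N\<close> starts at 0,
   and at the other end \<open>i\<close> is at most \<open>lo n i n + 1\<close>.\<close>
 have a1: "F e m \<le> N e m" "N e m \<le> i" "N e m \<le> m" "N e (m - 1) \<le> F e m" "N e (m + 1) \<le> F e m + 1"
  if e: "e \<in> E" and m: "1 \<le> m" "m \<le> n" for e m
 proof -
  have adm: "ALL m. 1 \<le> m & m \<le> n --> F e m \<le> N e m & N e m \<le> i & N e m \<le> m &
   (m < n --> N e m \<le> F e (m + 1) & N e (m + 1) \<le> F e m + 1)" using e adm_iff unfolding E_def by blast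
  then show "F e m \<le> N e m" "N e m \<le> i" "N e m \<le> m" using m by blast+
  show "N e (m - 1) \<le> F e m"
  proof (cases "m = 1")
   case False
   then have "1 \<le> m - 1" "m - 1 \<le> n" "m - 1 < n" "m - 1 + 1 = m" using m by linarith+
   then show ?thesis using adm by metis
  qed (simp add: N0)
  show "N e (m + 1) \<le> F e m + 1"
  proof (cases "m < n")
   case True
   then show ?thesis using adm m by blast
  next
   case False
   then have mn: "m = n" using m by linarith
   show ?thesis unfolding mn Nn F_def using ln by linarith
  qed
 qed
 have Ne: "N e m \<le> N e (m + 1)" "N e (m + 1) \<le> N e m + 1" if e: "e \<in> E" and m: "m \<le> n" for e m
 proof -
  have "N e m \<le> N e (m + 1) & N e (m + 1) \<le> N e m + 1"
  proof (cases "m = 0")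
   case True
   have "N e 1 \<le> 1" using a1(3)[OF e, of 1] i by linarith
   then show ?thesis using True N0 by simp
  next
   case False
   then have m1: "1 \<le> m" by linarith
   have "N e m \<le> N e (m + 1)"
   proof (cases "m = n")
    case True
    show ?thesis using a1(2)[OF e m1 m] Nn unfolding True by simp
   next
    case F: False
    then have "1 \<le> m + 1" "m + 1 \<le> n" using m by linarith+
    from a1(1)[OF e this] a1(4)[OF e this] show ?thesis by (simp only: add_diff_cancel_right')
   qed
   then show ?thesis using a1(5)[OF e m1 m] a1(1)[OF e m1 m] by linarith
  qed
  then show "N e m \<le> N e (m + 1)" "N e (m + 1) \<le> N e m + 1" by blast+
 qed
 have memT: "m \<in> T e <=> N e (m + 1) = N e m + 1" if "m \<le> n" for e m using that unfolding T_def by blast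
 have fT: "finite (T e)" for e unfolding T_def by simp
 have cnt: "m \<le> n + 1 ==> subset_count (T e) m = N e m" if e: "e \<in> E" for e m
 proof (induction m)
  case 0
  show ?case using N0 by simp
 next
  case (Suc m)
  then have m: "m \<le> n" by simp
  have "subset_count (T e) (m + 1) = N e m + (if m \<in> T e then 1 else 0)"
   using subset_count_step[OF fT, of e m] Suc.IH m by linarith
  also have "... = N e (m + 1)" using Ne[OF e m] unfolding memT[OF m] by simp
  finally show ?case by (simp only: Suc_eq_plus1)
 qed
 have "(\<Sum>p\<in>Sigma SS C. (case p of (S, f) => \<Prod>m=1..n. Y m ^ f m * Z m ^ subset_count S m)) =
  (\<Sum>e\<in>E. \<Prod>m=1..n. Y m ^ (l m + e (2 * m - 1)) * Z m ^ (l m + e (2 * m)))"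
 proof (rule sum.reindex_bij_witness[where i = "%e. (T e, G e)" and j = "%p. J (fst p) (snd p)"])
  fix p assume p: "p \<in> Sigma SS C"
  obtain S f where pe: "p = (S, f)" by (cases p)
  have S: "S \<in> SS" and f: "f \<in> C S" using p pe by auto
  have fm: "f m \<in> odd_choices S m" if "1 \<le> m" "m \<le> n" for m using f that unfolding C_def by auto
  have "T (J S f) = S"
  proof (rule Set.set_eqI)
   fix m
   show "m \<in> T (J S f) <=> m \<in> S"
   proof (cases "m \<le> n")
    case True
    then have "m \<le> n + 1" "m + 1 \<le> n + 1" by linarith+
    then show ?thesis unfolding memT[OF True] NJ[OF S \<open>m \<le> n + 1\<close>] NJ[OF S \<open>m + 1 \<le> n + 1\<close>] step[OF S] by simp
   next
    case False
    then show ?thesis using S unfolding T_def SS_def by auto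
   qed
  qed
  moreover have "G (J S f) = f"
  proof
   fix m show "G (J S f) m = f m"
   proof (cases "m \<in> {1..n}")
    case True
    then show ?thesis unfolding G_def using FJ[OF S f] by simp
   next
    case False
    then show ?thesis using PiE_arb[OF f[unfolded C_def] False] unfolding G_def by (simp only: restrict_apply if_False)
   qed
  qed
  ultimately show "(T (J (fst p) (snd p)), G (J (fst p) (snd p))) = p" unfolding pe by simp
  have "admissible n i (J S f)" unfolding adm_iff
  proof (intro allI impI)
   fix m assume m: "1 \<le> m & m \<le> n"
   have m1: "1 \<le> m" "m \<le> n" "m \<le> n + 1" "m + 1 \<le> n + 1" using m by linarith+
   have x: "subset_count S m \<le> F (J S f) (m + 1)" if "m < n"
   proof -
    have m2: "1 \<le> m + 1" "m + 1 \<le> n" using that by linarith+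
    show ?thesis unfolding FJ[OF S f m2]
     using ch(3)[OF S m2 fm[OF m2]] unfolding add_diff_cancel_right' .
   qed
   show "F (J S f) m \<le> N (J S f) m & N (J S f) m \<le> i & N (J S f) m \<le> m &
     (m < n --> N (J S f) m \<le> F (J S f) (m + 1) & N (J S f) (m + 1) \<le> F (J S f) m + 1)"
    unfolding NJ[OF S m1(3)] NJ[OF S m1(4)] FJ[OF S f m1(1,2)]
    using x ch(1,2)[OF S m1(1,2) fm[OF m1(1,2)]] bd(1,2)[OF S m1(3)] by blast
  qed
  then show "J (fst p) (snd p) \<in> E" unfolding pe fst_conv snd_conv E_def J_def by simp
  show "(\<Prod>m=1..n. Y m ^ (l m + J (fst p) (snd p) (2 * m - 1)) * Z m ^ (l m + J (fst p) (snd p) (2 * m))) =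
    (case p of (S, f) => \<Prod>m=1..n. Y m ^ f m * Z m ^ subset_count S m)"
   unfolding pe prod.case fst_conv snd_conv
  proof (intro prod.cong refl)
   fix m assume "m \<in> {1..n}"
   then have m: "1 \<le> m" "m \<le> n" "m \<le> n + 1" by auto
   show "Y m ^ (l m + J S f (2 * m - 1)) * Z m ^ (l m + J S f (2 * m)) = Y m ^ f m * Z m ^ subset_count S m"
    using FJ[OF S f m(1,2)] NJ[OF S m(3), of f] unfolding Nm[OF m(1,2)] F_def by (simp only:)
  qed
 next
  fix e assume e: "e \<in> E"
  have "T e \<inter> {..<n + 1} = T e" "T e \<subseteq> {..<n + 1}" unfolding T_def by auto
  then have S: "T e \<in> SS" using cnt[OF e, of "n + 1"] Nn unfolding SS_def by simp
  have f: "G e \<in> C (T e)" unfolding C_def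
  proof (rule PiE_I)
   fix m assume "m \<in> {1..n}"
   then have m: "1 \<le> m" "m \<le> n" "m \<le> n + 1" "m - 1 \<le> n" "m - 1 + 1 = m" by auto
   have fe: "G e m = F e m" using m unfolding G_def by simp
   note 1 = a1[OF e m(1,2)] Ne[OF e m(2)] Ne[OF e m(4), unfolded m(5)]
   \<comment> \<open>Within these bounds \<open>F\<close> falls below \<open>N\<close> only if
     \<open>N\<close> has just jumped and does not jump next, which is the case distinction of
     \<open>odd_choices\<close>.\<close>
   have "F e m = N e m \<or> N e m = N e (m - 1) + 1 & N e (m + 1) ~= N e m + 1 & F e m = N e m - 1"
    using 1 by linarith
   then show "G e m \<in> odd_choices (T e) m"
    unfolding odd_choices_def fe cnt[OF e m(3)] memT[OF m(2)] memT[OF m(4)] m(5) by auto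
  next
   fix m assume "m \<notin> {1..n}"
   then show "G e m = undefined" unfolding G_def by auto
  qed
  show "(T e, G e) \<in> Sigma SS C" using S f by blast
  have "J (T e) (G e) = e"
  proof
   fix v show "J (T e) (G e) v = e v"
   proof (cases "v \<in> {1..2*n}")
    case False
    have "e \<in> {1..2*n} \<rightarrow>\<^sub>E UNIV" using e unfolding E_def by blast
    from PiE_arb[OF this False] show ?thesis using False unfolding J_def by (simp only: restrict_apply if_False)
   next
    case True
    then have vr: "1 \<le> v" "v \<le> 2 * n" by simp_all
    obtain m where m: "1 \<le> m" "m \<le> n" and v: "v = 2 * m \<or> v = 2 * m - 1"
    proof (cases "even v")
     case True
     then obtain k where k: "v = 2 * k" by (rule evenE)
     then have "1 \<le> k" "k \<le> n" using vr by linarith+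
     then show thesis using that k by blast
    next
     case False
     then obtain k where k: "v = 2 * k + 1" by (rule oddE)
     then have "1 \<le> k + 1" "k + 1 \<le> n" using vr by linarith+
     moreover have "v = 2 * (k + 1) - 1" using k by simp
     ultimately show thesis using that by blast
    qed
    have "J (T e) (G e) (2 * m) = e (2 * m)"
     unfolding J1[OF m] using cnt[OF e, of m] Nm[OF m] m by simp
    moreover have "J (T e) (G e) (2 * m - 1) = e (2 * m - 1)"
     unfolding J2[OF m] G_def F_def using m by simp
    ultimately show ?thesis using v by blast
   qed
  qed
  then show "J (fst (T e, G e)) (snd (T e, G e)) = e" by simp
 qed
 then show ?thesis unfolding SS_def C_def E_def l_def .
qed

text \<open>Expanding the product over levels turns a subset into all its choices. The exponents
  \<open>lo\<close>, the lower ends of the strips, are common to all terms and are split off; what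
  is left is a dimension vector.\<close>

lemma toda_weight_sum:
 fixes Y Z :: "nat => 'a :: comm_ring_1"
 assumes i: "1 \<le> i" "i \<le> n"
 shows "(\<Sum>S\<in>{S. S \<subseteq> {..<n + 1} & card S = i}. \<Prod>m=1..n. toda_weight S (Y m) (Z m) m) =
  (\<Prod>m=1..n. (Y m * Z m) ^ lo n i m) *
  (\<Sum>e\<in>{e \<in> {1..2*n} \<rightarrow>\<^sub>E UNIV. admissible n i e}. \<Prod>m=1..n. Y m ^ e (2 * m - 1) * Z m ^ e (2 * m))"
proof -
 let ?SS = "{S. S \<subseteq> {..<n + 1} & card S = i}" and ?C = "%S. PiE {1..n} (odd_choices S)"
 let ?E = "{e \<in> {1..2*n} \<rightarrow>\<^sub>E (UNIV :: nat set). admissible n i e}"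
 let ?l = "lo n i"
 have fS: "finite S" if "S \<in> ?SS" for S using that finite_subset by blast
 have "(\<Prod>m=1..n. toda_weight S (Y m) (Z m) m) =
   (\<Sum>f\<in>?C S. \<Prod>m=1..n. Y m ^ f m * Z m ^ subset_count S m)" if S: "S \<in> ?SS" for S
 proof -
  have "(\<Prod>m=1..n. toda_weight S (Y m) (Z m) m) =
    (\<Prod>m=1..n. \<Sum>k\<in>odd_choices S m. Y m ^ k * Z m ^ subset_count S m)"
   by (intro prod.cong refl toda_weight_choices fS[OF S]) simp
  also have "... = (\<Sum>f\<in>?C S. \<Prod>m=1..n. Y m ^ f m * Z m ^ subset_count S m)"
   by (rule prod_sum_PiE) (auto simp: odd_choices_def)
  finally show ?thesis .
 qed
 then have "(\<Sum>S\<in>?SS. \<Prod>m=1..n. toda_weight S (Y m) (Z m) m) =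
   (\<Sum>S\<in>?SS. \<Sum>f\<in>?C S. \<Prod>m=1..n. Y m ^ f m * Z m ^ subset_count S m)"
  by (rule sum.cong[OF refl])
 also have "... = (\<Sum>(S, f)\<in>Sigma ?SS ?C. \<Prod>m=1..n. Y m ^ f m * Z m ^ subset_count S m)"
  by (rule sum.Sigma) (auto intro!: finite_PiE simp: odd_choices_def)
 also have "... = (\<Sum>e\<in>?E. \<Prod>m=1..n. Y m ^ (?l m + e (2 * m - 1)) * Z m ^ (?l m + e (2 * m)))"
  by (rule subset_choice_sum[OF i])
 also have "... = (\<Prod>m=1..n. (Y m * Z m) ^ ?l m) * (\<Sum>e\<in>?E. \<Prod>m=1..n. Y m ^ e (2 * m - 1) * Z m ^ e (2 * m))"
  unfolding sum_distrib_left prod.distrib[symmetric]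
  by (intro sum.cong prod.cong refl) (simp add: power_add power_mult_distrib mult_ac)
 finally show ?thesis .
qed

section \<open>Extension of functionals and injectivity\<close>

text \<open>For \<open>b\<close> outside \<open>S\<close>, the sum of an element of \<open>S\<close>
  and a multiple of \<open>b\<close> determines both, so the extension may be taken to vanish on
  \<open>b\<close>.\<close>

lemma extend_functional_insert:
 assumes V: "vectorspace class_ring V" and S: "VectorSpace.subspace class_ring S V" and b: "b \<in> carrier V"
  and \<psi>: "!!x y. x \<in> S ==> y \<in> S ==> \<psi> (x \<oplus>\<^bsub>V\<^esub> y) = \<psi> x + (\<psi> y :: complex)"
   "!!c x. x \<in> S ==> \<psi> (c \<odot>\<^bsub>V\<^esub> x) = c * \<psi> x"
 shows "\<exists>S' \<psi>'. VectorSpace.subspace class_ring S' V & S \<subseteq> S' & b \<in> S' &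
  (\<forall>x\<in>S'. \<forall>y\<in>S'. \<psi>' (x \<oplus>\<^bsub>V\<^esub> y) = \<psi>' x + (\<psi>' y :: complex)) &
  (ALL c. \<forall>x\<in>S'. \<psi>' (c \<odot>\<^bsub>V\<^esub> x) = c * \<psi>' x) & (\<forall>x\<in>S. \<psi>' x = \<psi> x)"
proof (cases "b \<in> S")
 case True
 then show ?thesis using S \<psi> by (intro exI[of _ S] exI[of _ \<psi>]) auto
next
 case False
 interpret V: vectorspace class_ring V by fact
 have sub: "submodule class_ring S V" using S by (simp add: VectorSpace.subspace_def)
 have SV: "x \<in> carrier V" if "x \<in> S" for x using submodule.subset[OF sub] that by blast
 have Sadd: "x \<oplus>\<^bsub>V\<^esub> y \<in> S" if "x \<in> S" "y \<in> S" for x y using submodule.m_closed[OF sub that] .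
 have Ssm: "c \<odot>\<^bsub>V\<^esub> x \<in> S" if "x \<in> S" for c x using submodule.smult_closed[OF sub _ that, of c] by simp
 have S0: "zero V \<in> S" using submodule.zero_closed[OF sub] .
 have sm: "c \<odot>\<^bsub>V\<^esub> x \<in> carrier V" if "x \<in> carrier V" for c x using V.smult_closed[of c x] that by simp
 have ld: "(c + d) \<odot>\<^bsub>V\<^esub> x = c \<odot>\<^bsub>V\<^esub> x \<oplus>\<^bsub>V\<^esub> d \<odot>\<^bsub>V\<^esub> x" if "x \<in> carrier V" for c d x
  using V.smult_l_distr[of c d x] that by (simp add: class_ring_simps)
 have rd: "c \<odot>\<^bsub>V\<^esub> (x \<oplus>\<^bsub>V\<^esub> y) = c \<odot>\<^bsub>V\<^esub> x \<oplus>\<^bsub>V\<^esub> c \<odot>\<^bsub>V\<^esub> y"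
  if "x \<in> carrier V" "y \<in> carrier V" for c x y
  using V.smult_r_distr[of c x y] that by simp
 have as: "(c * d) \<odot>\<^bsub>V\<^esub> x = c \<odot>\<^bsub>V\<^esub> (d \<odot>\<^bsub>V\<^esub> x)" if "x \<in> carrier V" for c d x
  using V.smult_assoc1[of c d x] that by (simp add: class_ring_simps)
 have one: "1 \<odot>\<^bsub>V\<^esub> x = x" if "x \<in> carrier V" for x using V.smult_one[OF that] by simp
 have z0: "0 \<odot>\<^bsub>V\<^esub> x = zero V" if "x \<in> carrier V" for x using V.lmult_0[OF that] by simp
 \<comment> \<open>Otherwise a nonzero multiple of \<open>b\<close>, and hence \<open>b\<close>
   itself, would lie in \<open>S\<close>.\<close>
 have uniq: "c = d" if eq: "s \<oplus>\<^bsub>V\<^esub> c \<odot>\<^bsub>V\<^esub> b = t \<oplus>\<^bsub>V\<^esub> d \<odot>\<^bsub>V\<^esub> b" and st: "s \<in> S" "t \<in> S" for s t c d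
 proof (rule ccontr)
  assume cd: "c ~= d"
  have "c \<odot>\<^bsub>V\<^esub> b = (c - d) \<odot>\<^bsub>V\<^esub> b \<oplus>\<^bsub>V\<^esub> d \<odot>\<^bsub>V\<^esub> b" using ld[OF b, of "c - d" d] by simp
  then have "(s \<oplus>\<^bsub>V\<^esub> (c - d) \<odot>\<^bsub>V\<^esub> b) \<oplus>\<^bsub>V\<^esub> d \<odot>\<^bsub>V\<^esub> b = t \<oplus>\<^bsub>V\<^esub> d \<odot>\<^bsub>V\<^esub> b"
   using eq SV st sm[OF b] by (simp add: V.a_assoc)
  then have "s \<oplus>\<^bsub>V\<^esub> (c - d) \<odot>\<^bsub>V\<^esub> b = t"
   using SV st sm[OF b] by (metis V.M.add.right_cancel V.M.add.m_closed)
  moreover have n: "(-1) \<odot>\<^bsub>V\<^esub> s \<oplus>\<^bsub>V\<^esub> s = zero V"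
   using ld[OF SV[OF st(1)], of "-1" 1] one[OF SV[OF st(1)]] z0[OF SV[OF st(1)]] by simp
  moreover have "(-1) \<odot>\<^bsub>V\<^esub> s \<oplus>\<^bsub>V\<^esub> (s \<oplus>\<^bsub>V\<^esub> (c - d) \<odot>\<^bsub>V\<^esub> b) =
    ((-1) \<odot>\<^bsub>V\<^esub> s \<oplus>\<^bsub>V\<^esub> s) \<oplus>\<^bsub>V\<^esub> (c - d) \<odot>\<^bsub>V\<^esub> b"
   using V.a_assoc[OF sm[OF SV[OF st(1)]] SV[OF st(1)] sm[OF b]] by simp
  ultimately have "(c - d) \<odot>\<^bsub>V\<^esub> b = (-1) \<odot>\<^bsub>V\<^esub> s \<oplus>\<^bsub>V\<^esub> t"
   using V.l_zero[OF sm[OF b, of "c - d"]] by metis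
  then have "(c - d) \<odot>\<^bsub>V\<^esub> b \<in> S" using Sadd[OF Ssm[OF st(1)] st(2)] by simp
  from Ssm[OF this, of "inverse (c - d)"] have "(inverse (c - d) * (c - d)) \<odot>\<^bsub>V\<^esub> b \<in> S"
   using as[OF b] by simp
  then show False using False cd one[OF b] by simp
 qed
 define S' where "S' = {s \<oplus>\<^bsub>V\<^esub> c \<odot>\<^bsub>V\<^esub> b | s c. s \<in> S}"
 define \<psi>' where "\<psi>' x = (THE w. EX s c. s \<in> S & x = s \<oplus>\<^bsub>V\<^esub> c \<odot>\<^bsub>V\<^esub> b & w = \<psi> s)" for x
 have \<psi>': "\<psi>' (s \<oplus>\<^bsub>V\<^esub> c \<odot>\<^bsub>V\<^esub> b) = \<psi> s" if s: "s \<in> S" for s c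
  unfolding \<psi>'_def
 proof (rule the_equality)
  fix w assume "EX t d. t \<in> S & s \<oplus>\<^bsub>V\<^esub> c \<odot>\<^bsub>V\<^esub> b = t \<oplus>\<^bsub>V\<^esub> d \<odot>\<^bsub>V\<^esub> b & w = \<psi> t"
  then obtain t d where t: "t \<in> S" "s \<oplus>\<^bsub>V\<^esub> c \<odot>\<^bsub>V\<^esub> b = t \<oplus>\<^bsub>V\<^esub> d \<odot>\<^bsub>V\<^esub> b" "w = \<psi> t" by blast
  with uniq[OF t(2) s t(1)] have "s = t" using SV s sm[OF b] by (metis V.M.add.right_cancel)
  then show "w = \<psi> s" using t by simp
 qed (use s in blast)
 have add: "(s \<oplus>\<^bsub>V\<^esub> c \<odot>\<^bsub>V\<^esub> b) \<oplus>\<^bsub>V\<^esub> (t \<oplus>\<^bsub>V\<^esub> d \<odot>\<^bsub>V\<^esub> b) = (s \<oplus>\<^bsub>V\<^esub> t) \<oplus>\<^bsub>V\<^esub> (c + d) \<odot>\<^bsub>V\<^esub> b"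
  if "s \<in> S" "t \<in> S" for s t c d
  using SV[OF that(1)] SV[OF that(2)] sm[OF b] by (simp add: ld[OF b] V.a_ac)
 have smul: "e \<odot>\<^bsub>V\<^esub> (s \<oplus>\<^bsub>V\<^esub> c \<odot>\<^bsub>V\<^esub> b) = e \<odot>\<^bsub>V\<^esub> s \<oplus>\<^bsub>V\<^esub> (e * c) \<odot>\<^bsub>V\<^esub> b" if "s \<in> S" for s c e
  using rd[OF SV[OF that] sm[OF b]] as[OF b] by simp
 have inS': "s \<oplus>\<^bsub>V\<^esub> c \<odot>\<^bsub>V\<^esub> b \<in> S'" if "s \<in> S" for s c unfolding S'_def using that by blast
 have SS': "s = s \<oplus>\<^bsub>V\<^esub> 0 \<odot>\<^bsub>V\<^esub> b" if "s \<in> S" for s using z0[OF b] SV[OF that] by simp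
 have bb: "b = zero V \<oplus>\<^bsub>V\<^esub> 1 \<odot>\<^bsub>V\<^esub> b" using one[OF b] b by simp
 have "VectorSpace.subspace class_ring S' V"
  unfolding VectorSpace.subspace_def
 proof (intro conjI V submodule.intro)
  show "module class_ring V" using V by (simp add: vectorspace_def)
  show "S' \<subseteq> carrier V" unfolding S'_def using SV sm[OF b] by auto
  show "zero V \<in> S'" using inS'[OF S0, of 0] SS'[OF S0] by simp
  fix x y assume "x \<in> S'" "y \<in> S'"
  then show "x \<oplus>\<^bsub>V\<^esub> y \<in> S'" using add inS' Sadd unfolding S'_def by force
 next
  fix c x assume "x \<in> S'"
  then show "c \<odot>\<^bsub>V\<^esub> x \<in> S'" using smul inS' Ssm unfolding S'_def by force
 qed
 moreover have "S \<subseteq> S'" using SS' inS' by (metis subsetI)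
 moreover have "b \<in> S'" using bb inS'[OF S0, of 1] by simp
 moreover have "\<forall>x\<in>S'. \<forall>y\<in>S'. \<psi>' (x \<oplus>\<^bsub>V\<^esub> y) = \<psi>' x + \<psi>' y"
  unfolding S'_def by (auto simp: add \<psi>' Sadd \<psi>)
 moreover have "ALL c. \<forall>x\<in>S'. \<psi>' (c \<odot>\<^bsub>V\<^esub> x) = c * \<psi>' x"
  unfolding S'_def by (auto simp: smul \<psi>' Ssm \<psi>)
 moreover have "\<forall>x\<in>S. \<psi>' x = \<psi> x" using \<psi>' SS' by metis
 ultimately show ?thesis by blast
qed

definition functional_on :: "'a set => (complex, 'a) module => ('a => complex) => bool" where
 "functional_on S V \<psi> <=> (\<forall>x\<in>S. \<forall>y\<in>S. \<psi> (x \<oplus>\<^bsub>V\<^esub> y) = \<psi> x + \<psi> y) &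
  (ALL c. \<forall>x\<in>S. \<psi> (c \<odot>\<^bsub>V\<^esub> x) = c * \<psi> x)"

lemma extend_functional:
 assumes V: "vectorspace class_ring V" and fd: "vectorspace.fin_dim class_ring V"
  and W: "VectorSpace.subspace class_ring W V" and f: "functional_on W V f"
 shows "\<exists>\<psi>. functional_on (carrier V) V \<psi> & (\<forall>x\<in>W. \<psi> x = f x)"
proof -
 interpret V: vectorspace class_ring V by fact
 obtain B where B: "finite B" "B \<subseteq> carrier V" "V.span B = carrier V"
  using fd by (auto simp: V.fin_dim_def)
 have "\<exists>S \<psi>. VectorSpace.subspace class_ring S V & W \<subseteq> S & B \<subseteq> S & functional_on S V \<psi> & (\<forall>x\<in>W. \<psi> x = f x)"
  using B(1,2)
 proof (induction rule: finite_induct)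
  case empty
  then show ?case using W f by (intro exI[of _ W] exI[of _ f]) auto
 next
  case (insert b B)
  then have "\<exists>S \<psi>. VectorSpace.subspace class_ring S V & W \<subseteq> S & B \<subseteq> S & functional_on S V \<psi> &
    (\<forall>x\<in>W. \<psi> x = f x)" by simp
  then obtain S \<psi> where S: "VectorSpace.subspace class_ring S V" "W \<subseteq> S" "B \<subseteq> S"
   "functional_on S V \<psi>" "\<forall>x\<in>W. \<psi> x = f x" by (elim exE conjE)
  have bV: "b \<in> carrier V" using insert.prems by simp
  have "\<exists>S' \<psi>'. VectorSpace.subspace class_ring S' V & S \<subseteq> S' & b \<in> S' &
   (\<forall>x\<in>S'. \<forall>y\<in>S'. \<psi>' (x \<oplus>\<^bsub>V\<^esub> y) = \<psi>' x + (\<psi>' y :: complex)) &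
   (ALL c. \<forall>x\<in>S'. \<psi>' (c \<odot>\<^bsub>V\<^esub> x) = c * \<psi>' x) & (\<forall>x\<in>S. \<psi>' x = \<psi> x)"
   by (rule extend_functional_insert[OF V S(1) bV]) (use S(4) in \<open>auto simp: functional_on_def\<close>)
  then obtain S' \<psi>' where S': "VectorSpace.subspace class_ring S' V" "S \<subseteq> S'" "b \<in> S'"
   "\<forall>x\<in>S'. \<forall>y\<in>S'. \<psi>' (x \<oplus>\<^bsub>V\<^esub> y) = \<psi>' x + (\<psi>' y :: complex)"
   "ALL c. \<forall>x\<in>S'. \<psi>' (c \<odot>\<^bsub>V\<^esub> x) = c * \<psi>' x" "\<forall>x\<in>S. \<psi>' x = \<psi> x" by (elim exE conjE)
  show ?case
   by (intro exI[of _ S'] exI[of _ \<psi>'] conjI S') (use S S' in \<open>auto simp: functional_on_def\<close>)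
 qed
 then obtain S \<psi> where S: "VectorSpace.subspace class_ring S V" "B \<subseteq> S" "functional_on S V \<psi>"
  "\<forall>x\<in>W. \<psi> x = f x" by (elim exE conjE)
 have sm: "submodule class_ring S V" using S(1) by (simp add: VectorSpace.subspace_def)
 have "carrier V \<subseteq> S" using V.span_is_subset[OF S(2) sm] B(3) by simp
 then have "S = carrier V" using submodule.subset[OF sm] by simp
 then show ?thesis using S by blast
qed

lemma functional_on_zero:
 assumes "vectorspace class_ring V" "functional_on (carrier V) V \<psi>"
 shows "\<psi> (zero V) = 0"
proof -
 interpret V: vectorspace class_ring V by fact
 have "\<psi> (0 \<odot>\<^bsub>V\<^esub> zero V) = 0 * \<psi> (zero V)"
  using assms(2) V.zero_closed unfolding functional_on_def by blast
 then show ?thesis using V.lmult_0[OF V.zero_closed] by simp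
qed

text \<open>Functionals on \<open>Y\<close> at \<open>v\<close> correspond to homomorphisms into the
  injective at \<open>v\<close>: a vector goes to the functional that lets a path act on it and then
  applies \<open>\<psi>\<close>.\<close>

definition hom_to_inj :: "nat => nat => ('a, nat, toda_arrow) quiver_rep => ('a => complex) => nat => 'a => univ" where
 "hom_to_inj n v Y \<psi> w y = (%k. if k \<in> to_nat ` {p. toda_awalk n w p v}
  then \<psi> (fold (rep_map Y) (from_nat k) y) else 0)"

lemma hom_to_inj_apply [simp]:
 "hom_to_inj n v Y \<psi> w y (to_nat p) = (if toda_awalk n w p v then \<psi> (fold (rep_map Y) p y) else 0)"
 by (auto simp: hom_to_inj_def inj_image_mem_iff)

lemma compatible_compose: "compatible n u F z ==> compatible n u (%p. \<psi> (F p)) (\<psi> z)"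
 unfolding compatible_def by (metis (full_types))

lemma representation_vectorspace:
 "representation (tq n) X ==> v \<in> {1..2*n} ==> vectorspace class_ring (rep_space X v)"
 by (simp add: representation_def)

lemma hom_to_inj_closed:
 assumes Y: "toda_rep n Y" and v: "v \<in> {1..2*n}" and \<psi>: "functional_on (spc Y v) (rep_space Y v) \<psi>"
  and y: "y \<in> spc Y w"
 shows "hom_to_inj n v Y \<psi> w y \<in> inj_space n v w"
proof (rule inj_spaceI)
 show "toda_awalk n w p v" if "hom_to_inj n v Y \<psi> w y (to_nat p) ~= 0" for p
  using that by (auto split: if_splits)
 show "hom_to_inj n v Y \<psi> w y k = 0" if "k \<notin> range (to_nat :: toda_arrow list => nat)" for k
  using that by (auto simp: hom_to_inj_def)
 have R: "representation (tq n) Y" using Y by (simp add: toda_rep_def)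
 have z: "\<psi> (zero (rep_space Y v)) = 0"
  by (rule functional_on_zero[OF representation_vectorspace[OF R v] \<psi>])
 have "(%p. hom_to_inj n v Y \<psi> w y (to_nat p)) =
   (%p. \<psi> (if toda_awalk n w p v then fold (rep_map Y) p y else zero (rep_space Y v)))"
  using z by auto
 then show "compatible n w (%p. hom_to_inj n v Y \<psi> w y (to_nat p)) 0"
  using compatible_compose[OF toda_rep_compatible[OF Y y v], of \<psi>] z by simp
qed

lemma hom_to_inj_hom:
 assumes Y: "toda_rep n Y" and v: "v \<in> {1..2*n}" and \<psi>: "functional_on (spc Y v) (rep_space Y v) \<psi>"
 shows "hom_to_inj n v Y \<psi> \<in> rep_hom (tq n) Y (inj_rep n v)"
 unfolding rep_hom_def
proof (intro CollectI conjI ballI)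
 have R: "representation (tq n) Y" using Y by (simp add: toda_rep_def)
 note cl = hom_to_inj_closed[OF Y v \<psi>]
 fix w assume w: "w \<in> verts (tq n)"
 interpret W: vectorspace class_ring "rep_space Y w" using R w by (auto simp: representation_def)
 have lin: "\<psi> (fold (rep_map Y) p (x \<oplus>\<^bsub>rep_space Y w\<^esub> y)) = \<psi> (fold (rep_map Y) p x) + \<psi> (fold (rep_map Y) p y)"
  "\<psi> (fold (rep_map Y) p (c \<odot>\<^bsub>rep_space Y w\<^esub> x)) = c * \<psi> (fold (rep_map Y) p x)"
  if "x \<in> spc Y w" "y \<in> spc Y w" "toda_awalk n w p v" for x y c p
 proof -
  note h = fold_rep_map[OF R that(3)]
  have "fold (rep_map Y) p x \<in> spc Y v" "fold (rep_map Y) p y \<in> spc Y v"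
   using fold_rep_map_closed[OF R that(3)] that by blast+
  then show "\<psi> (fold (rep_map Y) p (x \<oplus>\<^bsub>rep_space Y w\<^esub> y)) = \<psi> (fold (rep_map Y) p x) + \<psi> (fold (rep_map Y) p y)"
   "\<psi> (fold (rep_map Y) p (c \<odot>\<^bsub>rep_space Y w\<^esub> x)) = c * \<psi> (fold (rep_map Y) p x)"
   using module_hom_add[OF h that(1,2)] module_hom_smult[OF h, of c x] that(1) \<psi>
   by (simp_all add: functional_on_def)
 qed
 show "hom_to_inj n v Y \<psi> w \<in> module_hom class_ring (rep_space Y w) (rep_space (inj_rep n v) w)"
  unfolding module_hom_def
 proof (intro CollectI conjI allI impI)
  show "hom_to_inj n v Y \<psi> w \<in> spc Y w \<rightarrow> spc (inj_rep n v) w"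
   using cl by simp
  fix x y assume "x \<in> spc Y w & y \<in> spc Y w"
  then have xy: "x \<in> spc Y w" "y \<in> spc Y w" by auto
  have "hom_to_inj n v Y \<psi> w (x \<oplus>\<^bsub>rep_space Y w\<^esub> y) =
    (%k. hom_to_inj n v Y \<psi> w x k + hom_to_inj n v Y \<psi> w y k)"
   by (rule inj_space_eqI[of _ n v w _ v w])
    (use xy lin(1) in \<open>auto intro!: cl lin_closedD(2)[OF lin_closed_inj_space]\<close>)
  then show "hom_to_inj n v Y \<psi> w (x \<oplus>\<^bsub>rep_space Y w\<^esub> y) =
    hom_to_inj n v Y \<psi> w x \<oplus>\<^bsub>rep_space (inj_rep n v) w\<^esub> hom_to_inj n v Y \<psi> w y" by simp
 next
  fix c :: complex and x assume "c \<in> carrier class_ring & x \<in> spc Y w"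
  then have x: "x \<in> spc Y w" by auto
  have "c \<odot>\<^bsub>rep_space Y w\<^esub> x \<in> spc Y w" using W.smult_closed[of c x] x by simp
  then have "hom_to_inj n v Y \<psi> w (c \<odot>\<^bsub>rep_space Y w\<^esub> x) = (%k. c * hom_to_inj n v Y \<psi> w x k)"
   by (intro inj_space_eqI[of _ n v w _ v w])
    (use x lin(2)[OF x x] in \<open>auto intro!: cl lin_closedD(3)[OF lin_closed_inj_space]\<close>)
  then show "hom_to_inj n v Y \<psi> w (c \<odot>\<^bsub>rep_space Y w\<^esub> x) =
    c \<odot>\<^bsub>rep_space (inj_rep n v) w\<^esub> hom_to_inj n v Y \<psi> w x" by simp
 qed
next
 note cl = hom_to_inj_closed[OF Y v \<psi>]
 fix al y assume al: "al \<in> arcs (tq n)" and y: "y \<in> carrier (rep_space Y (tail (tq n) al))"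
 have "rep_map Y al y \<in> spc Y (toda_head al)"
  using Y al y unfolding toda_rep_def representation_def module_hom_def by auto
 from cl[OF this] inj_rep_map_closed[OF al cl[OF y, simplified]]
 show "hom_to_inj n v Y \<psi> (head (tq n) al) (rep_map Y al y) =
   rep_map (inj_rep n v) al (hom_to_inj n v Y \<psi> (tail (tq n) al) y)"
  by (intro inj_space_eqI[of _ n v "toda_head al" _ v "toda_head al"])
   (use al in \<open>auto simp: toda_awalk_simps\<close>)
qed

lemma rep_hom_fold:
 assumes "representation (tq n) X" "f \<in> rep_hom (tq n) X Y" "toda_awalk n u p v" "x \<in> spc X u"
 shows "f v (fold (rep_map X) p x) = fold (rep_map Y) p (f u x)"
 using assms(3,4)
proof (induction p arbitrary: u x)
 case (Cons al p)
 then have a: "al \<in> arcs (tq n)" "u = toda_tail al" "toda_awalk n (toda_head al) p v"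
  by (auto simp: toda_awalk_simps)
 have "rep_map X al x \<in> spc X (toda_head al)"
  using assms(1) a Cons.prems(2) unfolding representation_def module_hom_def by auto
 moreover have "f (toda_head al) (rep_map X al x) = rep_map Y al (f u x)"
  using assms(2) a Cons.prems(2) unfolding rep_hom_def by auto
 ultimately show ?case using Cons.IH[OF a(3)] by simp
qed (auto simp: toda_awalk_simps)

text \<open>A homomorphism into \<open>inj_rep n v\<close> is determined by its values at the
  trivial path, a functional on \<open>X\<close> at \<open>v\<close>. Transported along the
  injection and extended to \<open>Y\<close>, this functional yields the extension of
  \<open>g\<close>.\<close>

lemma injective_inj_rep:
 assumes v: "v \<in> {1..2 * n}"
 shows "injective_module (tq n) (tp n) (inj_rep n v)"
 unfolding injective_module_def
proof (intro conjI jacobian_module_inj_rep allI impI ballI)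
 fix X Y :: "(univ, nat, toda_arrow) quiver_rep" and f g
 assume XY: "jacobian_module (tq n) (tp n) X & jacobian_module (tq n) (tp n) Y"
  and f: "f \<in> rep_mono (tq n) X Y" and g: "g \<in> rep_hom (tq n) X (inj_rep n v)"
 have X: "toda_rep n X" and Y: "toda_rep n Y" and fd: "vectorspace.fin_dim class_ring (rep_space Y v)"
  using XY v by (auto simp: jacobian_module_iff)
 have RX: "representation (tq n) X" and RY: "representation (tq n) Y"
  using X Y by (auto simp: toda_rep_def)
 note VX = representation_vectorspace[OF RX v] and VY = representation_vectorspace[OF RY v]
 have fh: "f \<in> rep_hom (tq n) X Y" using f by (simp add: rep_mono_def)
 have inj: "inj_on (f v) (spc X v)" using f v by (simp add: rep_mono_def)
 have fv: "f v \<in> module_hom class_ring (rep_space X v) (rep_space Y v)"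
  and gv: "g v \<in> module_hom class_ring (rep_space X v) (rep_space (inj_rep n v) v)"
  using fh g v by (auto simp: rep_hom_def)
 interpret VX: vectorspace class_ring "rep_space X v" by fact
 interpret L: linear_map class_ring "rep_space X v" "rep_space Y v" "f v"
  using VX VY fv by (simp add: linear_map_def mod_hom_def mod_hom_axioms_def vectorspace.axioms)
 let ?W = "f v ` spc X v"
 let ?e = "to_nat ([] :: toda_arrow list)"
 let ?inv = "inv_into (spc X v) (f v)"
 have W: "VectorSpace.subspace class_ring ?W (rep_space Y v)"
  using L.imT_is_subspace by (simp add: L.im_def)
 \<comment> \<open>The functional to be extended: undo the injection, apply \<open>g\<close> and
   evaluate at the trivial path.\<close>
 have fl: "functional_on ?W (rep_space Y v) (%y. g v (?inv y) ?e)"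
  unfolding functional_on_def
 proof (intro conjI ballI allI)
  fix x y assume "x \<in> ?W" "y \<in> ?W"
  then obtain x' y' where xy: "x' \<in> spc X v" "y' \<in> spc X v"
   "x = f v x'" "y = f v y'" by blast
  have "?inv (x \<oplus>\<^bsub>rep_space Y v\<^esub> y) = x' \<oplus>\<^bsub>rep_space X v\<^esub> y'"
   using xy inj VX.a_closed[OF xy(1,2)] module_hom_add[OF fv xy(1,2)] by (metis inv_into_f_f)
  then show "g v (?inv (x \<oplus>\<^bsub>rep_space Y v\<^esub> y)) ?e = g v (?inv x) ?e + g v (?inv y) ?e"
   using xy inj module_hom_add[OF gv xy(1,2)] by simp
 next
  fix c x assume "x \<in> ?W"
  then obtain x' where x: "x' \<in> spc X v" "x = f v x'" by blast
  have "c \<odot>\<^bsub>rep_space X v\<^esub> x' \<in> spc X v" using VX.smult_closed[of c x'] x by simp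
  then have "?inv (c \<odot>\<^bsub>rep_space Y v\<^esub> x) = c \<odot>\<^bsub>rep_space X v\<^esub> x'"
   using x inj module_hom_smult[OF fv _ x(1), of c] inv_into_f_f[OF inj] by (metis UNIV_I partial_object.select_convs(1))
  then show "g v (?inv (c \<odot>\<^bsub>rep_space Y v\<^esub> x)) ?e = c * g v (?inv x) ?e"
   using x inj module_hom_smult[OF gv _ x(1), of c] by simp
 qed
 obtain \<psi> where \<psi>: "functional_on (spc Y v) (rep_space Y v) \<psi>"
  "\<forall>y\<in>?W. \<psi> y = g v (?inv y) ?e"
  using extend_functional[OF VY fd W fl] by blast
 let ?h = "hom_to_inj n v Y \<psi>"
 have "?h w (f w x) = g w x" if w: "w \<in> {1..2*n}" and x: "x \<in> spc X w" for w x
 proof -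
  have fx: "f w x \<in> spc Y w" and gx: "g w x \<in> inj_space n v w"
   using fh g w x by (auto simp: rep_hom_def module_hom_def)
  show ?thesis
  proof (rule inj_space_eqI[OF hom_to_inj_closed[OF Y v \<psi>(1) fx] gx])
   fix p :: "toda_arrow list"
   show "?h w (f w x) (to_nat p) = g w x (to_nat p)"
   proof (cases "toda_awalk n w p v")
    case True
    let ?x = "fold (rep_map X) p x"
    have xc: "?x \<in> spc X v" by (rule fold_rep_map_closed[OF RX True x])
    have "?h w (f w x) (to_nat p) = \<psi> (f v ?x)"
     using True rep_hom_fold[OF RX fh True x] by simp
    also have "... = g v ?x ?e" using \<psi>(2) xc inj by simp
    also have "... = g w x (to_nat p)"
     using rep_hom_fold[OF RX g True x] by (simp add: fold_inj_rep_map)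
    finally show ?thesis .
   next
    case False
    then show ?thesis using inj_spaceD(1)[OF gx, of p] by auto
   qed
  qed
 qed
 then show "\<exists>h\<in>rep_hom (tq n) Y (inj_rep n v).
   \<forall>w\<in>verts (tq n). \<forall>x\<in>spc X w. h w (f w x) = g w x"
  using hom_to_inj_hom[OF Y v \<psi>(1)] by (intro bexI[of _ ?h]) auto
qed

lemma inj_rep_map_socle:
 assumes "al \<in> arcs (tq n)" "v \<in> {1..2*n}" "toda_tail al = v"
 shows "rep_map (inj_rep n v) al inj_socle = (%_. 0)"
proof (rule inj_space_eqI)
 show "rep_map (inj_rep n v) al inj_socle \<in> inj_space n v (toda_head al)"
  by (rule inj_rep_map_closed[OF assms(1)]) (use inj_socle_in assms in auto)
 show "(%_. 0) \<in> inj_space n v v" by (rule lin_closedD(1)[OF lin_closed_inj_space])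
qed simp

text \<open>The image of the simple module is spanned by \<open>inj_socle\<close>, which every
  nonzero subrepresentation contains; hence it is essential.\<close>

lemma injective_envelope_inj_rep:
 assumes v: "v \<in> {1..2 * n}"
 shows "is_injective_envelope (tq n) (tp n) (simple_rep v) (inj_rep n v)"
proof -
 let ?S = "simple_rep v :: (complex, nat, toda_arrow) quiver_rep"
 let ?f = "%w (c :: complex) k. c * inj_socle k"
 have z: "(%_. 0) \<in> inj_space n v w" for w by (rule lin_closedD(1)[OF lin_closed_inj_space])
 have sc: "(%k. c * inj_socle k) \<in> inj_space n v v" for c
  by (rule lin_closedD(3)[OF lin_closed_inj_space inj_socle_in[OF v]])
 have hom: "?f \<in> rep_hom (tq n) ?S (inj_rep n v)"
  unfolding rep_hom_def
 proof (intro CollectI conjI ballI)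
  fix w
  show "?f w \<in> module_hom class_ring (rep_space ?S w) (rep_space (inj_rep n v) w)"
   using sc z by (auto simp: module_hom_def simple_rep_def algebra_simps)
 next
  fix al x assume al: "al \<in> arcs (tq n)"
   and x: "x \<in> carrier (rep_space ?S (tail (tq n) al))"
  show "?f (head (tq n) al) (rep_map ?S al x) =
    rep_map (inj_rep n v) al (?f (tail (tq n) al) x)"
  proof (cases "toda_tail al = v")
   case True
   then show ?thesis using inj_rep_map_socle[OF al v True]
    by (simp add: inj_rep_map_add(2) simple_rep_def)
  next
   case False
   then have "x = 0" using x by (simp add: simple_rep_def)
   then show ?thesis using inj_rep_map_add(2)[of n v al 0 inj_socle] by (simp add: simple_rep_def)
  qed
 qed
 have ne: "inj_socle (to_nat ([] :: toda_arrow list)) ~= 0" by simp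
 have mono: "?f \<in> rep_mono (tq n) ?S (inj_rep n v)"
  using hom ne unfolding rep_mono_def inj_on_def
  by (auto simp: fun_eq_iff simple_rep_def dest: spec[of _ "to_nat ([] :: toda_arrow list)"])
 have im: "rep_image ?S ?f w = (if w = v then range (%c k. c * inj_socle k) else {%_. 0})" for w
  by (auto simp: rep_image_def simple_rep_def)
 have "essential_subrep (tq n) (inj_rep n v) (rep_image ?S ?f)"
  unfolding essential_subrep_def
 proof (intro conjI allI impI)
  have "lin_closed (rep_image ?S ?f w)" for w
  proof (cases "w = v")
   case True
   have "(%k. c * inj_socle k + d * inj_socle k) = (%k. (c + d) * inj_socle k)"
    "(%k. c * (d * inj_socle k)) = (%k. (c * d) * inj_socle k)" for c d
    by (simp_all add: algebra_simps)
   moreover have "(%_. 0) \<in> range (%c k. c * inj_socle k)" by (rule image_eqI[of _ _ 0]) simp_all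
   ultimately show ?thesis unfolding im lin_closed_def using True by (auto intro: rangeI)
  qed (simp add: im lin_closed_def)
  moreover have "rep_image ?S ?f w \<subseteq> inj_space n v w" for w
   unfolding im using sc z by auto
  moreover have "rep_map (inj_rep n v) al ` rep_image ?S ?f (toda_tail al) \<subseteq>
    rep_image ?S ?f (toda_head al)" if "al \<in> arcs (tq n)" for al
  proof clarify
   fix y assume "y \<in> rep_image ?S ?f (toda_tail al)"
   then have "\<exists>x\<in>spc ?S (toda_tail al). y = ?f (toda_tail al) x"
    unfolding rep_image_def image_iff .
   then obtain x where x: "x \<in> spc ?S (toda_tail al)" "y = ?f (toda_tail al) x"
    by (rule bexE)
   have "?f (toda_head al) (rep_map ?S al x) = rep_map (inj_rep n v) al (?f (toda_tail al) x)"
    using hom that x(1) unfolding rep_hom_def by simp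
   then show "rep_map (inj_rep n v) al y \<in> rep_image ?S ?f (toda_head al)"
    unfolding rep_image_def using x(2) by (auto simp: simple_rep_def intro!: image_eqI[of _ _ 0])
  qed
  ultimately show "subrep (tq n) (inj_rep n v) (rep_image ?S ?f)"
   unfolding subrep_def toda_quiver_simps inj_rep_space subspace_fun_space_iff[OF lin_closed_inj_space]
   by blast
 next
  fix V assume V: "subrep (tq n) (inj_rep n v) V &
    (\<exists>w\<in>verts (tq n). V w ~= {\<zero>\<^bsub>rep_space (inj_rep n v) w\<^esub>})"
  then have "\<exists>w\<in>{1..2*n}. V w ~= {%_. 0}" by simp
  then obtain w where w: "w \<in> {1..2*n}" "V w ~= {%_. 0}" by (rule bexE)
  have "VectorSpace.subspace class_ring (V w) (rep_space (inj_rep n v) w)"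
   using V w by (simp add: subrep_def)
  then have "(%_. 0) \<in> V w"
   by (simp add: subspace_fun_space_iff[OF lin_closed_inj_space] lin_closed_def)
  then obtain \<phi> where "\<phi> \<in> V w" "\<phi> ~= (%_. 0)" using w(2) by blast
  then have "inj_socle \<in> V v" using inj_rep_subrep_socle[of n v V w \<phi>] V w(1) by blast
  moreover have "inj_socle \<in> rep_image ?S ?f v"
   unfolding im by (auto intro: image_eqI[of _ _ 1])
  moreover have "inj_socle ~= (%_. 0)" using ne by metis
  ultimately have "rep_image ?S ?f v \<inter> V v ~= {\<zero>\<^bsub>rep_space (inj_rep n v) v\<^esub>}" by auto
  then show "\<exists>w\<in>verts (tq n). rep_image ?S ?f w \<inter> V w ~= {\<zero>\<^bsub>rep_space (inj_rep n v) w\<^esub>}"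
   using v by auto
 qed
 then show ?thesis unfolding is_injective_envelope_def
  using injective_inj_rep[OF v] mono by blast
qed

section \<open>Socles and essential extensions\<close>

text \<open>Some path moves \<open>x\<close> to an element with \<open>P\<close> that no further arrow keeps in \<open>P\<close>, since long paths act as zero.\<close>

lemma toda_rep_last:
 assumes X: "toda_rep n X" and x: "x \<in> spc X w" and w: "w \<in> {1..2*n}"
  and P: "P w x" "!!v. v \<in> {1..2*n} ==> ~ P v (zero (rep_space X v))"
 obtains p v where "toda_awalk n w p v" "P v (fold (rep_map X) p x)"
  "!!al. al \<in> arcs (tq n) ==> toda_tail al = v ==>
   ~ P (toda_head al) (rep_map X al (fold (rep_map X) p x))"
proof -
 let ?Q = "%p. EX v. toda_awalk n w p v & P v (fold (rep_map X) p x)"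
 have "?Q []" using w P(1) by (auto simp: toda_awalk_simps)
 moreover have "length p < 2 * n" if Qp: "?Q p" for p
 proof (rule ccontr)
  assume "~ length p < 2 * n"
  moreover obtain v where v: "toda_awalk n w p v" "P v (fold (rep_map X) p x)" using Qp by blast
  ultimately have "fold (rep_map X) p x = zero (rep_space X v)" using toda_rep_long[OF X x v(1)] by simp
  then show False using v P(2) toda_awalk_verts(2)[OF v(1)] by simp
 qed
 ultimately obtain p where p: "?Q p" "!!q. ?Q q ==> length q \<le> length p"
  using ex_has_greatest_nat[of ?Q "[]" length "2 * n"] by (metis less_imp_le)
 then obtain v where v: "toda_awalk n w p v" "P v (fold (rep_map X) p x)" by blast
 have "~ P (toda_head al) (rep_map X al (fold (rep_map X) p x))"
  if "al \<in> arcs (tq n)" "toda_tail al = v" for al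
 proof
  assume "P (toda_head al) (rep_map X al (fold (rep_map X) p x))"
  moreover have "toda_awalk n w (p @ [al]) (toda_head al)"
   using v(1) that wf_digraph.head_in_verts[OF wf_digraph_toda_quiver that(1)]
   by (auto simp: toda_awalk_append_iff toda_awalk_simps)
  ultimately have "?Q (p @ [al])" by auto
  then show False using p(2)[of "p @ [al]"] by simp
 qed
 with v show thesis by (rule that)
qed

text \<open>A nonzero vector killed by all arrows spans a subrepresentation concentrated at
  \<open>v\<close>. An essential one must meet it in a nonzero multiple of the vector.\<close>

lemma socle_in_essential:
 assumes X: "representation (tq n) X" and U: "essential_subrep (tq n) X U"
  and v: "v \<in> {1..2*n}" and x: "x \<in> spc X v"
  and k: "!!al. al \<in> arcs (tq n) ==> toda_tail al = v ==> rep_map X al x = zero (rep_space X (toda_head al))"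
 shows "x \<in> U v"
proof -
 note VS = representation_vectorspace[OF X]
 interpret V: vectorspace class_ring "rep_space X v" by (rule VS[OF v])
 have Usub: "VectorSpace.subspace class_ring (U w) (rep_space X w)" if "w \<in> {1..2*n}" for w
  using U that by (auto simp: essential_subrep_def subrep_def)
 have U0: "zero (rep_space X w) \<in> U w" if "w \<in> {1..2*n}" for w
  using Usub[OF that] by (auto simp: VectorSpace.subspace_def submodule.zero_closed)
 show ?thesis
 proof (cases "x = zero (rep_space X v)")
  case True
  then show ?thesis using U0[OF v] by simp
 next
  case False
  define C where "C w = (if w = v then range (%c. c \<odot>\<^bsub>rep_space X v\<^esub> x) else {zero (rep_space X w)})" for w
  have "subrep (tq n) X C"
   unfolding subrep_def
  proof (intro conjI ballI)
   fix w assume w: "w \<in> verts (tq n)"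
   interpret W: vectorspace class_ring "rep_space X w" using VS w by simp
   have "submodule class_ring (C w) (rep_space X w)"
   proof (cases "w = v")
    case True
    have "c \<odot>\<^bsub>rep_space X v\<^esub> x \<oplus>\<^bsub>rep_space X v\<^esub> d \<odot>\<^bsub>rep_space X v\<^esub> x = (c + d) \<odot>\<^bsub>rep_space X v\<^esub> x"
     "c \<odot>\<^bsub>rep_space X v\<^esub> (d \<odot>\<^bsub>rep_space X v\<^esub> x) = (c * d) \<odot>\<^bsub>rep_space X v\<^esub> x"
     "c \<odot>\<^bsub>rep_space X v\<^esub> x \<in> spc X v" for c d
     using V.smult_l_distr[of c d x] V.smult_assoc1[of c d x] V.smult_closed[of c x] x
     by (simp_all add: class_ring_simps)
    moreover have "zero (rep_space X v) = 0 \<odot>\<^bsub>rep_space X v\<^esub> x" using V.lmult_0[OF x] by simp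
    ultimately show ?thesis unfolding C_def submodule_def
     using True W.module.module_axioms by (auto intro: rangeI)
   next
    case False
    then show ?thesis unfolding C_def submodule_def
     using W.module.module_axioms W.rmult_0 by auto
   qed
   then show "VectorSpace.subspace class_ring (C w) (rep_space X w)"
    using VS w by (simp add: VectorSpace.subspace_def)
  next
   fix al assume al: "al \<in> arcs (tq n)"
   have t: "toda_tail al \<in> {1..2*n}" "toda_head al \<in> {1..2*n}"
    using wf_digraph.head_in_verts[OF wf_digraph_toda_quiver al]
     wf_digraph.tail_in_verts[OF wf_digraph_toda_quiver al] by simp_all
   have h: "rep_map X al \<in> module_hom class_ring (rep_space X (toda_tail al)) (rep_space X (toda_head al))"
    using X al by (simp add: representation_def)
   interpret H: vectorspace class_ring "rep_space X (toda_head al)" using VS t by simp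
   have H0: "zero (rep_space X (toda_head al)) \<in> C (toda_head al)"
    using V.lmult_0[OF x] by (auto simp: C_def intro: image_eqI[of _ _ 0])
   have "rep_map X al y = zero (rep_space X (toda_head al))" if "y \<in> C (toda_tail al)" for y
   proof (cases "toda_tail al = v")
    case True
    then obtain c where "y = c \<odot>\<^bsub>rep_space X v\<^esub> x" using \<open>y \<in> C (toda_tail al)\<close> by (auto simp: C_def)
    then show ?thesis using module_hom_smult[OF h, of c x] True x k[OF al True] H.rmult_0[of c] by simp
   next
    case False
    then have "y = zero (rep_space X (toda_tail al))" using \<open>y \<in> C (toda_tail al)\<close> by (simp add: C_def)
    then show ?thesis using module_hom_zero[OF VS[OF t(1)] VS[OF t(2)] h] by simp
   qed
   then show "rep_map X al ` C (tail (tq n) al) \<subseteq> C (head (tq n) al)"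
    using H0 by auto
  qed
  moreover have "x \<in> C v" using V.smult_one[OF x] by (auto simp: C_def intro: image_eqI[of _ _ 1])
  then have "C v ~= {zero (rep_space X v)}" using False by blast
  ultimately obtain w where w: "w \<in> {1..2*n}" "U w \<inter> C w ~= {zero (rep_space X w)}"
   using U v unfolding essential_subrep_def by (metis toda_quiver_simps(1))
  have "zero (rep_space X w) \<in> C w" using V.lmult_0[OF x] by (auto simp: C_def intro: image_eqI[of _ _ 0])
  then obtain y where y: "y \<in> U w" "y \<in> C w" "y ~= zero (rep_space X w)" using w U0[OF w(1)] by blast
  then have wv: "w = v" by (auto simp: C_def split: if_splits)
  then obtain c where c: "y = c \<odot>\<^bsub>rep_space X v\<^esub> x" using y by (auto simp: C_def)
  have c0: "c ~= 0" using y(3) c wv V.lmult_0[OF x] by auto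
  have "submodule class_ring (U v) (rep_space X v)" using Usub[OF v] by (simp add: VectorSpace.subspace_def)
  from submodule.smult_closed[OF this, of "inverse c" y] have "inverse c \<odot>\<^bsub>rep_space X v\<^esub> y \<in> U v"
   using y wv by simp
  moreover have "inverse c \<odot>\<^bsub>rep_space X v\<^esub> y = x"
   using V.smult_assoc1[of "inverse c" c x] V.smult_one[OF x] c c0 x by (simp add: class_ring_simps)
  ultimately show ?thesis by simp
 qed
qed

lemma model_map_letter: "model_map n i l1 l2 (letter y j) \<phi> = (%p. (if y then - l1 else l2) * \<phi> p)"
 by (simp add: letter_def)

lemma model_map_step:
 "model_map n i l1 l2 (step True j) \<phi> = (%p. if lo n i (j + 1) < p then \<phi> p else 0)"
 "model_map n i l1 l2 (step False j) \<phi> = (%p. if lo n i (j - 1) < p then \<phi> (p + 1) else 0)"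
 by (simp_all add: step_def)

lemma arc_from_even:
 assumes "al \<in> arcs (tq n)" "toda_tail al = 2 * j"
 obtains d where "al = step d j" "1 \<le> j" "j \<le> n" "can_step n d j" "toda_head al = 2 * next_level d j - 1"
proof -
 have "toda_awalk n (2 * j) [al] (toda_head al)"
  using assms wf_digraph.head_in_verts[OF wf_digraph_toda_quiver assms(1)] by (simp add: toda_awalk_simps)
 then obtain d where d: "al = step d j" "1 \<le> j" "j \<le> n" "can_step n d j" by (rule awalk_even_ConsE)
 then show thesis using that[of d] by (simp add: toda_head_step)
qed

lemma arc_from_odd:
 assumes "al \<in> arcs (tq n)" "toda_tail al = 2 * j - 1" "1 \<le> j"
 obtains y where "al = letter y j" "j \<le> n"
proof -
 have "toda_awalk n (2 * j - 1) [al] (toda_head al)"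
  using assms wf_digraph.head_in_verts[OF wf_digraph_toda_quiver assms(1)] by (simp add: toda_awalk_simps)
 then obtain y where "al = letter y j" "j \<le> n" using assms(3) by (rule awalk_odd_ConsE)
 then show thesis by (rule that)
qed

text \<open>A position is killed by a step up only if it is the lowest and \<open>lo\<close> grows
  from \<open>j\<close> to \<open>j + 1\<close>, and by a step down only if \<open>lo\<close> does
  not grow from \<open>j - 1\<close> to \<open>j\<close>. Both together single out the kink
  \<open>i + j = n + 1\<close>, where \<open>lo\<close> is still 0.\<close>

lemma strip_socle:
 assumes s: "s \<in> strip n i j" and j: "1 \<le> j" "j \<le> n" and i: "i \<le> n"
  and k: "!!d. can_step n d j ==> model_map n i l1 l2 (step d j) s = (%_. 0)" and p: "s p ~= 0"
 shows "i + j = n + 1 & p = 1"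
proof -
 have b: "lo n i j < p" "p \<le> i" "p \<le> j" using stripD[OF s p] by auto
 have "n + 1 \<le> i + j & p = lo n i j + 1"
 proof (cases "j < n")
  case True
  have "model_map n i l1 l2 (step True j) s p = 0" using k[of True] True by (simp add: can_step_def)
  then have "p \<le> lo n i (j + 1)" using p by (simp add: model_map_step split: if_splits)
  then show ?thesis using b by (auto simp: lo_def)
 next
  case False
  then show ?thesis using b j by (auto simp: lo_def)
 qed
 moreover have "i + j \<le> n + 1"
 proof (cases "1 < j")
  case True
  have "model_map n i l1 l2 (step False j) s (p - 1) = 0" using k[of False] True by (simp add: can_step_def)
  then have "p - 1 \<le> lo n i (j - 1)" using p b by (simp add: model_map_step split: if_splits)
  then show ?thesis using b True by (auto simp: lo_def)
 next
  case False
  then show ?thesis using j i by auto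
 qed
 ultimately show ?thesis by (auto simp: lo_def)
qed

text \<open>
 The two prescribed images under \<open>r\<close> and \<open>\<ell>\<close> agree wherever both determine a value of the
 common preimage.
\<close>

lemma strip_glue:
 assumes r: "r \<in> strip n i (j + 1)" and l: "l \<in> strip n i (j - 1)" and j: "1 \<le> j" "j \<le> n" and i: "i \<le> n"
  and eq: "!!p. lo n i j < p ==> r (p + 1) = l p"
 obtains m where "m \<in> strip n i j" "model_map n i l1 l2 (step True j) m = r"
  "model_map n i l1 l2 (step False j) m = l"
proof -
 define m where "m p = (if lo n i (j + 1) < p then r p else if lo n i j < p then l (p - 1) else 0)" for p
 have "m \<in> strip n i j"
 proof (rule stripI)
  fix p assume p: "m p ~= 0"
  show "lo n i j < p & p \<le> i & p \<le> j"
  proof (cases "lo n i (j + 1) < p")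
   case True
   then have rp: "r p ~= 0" using p by (simp add: m_def)
   have b: "p \<le> i" "p \<le> j + 1" using stripD[OF r rp] by auto
   have "p ~= j + 1"
   proof
    assume pj: "p = j + 1"
    have "lo n i j < j" using i j by (auto simp: lo_def)
    then have "l j ~= 0" using eq[of j] rp pj by simp
    then show False using stripD[OF l, of j] j by auto
   qed
   then show ?thesis using b True by (auto simp: lo_def)
  next
   case False
   then have "l (p - 1) ~= 0" "lo n i j < p" using p by (auto simp: m_def split: if_splits)
   then show ?thesis using stripD[OF l, of "p - 1"] False j by (auto simp: lo_def)
  qed
 qed
 moreover have "model_map n i l1 l2 (step True j) m = r"
 proof
  fix p show "model_map n i l1 l2 (step True j) m p = r p"
   using stripD[OF r, of p] by (cases "r p = 0") (auto simp: model_map_step m_def)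
 qed
 moreover have "model_map n i l1 l2 (step False j) m = l"
 proof
  fix p show "model_map n i l1 l2 (step False j) m p = l p"
  proof (cases "lo n i (j - 1) < p")
   case True
   have "lo n i j < p" if "lo n i (j + 1) < p + 1" using that True by (auto simp: lo_def)
   moreover have "lo n i j < p + 1" using True by (auto simp: lo_def)
   ultimately show ?thesis using True eq[of p] by (auto simp: model_map_step m_def)
  next
   case False
   then show ?thesis using stripD[OF l, of p] by (cases "l p = 0") (auto simp: model_map_step)
  qed
 qed
 ultimately show thesis by (rule that)
qed

section \<open>Extensions of the model by one vector\<close>

locale toda_data =
 fixes n i :: nat and l1 l2 :: complex
 assumes n: "1 \<le> n" and i: "1 \<le> i" "i \<le> n" and l: "(l1, l2) ~= (0, 0)"
begin

abbreviation "M \<equiv> model n i l1 l2"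
abbreviation "mu \<equiv> model_map n i l1 l2"
text \<open>The level of the socle of the model, found in \<open>strip_socle\<close>. Its strip
  starts at position 1, which carries the socle vector \<open>sfun\<close>.\<close>

abbreviation "top_level \<equiv> n + 1 - i"
abbreviation "sfun \<equiv> (unit_fun 1 :: univ)"

lemma top_level: "1 \<le> top_level" "top_level \<le> n" "2 * top_level \<in> {1..2*n}" "2 * top_level - 1 \<in> {1..2*n}"
 using i n by auto

lemma sfun_in: "sfun \<in> strip n i top_level"
 using i by (auto intro!: stripI simp: unit_fun_def lo_def split: if_splits)

lemma mu_sfun:
 assumes "al \<in> arcs (tq n)" "toda_tail al = 2 * top_level"
 shows "mu al sfun = (%_. 0)"
proof -
 obtain d where d: "al = step d top_level" using arc_from_even[OF assms] by blast
 show ?thesis unfolding d using i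
  by (cases d) (auto simp: model_map_step unit_fun_def lo_def fun_eq_iff)
qed

text \<open>In homological terms, the first extension group of the simple module at \<open>v\<close>
  by the model vanishes except at \<open>2 * top_level - 1\<close>, where it is at most
  one-dimensional with coordinate \<open>\<kappa>\<close>. The images of \<open>x\<close> are given
  arrow by arrow, and the relations in \<open>X\<close> decide whether they come from one vector of
  the model.\<close>

lemma lift_extension:
 assumes X: "toda_rep n X" and f: "f \<in> rep_mono (tq n) M X"
  and v: "v \<in> {1..2*n}" and x: "x \<in> spc X v"
  and arr: "!!al. al \<in> arcs (tq n) ==> toda_tail al = v ==>
   \<exists>m\<in>strip n i (level (toda_head al)). rep_map X al x = f (toda_head al) m"
 shows "v ~= 2 * top_level - 1 ==> \<exists>m\<in>strip n i (level v). \<forall>al\<in>arcs (tq n). toda_tail al = v -->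
   rep_map X al x = f (toda_head al) (mu al m)"
  and "v = 2 * top_level - 1 ==> \<exists>\<kappa>.
   l1 \<odot>\<^bsub>rep_space X (2 * top_level)\<^esub> rep_map X (letter False top_level) x
    \<oplus>\<^bsub>rep_space X (2 * top_level)\<^esub> l2 \<odot>\<^bsub>rep_space X (2 * top_level)\<^esub> rep_map X (letter True top_level) x
    = f (2 * top_level) (%k. \<kappa> * sfun k) &
   (\<kappa> = 0 --> (\<exists>m\<in>strip n i (level v). \<forall>al\<in>arcs (tq n). toda_tail al = v -->
    rep_map X al x = f (toda_head al) (mu al m)))"
proof -
 let ?P = "\<exists>m\<in>strip n i (level v). \<forall>al\<in>arcs (tq n). toda_tail al = v -->
   rep_map X al x = f (toda_head al) (mu al m)"
 have RX: "representation (tq n) X" using X by (simp add: toda_rep_def)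
 have fh: "f \<in> rep_hom (tq n) M X" using f by (simp add: rep_mono_def)
 have fM: "f w \<in> module_hom class_ring (fun_space (strip n i (level w))) (rep_space X w)" if "w \<in> {1..2*n}" for w
  using fh that by (auto simp: rep_hom_def)
 have finj: "a = b" if "f w a = f w b" "a \<in> strip n i (level w)" "b \<in> strip n i (level w)" "w \<in> {1..2*n}" for a b w
  using f that unfolding rep_mono_def inj_on_def by auto
 have farr: "rep_map X al (f (toda_tail al) m) = f (toda_head al) (mu al m)"
  if "al \<in> arcs (tq n)" "m \<in> strip n i (level (toda_tail al))" for al m
  using fh that unfolding rep_hom_def by auto
 have f0: "f w (%_. 0) = zero (rep_space X w)" if "w \<in> {1..2*n}" for w
  using module_hom_zero[OF vectorspace_fun_space[OF lin_closed_strip] representation_vectorspace[OF RX that] fM[OF that]]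
  by simp
 have main: "(v ~= 2 * top_level - 1 --> ?P) & (v = 2 * top_level - 1 --> (\<exists>\<kappa>.
   l1 \<odot>\<^bsub>rep_space X (2 * top_level)\<^esub> rep_map X (letter False top_level) x
    \<oplus>\<^bsub>rep_space X (2 * top_level)\<^esub> l2 \<odot>\<^bsub>rep_space X (2 * top_level)\<^esub> rep_map X (letter True top_level) x
    = f (2 * top_level) (%k. \<kappa> * sfun k) & (\<kappa> = 0 --> ?P)))"
 proof (rule vertex_cases[OF v])
  fix j assume vj: "v = 2 * j - 1" and j: "1 \<le> j" "j \<le> n"
  have "\<exists>m\<in>strip n i j. rep_map X (letter y j) x = f (2 * j) m" for y
   using arr[of "letter y j"] vj j by simp
  then obtain m where m: "!!y. m y \<in> strip n i j" "!!y. rep_map X (letter y j) x = f (2 * j) (m y)" by metis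
  \<comment> \<open>\<open>s\<close> measures the failure of the two images to be \<open>l2\<close>
    and \<open>- l1\<close> times a common vector.\<close>
  define s where "s = (%p. l1 * m False p + l2 * m True p)"
  have s: "s \<in> strip n i j" unfolding s_def
   by (intro lin_closedD(2)[OF lin_closed_strip] lin_closedD(3)[OF lin_closed_strip] m)
  \<comment> \<open>Letters on the two sides of a step commute in \<open>X\<close>. Pulled back
    along the injective \<open>f\<close>, this says that every step annihilates \<open>s\<close>,
    which therefore lies in the socle of the strip.\<close>
  have kill: "mu (step d j) s = (%_. 0)" if d: "can_step n d j" for d
  proof -
   let ?k = "next_level d j"
   have k: "1 \<le> ?k" "?k \<le> n" using next_level_range[OF d j] by auto
   have kv: "2 * ?k \<in> {1..2*n}" "2 * j \<in> {1..2*n}" "2 * ?k - 1 \<in> {1..2*n}" using k j by auto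
   let ?F = "%p. if toda_awalk n (2 * j - 1) p (2 * ?k) then fold (rep_map X) p x else zero (rep_space X (2 * ?k))"
   have F: "?F [letter y j, step d j, letter z ?k] =
     f (2 * ?k) (mu (letter z ?k) (mu (step d j) (m y)))" for y z
   proof -
    have "toda_awalk n (2 * j - 1) [letter y j, step d j, letter z ?k] (2 * ?k)"
     by (intro awalk_letterI awalk_stepI) (use j d k in \<open>auto simp: toda_awalk_simps\<close>)
    moreover have "mu (step d j) (m y) \<in> strip n i ?k"
     using model_map_closed[of "step d j" n "m y" i l1 l2] m(1)[of y] j d k by (simp add: toda_head_step)
    ultimately show ?thesis
     using farr[of "step d j" "m y"] farr[of "letter z ?k" "mu (step d j) (m y)"] m j d k
     by (simp add: toda_head_step)
   qed
   have xc: "x \<in> spc X (2 * j - 1)" using x vj by simp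
   have nil: "toda_awalk n (2 * j - 1) [] (2 * j - 1)" "toda_awalk n (2 * ?k) [] (2 * ?k)"
    using kv vj v by (auto simp: toda_awalk_simps)
   have "?F ([] @ [letter False j, step d j, letter True ?k]) = ?F ([] @ [letter True j, step d j, letter False ?k])"
    by (rule compatible_commute[OF toda_rep_compatible[OF X xc kv(1)] j d nil])
   then have "?F [letter False j, step d j, letter True ?k] = ?F [letter True j, step d j, letter False ?k]"
    by (simp only: append_Nil)
   then have "f (2 * ?k) (mu (letter True ?k) (mu (step d j) (m False))) =
     f (2 * ?k) (mu (letter False ?k) (mu (step d j) (m True)))"
    unfolding F .
   moreover have "mu (letter z ?k) (mu (step d j) (m y)) \<in> strip n i ?k" for y z
    using model_map_closed[of "step d j" n "m y" i l1 l2] m(1)[of y] j d k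
     model_map_closed[of "letter z ?k" n "mu (step d j) (m y)" i l1 l2] by (simp add: toda_head_step)
   ultimately have "mu (letter True ?k) (mu (step d j) (m False)) = mu (letter False ?k) (mu (step d j) (m True))"
    using finj[of "2 * ?k"] kv by simp
   then have "- l1 * mu (step d j) (m False) p = l2 * mu (step d j) (m True) p" for p
    unfolding model_map_letter by (auto dest: fun_cong[of _ _ p])
   then have e: "l1 * mu (step d j) (m False) p + l2 * mu (step d j) (m True) p = 0" for p
    by (metis add.commute minus_mult_left right_minus)
   show ?thesis
   proof
    fix p
    have "mu (step d j) s p = l1 * mu (step d j) (m False) p + l2 * mu (step d j) (m True) p"
     by (cases d) (simp_all add: model_map_step s_def)
    then show "mu (step d j) s p = 0" using e by simp
   qed
  qed
  have soc: "i + j = n + 1 & p = 1" if "s p ~= 0" for p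
   by (rule strip_socle[OF s j i(2) kill that])
  have P: ?P if s0: "s = (%_. 0)"
  proof -
   have e: "l1 * m False p = - l2 * m True p" for p
    using fun_cong[OF s0, of p] by (simp add: s_def eq_neg_iff_add_eq_0)
   \<comment> \<open>The common vector, recovered by dividing by a nonzero scalar: \<open>l2\<close>
     belongs to the letter \<open>False\<close> and \<open>- l1\<close> to the letter
     \<open>True\<close>.\<close>
   define c where "c = (%p. (if l2 = 0 then - inverse l1 else inverse l2) * m (l2 = 0) p)"
   have c: "c \<in> strip n i j" unfolding c_def by (rule lin_closedD(3)[OF lin_closed_strip m(1)])
   have "m y = mu (letter y j) c" for y
   proof
    fix p show "m y p = mu (letter y j) c p"
     using e[of p] l unfolding model_map_letter c_def
     by (cases y; cases "l2 = 0") (auto simp: field_simps)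
   qed
   then have "rep_map X al x = f (toda_head al) (mu al c)"
    if "al \<in> arcs (tq n)" "toda_tail al = v" for al
    using arc_from_odd[OF that(1) _ j(1)] that(2) vj m(2) by (metis toda_arrow_simps(4))
   then show ?P using c vj j by auto
  qed
  show ?thesis
  proof (cases "i + j = n + 1")
   case True
   then have jj: "j = top_level" by simp
   have sk: "s = (%k. s 1 * sfun k)"
   proof
    fix k show "s k = s 1 * sfun k" using soc[of k] by (cases "s k = 0") (auto simp: unit_fun_def)
   qed
   have "l1 \<odot>\<^bsub>rep_space X (2 * j)\<^esub> f (2 * j) (m False) \<oplus>\<^bsub>rep_space X (2 * j)\<^esub>
     l2 \<odot>\<^bsub>rep_space X (2 * j)\<^esub> f (2 * j) (m True) = f (2 * j) s"
   proof -
    have h: "f (2 * j) \<in> module_hom class_ring (fun_space (strip n i j)) (rep_space X (2 * j))"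
     using fM[of "2 * j"] j by simp
    show ?thesis
     using module_hom_smult[OF h, of l1 "m False"] module_hom_smult[OF h, of l2 "m True"]
      module_hom_add[OF h, of "%k. l1 * m False k" "%k. l2 * m True k"]
      lin_closedD(3)[OF lin_closed_strip] m(1) by (simp add: s_def)
   qed
   then have "l1 \<odot>\<^bsub>rep_space X (2 * j)\<^esub> rep_map X (letter False j) x \<oplus>\<^bsub>rep_space X (2 * j)\<^esub>
     l2 \<odot>\<^bsub>rep_space X (2 * j)\<^esub> rep_map X (letter True j) x = f (2 * j) (%k. s 1 * sfun k)"
    unfolding m(2) using arg_cong[OF sk, of "f (2 * j)"] by (rule trans)
   moreover have "s 1 = 0 --> ?P"
   proof
    assume s1: "s 1 = 0"
    have "s k = 0" for k using soc[of k] s1 by (cases "s k = 0") auto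
    then have "s = (%_. 0)" by blast
    then show ?P by (rule P)
   qed
   moreover have "v = 2 * top_level - 1" using vj jj by simp
   ultimately show ?thesis unfolding jj by blast
  next
   case False
   have "s = (%_. 0)" using soc False by blast
   moreover have "v ~= 2 * top_level - 1" using vj False j top_level(1) i by auto
   ultimately show ?thesis using P by blast
  qed
 next
  fix j assume vj: "v = 2 * j" and j: "1 \<le> j" "j \<le> n"
  \<comment> \<open>A step that would leave the quiver is given the image 0, in keeping with the
    value of a missing term in the relations.\<close>
  have "EX m. m \<in> strip n i (next_level d j) &
    (if can_step n d j then rep_map X (step d j) x = f (2 * next_level d j - 1) m else m = (%_. 0))" for d
  proof (cases "can_step n d j")
   case True
   then show ?thesis using arr[of "step d j"] vj j next_level_range[OF True j] by (auto simp: toda_head_step)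
  next
   case False
   then show ?thesis using lin_closedD(1)[OF lin_closed_strip] by auto
  qed
  then obtain m where m: "!!d. m d \<in> strip n i (next_level d j)"
   "!!d. can_step n d j ==> rep_map X (step d j) x = f (2 * next_level d j - 1) (m d)"
   "!!d. ~ can_step n d j ==> m d = (%_. 0)" by metis
  obtain y where y: "(if y then - l1 else l2) ~= 0"
   using l that[of True] that[of False] by (auto split: if_splits)
  define c where "c = (if y then - l1 else l2)"
  have c0: "c ~= 0" using y by (simp add: c_def)
  have vv: "2 * j - 1 \<in> {1..2*n}" using j by auto
  let ?F = "%p. if toda_awalk n (2 * j) p (2 * j - 1) then fold (rep_map X) p x else zero (rep_space X (2 * j - 1))"
  \<comment> \<open>Up to \<open>f\<close>, the result of a step, the letter \<open>y\<close> and
    the step back. The swap relation equates the two directions, which is the condition under which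
    the images can be glued.\<close>
  define G where "G d = (%p. if lo n i j < p then c * m d (if d then p + 1 else p) else 0)" for d
  have Gs: "G d \<in> strip n i j & (if can_step n d j then ?F [step d j, letter y (next_level d j), step (~ d) (next_level d j)]
    else zero (rep_space X (2 * j - 1))) = f (2 * j - 1) (G d)" for d
  proof (cases "can_step n d j")
   case True
   let ?k = "next_level d j"
   have k: "1 \<le> ?k" "?k \<le> n" using next_level_range[OF True j] by auto
   have bk: "can_step n (~ d) ?k" "next_level (~ d) ?k = j" using True can_step_next_level[OF True j] by auto
   have aw: "toda_awalk n (2 * j) [step d j, letter y ?k, step (~ d) ?k] (2 * j - 1)"
    by (intro awalk_letterI awalk_stepI) (use j True k bk in \<open>auto simp: toda_awalk_simps\<close>)
   have c1: "mu (letter y ?k) (m d) \<in> strip n i ?k"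
    using model_map_closed[of "letter y ?k" n "m d" i l1 l2] m(1)[of d] k by simp
   have c2: "mu (step (~ d) ?k) (mu (letter y ?k) (m d)) \<in> strip n i j"
    using model_map_closed[of "step (~ d) ?k" n "mu (letter y ?k) (m d)" i l1 l2] c1 k bk j
    by (simp add: toda_head_step)
   have G: "mu (step (~ d) ?k) (mu (letter y ?k) (m d)) = G d"
    using j by (cases d) (auto simp: model_map_step model_map_letter G_def c_def next_level_def fun_eq_iff)
   show ?thesis
    using aw True c2 G farr[of "letter y ?k" "m d"] farr[of "step (~ d) ?k" "mu (letter y ?k) (m d)"]
     m(1,2)[of d] c1 k bk j by (simp add: toda_head_step)
  next
   case False
   have "G d = (%_. 0)" using m(3)[OF False] by (auto simp: G_def)
   then show ?thesis using False f0[OF vv] lin_closedD(1)[OF lin_closed_strip] by simp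
  qed
  have xc: "x \<in> spc X (2 * j)" using x vj by simp
  have nil: "toda_awalk n (2 * j) [] (2 * j)" "toda_awalk n (2 * j - 1) [] (2 * j - 1)"
   using j by (auto simp: toda_awalk_simps)
  have FF: "(if can_step n True j then ?F [step True j, letter y (next_level True j), step False (next_level True j)]
    else zero (rep_space X (2 * j - 1))) =
    (if can_step n False j then ?F [step False j, letter y (next_level False j), step True (next_level False j)]
    else zero (rep_space X (2 * j - 1)))"
   using compatible_swap[OF toda_rep_compatible[OF X xc vv] j nil, of True y]
   by (simp only: append_Nil append_Nil2 append_Cons not_True_eq_False not_False_eq_True)
  have "f (2 * j - 1) (G True) = f (2 * j - 1) (G False)"
   by (rule box_equals[OF FF Gs[of True, THEN conjunct2, unfolded not_True_eq_False]
     Gs[of False, THEN conjunct2, unfolded not_False_eq_True]])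
  then have "G True = G False" using finj[of "2 * j - 1"] Gs vv j by simp
  then have "m True (p + 1) = m False p" if "lo n i j < p" for p
   using that c0 by (auto simp: G_def dest: fun_cong[of _ _ p])
  then obtain m' where m': "m' \<in> strip n i j" "mu (step True j) m' = m True" "mu (step False j) m' = m False"
   using strip_glue[of "m True" n i j "m False" l1 l2] m(1)[of True] m(1)[of False] j i(2)
   by (auto simp: next_level_def)
  have mu': "mu (step d j) m' = m d" for d using m' by (cases d) auto
  have "rep_map X al x = f (toda_head al) (mu al m')"
   if al: "al \<in> arcs (tq n)" "toda_tail al = v" for al
  proof -
   have "toda_tail al = 2 * j" using al(2) vj by simp
   then obtain d where d: "al = step d j" "can_step n d j" "toda_head al = 2 * next_level d j - 1"
    by (rule arc_from_even[OF al(1)])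
   then show ?thesis using m(2)[OF d(2)] mu' by simp
  qed
  then have ?P using m' vj by auto
  moreover have "v ~= 2 * top_level - 1" using vj top_level(1) by presburger
  ultimately show ?thesis by blast
 qed
 show "v ~= 2 * top_level - 1 ==> ?P" using main by blast
 show "v = 2 * top_level - 1 ==> \<exists>\<kappa>.
   l1 \<odot>\<^bsub>rep_space X (2 * top_level)\<^esub> rep_map X (letter False top_level) x
    \<oplus>\<^bsub>rep_space X (2 * top_level)\<^esub> l2 \<odot>\<^bsub>rep_space X (2 * top_level)\<^esub> rep_map X (letter True top_level) x
    = f (2 * top_level) (%k. \<kappa> * sfun k) & (\<kappa> = 0 --> ?P)" using main by blast
qed

end

text \<open>The difference of \<open>x\<close> and \<open>u\<close> is killed by every arrow that
  starts at \<open>v\<close>, so it lies in the essential \<open>U\<close>, and so does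
  \<open>x\<close>.\<close>

lemma killed_difference:
 assumes X: "representation (tq n) X" and U: "essential_subrep (tq n) X U"
  and v: "v \<in> {1..2*n}" and x: "x \<in> spc X v" and u: "u \<in> U v"
  and k: "!!al. al \<in> arcs (tq n) ==> toda_tail al = v ==> rep_map X al x = rep_map X al u"
 shows "x \<in> U v"
proof -
 interpret V: vectorspace class_ring "rep_space X v" by (rule representation_vectorspace[OF X v])
 have "VectorSpace.subspace class_ring (U v) (rep_space X v)"
  using U v by (simp add: essential_subrep_def subrep_def)
 then have sub: "submodule class_ring (U v) (rep_space X v)" by (simp add: VectorSpace.subspace_def)
 have uc: "u \<in> spc X v" using submodule.subset[OF sub] u by blast
 have sc: "c \<odot>\<^bsub>rep_space X v\<^esub> u \<in> spc X v" for c using V.smult_closed[of c u] uc by simp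
 let ?y = "x \<oplus>\<^bsub>rep_space X v\<^esub> (-1) \<odot>\<^bsub>rep_space X v\<^esub> u"
 have yc: "?y \<in> spc X v" using x sc by (rule V.a_closed)
 have "?y \<in> U v"
 proof (rule socle_in_essential[OF X U v yc])
  fix al assume al: "al \<in> arcs (tq n)" "toda_tail al = v"
  have h: "rep_map X al \<in> module_hom class_ring (rep_space X v) (rep_space X (toda_head al))"
   using X al by (auto simp: representation_def)
  interpret H: vectorspace class_ring "rep_space X (toda_head al)"
   using wf_digraph.head_in_verts[OF wf_digraph_toda_quiver al(1)]
   by (intro representation_vectorspace[OF X]) simp
  have hc: "rep_map X al u \<in> spc X (toda_head al)" using h uc by (auto simp: module_hom_def)
  show "rep_map X al ?y = zero (rep_space X (toda_head al))"
   using module_hom_add[OF h x sc[of "-1"]] module_hom_smult[OF h _ uc, of "-1"] k[OF al]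
    H.sum_neg_eq_zero_iff[OF hc hc] by (simp add: class_ring_simps)
 qed
 then have "?y \<oplus>\<^bsub>rep_space X v\<^esub> u \<in> U v" using submodule.m_closed[OF sub] u by blast
 moreover have "?y \<oplus>\<^bsub>rep_space X v\<^esub> u = x"
 proof -
  have "(-1) \<odot>\<^bsub>rep_space X v\<^esub> u \<oplus>\<^bsub>rep_space X v\<^esub> u = zero (rep_space X v)"
   using V.smult_l_distr[of "-1" 1 u] V.smult_one[OF uc] V.lmult_0[OF uc] uc by (simp add: class_ring_simps)
  then show ?thesis using V.a_assoc[OF x sc[of "-1"] uc] V.r_zero[OF x] by simp
 qed
 ultimately show ?thesis by simp
qed

section \<open>Images and direct sums of representations\<close>

lemma subspace_image:
 fixes V :: "(complex, 'a) module" and W :: "(complex, 'b) module"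
 assumes V: "vectorspace class_ring V" and W: "vectorspace class_ring W"
  and T: "T \<in> module_hom class_ring V W" and S: "VectorSpace.subspace class_ring S V"
 shows "VectorSpace.subspace class_ring (T ` S) W"
proof -
 interpret V: vectorspace class_ring V by fact
 interpret W: vectorspace class_ring W by fact
 have sub: "submodule class_ring S V" using S by (simp add: VectorSpace.subspace_def)
 have SV: "x \<in> carrier V" if "x \<in> S" for x using submodule.subset[OF sub] that by blast
 show ?thesis unfolding VectorSpace.subspace_def
 proof (intro conjI W submodule.intro)
  show "module class_ring W" using W by (simp add: vectorspace_def)
  show "T ` S \<subseteq> carrier W" using T SV by (auto simp: module_hom_def)
  show "zero W \<in> T ` S"
   using module_hom_zero[OF V W T] submodule.zero_closed[OF sub] by (metis imageI)
 next
  fix x y assume "x \<in> T ` S" "y \<in> T ` S"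
  then obtain a b where ab: "a \<in> S" "b \<in> S" "x = T a" "y = T b" by blast
  then have "x \<oplus>\<^bsub>W\<^esub> y = T (a \<oplus>\<^bsub>V\<^esub> b)" using module_hom_add[OF T SV SV] by simp
  then show "x \<oplus>\<^bsub>W\<^esub> y \<in> T ` S" using submodule.m_closed[OF sub ab(1,2)] by simp
 next
  fix c :: complex and x assume c: "c \<in> carrier class_ring" and "x \<in> T ` S"
  then obtain a where a: "a \<in> S" "x = T a" by blast
  then have "c \<odot>\<^bsub>W\<^esub> x = T (c \<odot>\<^bsub>V\<^esub> a)" using module_hom_smult[OF T c SV] by simp
  then show "c \<odot>\<^bsub>W\<^esub> x \<in> T ` S" using submodule.smult_closed[OF sub c a(1)] by simp
 qed
qed

lemma carrier_subspace: "vectorspace K V ==> VectorSpace.subspace K (carrier V) V"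
proof -
 assume V: "vectorspace K V"
 interpret vectorspace K V by (rule V)
 show ?thesis unfolding VectorSpace.subspace_def
 proof (intro conjI V submodule.intro)
  show "module K V" using V by (simp add: vectorspace_def)
 qed (simp_all add: smult_closed)
qed

lemma rep_homD:
 assumes "h \<in> rep_hom (tq n) X Y"
 shows "v \<in> {1..2*n} ==> h v \<in> module_hom class_ring (rep_space X v) (rep_space Y v)"
  and "al \<in> arcs (tq n) ==> x \<in> spc X (toda_tail al) ==>
   h (toda_head al) (rep_map X al x) = rep_map Y al (h (toda_tail al) x)"
  and "v \<in> {1..2*n} ==> x \<in> spc X v ==> h v x \<in> spc Y v"
 using assms unfolding rep_hom_def module_hom_def by auto

lemma arrow_verts:
 assumes "al \<in> arcs (tq n)"
 shows "toda_tail al \<in> {1..2*n}" "toda_head al \<in> {1..2*n}"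
 using wf_digraph.head_in_verts[OF wf_digraph_toda_quiver assms]
  wf_digraph.tail_in_verts[OF wf_digraph_toda_quiver assms] by simp_all

lemma rep_map_hom:
 assumes "representation (tq n) X" "al \<in> arcs (tq n)"
 shows "rep_map X al \<in> module_hom class_ring (rep_space X (toda_tail al)) (rep_space X (toda_head al))"
  and "x \<in> spc X (toda_tail al) ==> rep_map X al x \<in> spc X (toda_head al)"
 using assms unfolding representation_def module_hom_def by auto

lemma subrep_image:
 assumes X: "representation (tq n) X" and Y: "representation (tq n) Y"
  and h: "h \<in> rep_hom (tq n) X Y" and S: "subrep (tq n) X S"
 shows "subrep (tq n) Y (%v. h v ` S v)"
 unfolding subrep_def toda_quiver_simps
proof (intro conjI ballI)
 fix v assume v: "v \<in> {1..2*n}"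
 show "VectorSpace.subspace class_ring (h v ` S v) (rep_space Y v)"
  using subspace_image[OF representation_vectorspace[OF X v] representation_vectorspace[OF Y v] rep_homD(1)[OF h v]]
   S v by (simp add: subrep_def)
next
 fix al assume al: "al \<in> arcs (tq n)"
 show "rep_map Y al ` h (toda_tail al) ` S (toda_tail al) \<subseteq> h (toda_head al) ` S (toda_head al)"
 proof clarify
  fix s assume s: "s \<in> S (toda_tail al)"
  have "VectorSpace.subspace class_ring (S (toda_tail al)) (rep_space X (toda_tail al))"
   using S arrow_verts[OF al] by (simp add: subrep_def)
  then have "s \<in> spc X (toda_tail al)"
   using s by (auto simp: VectorSpace.subspace_def dest: submodule.subset)
  then have "rep_map Y al (h (toda_tail al) s) = h (toda_head al) (rep_map X al s)"
   using rep_homD(2)[OF h al] by simp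
  moreover have "rep_map X al s \<in> S (toda_head al)" using S al s by (auto simp: subrep_def)
  ultimately show "rep_map Y al (h (toda_tail al) s) \<in> h (toda_head al) ` S (toda_head al)" by auto
 qed
qed

lemma subrep_carrier:
 assumes X: "representation (tq n) X"
 shows "subrep (tq n) X (%v. spc X v)"
 unfolding subrep_def toda_quiver_simps
 using carrier_subspace[OF representation_vectorspace[OF X]] rep_map_hom(2)[OF X] by blast

lemma subrep_rep_image:
 assumes "representation (tq n) X" "representation (tq n) Y" "h \<in> rep_hom (tq n) X Y"
 shows "subrep (tq n) Y (rep_image X h)"
 using subrep_image[OF assms subrep_carrier[OF assms(1)]] by (simp add: rep_image_def[abs_def])

lemma rep_sum_simps [simp]:
 "spc (rep_sum S F) v = (\<Pi>\<^sub>E s\<in>S. spc (F s) v)"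
 "zero (rep_space (rep_sum S F) v) = (\<lambda>s\<in>S. \<zero>\<^bsub>rep_space (F s) v\<^esub>)"
 "x \<oplus>\<^bsub>rep_space (rep_sum S F) v\<^esub> y = (\<lambda>s\<in>S. x s \<oplus>\<^bsub>rep_space (F s) v\<^esub> y s)"
 "c \<odot>\<^bsub>rep_space (rep_sum S F) v\<^esub> x = (\<lambda>s\<in>S. c \<odot>\<^bsub>rep_space (F s) v\<^esub> x s)"
 "rep_map (rep_sum S F) al x = (\<lambda>s\<in>S. rep_map (F s) al (x s))"
 by (simp_all add: rep_sum_def)

lemma vectorspace_rep_sum:
 fixes F :: "'s => ('a, 'v, 'e) quiver_rep"
 assumes "!!s. s \<in> S ==> vectorspace class_ring (rep_space (F s) v)"
 shows "vectorspace class_ring (rep_space (rep_sum S F) v)"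
proof -
 let ?V = "%s. rep_space (F s) v"
 let ?C = "\<Pi>\<^sub>E s\<in>S. carrier (?V s)"
 have m: "module class_ring (?V s)" if "s \<in> S" for s using assms[OF that] by (simp add: vectorspace_def)
 have ag: "abelian_group (?V s)" if "s \<in> S" for s using m[OF that] by (simp add: module_def)
 have am: "abelian_monoid (?V s)" if "s \<in> S" for s using ag[OF that] by (simp add: abelian_group_def)
 have mem: "x s \<in> carrier (?V s)" if "x \<in> ?C" "s \<in> S" for x s using that by auto
 have ext: "(\<lambda>s\<in>S. x s) = x" if "x \<in> ?C" for x using that by (auto simp: extensional_restrict)
 have sm: "c \<odot>\<^bsub>?V s\<^esub> y \<in> carrier (?V s)" if "s \<in> S" "y \<in> carrier (?V s)" for c s y
  using module.smult_closed[OF m[OF that(1)] _ that(2), of c] by simp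
 show ?thesis
 proof (rule vs_criteria, unfold rep_sum_simps)
  show "field (class_ring :: complex ring)" by (rule class_field)
  show "(\<lambda>s\<in>S. \<zero>\<^bsub>?V s\<^esub>) \<in> ?C" using abelian_monoid.zero_closed[OF am] by auto
  show "ALL x y. x \<in> ?C & y \<in> ?C --> (\<lambda>s\<in>S. x s \<oplus>\<^bsub>?V s\<^esub> y s) \<in> ?C"
   using abelian_monoid.a_closed[OF am] mem by auto
  show "\<forall>x\<in>?C. \<exists>y\<in>?C. (\<lambda>s\<in>S. x s \<oplus>\<^bsub>?V s\<^esub> y s) = (\<lambda>s\<in>S. \<zero>\<^bsub>?V s\<^esub>)"
  proof
   fix x assume x: "x \<in> ?C"
   show "\<exists>y\<in>?C. (\<lambda>s\<in>S. x s \<oplus>\<^bsub>?V s\<^esub> y s) = (\<lambda>s\<in>S. \<zero>\<^bsub>?V s\<^esub>)"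
   proof (rule bexI[of _ "\<lambda>s\<in>S. \<ominus>\<^bsub>?V s\<^esub> x s"])
    show "(\<lambda>s\<in>S. x s \<oplus>\<^bsub>?V s\<^esub> (\<lambda>s\<in>S. \<ominus>\<^bsub>?V s\<^esub> x s) s) = (\<lambda>s\<in>S. \<zero>\<^bsub>?V s\<^esub>)"
     by (rule restrict_ext) (simp add: abelian_group.r_neg[OF ag mem[OF x]])
    show "(\<lambda>s\<in>S. \<ominus>\<^bsub>?V s\<^esub> x s) \<in> ?C" using abelian_group.a_inv_closed[OF ag mem[OF x]] by auto
   qed
  qed
  show "ALL c x. c \<in> carrier class_ring & x \<in> ?C --> (\<lambda>s\<in>S. c \<odot>\<^bsub>?V s\<^esub> x s) \<in> ?C"
   using sm mem by auto
  show "ALL x y. x \<in> ?C & y \<in> ?C --> (\<lambda>s\<in>S. x s \<oplus>\<^bsub>?V s\<^esub> y s) = (\<lambda>s\<in>S. y s \<oplus>\<^bsub>?V s\<^esub> x s)"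
   by (intro allI impI restrict_ext) (auto intro: abelian_monoid.a_comm[OF am])
  show "ALL x y z. x \<in> ?C & y \<in> ?C & z \<in> ?C -->
    (\<lambda>s\<in>S. (\<lambda>s\<in>S. x s \<oplus>\<^bsub>?V s\<^esub> y s) s \<oplus>\<^bsub>?V s\<^esub> z s) =
    (\<lambda>s\<in>S. x s \<oplus>\<^bsub>?V s\<^esub> (\<lambda>s\<in>S. y s \<oplus>\<^bsub>?V s\<^esub> z s) s)"
   by (intro allI impI restrict_ext) (auto intro: abelian_monoid.a_assoc[OF am])
  show "\<forall>x\<in>?C. (\<lambda>s\<in>S. x s \<oplus>\<^bsub>?V s\<^esub> (\<lambda>s\<in>S. \<zero>\<^bsub>?V s\<^esub>) s) = x"
  proof
   fix x assume x: "x \<in> ?C"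
   have "(\<lambda>s\<in>S. x s \<oplus>\<^bsub>?V s\<^esub> (\<lambda>s\<in>S. \<zero>\<^bsub>?V s\<^esub>) s) = (\<lambda>s\<in>S. x s)"
    by (rule restrict_ext) (simp add: abelian_monoid.r_zero[OF am mem[OF x]])
   then show "(\<lambda>s\<in>S. x s \<oplus>\<^bsub>?V s\<^esub> (\<lambda>s\<in>S. \<zero>\<^bsub>?V s\<^esub>) s) = x" using ext[OF x] by simp
  qed
  show "ALL a b x. a \<in> carrier class_ring & b \<in> carrier class_ring & x \<in> ?C -->
    (\<lambda>s\<in>S. (a \<otimes>\<^bsub>class_ring\<^esub> b) \<odot>\<^bsub>?V s\<^esub> x s) = (\<lambda>s\<in>S. a \<odot>\<^bsub>?V s\<^esub> (\<lambda>s\<in>S. b \<odot>\<^bsub>?V s\<^esub> x s) s)"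
   by (intro allI impI restrict_ext) (use module.smult_assoc1[OF m _ _ mem] in auto)
  show "\<forall>x\<in>?C. (\<lambda>s\<in>S. \<one>\<^bsub>class_ring\<^esub> \<odot>\<^bsub>?V s\<^esub> x s) = x"
  proof
   fix x assume x: "x \<in> ?C"
   have "(\<lambda>s\<in>S. \<one>\<^bsub>class_ring\<^esub> \<odot>\<^bsub>?V s\<^esub> x s) = (\<lambda>s\<in>S. x s)"
    by (rule restrict_ext) (rule module.smult_one[OF m mem[OF x]])
   then show "(\<lambda>s\<in>S. \<one>\<^bsub>class_ring\<^esub> \<odot>\<^bsub>?V s\<^esub> x s) = x" using ext[OF x] by simp
  qed
  show "ALL a b x. a \<in> carrier class_ring & b \<in> carrier class_ring & x \<in> ?C -->
    (\<lambda>s\<in>S. (a \<oplus>\<^bsub>class_ring\<^esub> b) \<odot>\<^bsub>?V s\<^esub> x s) =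
    (\<lambda>s\<in>S. (\<lambda>s\<in>S. a \<odot>\<^bsub>?V s\<^esub> x s) s \<oplus>\<^bsub>?V s\<^esub> (\<lambda>s\<in>S. b \<odot>\<^bsub>?V s\<^esub> x s) s)"
   by (intro allI impI restrict_ext) (use module.smult_l_distr[OF m _ _ mem] in auto)
  show "ALL a x y. a \<in> carrier class_ring & x \<in> ?C & y \<in> ?C -->
    (\<lambda>s\<in>S. a \<odot>\<^bsub>?V s\<^esub> (\<lambda>s\<in>S. x s \<oplus>\<^bsub>?V s\<^esub> y s) s) =
    (\<lambda>s\<in>S. (\<lambda>s\<in>S. a \<odot>\<^bsub>?V s\<^esub> x s) s \<oplus>\<^bsub>?V s\<^esub> (\<lambda>s\<in>S. a \<odot>\<^bsub>?V s\<^esub> y s) s)"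
   by (intro allI impI restrict_ext) (use module.smult_r_distr[OF m _ mem mem] in auto)
 qed
qed

lemma rep_sum_fold:
 assumes "x \<in> extensional S"
 shows "fold (rep_map (rep_sum S F)) p x = (\<lambda>s\<in>S. fold (rep_map (F s)) p (x s))"
 using assms
proof (induction p arbitrary: x)
 case Nil
 then show ?case by (simp add: extensional_restrict)
next
 case (Cons al p)
 have "fold (rep_map (rep_sum S F)) p (\<lambda>s\<in>S. rep_map (F s) al (x s)) =
   (\<lambda>s\<in>S. fold (rep_map (F s)) p ((\<lambda>s\<in>S. rep_map (F s) al (x s)) s))"
  by (rule Cons.IH) (rule restrict_extensional)
 also have "... = (\<lambda>s\<in>S. fold (rep_map (F s)) (al # p) (x s))"
  by (rule restrict_ext) simp
 finally have *: "fold (rep_map (rep_sum S F)) p (\<lambda>s\<in>S. rep_map (F s) al (x s)) =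
   (\<lambda>s\<in>S. fold (rep_map (F s)) (al # p) (x s))" .
 have "rep_map (rep_sum S F) al x = (\<lambda>s\<in>S. rep_map (F s) al (x s))" by (rule rep_sum_simps(5))
 then have "fold (rep_map (rep_sum S F)) (al # p) x =
   fold (rep_map (rep_sum S F)) p (\<lambda>s\<in>S. rep_map (F s) al (x s))" by (simp only: fold_simps)
 then show ?case using * by (rule trans)
qed

lemma representation_rep_sum:
 assumes "!!s. s \<in> S ==> representation (tq n) (F s)"
 shows "representation (tq n) (rep_sum S F)"
 unfolding representation_def toda_quiver_simps
proof (intro conjI ballI)
 fix v assume v: "v \<in> {1..2*n}"
 show "vectorspace class_ring (rep_space (rep_sum S F) v)"
  by (rule vectorspace_rep_sum) (rule representation_vectorspace[OF assms v])
next
 fix al assume al: "al \<in> arcs (tq n)"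
 have h: "rep_map (F s) al \<in> module_hom class_ring (rep_space (F s) (toda_tail al)) (rep_space (F s) (toda_head al))"
  if "s \<in> S" for s using rep_map_hom(1)[OF assms[OF that] al] .
 show "rep_map (rep_sum S F) al \<in> module_hom class_ring
   (rep_space (rep_sum S F) (toda_tail al)) (rep_space (rep_sum S F) (toda_head al))"
  unfolding module_hom_def rep_sum_simps
 proof (intro CollectI conjI allI impI)
  show "(%x. \<lambda>s\<in>S. rep_map (F s) al (x s)) \<in> (\<Pi>\<^sub>E s\<in>S. spc (F s) (toda_tail al)) \<rightarrow>
    (\<Pi>\<^sub>E s\<in>S. spc (F s) (toda_head al))"
   using rep_map_hom(2)[OF assms al] by (auto simp: PiE_iff)
 next
  fix x y
  assume "x \<in> (\<Pi>\<^sub>E s\<in>S. spc (F s) (toda_tail al)) & y \<in> (\<Pi>\<^sub>E s\<in>S. spc (F s) (toda_tail al))"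
  then have xy: "x s \<in> spc (F s) (toda_tail al)" "y s \<in> spc (F s) (toda_tail al)"
   if "s \<in> S" for s using that by auto
  show "(\<lambda>s\<in>S. rep_map (F s) al ((\<lambda>s\<in>S. x s \<oplus>\<^bsub>rep_space (F s) (toda_tail al)\<^esub> y s) s)) =
    (\<lambda>s\<in>S. (\<lambda>s\<in>S. rep_map (F s) al (x s)) s \<oplus>\<^bsub>rep_space (F s) (toda_head al)\<^esub> (\<lambda>s\<in>S. rep_map (F s) al (y s)) s)"
   by (rule restrict_ext) (use module_hom_add[OF h xy] in simp)
 next
  fix c :: complex and x
  assume "c \<in> carrier class_ring & x \<in> (\<Pi>\<^sub>E s\<in>S. spc (F s) (toda_tail al))"
  then have x: "x s \<in> spc (F s) (toda_tail al)" if "s \<in> S" for s using that by auto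
  show "(\<lambda>s\<in>S. rep_map (F s) al ((\<lambda>s\<in>S. c \<odot>\<^bsub>rep_space (F s) (toda_tail al)\<^esub> x s) s)) =
    (\<lambda>s\<in>S. c \<odot>\<^bsub>rep_space (F s) (toda_head al)\<^esub> (\<lambda>s\<in>S. rep_map (F s) al (x s)) s)"
   by (rule restrict_ext) (use module_hom_smult[OF h _ x, of _ c] in simp)
 qed
qed

lemma toda_rep_rep_sum:
 assumes "!!s. s \<in> S ==> toda_rep n (F s)"
 shows "toda_rep n (rep_sum S F)"
 unfolding toda_rep_def
proof (intro conjI allI impI)
 show "representation (tq n) (rep_sum S F)"
  by (rule representation_rep_sum) (use assms in \<open>simp add: toda_rep_def\<close>)
next
 fix al s p t q x
 assume al: "al \<in> arcs (tq n)" "toda_rel n al = ((s, p), (t, q))"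
  and x: "x \<in> spc (rep_sum S F) (toda_head al)"
 have xe: "x \<in> extensional S" using x by (simp add: PiE_def)
 have *: "(if s = 0 then zero (rep_space (F k) (toda_tail al)) else fold (rep_map (F k)) p (x k)) =
    (if t = 0 then zero (rep_space (F k) (toda_tail al)) else fold (rep_map (F k)) q (x k))" if k: "k \<in> S" for k
  using assms[OF k] al x k unfolding toda_rep_def by (auto simp: PiE_iff simp del: if_split)
 have "(if s = 0 then (\<lambda>k\<in>S. zero (rep_space (F k) (toda_tail al))) else (\<lambda>k\<in>S. fold (rep_map (F k)) p (x k))) =
   (\<lambda>k\<in>S. (if s = 0 then zero (rep_space (F k) (toda_tail al)) else fold (rep_map (F k)) p (x k)))"
  "(if t = 0 then (\<lambda>k\<in>S. zero (rep_space (F k) (toda_tail al))) else (\<lambda>k\<in>S. fold (rep_map (F k)) q (x k))) =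
   (\<lambda>k\<in>S. (if t = 0 then zero (rep_space (F k) (toda_tail al)) else fold (rep_map (F k)) q (x k)))" by simp_all
 moreover have "(\<lambda>k\<in>S. (if s = 0 then zero (rep_space (F k) (toda_tail al)) else fold (rep_map (F k)) p (x k))) =
   (\<lambda>k\<in>S. (if t = 0 then zero (rep_space (F k) (toda_tail al)) else fold (rep_map (F k)) q (x k)))"
  by (rule restrict_ext) (rule *)
 ultimately show "(if s = 0 then zero (rep_space (rep_sum S F) (toda_tail al)) else fold (rep_map (rep_sum S F)) p x) =
   (if t = 0 then zero (rep_space (rep_sum S F) (toda_tail al)) else fold (rep_map (rep_sum S F)) q x)"
  unfolding rep_sum_simps rep_sum_fold[OF xe] by simp
qed

text \<open>Copresentations are phrased with direct sums, so a single injective enters as a sum over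
  one index.\<close>

lemma rep_hom_into_single:
 assumes "h \<in> rep_hom (tq n) X (F s0)"
 shows "(%w x. \<lambda>s\<in>{s0}. h w x) \<in> rep_hom (tq n) X (rep_sum {s0} F)"
 unfolding rep_hom_def module_hom_def toda_quiver_simps
 using rep_homD(3)[OF assms] rep_homD(2)[OF assms] module_hom_add[OF rep_homD(1)[OF assms]]
  module_hom_smult[OF rep_homD(1)[OF assms]]
 by (auto intro!: restrict_ext)

lemma rep_hom_component:
 assumes "s0 \<in> S" "!!s. s \<in> S ==> representation (tq n) (F s)"
 shows "(%w y. y s0) \<in> rep_hom (tq n) (rep_sum S F) (F s0)"
 unfolding rep_hom_def module_hom_def toda_quiver_simps using assms by auto

lemma rep_hom_compose:
 assumes "h \<in> rep_hom (tq n) X Y" "k \<in> rep_hom (tq n) Y Z"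
 shows "(%w x. k w (h w x)) \<in> rep_hom (tq n) X Z"
proof -
 have "(%x. k w (h w x)) \<in> module_hom class_ring (rep_space X w) (rep_space Z w)" if "w \<in> {1..2*n}" for w
  by (rule module_hom_compose[OF rep_homD(1)[OF assms(1) that] rep_homD(1)[OF assms(2) that]])
 moreover have "k (toda_head al) (h (toda_head al) (rep_map X al x)) = rep_map Z al (k (toda_tail al) (h (toda_tail al) x))"
  if "al \<in> arcs (tq n)" "x \<in> spc X (toda_tail al)" for al x
  using rep_homD(2)[OF assms(1) that] rep_homD(2)[OF assms(2) that(1) rep_homD(3)[OF assms(1) _ that(2)]]
   arrow_verts(1)[OF that(1)] by simp
 ultimately show ?thesis by (simp add: rep_hom_def)
qed

lemma essential_single:
 assumes X: "representation (tq n) (F s0)" and U: "essential_subrep (tq n) (F s0) U"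
 shows "essential_subrep (tq n) (rep_sum {s0} F) (%w. (%x. \<lambda>s\<in>{s0}. x) ` U w)"
 unfolding essential_subrep_def
proof (intro conjI allI impI)
 let ?S = "rep_sum {s0} F"
 have RS: "representation (tq n) ?S" by (rule representation_rep_sum) (use X in simp)
 have id: "(%w x. x) \<in> rep_hom (tq n) (F s0) (F s0)"
  by (auto simp: rep_hom_def module_hom_def)
 show "subrep (tq n) ?S (%w. (%x. \<lambda>s\<in>{s0}. x) ` U w)"
  using subrep_image[OF X RS rep_hom_into_single[where F = F and ?s0.0 = s0, OF id]] U by (simp add: essential_subrep_def)
 fix V assume V: "subrep (tq n) ?S V & (\<exists>v\<in>verts (tq n). V v ~= {\<zero>\<^bsub>rep_space ?S v\<^esub>})"
 have comp: "(%w y. y s0) \<in> rep_hom (tq n) ?S (F s0)" by (rule rep_hom_component) (use X in auto)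
 have V1: "subrep (tq n) (F s0) (%w. (%y. y s0) ` V w)"
  using subrep_image[OF RS X comp] V by simp
 have Vsub: "V w \<subseteq> spc ?S w" "\<zero>\<^bsub>rep_space ?S w\<^esub> \<in> V w" if "w \<in> {1..2*n}" for w
  using V that by (auto simp: subrep_def VectorSpace.subspace_def submodule_def)
 have ext: "y = (\<lambda>s\<in>{s0}. y s0)" if "y \<in> V w" "w \<in> {1..2*n}" for y w
  using Vsub(1)[OF that(2)] that(1) by (auto simp: fun_eq_iff PiE_iff extensional_def)
 obtain v where v: "v \<in> {1..2*n}" "V v ~= {\<zero>\<^bsub>rep_space ?S v\<^esub>}"
  using V[THEN conjunct2] unfolding toda_quiver_simps by (rule bexE)
 obtain y where y: "y \<in> V v" "y ~= \<zero>\<^bsub>rep_space ?S v\<^esub>" using v Vsub(2) by blast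
 have "y s0 ~= zero (rep_space (F s0) v)" using ext[OF y(1) v(1)] y(2) by auto
 then have "(%y. y s0) ` V v ~= {zero (rep_space (F s0) v)}" using y(1) by blast
 then have "\<exists>w\<in>{1..2*n}. U w \<inter> (%y. y s0) ` V w ~= {zero (rep_space (F s0) w)}"
  using U V1 v(1) unfolding essential_subrep_def toda_quiver_simps by blast
 then obtain w where w: "w \<in> {1..2*n}" "U w \<inter> (%y. y s0) ` V w ~= {zero (rep_space (F s0) w)}" by blast
 have "zero (rep_space (F s0) w) \<in> U w"
  using U w(1) by (auto simp: essential_subrep_def subrep_def VectorSpace.subspace_def submodule_def)
 moreover have "zero (rep_space (F s0) w) \<in> (%y. y s0) ` V w"
  using Vsub(2)[OF w(1)] by (intro image_eqI[of _ _ "\<zero>\<^bsub>rep_space ?S w\<^esub>"]) auto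
 ultimately obtain z where z: "z \<in> V w" "z s0 \<in> U w" "z s0 ~= zero (rep_space (F s0) w)" using w(2) by blast
 have "z \<in> (%x. \<lambda>s\<in>{s0}. x) ` U w" using ext[OF z(1) w(1)] z(2) by (metis imageI)
 moreover have "z ~= \<zero>\<^bsub>rep_space ?S w\<^esub>" using z(3) by auto
 ultimately have "(%x. \<lambda>s\<in>{s0}. x) ` U w \<inter> V w ~= {\<zero>\<^bsub>rep_space ?S w\<^esub>}"
  using z(1) by blast
 then show "\<exists>v\<in>verts (tq n). (%x. \<lambda>s\<in>{s0}. x) ` U v \<inter> V v ~= {\<zero>\<^bsub>rep_space ?S v\<^esub>}"
  using w(1) unfolding toda_quiver_simps by (rule rev_bexI[rotated])
qed

text \<open>Any nonzero subrepresentation of \<open>inj_rep n v\<close> contains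
  \<open>inj_socle\<close> as well, so the two meet there.\<close>

lemma essential_if_socle:
 assumes U: "subrep (tq n) (inj_rep n v) U" and v: "v \<in> {1..2*n}" and s: "inj_socle \<in> U v"
 shows "essential_subrep (tq n) (inj_rep n v) U"
 unfolding essential_subrep_def
proof (intro conjI U allI impI)
 fix V assume V: "subrep (tq n) (inj_rep n v) V &
   (\<exists>w\<in>verts (tq n). V w ~= {\<zero>\<^bsub>rep_space (inj_rep n v) w\<^esub>})"
 then have "\<exists>w\<in>{1..2*n}. V w ~= {%_. 0}" by simp
 then obtain w where w: "w \<in> {1..2*n}" "V w ~= {%_. 0}" by (rule bexE)
 have "VectorSpace.subspace class_ring (V w) (rep_space (inj_rep n v) w)"
  using V w by (simp add: subrep_def)
 then have "(%_. 0) \<in> V w"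
  by (simp add: subspace_fun_space_iff[OF lin_closed_inj_space] lin_closed_def)
 then obtain \<phi> where "\<phi> \<in> V w" "\<phi> ~= (%_. 0)" using w(2) by blast
 then have "inj_socle \<in> V v" using inj_rep_subrep_socle[of n v V w \<phi>] V w(1) by blast
 moreover have "inj_socle (to_nat ([] :: toda_arrow list)) ~= 0" by simp
 then have "inj_socle ~= (%_. 0)" by metis
 ultimately have "U v \<inter> V v ~= {\<zero>\<^bsub>rep_space (inj_rep n v) v\<^esub>}" using s by auto
 then show "\<exists>w\<in>verts (tq n). U w \<inter> V w ~= {\<zero>\<^bsub>rep_space (inj_rep n v) w\<^esub>}" using v by auto
qed

section \<open>A minimal injective copresentation of the model\<close>

context toda_data
begin

text \<open>At an odd vertex some letter acts by a nonzero scalar, so nothing is killed; at an even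
  vertex \<open>strip_socle\<close> applies.\<close>

lemma model_socle:
 assumes v: "v \<in> {1..2*n}" and m: "m \<in> strip n i (level v)" "m ~= (%_. 0)"
  and k: "!!al. al \<in> arcs (tq n) ==> toda_tail al = v ==> mu al m = (%_. 0)"
 shows "v = 2 * top_level" "m = (%k. m 1 * sfun k)" "m 1 ~= 0"
proof -
 have *: "v = 2 * top_level & (ALL p. m p ~= 0 --> p = 1)"
 proof (rule vertex_cases[OF v])
  fix j assume vj: "v = 2 * j - 1" and j: "1 \<le> j" "j \<le> n"
  have "mu (letter y j) m = (%_. 0)" for y using k[of "letter y j"] vj j by simp
  then have z: "(%p. (if y then - l1 else l2) * m p) = (%_. 0)" for y
   unfolding model_map_letter .
  have "(if y then - l1 else l2) * m p = 0" for y p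
   using fun_cong[OF z[of y], of p] by simp
  from this[of True] this[of False] have "m p = 0" for p using l by auto
  then show ?thesis using m(2) by auto
 next
  fix j assume vj: "v = 2 * j" and j: "1 \<le> j" "j \<le> n"
  have ms: "m \<in> strip n i j" using m(1) vj by simp
  have kk: "mu (step d j) m = (%_. 0)" if "can_step n d j" for d
   using k[of "step d j"] vj j that by simp
  have *: "i + j = n + 1 & p = 1" if "m p ~= 0" for p by (rule strip_socle[OF ms j i(2) kk that])
  obtain p where "m p ~= 0" using m(2) by auto
  then have "j = top_level" using *[of p] by arith
  then show ?thesis using vj * by blast
 qed
 show "v = 2 * top_level" using * by blast
 show eq: "m = (%k. m 1 * sfun k)"
 proof
  fix k show "m k = m 1 * sfun k" using * by (cases "m k = 0") (auto simp: unit_fun_def)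
 qed
 show "m 1 ~= 0" using m(2) eq by auto
qed

lemma model_mu_closed:
 "al \<in> arcs (tq n) ==> m \<in> strip n i (level (toda_tail al)) ==> mu al m \<in> strip n i (level (toda_head al))"
 by (rule model_map_closed)

text \<open>If the arrow images of \<open>x\<close> are those of a vector of the model, then the
  difference is killed by all arrows and the essential image absorbs it. The scalar
  \<open>\<kappa>\<close> is the only obstruction.\<close>

lemma in_image_of_arrows:
 assumes X: "toda_rep n X" and f: "f \<in> rep_mono (tq n) M X"
  and ess: "essential_subrep (tq n) X (rep_image M f)"
  and v: "v \<in> {1..2*n}" and x: "x \<in> spc X v"
  and arr: "!!al. al \<in> arcs (tq n) ==> toda_tail al = v ==> rep_map X al x \<in> rep_image M f (toda_head al)"
 shows "v ~= 2 * top_level - 1 ==> x \<in> rep_image M f v"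
  and "v = 2 * top_level - 1 ==> \<exists>\<kappa>.
   l1 \<odot>\<^bsub>rep_space X (2 * top_level)\<^esub> rep_map X (letter False top_level) x
    \<oplus>\<^bsub>rep_space X (2 * top_level)\<^esub> l2 \<odot>\<^bsub>rep_space X (2 * top_level)\<^esub> rep_map X (letter True top_level) x
    = f (2 * top_level) (%k. \<kappa> * sfun k) & (\<kappa> = 0 --> x \<in> rep_image M f v)"
proof -
 have RX: "representation (tq n) X" using X by (simp add: toda_rep_def)
 have fh: "f \<in> rep_hom (tq n) M X" using f by (simp add: rep_mono_def)
 have arr': "\<exists>m\<in>strip n i (level (toda_head al)). rep_map X al x = f (toda_head al) m"
  if "al \<in> arcs (tq n)" "toda_tail al = v" for al
  using arr[OF that] by (auto simp: rep_image_def)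
 have *: "x \<in> rep_image M f v" if H: "\<exists>m\<in>strip n i (level v). \<forall>al\<in>arcs (tq n). toda_tail al = v -->
   rep_map X al x = f (toda_head al) (mu al m)"
 proof -
  obtain m where m: "m \<in> strip n i (level v)"
   "\<forall>al\<in>arcs (tq n). toda_tail al = v --> rep_map X al x = f (toda_head al) (mu al m)"
   using H by (rule bexE)
  have fm: "f v m \<in> rep_image M f v" using m(1) by (simp add: rep_image_def)
  show ?thesis
  proof (rule killed_difference[OF RX ess v x fm])
   fix al assume "al \<in> arcs (tq n)" "toda_tail al = v"
   then show "rep_map X al x = rep_map X al (f v m)"
    using m rep_homD(2)[OF fh, of al m] by simp
  qed
 qed
 show "v ~= 2 * top_level - 1 ==> x \<in> rep_image M f v"
  using lift_extension(1)[OF X f v x arr'] * by blast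
 show "\<exists>\<kappa>.
   l1 \<odot>\<^bsub>rep_space X (2 * top_level)\<^esub> rep_map X (letter False top_level) x
    \<oplus>\<^bsub>rep_space X (2 * top_level)\<^esub> l2 \<odot>\<^bsub>rep_space X (2 * top_level)\<^esub> rep_map X (letter True top_level) x
    = f (2 * top_level) (%k. \<kappa> * sfun k) & (\<kappa> = 0 --> x \<in> rep_image M f v)"
  if "v = 2 * top_level - 1"
  using lift_extension(2)[OF X f v x arr' that] * by metis
qed

abbreviation "I0 \<equiv> inj_rep n (2 * top_level)"
abbreviation "I1 \<equiv> inj_rep n (2 * top_level - 1)"

text \<open>\<open>emb\<close> corresponds to the functional that reads position 1 at the socle
  vertex. \<open>corestrict\<close> corresponds to the combination with coefficients
  \<open>l1\<close> and \<open>l2\<close> of the values at the two letters: it is dual to the map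
  that defines the module, taken at level \<open>top_level\<close> instead of
  \<open>i\<close>.\<close>

definition "emb = hom_to_inj n (2 * top_level) M (%\<phi>. \<phi> 1)"
definition "corestrict = hom_to_inj n (2 * top_level - 1) I0
 (%\<phi>. l1 * \<phi> (to_nat [letter False top_level]) + l2 * \<phi> (to_nat [letter True top_level]))"

lemma emb_hom: "emb \<in> rep_hom (tq n) M I0"
 unfolding emb_def by (rule hom_to_inj_hom[OF toda_rep_model top_level(3)]) (simp add: functional_on_def)

lemma corestrict_hom: "corestrict \<in> rep_hom (tq n) I0 I1"
 unfolding corestrict_def
 by (rule hom_to_inj_hom[OF toda_rep_inj_rep top_level(4)]) (simp add: functional_on_def algebra_simps)

lemma emb_sfun: "emb (2 * top_level) sfun = inj_socle"
proof (rule inj_space_eqI)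
 show "emb (2 * top_level) sfun \<in> inj_space n (2 * top_level) (2 * top_level)"
  using rep_homD(3)[OF emb_hom top_level(3), of sfun] sfun_in by simp
 show "inj_socle \<in> inj_space n (2 * top_level) (2 * top_level)" by (rule inj_socle_in[OF top_level(3)])
 fix p :: "toda_arrow list"
 show "emb (2 * top_level) sfun (to_nat p) = inj_socle (to_nat p)"
 proof (cases p)
  case Nil
  then show ?thesis using top_level(3) by (simp add: emb_def toda_awalk_simps unit_fun_def)
 next
  case (Cons al q)
  have "fold mu q (%_. 0) = (%_. 0)" if "toda_awalk n (toda_head al) q w" for w
   using module_hom_zero[OF representation_vectorspace[OF representation_model] representation_vectorspace[OF representation_model]
     fold_rep_map[OF representation_model that], OF toda_awalk_verts[OF that]] by simp
  then show ?thesis using Cons mu_sfun[of al] by (auto simp: emb_def toda_awalk_simps)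
 qed
qed

text \<open>A nonzero difference of two vectors with equal image would be carried by some path to a
  nonzero vector in the socle of the model, where reading position 1 does not give 0.\<close>

lemma emb_mono: "emb \<in> rep_mono (tq n) M I0"
 unfolding rep_mono_def
proof (intro CollectI conjI emb_hom ballI inj_onI)
 fix v x y
 assume "v \<in> verts (tq n)" "x \<in> spc M v" "y \<in> spc M v"
  and e: "emb v x = emb v y"
 then have v: "v \<in> {1..2*n}" and xy: "x \<in> strip n i (level v)" "y \<in> strip n i (level v)" by simp_all
 define d where "d = (%k. x k - 1 * y k)"
 have d: "d \<in> spc M v" using lin_closed_diff[OF lin_closed_strip xy, of 1] by (simp add: d_def)
 show "x = y"
 proof (rule ccontr)
  assume "x ~= y"
  then have dn: "d ~= (%_. 0)" by (auto simp: d_def fun_eq_iff)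
  have z0: "~ zero (rep_space M v) ~= (%_. 0)" for v by simp
  obtain p w where p: "toda_awalk n v p w" "fold (rep_map M) p d ~= (%_. 0)"
   "!!al. al \<in> arcs (tq n) ==> toda_tail al = w ==>
    ~ rep_map M al (fold (rep_map M) p d) ~= (%_. 0)"
   using toda_rep_last[OF toda_rep_model d v, of "%v x. x ~= (%_. 0)", OF dn z0] by blast
  have z: "fold (rep_map M) p d \<in> strip n i (level w)"
   using fold_rep_map_closed[OF representation_model p(1) d] by simp
  have soc: "w = 2 * top_level" "fold mu p d 1 ~= 0"
   using model_socle[OF toda_awalk_verts(2)[OF p(1)] z p(2)] p(3) by auto
  have "x = (%k. d k + y k)" by (auto simp: d_def)
  have "emb v x = emb v (%k. d k + y k)" by (auto simp: d_def)
  also have "... = (%k. emb v d k + emb v y k)"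
   using module_hom_add[OF rep_homD(1)[OF emb_hom v] d, of y] xy by simp
  finally have "emb v d (to_nat p) = 0" using e by (auto simp: fun_eq_iff)
  then show False using p(1) soc by (simp add: emb_def)
 qed
qed

lemma emb_essential: "essential_subrep (tq n) I0 (rep_image M emb)"
proof (rule essential_if_socle[OF _ top_level(3)])
 show "subrep (tq n) I0 (rep_image M emb)"
  by (rule subrep_rep_image[OF representation_model representation_inj_rep emb_hom])
 show "inj_socle \<in> rep_image M emb (2 * top_level)"
  unfolding rep_image_def emb_sfun[symmetric] using sfun_in by simp
qed

text \<open>Relations have length 3, so values at the two letters can be prescribed freely, in
  particular with combination 1.\<close>

lemma two_letters:
 obtains \<phi> where "\<phi> \<in> inj_space n (2 * top_level) (2 * top_level - 1)"
  "l1 * \<phi> (to_nat [letter False top_level]) + l2 * \<phi> (to_nat [letter True top_level]) = 1"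
  "\<forall>p :: toda_arrow list. 2 \<le> length p --> \<phi> (to_nat p) = 0"
proof -
 obtain c1 c2 where c: "l1 * c1 + l2 * c2 = (1 :: complex)"
  using l that by (metis add_0 add.right_neutral mult_zero_right right_inverse)
 define \<phi> where "\<phi> k = (if k = to_nat [letter False top_level] then c1
   else if k = to_nat [letter True top_level] then c2 else 0)" for k
 have aw: "toda_awalk n (2 * top_level - 1) [letter y top_level] (2 * top_level)" for y
  using top_level by (intro awalk_letterI) (auto simp: toda_awalk_simps)
 have long: "\<phi> (to_nat p) = 0" if "2 \<le> length p" for p :: "toda_arrow list"
  using that by (auto simp: \<phi>_def)
 have "\<phi> \<in> inj_space n (2 * top_level) (2 * top_level - 1)"
 proof (rule inj_spaceI)
  show "toda_awalk n (2 * top_level - 1) p (2 * top_level)" if "\<phi> (to_nat p) ~= 0" for p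
   using that aw by (auto simp: \<phi>_def split: if_splits)
  show "\<phi> k = 0" if "k \<notin> range (to_nat :: toda_arrow list => nat)" for k
   using that by (auto simp: \<phi>_def)
  show "compatible n (2 * top_level - 1) (%p. \<phi> (to_nat p)) 0"
   by (rule compatible_short) (use long in simp)
 qed
 then show thesis using that[of \<phi>] c long by (simp add: \<phi>_def)
qed

lemma corestrict_essential: "essential_subrep (tq n) I1 (rep_image I0 corestrict)"
proof (rule essential_if_socle[OF _ top_level(4)])
 show "subrep (tq n) I1 (rep_image I0 corestrict)"
  by (rule subrep_rep_image[OF representation_inj_rep representation_inj_rep corestrict_hom])
 obtain \<phi> where \<phi>: "\<phi> \<in> inj_space n (2 * top_level) (2 * top_level - 1)"
  "l1 * \<phi> (to_nat [letter False top_level]) + l2 * \<phi> (to_nat [letter True top_level]) = 1"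
  "\<forall>p :: toda_arrow list. 2 \<le> length p --> \<phi> (to_nat p) = 0" by (rule two_letters)
 have "corestrict (2 * top_level - 1) \<phi> = inj_socle"
 proof (rule inj_space_eqI)
  show "corestrict (2 * top_level - 1) \<phi> \<in> inj_space n (2 * top_level - 1) (2 * top_level - 1)"
   using rep_homD(3)[OF corestrict_hom top_level(4), of \<phi>] \<phi>(1) by simp
  show "inj_socle \<in> inj_space n (2 * top_level - 1) (2 * top_level - 1)" by (rule inj_socle_in[OF top_level(4)])
  fix p :: "toda_arrow list"
  show "corestrict (2 * top_level - 1) \<phi> (to_nat p) = inj_socle (to_nat p)"
   using \<phi>(2) \<phi>(3)[rule_format, of "p @ [letter False top_level]"] \<phi>(3)[rule_format, of "p @ [letter True top_level]"] top_level(4)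
   by (cases p) (auto simp: corestrict_def fold_inj_rep_map toda_awalk_simps)
 qed
 then show "inj_socle \<in> rep_image I0 corestrict (2 * top_level - 1)"
  unfolding rep_image_def using \<phi>(1) by (metis fun_space_simps(1) imageI inj_rep_space)
qed

text \<open>The image of \<open>emb\<close> is killed because the combination of letters with
  coefficients \<open>l1\<close> and \<open>l2\<close> is zero on the model. Conversely, a kernel
  element outside the image is moved by a path until all its arrows lead into the image; then the
  obstruction \<open>\<kappa>\<close> is the value of \<open>corestrict\<close> at the trivial path,
  which is 0.\<close>

lemma corestrict_kernel:
 assumes v: "v \<in> {1..2*n}" and x: "x \<in> inj_space n (2 * top_level) v"
 shows "corestrict v x = (%_. 0) <=> x \<in> rep_image M emb v"
proof
 let ?A = "letter False top_level" and ?B = "letter True top_level"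
 have cin: "corestrict w y \<in> inj_space n (2 * top_level - 1) w"
  if "w \<in> {1..2*n}" "y \<in> inj_space n (2 * top_level) w" for w y
  using rep_homD(3)[OF corestrict_hom that(1), of y] that(2) by simp
 {
  assume "x \<in> rep_image M emb v"
  then obtain m where m: "m \<in> strip n i (level v)" "x = emb v m" by (auto simp: rep_image_def)
  show "corestrict v x = (%_. 0)"
  proof (rule inj_space_eqI[OF cin[OF v x] lin_closedD(1)[OF lin_closed_inj_space]])
   fix p :: "toda_arrow list"
   show "corestrict v x (to_nat p) = 0"
   proof (cases "toda_awalk n v p (2 * top_level - 1)")
    case True
    have aw: "toda_awalk n v (p @ [letter y top_level]) (2 * top_level)" for y
     using True top_level by (auto simp: toda_awalk_append_iff toda_awalk_simps)
    show ?thesis using True aw unfolding m(2)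
     by (simp add: corestrict_def emb_def fold_inj_rep_map model_map_letter)
   qed (simp add: corestrict_def)
  qed
 }
 assume ker: "corestrict v x = (%_. 0)"
 show "x \<in> rep_image M emb v"
 proof (rule ccontr)
  assume nx: "x \<notin> rep_image M emb v"
  \<comment> \<open>In the kernel but outside the image: some path keeps this property, after which
    every further arrow destroys it.\<close>
  let ?P = "%v x. x \<in> inj_space n (2 * top_level) v & corestrict v x = (%_. 0) & x \<notin> rep_image M emb v"
  have xc: "x \<in> spc I0 v" using x by simp
  have P0: "?P v x" using x ker nx by blast
  have z: "~ ?P w (zero (rep_space I0 w))" if "w \<in> {1..2*n}" for w
   using subrep_rep_image[OF representation_model representation_inj_rep emb_hom] that
   by (auto simp: subrep_def VectorSpace.subspace_def submodule_def)
  obtain p w where p: "toda_awalk n v p w" "?P w (fold (rep_map I0) p x)"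
   "!!al. al \<in> arcs (tq n) ==> toda_tail al = w ==>
    ~ ?P (toda_head al) (rep_map I0 al (fold (rep_map I0) p x))"
   using toda_rep_last[OF toda_rep_inj_rep xc v, of ?P, OF P0 z] by blast
  define y where "y = fold (rep_map I0) p x"
  have w: "w \<in> {1..2*n}" by (rule toda_awalk_verts(2)[OF p(1)])
  have y: "y \<in> inj_space n (2 * top_level) w" "corestrict w y = (%_. 0)" "y \<notin> rep_image M emb w"
   using p(2) unfolding y_def by blast+
  have arr: "rep_map I0 al y \<in> rep_image M emb (toda_head al)"
   if al: "al \<in> arcs (tq n)" "toda_tail al = w" for al
  proof -
   have yt: "y \<in> inj_space n (2 * top_level) (toda_tail al)" using y(1) al(2) by simp
   have "corestrict (toda_head al) (rep_map I0 al y) = rep_map I1 al (corestrict w y)"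
    using rep_homD(2)[OF corestrict_hom al(1), of y] yt al(2) by simp
   also have "... = (%_. 0)" unfolding y(2) using inj_rep_map_add(2)[of n _ al 0] by simp
   finally show ?thesis
    using p(3)[OF al] inj_rep_map_closed[OF al(1) yt] unfolding y_def[symmetric] by blast
  qed
  have yc: "y \<in> spc I0 w" using y(1) by simp
  note im = in_image_of_arrows[OF toda_rep_inj_rep emb_mono emb_essential w yc arr]
  have wt: "w = 2 * top_level - 1" using im(1) y(3) by blast
  then obtain \<kappa> where \<kappa>: "(%k. l1 * rep_map I0 ?A y k + l2 * rep_map I0 ?B y k) = emb (2 * top_level) (%k. \<kappa> * sfun k)"
   "\<kappa> = 0 --> y \<in> rep_image M emb w" using im(2) by auto
  have "emb (2 * top_level) (%k. \<kappa> * sfun k) = (%k. \<kappa> * inj_socle k)"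
   using module_hom_smult[OF rep_homD(1)[OF emb_hom top_level(3)], of \<kappa> sfun] sfun_in emb_sfun by simp
  then have "\<kappa> = l1 * y (to_nat [?A]) + l2 * y (to_nat [?B])"
   using fun_cong[OF \<kappa>(1), of "to_nat ([] :: toda_arrow list)"] by simp
  also have "... = corestrict w y (to_nat ([] :: toda_arrow list))"
   using wt w by (simp add: corestrict_def toda_awalk_simps)
  finally have "\<kappa> = 0" using y(2) by simp
  then show False using \<kappa>(2) y(3) by blast
 qed
qed

end

section \<open>Uniqueness of the multiplicities\<close>

lemma essential_subrep_cong:
 assumes E: "essential_subrep (tq n) X U" and e: "!!v. v \<in> {1..2*n} ==> U v = U' v"
 shows "essential_subrep (tq n) X U'"
 unfolding essential_subrep_def toda_quiver_simps
proof (intro conjI allI impI)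
 have s: "subrep (tq n) X U" using E by (simp add: essential_subrep_def)
 show "subrep (tq n) X U'" unfolding subrep_def toda_quiver_simps
 proof (intro conjI ballI)
  fix v assume "v \<in> {1..2*n}"
  then show "VectorSpace.subspace class_ring (U' v) (rep_space X v)"
   using s e[of v, symmetric] by (simp add: subrep_def)
 next
  fix al assume al: "al \<in> arcs (tq n)"
  then show "rep_map X al ` U' (toda_tail al) \<subseteq> U' (toda_head al)"
   using s e[OF arrow_verts(1)[OF al], symmetric] e[OF arrow_verts(2)[OF al], symmetric] by (simp add: subrep_def)
 qed
next
 fix V assume "subrep (tq n) X V & (\<exists>v\<in>{1..2 * n}. V v ~= {\<zero>\<^bsub>rep_space X v\<^esub>})"
 then have "\<exists>v\<in>{1..2 * n}. U v \<inter> V v ~= {\<zero>\<^bsub>rep_space X v\<^esub>}"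
  by (rule E[unfolded essential_subrep_def toda_quiver_simps, THEN conjunct2, THEN spec, THEN mp])
 then obtain v where v: "v \<in> {1..2 * n}" "U v \<inter> V v ~= {\<zero>\<^bsub>rep_space X v\<^esub>}" by (rule bexE)
 show "\<exists>v\<in>{1..2 * n}. U' v \<inter> V v ~= {\<zero>\<^bsub>rep_space X v\<^esub>}"
  using v(2) unfolding e[OF v(1)] using v(1) by (rule bexI)
qed

lemma extensional_singleton: "x \<in> extensional {s} ==> x = (\<lambda>k\<in>{s}. x s)"
 by (auto simp: extensional_def fun_eq_iff)

text \<open>A copresentation may use any envelopes, so a socle vector is produced abstractly, as the
  image of 1 from the simple module.\<close>

lemma envelope_socle:
 assumes j: "j \<in> {1..2*n}"
  and I: "is_injective_envelope (tq n) (tp n) (simple_rep j) I"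
 obtains e where "e \<in> spc I j" "e ~= zero (rep_space I j)"
  "!!al. al \<in> arcs (tq n) ==> toda_tail al = j ==> rep_map I al e = zero (rep_space I (toda_head al))"
proof -
 let ?S = "simple_rep j :: (complex, nat, toda_arrow) quiver_rep"
 have J: "toda_rep n I"
  using I by (simp add: is_injective_envelope_def injective_module_def jacobian_module_iff)
 then have R: "representation (tq n) I" by (simp add: toda_rep_def)
 obtain f where f: "f \<in> rep_mono (tq n) ?S I" using I by (auto simp: is_injective_envelope_def)
 then have fh: "f \<in> rep_hom (tq n) ?S I" by (simp add: rep_mono_def)
 have S: "spc ?S w = (if w = j then UNIV else {0})" "smult (rep_space ?S w) c x = c * x"
  "rep_map ?S al x = 0" for w c x al
  by (simp_all add: simple_rep_def)
 have f0: "f w 0 = zero (rep_space I w)" if w: "w \<in> {1..2*n}" for w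
 proof -
  interpret V: vectorspace class_ring "rep_space I w" by (rule representation_vectorspace[OF R w])
  have c: "f w 0 \<in> spc I w" by (rule rep_homD(3)[OF fh w]) (simp add: S)
  have "f w (0 * 0) = 0 \<odot>\<^bsub>rep_space I w\<^esub> f w 0"
   using module_hom_smult[OF rep_homD(1)[OF fh w], of 0 0] by (simp add: S)
  then show ?thesis using V.lmult_0[OF c] by simp
 qed
 have "f j 1 ~= zero (rep_space I j)"
 proof
  assume "f j 1 = zero (rep_space I j)"
  then have eq: "f j 1 = f j 0" using f0[OF j] by simp
  have ij: "inj_on (f j) (spc ?S j)" using f j by (simp add: rep_mono_def)
  show False using inj_onD[OF ij eq] by (simp add: S)
 qed
 moreover have "rep_map I al (f j 1) = zero (rep_space I (toda_head al))"
  if "al \<in> arcs (tq n)" "toda_tail al = j" for al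
  using rep_homD(2)[OF fh that(1), of 1] that(2) f0[OF arrow_verts(2)[OF that(1)]] by (simp add: S)
 moreover have "f j 1 \<in> spc I j" by (rule rep_homD(3)[OF fh j]) (simp add: S)
 ultimately show thesis using that by blast
qed

lemma rep_sum_socle:
 assumes F: "!!s. s \<in> S ==> representation (tq n) (F s)" and s: "s \<in> S" and j: "j \<in> {1..2*n}"
  and e: "e \<in> spc (F s) j"
  "!!al. al \<in> arcs (tq n) ==> toda_tail al = j ==> rep_map (F s) al e = zero (rep_space (F s) (toda_head al))"
 defines "u \<equiv> \<lambda>k\<in>S. if k = s then e else zero (rep_space (F k) j)"
 shows "u \<in> spc (rep_sum S F) j"
  and "al \<in> arcs (tq n) ==> toda_tail al = j ==>
   rep_map (rep_sum S F) al u = zero (rep_space (rep_sum S F) (toda_head al))"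
proof -
 have V: "vectorspace class_ring (rep_space (F k) w)" if "k \<in> S" "w \<in> {1..2*n}" for k w
  by (rule representation_vectorspace[OF F[OF that(1)] that(2)])
 have z: "zero (rep_space (F k) w) \<in> spc (F k) w" if "k \<in> S" "w \<in> {1..2*n}" for k w
 proof -
  interpret vectorspace class_ring "rep_space (F k) w" by (rule V[OF that])
  show ?thesis by simp
 qed
 show "u \<in> spc (rep_sum S F) j"
  using e(1) z[OF _ j] by (auto simp: u_def)
 assume al: "al \<in> arcs (tq n)" "toda_tail al = j"
 have h: "toda_head al \<in> {1..2*n}" by (rule arrow_verts(2)[OF al(1)])
 have "rep_map (F k) al (zero (rep_space (F k) j)) = zero (rep_space (F k) (toda_head al))" if "k \<in> S" for k
  by (rule module_hom_zero[OF V[OF that j] V[OF that h]]) (use rep_map_hom(1)[OF F[OF that] al(1)] al(2) in simp)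
 then have "rep_map (F k) al (u k) = zero (rep_space (F k) (toda_head al))" if "k \<in> S" for k
  using that e(2)[OF al] by (simp add: u_def)
 then show "rep_map (rep_sum S F) al u = zero (rep_space (rep_sum S F) (toda_head al))"
  unfolding rep_sum_simps by (intro restrict_ext)
qed

lemma rep_iso_inverse:
 assumes R: "representation (tq n) X" "representation (tq n) Y"
  and h: "h \<in> rep_hom (tq n) X Y"
  and b: "!!v. v \<in> {1..2*n} ==> bij_betw (h v) (spc X v) (spc Y v)"
 obtains k where "k \<in> rep_hom (tq n) Y X"
  "!!v. v \<in> {1..2*n} ==> bij_betw (k v) (spc Y v) (spc X v)"
proof -
 define k where "k v = inv_into (spc X v) (h v)" for v
 have bk: "bij_betw (k v) (spc Y v) (spc X v)" if "v \<in> {1..2*n}" for v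
  unfolding k_def by (rule bij_betw_inv_into[OF b[OF that]])
 have kc: "k v y \<in> spc X v" "h v (k v y) = y" if "v \<in> {1..2*n}" "y \<in> spc Y v" for v y
  using bij_betwE[OF bk[OF that(1)]] that b[OF that(1)] by (auto simp: k_def bij_betw_inv_into_right)
 have kh: "k v y = x" if "v \<in> {1..2*n}" "x \<in> spc X v" "h v x = y" for v x y
  using that b[OF that(1)] by (auto simp: k_def bij_betw_inv_into_left)
 have "k v \<in> module_hom class_ring (rep_space Y v) (rep_space X v)" if v: "v \<in> {1..2*n}" for v
 proof -
  interpret X: vectorspace class_ring "rep_space X v" by (rule representation_vectorspace[OF R(1) v])
  note H = rep_homD(1)[OF h v]
  have "k v (y \<oplus>\<^bsub>rep_space Y v\<^esub> z) = k v y \<oplus>\<^bsub>rep_space X v\<^esub> k v z"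
   if "y \<in> spc Y v" "z \<in> spc Y v" for y z
   using kc[OF v that(1)] kc[OF v that(2)] module_hom_add[OF H, of "k v y" "k v z"] by (intro kh[OF v]) simp_all
  moreover have "k v (c \<odot>\<^bsub>rep_space Y v\<^esub> y) = c \<odot>\<^bsub>rep_space X v\<^esub> k v y"
   if "y \<in> spc Y v" for c y
   using kc[OF v that] module_hom_smult[OF H, of c "k v y"] X.smult_closed[of c "k v y"]
   by (intro kh[OF v]) simp_all
  ultimately show ?thesis using kc(1)[OF v] by (simp add: module_hom_def)
 qed
 moreover have "k (toda_head al) (rep_map Y al y) = rep_map X al (k (toda_tail al) y)"
  if al: "al \<in> arcs (tq n)" and y: "y \<in> spc Y (toda_tail al)" for al y
 proof (rule kh[OF arrow_verts(2)[OF al]])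
  note c = kc[OF arrow_verts(1)[OF al] y]
  show "rep_map X al (k (toda_tail al) y) \<in> spc X (toda_head al)"
   by (rule rep_map_hom(2)[OF R(1) al c(1)])
  show "h (toda_head al) (rep_map X al (k (toda_tail al) y)) = rep_map Y al y"
   using rep_homD(2)[OF h al c(1)] c(2) by simp
 qed
 ultimately have "k \<in> rep_hom (tq n) Y X" by (simp add: rep_hom_def)
 then show thesis using that bk by blast
qed

text \<open>Composing the first map with the isomorphism changes neither its image nor any of the
  other data.\<close>

lemma minimal_injective_copresentation_iso:
 assumes h: "h \<in> rep_hom (tq n) X Y"
  and b: "!!v. v \<in> {1..2*n} ==> bij_betw (h v) (spc X v) (spc Y v)"
  and m: "minimal_injective_copresentation (tq n) (tp n) Y b0 a0"
 shows "minimal_injective_copresentation (tq n) (tp n) X b0 a0"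
proof -
 let ?Q = "toda_quiver n"
 obtain I f g where 1: "\<forall>j\<in>verts ?Q. is_injective_envelope ?Q (tp n) (simple_rep j) (I j)"
  and f: "f \<in> rep_mono ?Q Y (rep_multisum ?Q I b0)"
  and g: "g \<in> rep_hom ?Q (rep_multisum ?Q I b0) (rep_multisum ?Q I a0)"
  and k: "\<forall>v\<in>verts ?Q. {x \<in> spc (rep_multisum ?Q I b0) v.
      g v x = \<zero>\<^bsub>rep_space (rep_multisum ?Q I a0) v\<^esub>} = rep_image Y f v"
  and e: "essential_subrep ?Q (rep_multisum ?Q I b0) (rep_image Y f)"
  and e': "essential_subrep ?Q (rep_multisum ?Q I a0) (rep_image (rep_multisum ?Q I b0) g)"
  using m unfolding minimal_injective_copresentation_def by (elim exE conjE)
 let ?f = "%v x. f v (h v x)"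
 have im: "rep_image X ?f v = rep_image Y f v" if "v \<in> {1..2*n}" for v
 proof -
  have "h v ` spc X v = spc Y v" using b[OF that] by (simp add: bij_betw_def)
  then have "f v ` h v ` spc X v = f v ` spc Y v" by simp
  then show ?thesis unfolding rep_image_def image_image .
 qed
 have fh: "f \<in> rep_hom ?Q Y (rep_multisum ?Q I b0)" using f by (simp add: rep_mono_def)
 have "inj_on (?f v) (spc X v)" if "v \<in> {1..2*n}" for v
 proof (rule comp_inj_on[of "h v" _ "f v", unfolded comp_def])
  show "inj_on (h v) (spc X v)" using b[OF that] by (simp add: bij_betw_def)
  have "h v ` spc X v = spc Y v" using b[OF that] by (simp add: bij_betw_def)
  then show "inj_on (f v) (h v ` spc X v)" using f that by (simp add: rep_mono_def)
 qed
 then have 2: "?f \<in> rep_mono ?Q X (rep_multisum ?Q I b0)"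
  using rep_hom_compose[OF h fh] by (simp add: rep_mono_def)
 have 3: "essential_subrep ?Q (rep_multisum ?Q I b0) (rep_image X ?f)"
  by (rule essential_subrep_cong[OF e]) (simp add: im)
 have 4: "\<forall>v\<in>verts ?Q. {x \<in> spc (rep_multisum ?Q I b0) v.
      g v x = \<zero>\<^bsub>rep_space (rep_multisum ?Q I a0) v\<^esub>} = rep_image X ?f v"
  using k im by simp
 show ?thesis unfolding minimal_injective_copresentation_def
  by (intro exI[of _ I] exI[of _ ?f] exI[of _ g] conjI 1 2 g 4 3 e')
qed

context toda_data
begin

abbreviation "mic \<equiv> minimal_injective_copresentation (tq n) (tp n) M"

lemma multisum_single:
 assumes "v \<in> {1..2*n}"
 shows "rep_multisum (tq n) I (%w. if w = v then 1 else 0) = rep_sum {(v, 0)} (%(j, k). I j)"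
proof -
 have "{(j, k). j \<in> verts (tq n) & k < (if j = v then 1 else 0 :: nat)} = {(v, 0)}"
  using assms by (auto split: if_splits)
 then show ?thesis by (simp add: rep_multisum_def)
qed

lemma mic_model: "mic (%v. if v = 2 * top_level then 1 else 0) (%v. if v = 2 * top_level - 1 then 1 else 0)"
proof -
 let ?Q = "toda_quiver n" and ?F = "%(j, k :: nat). inj_rep n j"
 let ?s = "(2 * top_level, 0 :: nat)" and ?t = "(2 * top_level - 1, 0 :: nat)"
 let ?X = "rep_sum {?s} ?F" and ?Y = "rep_sum {?t} ?F"
 let ?f = "%v m. \<lambda>k\<in>{?s}. emb v m" and ?g = "%v x. \<lambda>k\<in>{?t}. corestrict v (x ?s)"
 have f: "?f \<in> rep_hom ?Q M ?X"
  by (rule rep_hom_into_single) (simp add: emb_hom)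
 have g: "?g \<in> rep_hom ?Q ?X ?Y"
 proof (rule rep_hom_into_single)
  have "(%w y. y ?s) \<in> rep_hom ?Q ?X (?F ?s)"
   by (rule rep_hom_component) (auto simp: representation_inj_rep)
  then have "(%w y. y ?s) \<in> rep_hom ?Q ?X I0" by simp
  from rep_hom_compose[OF this corestrict_hom]
  show "(%v x. corestrict v (x ?s)) \<in> rep_hom ?Q ?X (?F ?t)" by simp
 qed
 have fm: "?f \<in> rep_mono ?Q M ?X"
  unfolding rep_mono_def
 proof (intro CollectI conjI f ballI inj_onI)
  fix v x y assume v: "v \<in> verts ?Q" and xy: "x \<in> spc M v" "y \<in> spc M v"
   and e: "(\<lambda>k\<in>{?s}. emb v x) = (\<lambda>k\<in>{?s}. emb v y)"
  have "emb v x = emb v y" using fun_cong[OF e, of ?s] by simp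
  moreover have "inj_on (emb v) (spc M v)" using emb_mono v by (simp add: rep_mono_def)
  ultimately show "x = y" using xy by (simp add: inj_on_def)
 qed
 have imf: "rep_image M ?f v = (%x. \<lambda>k\<in>{?s}. x) ` rep_image M emb v" for v
  by (simp add: rep_image_def image_image)
 have Xc: "spc ?X v = (%x. \<lambda>k\<in>{?s}. x) ` inj_space n (2 * top_level) v" for v
 proof (intro equalityI subsetI)
  fix x assume x: "x \<in> spc ?X v"
  have x1: "x ?s \<in> inj_space n (2 * top_level) v" using PiE_mem[OF x[unfolded rep_sum_simps], of ?s] by simp
  have "x \<in> extensional {?s}" using x[unfolded rep_sum_simps] unfolding PiE_def by (rule IntD2)
  then have x2: "x = (\<lambda>k\<in>{?s}. x ?s)" by (rule extensional_singleton)
  show "x \<in> (%x. \<lambda>k\<in>{?s}. x) ` inj_space n (2 * top_level) v" by (rule image_eqI) (rule x2, rule x1)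
 next
  fix x assume "x \<in> (%x. \<lambda>k\<in>{?s}. x) ` inj_space n (2 * top_level) v"
  then obtain y where y: "y \<in> inj_space n (2 * top_level) v" "x = (\<lambda>k\<in>{?s}. y)" by (rule imageE)
  show "x \<in> spc ?X v" unfolding rep_sum_simps y(2)
   by (rule restrict_PiE_iff[THEN iffD2]) (use y(1) in simp)
 qed
 have img: "rep_image ?X ?g v = (%x. \<lambda>k\<in>{?t}. x) ` rep_image I0 corestrict v" for v
  unfolding rep_image_def Xc by (simp add: image_image)
 have ker: "\<forall>v\<in>verts ?Q. {x \<in> spc ?X v. ?g v x = \<zero>\<^bsub>rep_space ?Y v\<^esub>} = rep_image M ?f v"
 proof
  fix v assume v: "v \<in> verts ?Q"
  have eq: "(\<lambda>k\<in>{?t}. y) = (\<lambda>k\<in>{?t}. z) <=> y = z" for y z :: univ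
   by (metis restrict_apply' singletonI)
  have "?g v (\<lambda>k\<in>{?s}. x) = \<zero>\<^bsub>rep_space ?Y v\<^esub> <=> x \<in> rep_image M emb v"
   if "x \<in> inj_space n (2 * top_level) v" for x
  proof -
   have "\<zero>\<^bsub>rep_space ?Y v\<^esub> = (\<lambda>k\<in>{?t}. (%_. 0))"
    unfolding rep_sum_simps by (rule restrict_ext) simp
   then show ?thesis using corestrict_kernel[OF _ that] v eq[of "corestrict v x" "%_. 0"] by simp
  qed
  moreover have "rep_image M emb v \<subseteq> inj_space n (2 * top_level) v"
   using rep_homD(3)[OF emb_hom, of v] v by (auto simp: rep_image_def)
  ultimately show "{x \<in> spc ?X v. ?g v x = \<zero>\<^bsub>rep_space ?Y v\<^esub>} = rep_image M ?f v"
   unfolding imf Xc by blast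
 qed
 have ef: "essential_subrep ?Q ?X (rep_image M ?f)"
  unfolding imf[abs_def] by (rule essential_single) (simp_all add: representation_inj_rep emb_essential)
 have eg: "essential_subrep ?Q ?Y (rep_image ?X ?g)"
  unfolding img[abs_def] by (rule essential_single) (simp_all add: representation_inj_rep corestrict_essential)
 have env: "\<forall>j\<in>verts ?Q. is_injective_envelope ?Q (tp n) (simple_rep j) (inj_rep n j)"
  using injective_envelope_inj_rep by simp
 show ?thesis unfolding minimal_injective_copresentation_def
  by (rule exI[of _ "inj_rep n"], rule exI[of _ ?f], rule exI[of _ ?g],
    unfold multisum_single[OF top_level(3)] multisum_single[OF top_level(4)])
   (rule conjI[OF env conjI[OF fm conjI[OF g conjI[OF ker conjI[OF ef eg]]]]])
qed

text \<open>Pulled back along the injective \<open>f\<close>, a vector killed by all arrows lies in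
  the socle of the model.\<close>

lemma model_sub:
 assumes X: "toda_rep n X" and f: "f \<in> rep_mono (tq n) M X" and v: "v \<in> {1..2*n}"
  and u: "u \<in> rep_image M f v" "u ~= zero (rep_space X v)"
  and k: "!!al. al \<in> arcs (tq n) ==> toda_tail al = v ==> rep_map X al u = zero (rep_space X (toda_head al))"
 shows "v = 2 * top_level & (EX c. c ~= 0 & u = f v (%k. c * sfun k))"
proof -
 have RX: "representation (tq n) X" using X by (simp add: toda_rep_def)
 have fh: "f \<in> rep_hom (tq n) M X" using f by (simp add: rep_mono_def)
 have f0: "f w (%_. 0) = zero (rep_space X w)" if "w \<in> {1..2*n}" for w
  using module_hom_zero[OF vectorspace_fun_space[OF lin_closed_strip] representation_vectorspace[OF RX that], of "f w"]
   rep_homD(1)[OF fh that] by simp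
 have finj: "a = b" if "f w a = f w b" "a \<in> strip n i (level w)" "b \<in> strip n i (level w)" "w \<in> {1..2*n}" for a b w
  using f that unfolding rep_mono_def inj_on_def by auto
 obtain m where m: "m \<in> strip n i (level v)" "u = f v m" using u(1) by (auto simp: rep_image_def)
 have m0: "m ~= (%_. 0)" using m(2) u(2) f0[OF v] by auto
 have mk: "mu al m = (%_. 0)" if al: "al \<in> arcs (tq n)" "toda_tail al = v" for al
 proof (rule finj[of "toda_head al"])
  show "f (toda_head al) (mu al m) = f (toda_head al) (%_. 0)"
   using rep_homD(2)[OF fh al(1), of m] m al(2) k[OF al] f0[OF arrow_verts(2)[OF al(1)]] by simp
  show "mu al m \<in> strip n i (level (toda_head al))" using model_mu_closed[OF al(1)] m(1) al(2) by simp
  show "(%_. 0) \<in> strip n i (level (toda_head al))" by (rule lin_closedD(1)[OF lin_closed_strip])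
  show "toda_head al \<in> {1..2*n}" by (rule arrow_verts(2)[OF al(1)])
 qed
 note ms = model_socle[OF v m(1) m0 mk]
 have "u = f v (%k. m 1 * sfun k)" unfolding m(2) using arg_cong[OF ms(2), of "f v"] .
 then show ?thesis using ms by blast
qed

end

context toda_data
begin

lemma sfun_nonzero: "sfun ~= (%_. 0)"
proof
 assume "sfun = (%_. 0)"
 from fun_cong[OF this, of 1] show False by (simp add: unit_fun_def)
qed

text \<open>The socle vectors of the summands are independent. Those of the first term lie in the
  essential image of the model, hence in its one-dimensional socle. Those of the second term have
  preimages with nonzero obstruction \<open>\<kappa>\<close>, and two such preimages could be
  combined to obstruction 0. Both terms are nonzero, the second because the model is not
  injective.\<close>

lemma mic_unique:
 assumes m: "mic b a" and v: "v \<in> {1..2*n}"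
 shows "b v = (if v = 2 * top_level then 1 else 0)" "a v = (if v = 2 * top_level - 1 then 1 else 0)"
proof -
 let ?Q = "toda_quiver n" and ?t = "2 * top_level"
 obtain I f g where env: "\<forall>j\<in>verts ?Q. is_injective_envelope ?Q (tp n) (simple_rep j) (I j)"
  and f: "f \<in> rep_mono ?Q M (rep_multisum ?Q I b)"
  and g: "g \<in> rep_hom ?Q (rep_multisum ?Q I b) (rep_multisum ?Q I a)"
  and ker: "\<forall>v\<in>verts ?Q. {x \<in> spc (rep_multisum ?Q I b) v.
      g v x = \<zero>\<^bsub>rep_space (rep_multisum ?Q I a) v\<^esub>} = rep_image M f v"
  and ess: "essential_subrep ?Q (rep_multisum ?Q I b) (rep_image M f)"
  and ess': "essential_subrep ?Q (rep_multisum ?Q I a) (rep_image (rep_multisum ?Q I b) g)"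
  using m unfolding minimal_injective_copresentation_def by (elim exE conjE)
 define F where "F = (%(j, k :: nat). I j)"
 define B where "B = {(j, k). j \<in> verts ?Q & k < b j}"
 define A where "A = {(j, k). j \<in> verts ?Q & k < a j}"
 define X where "X = rep_sum B F"
 define Y where "Y = rep_sum A F"
 have XY: "rep_multisum ?Q I b = X" "rep_multisum ?Q I a = Y"
  by (simp_all add: X_def Y_def rep_multisum_def A_def B_def F_def)
 note f = f[unfolded XY] and g = g[unfolded XY] and ker = ker[unfolded XY] and ess = ess[unfolded XY]
  and ess' = ess'[unfolded XY]
 have inj: "injective_module ?Q (tp n) (I j)" if "j \<in> {1..2*n}" for j
  using env that by (simp add: is_injective_envelope_def)
 have TI: "toda_rep n (I j)" if "j \<in> {1..2*n}" for j
  using inj[OF that] by (simp add: injective_module_def jacobian_module_iff)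
 have TF: "toda_rep n (F s)" if "s \<in> A \<union> B" for s
  using that TI by (auto simp: A_def B_def F_def)
 have RF: "representation ?Q (F s)" if "s \<in> A \<union> B" for s
  using TF[OF that] by (simp add: toda_rep_def)
 have TX: "toda_rep n X" unfolding X_def by (rule toda_rep_rep_sum) (rule TF, simp)
 have TY: "toda_rep n Y" unfolding Y_def by (rule toda_rep_rep_sum) (rule TF, simp)
 have RX: "representation ?Q X" and RY: "representation ?Q Y" using TX TY by (simp_all add: toda_rep_def)
 have fh: "f \<in> rep_hom ?Q M X" using f by (simp add: rep_mono_def)
 have f0: "f w (%_. 0) = zero (rep_space X w)" if "w \<in> {1..2*n}" for w
  using module_hom_zero[OF vectorspace_fun_space[OF lin_closed_strip] representation_vectorspace[OF RX that], of "f w"]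
   rep_homD(1)[OF fh that] by simp
 have finj: "p = q" if "f w p = f w q" "p \<in> strip n i (level w)" "q \<in> strip n i (level w)" "w \<in> {1..2*n}" for p q w
  using f that unfolding rep_mono_def inj_on_def by auto
 have g0: "g w (zero (rep_space X w)) = zero (rep_space Y w)" if "w \<in> {1..2*n}" for w
  by (rule module_hom_zero[OF representation_vectorspace[OF RX that] representation_vectorspace[OF RY that] rep_homD(1)[OF g that]])
 have kerD: "x \<in> rep_image M f w <=> g w x = zero (rep_space Y w)"
  if "w \<in> {1..2*n}" "x \<in> spc X w" for x w
  using ker[rule_format, of w] that by auto
 have "EX e. e \<in> spc (I j) j & e ~= zero (rep_space (I j) j) &
   (ALL al. al \<in> arcs ?Q --> toda_tail al = j --> rep_map (I j) al e = zero (rep_space (I j) (toda_head al)))"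
  if j: "j \<in> {1..2*n}" for j
 proof -
  have E: "is_injective_envelope ?Q (tp n) (simple_rep j) (I j)" using env j by simp
  show ?thesis by (rule envelope_socle[OF j E]) blast
 qed
 then have "EX e. ALL j. j \<in> {1..2*n} --> e j \<in> spc (I j) j & e j ~= zero (rep_space (I j) j) &
   (ALL al. al \<in> arcs ?Q --> toda_tail al = j --> rep_map (I j) al (e j) = zero (rep_space (I j) (toda_head al)))"
  by (intro choice allI) blast
 then obtain e where e0: "ALL j. j \<in> {1..2*n} --> e j \<in> spc (I j) j & e j ~= zero (rep_space (I j) j) &
   (ALL al. al \<in> arcs ?Q --> toda_tail al = j --> rep_map (I j) al (e j) = zero (rep_space (I j) (toda_head al)))"
  by (rule exE)
 have e: "e j \<in> spc (I j) j" "e j ~= zero (rep_space (I j) j)"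
  "!!al. al \<in> arcs ?Q ==> toda_tail al = j ==> rep_map (I j) al (e j) = zero (rep_space (I j) (toda_head al))"
  if "j \<in> {1..2*n}" for j
  using e0[rule_format, OF that] by simp_all
 \<comment> \<open>The socle vector of the summand \<open>(j, k)\<close>, extended by zero to the
   other summands.\<close>
 define u where "u S j k = (\<lambda>s\<in>S. if s = (j, k) then e j else zero (rep_space (F s) j))" for S j and k :: nat
 have Fjk: "F (j, k) = I j" for j k by (simp add: F_def)
 have soc: "u S j k \<in> spc (rep_sum S F) j" "u S j k ~= zero (rep_space (rep_sum S F) j)"
  "!!al. al \<in> arcs ?Q ==> toda_tail al = j ==> rep_map (rep_sum S F) al (u S j k) = zero (rep_space (rep_sum S F) (toda_head al))"
  if S: "S = A \<or> S = B" and s: "(j, k) \<in> S" and j: "j \<in> {1..2*n}" for S j k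
 proof -
  have R: "representation ?Q (F s)" if "s \<in> S" for s using RF[of s] that S by blast
  have e': "e j \<in> carrier (rep_space (F (j, k)) j)"
   "!!al. al \<in> arcs ?Q ==> toda_tail al = j ==> rep_map (F (j, k)) al (e j) = zero (rep_space (F (j, k)) (toda_head al))"
   unfolding Fjk using e[OF j] by simp_all
  show "u S j k \<in> spc (rep_sum S F) j" unfolding u_def
   by (rule rep_sum_socle(1)[where F = F and S = S and s = "(j, k)", OF R s j e'])
  show "rep_map (rep_sum S F) al (u S j k) = zero (rep_space (rep_sum S F) (toda_head al))"
   if "al \<in> arcs ?Q" "toda_tail al = j" for al
   unfolding u_def by (rule rep_sum_socle(2)[where F = F and S = S and s = "(j, k)", OF R s j e' that])
  show "u S j k ~= zero (rep_space (rep_sum S F) j)"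
  proof
   assume "u S j k = zero (rep_space (rep_sum S F) j)"
   then have "u S j k (j, k) = zero (rep_space (F (j, k)) j)" using s by simp
   then show False using e(2)[OF j] s by (simp add: u_def Fjk)
  qed
 qed
 have AB: "j \<in> {1..2*n}" if "(j, k) \<in> A \<or> (j, k) \<in> B" for j k using that by (auto simp: A_def B_def)
 have Bt: "j = ?t & (EX c. c ~= 0 & u B j k = f j (%p. c * sfun p))" if s: "(j, k) \<in> B" for j k
 proof -
  have j: "j \<in> {1..2*n}" using AB s by blast
  note so = soc[OF disjI2[OF refl] s j, folded X_def]
  have "u B j k \<in> rep_image M f j" by (rule socle_in_essential[OF RX ess j so(1,3)])
  from model_sub[OF TX f j this so(2,3)] show ?thesis .
 qed
 have cs: "(%p. c * sfun p) \<in> strip n i top_level" for c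
  by (rule lin_closedD(3)[OF lin_closed_strip sfun_in])
 have fs: "c \<odot>\<^bsub>rep_space X ?t\<^esub> f ?t (%p. d * sfun p) = f ?t (%p. c * d * sfun p)" for c d
  using module_hom_smult[OF rep_homD(1)[OF fh top_level(3)], of c "%p. d * sfun p"] cs[of d]
  by (simp add: mult.assoc)
 \<comment> \<open>Two socle vectors of the first term would be multiples of the same vector
   although they are supported in different summands.\<close>
 have Bk: "k = k'" if s: "(?t, k) \<in> B" "(?t, k') \<in> B" for k k'
 proof (rule ccontr)
  assume k: "k ~= k'"
  obtain c where c: "c ~= 0" "u B ?t k = f ?t (%p. c * sfun p)" using Bt[OF s(1)] by blast
  obtain d where d: "d ~= 0" "u B ?t k' = f ?t (%p. d * sfun p)" using Bt[OF s(2)] by blast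
  have "c \<odot>\<^bsub>rep_space X ?t\<^esub> u B ?t k' = d \<odot>\<^bsub>rep_space X ?t\<^esub> u B ?t k"
   unfolding c(2) d(2) fs by (simp add: mult.commute)
  then have "(c \<odot>\<^bsub>rep_space X ?t\<^esub> u B ?t k') (?t, k') = (d \<odot>\<^bsub>rep_space X ?t\<^esub> u B ?t k) (?t, k')" by simp
  then have eq: "c \<odot>\<^bsub>rep_space (I ?t) ?t\<^esub> e ?t = d \<odot>\<^bsub>rep_space (I ?t) ?t\<^esub> zero (rep_space (I ?t) ?t)"
   using s k by (simp add: X_def u_def Fjk)
  interpret V: vectorspace class_ring "rep_space (I ?t) ?t"
   by (rule representation_vectorspace[OF _ top_level(3)]) (use TI[OF top_level(3)] in \<open>simp add: toda_rep_def\<close>)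
  have z: "c \<odot>\<^bsub>rep_space (I ?t) ?t\<^esub> e ?t = zero (rep_space (I ?t) ?t)" using eq V.smult_r_null[of d] by simp
  have "inverse c \<odot>\<^bsub>rep_space (I ?t) ?t\<^esub> (c \<odot>\<^bsub>rep_space (I ?t) ?t\<^esub> e ?t) = e ?t"
   using V.smult_assoc1[of "inverse c" c "e ?t"] V.smult_one[of "e ?t"] e(1)[OF top_level(3)] c(1)
   by (simp add: class_ring_simps)
  then show False using z V.smult_r_null[of "inverse c"] e(2)[OF top_level(3)] by simp
 qed
 have "B ~= {}"
 proof
  assume "B = {}"
  then have "f ?t sfun = zero (rep_space X ?t)"
   using rep_homD(3)[OF fh top_level(3), of sfun] sfun_in by (simp add: X_def restrict_def)
  then have "sfun = (%_. 0)" using finj[of ?t sfun "%_. 0"] f0[OF top_level(3)] sfun_in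
    lin_closedD(1)[OF lin_closed_strip] top_level(3) by simp
  then show False using sfun_nonzero by simp
 qed
 then obtain j0 k0 where jk: "(j0, k0) \<in> B" by auto
 have bpos: "b ?t > 0" using Bt[OF jk] jk by (auto simp: B_def)
 have t0: "(?t, 0) \<in> B" using bpos top_level(3) by (simp add: B_def)
 have b1: "b ?t = 1"
 proof (rule ccontr)
  assume "b ?t ~= 1"
  then have "(?t, 1) \<in> B" using bpos top_level(3) by (simp add: B_def)
  from Bk[OF t0 this] show False by simp
 qed
 have B1: "B = {(?t, 0)}"
 proof (intro equalityI subsetI)
  fix s assume "s \<in> B"
  then show "s \<in> {(?t, 0)}" using Bt[of "fst s" "snd s"] b1 by (cases s) (simp add: B_def)
 qed (use t0 in simp)
 show "b v = (if v = ?t then 1 else 0)"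
 proof (cases "v = ?t")
  case False
  have "b v = 0"
  proof (rule ccontr)
   assume "b v ~= 0"
   then have "(v, 0) \<in> B" using v by (simp add: B_def)
   then show False using Bt[of v 0] False by simp
  qed
  then show ?thesis using False by simp
 qed (use b1 in simp)
 let ?s = "2 * top_level - 1"
 let ?l = "%x. l1 \<odot>\<^bsub>rep_space X ?t\<^esub> rep_map X (letter False top_level) x
   \<oplus>\<^bsub>rep_space X ?t\<^esub> l2 \<odot>\<^bsub>rep_space X ?t\<^esub> rep_map X (letter True top_level) x"
 \<comment> \<open>A preimage \<open>x\<close> of a socle vector of the second term is not in the
   image of the model though all its arrows lead there, so its obstruction is nonzero.\<close>
 have At: "j = ?s & (\<exists>x \<kappa>. x \<in> spc X ?s & g ?s x = u A ?s k & \<kappa> ~= 0 &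
   ?l x = f ?t (%p. \<kappa> * sfun p) &
   (\<forall>al\<in>arcs ?Q. toda_tail al = ?s --> rep_map X al x \<in> rep_image M f (toda_head al)))" if s: "(j, k) \<in> A" for j k
 proof -
  have j: "j \<in> {1..2*n}" using AB s by blast
  note so = soc[OF disjI1[OF refl] s j, folded Y_def]
  have "u A j k \<in> rep_image X g j" by (rule socle_in_essential[OF RY ess' j so(1,3)])
  then obtain x where x: "x \<in> spc X j" "g j x = u A j k" by (auto simp: rep_image_def)
  have arr: "rep_map X al x \<in> rep_image M f (toda_head al)" if al: "al \<in> arcs ?Q" "toda_tail al = j" for al
  proof -
   have xt: "x \<in> spc X (toda_tail al)" using x(1) al(2) by simp
   have "g (toda_head al) (rep_map X al x) = zero (rep_space Y (toda_head al))"
    using rep_homD(2)[OF g al(1) xt] x(2) so(3)[OF al] al(2) by simp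
   then show ?thesis using kerD[OF arrow_verts(2)[OF al(1)] rep_map_hom(2)[OF RX al(1) xt]] by blast
  qed
  have nx: "x \<notin> rep_image M f j" using kerD[OF j x(1)] x(2) so(2) by simp
  note im = in_image_of_arrows[OF TX f ess j x(1) arr]
  have js: "j = ?s" using im(1) nx by blast
  have "\<exists>\<kappa>. ?l x = f ?t (%p. \<kappa> * sfun p) & (\<kappa> = 0 --> x \<in> rep_image M f j)"
   by (rule in_image_of_arrows(2)[OF TX f ess j x(1) _ js]) (rule arr)
  then obtain \<kappa> where "?l x = f ?t (%p. \<kappa> * sfun p)" "\<kappa> = 0 --> x \<in> rep_image M f j"
   by (elim exE conjE)
  then show ?thesis using js nx x arr by blast
 qed
 have Ak: "k = k'" if s: "(?s, k) \<in> A" "(?s, k') \<in> A" for k k'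
 proof (rule ccontr)
  assume k: "k ~= k'"
  obtain x \<kappa> where x: "x \<in> spc X ?s" "g ?s x = u A ?s k" "\<kappa> ~= 0" "?l x = f ?t (%p. \<kappa> * sfun p)"
   "\<forall>al\<in>arcs ?Q. toda_tail al = ?s --> rep_map X al x \<in> rep_image M f (toda_head al)"
   using At[OF s(1)] by blast
  obtain y \<eta> where y: "y \<in> spc X ?s" "g ?s y = u A ?s k'" "\<eta> ~= 0" "?l y = f ?t (%p. \<eta> * sfun p)"
   "\<forall>al\<in>arcs ?Q. toda_tail al = ?s --> rep_map X al y \<in> rep_image M f (toda_head al)"
   using At[OF s(2)] by blast
  interpret V: vectorspace class_ring "rep_space X ?s" by (rule representation_vectorspace[OF RX top_level(4)])
  interpret U: vectorspace class_ring "rep_space X ?t" by (rule representation_vectorspace[OF RX top_level(3)])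
  \<comment> \<open>The combination in which the obstructions of \<open>x\<close> and
    \<open>y\<close> cancel.\<close>
  let ?z = "\<eta> \<odot>\<^bsub>rep_space X ?s\<^esub> x \<oplus>\<^bsub>rep_space X ?s\<^esub> (- \<kappa>) \<odot>\<^bsub>rep_space X ?s\<^esub> y"
  have c: "\<eta> \<odot>\<^bsub>rep_space X ?s\<^esub> x \<in> spc X ?s" "(- \<kappa>) \<odot>\<^bsub>rep_space X ?s\<^esub> y \<in> spc X ?s"
   using V.smult_closed[of \<eta> x] V.smult_closed[of "- \<kappa>" y] x(1) y(1) by simp_all
  have zc: "?z \<in> spc X ?s" using c by (rule V.a_closed)
  have hz: "h ?z = \<eta> \<odot>\<^bsub>W\<^esub> h x \<oplus>\<^bsub>W\<^esub> (- \<kappa>) \<odot>\<^bsub>W\<^esub> h y"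
   if "h \<in> module_hom class_ring (rep_space X ?s) W" for h and W :: "(complex, nat \<times> nat => univ) module"
   using module_hom_add[OF that c] module_hom_smult[OF that, of \<eta> x] module_hom_smult[OF that, of "- \<kappa>" y] x(1) y(1)
   by simp
  have sub: "subrep ?Q X (rep_image M f)" using ess by (simp add: essential_subrep_def)
  have arr: "rep_map X al ?z \<in> rep_image M f (toda_head al)" if al: "al \<in> arcs ?Q" "toda_tail al = ?s" for al
  proof -
   have "VectorSpace.subspace class_ring (rep_image M f (toda_head al)) (rep_space X (toda_head al))"
    using sub arrow_verts(2)[OF al(1)] by (simp add: subrep_def)
   then have sm: "submodule class_ring (rep_image M f (toda_head al)) (rep_space X (toda_head al))"
    by (simp add: VectorSpace.subspace_def)
   have "rep_map X al \<in> module_hom class_ring (rep_space X ?s) (rep_space X (toda_head al))"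
    using rep_map_hom(1)[OF RX al(1)] al(2) by simp
   then have e: "rep_map X al ?z = \<eta> \<odot>\<^bsub>rep_space X (toda_head al)\<^esub> rep_map X al x
     \<oplus>\<^bsub>rep_space X (toda_head al)\<^esub> (- \<kappa>) \<odot>\<^bsub>rep_space X (toda_head al)\<^esub> rep_map X al y"
    by (rule hz)
   have im: "rep_map X al x \<in> rep_image M f (toda_head al)" "rep_map X al y \<in> rep_image M f (toda_head al)"
    using x(5) y(5) al by blast+
   show ?thesis unfolding e
    by (rule submodule.m_closed[OF sm submodule.smult_closed[OF sm _ im(1)] submodule.smult_closed[OF sm _ im(2)]])
     simp_all
  qed
  have "\<exists>\<theta>. ?l ?z = f ?t (%p. \<theta> * sfun p) & (\<theta> = 0 --> ?z \<in> rep_image M f ?s)"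
   by (rule in_image_of_arrows(2)[OF TX f ess top_level(4) zc _ refl]) (rule arr)
  then obtain \<theta> where \<theta>: "?l ?z = f ?t (%p. \<theta> * sfun p)" "\<theta> = 0 --> ?z \<in> rep_image M f ?s"
   by (elim exE conjE)
  have lh: "?l \<in> module_hom class_ring (rep_space X ?s) (rep_space X ?t)"
  proof -
   have h: "rep_map X (letter y top_level) \<in> module_hom class_ring (rep_space X ?s) (rep_space X ?t)" for y
    using rep_map_hom(1)[OF RX, of "letter y top_level"] top_level(1,2) by simp
   have hc: "rep_map X (letter y top_level) w \<in> spc X ?t" if "w \<in> spc X ?s" for y w
    using h[of y] that by (auto simp: module_hom_def)
   have lc: "d \<odot>\<^bsub>rep_space X ?t\<^esub> rep_map X (letter y top_level) w \<in> spc X ?t"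
    if "w \<in> spc X ?s" for d y w
    using U.smult_closed[of d] hc[OF that] by simp
   show ?thesis unfolding module_hom_def
   proof (intro CollectI conjI allI impI)
    show "?l \<in> spc X ?s \<rightarrow> spc X ?t" using lc U.a_closed by simp
   next
    fix w w' assume w: "w \<in> spc X ?s & w' \<in> spc X ?s"
    then show "?l (w \<oplus>\<^bsub>rep_space X ?s\<^esub> w') = ?l w \<oplus>\<^bsub>rep_space X ?t\<^esub> ?l w'"
     using module_hom_add[OF h, of w w'] hc U.smult_r_distr lc by (simp add: U.a_ac)
   next
    fix d :: complex and w assume w: "d \<in> carrier class_ring & w \<in> spc X ?s"
    then show "?l (d \<odot>\<^bsub>rep_space X ?s\<^esub> w) = d \<odot>\<^bsub>rep_space X ?t\<^esub> ?l w"
     using module_hom_smult[OF h, of d w] hc lc U.smult_r_distr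
      U.smult_assoc1[of l1 d] U.smult_assoc1[of d l1] U.smult_assoc1[of l2 d] U.smult_assoc1[of d l2]
     by (simp add: class_ring_simps mult.commute)
   qed
  qed
  have "?l ?z = \<eta> \<odot>\<^bsub>rep_space X ?t\<^esub> ?l x \<oplus>\<^bsub>rep_space X ?t\<^esub> (- \<kappa>) \<odot>\<^bsub>rep_space X ?t\<^esub> ?l y"
   by (rule hz[OF lh])
  also have "... = f ?t (%p. \<eta> * \<kappa> * sfun p) \<oplus>\<^bsub>rep_space X ?t\<^esub> f ?t (%p. - \<kappa> * \<eta> * sfun p)"
   unfolding x(4) y(4) fs ..
  also have "... = f ?t (%p. \<eta> * \<kappa> * sfun p + - \<kappa> * \<eta> * sfun p)"
   using module_hom_add[OF rep_homD(1)[OF fh top_level(3)], of "%p. \<eta> * \<kappa> * sfun p" "%p. - \<kappa> * \<eta> * sfun p"]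
    cs[of "\<eta> * \<kappa>"] cs[of "- \<kappa> * \<eta>"] by simp
  also have "(%p. \<eta> * \<kappa> * sfun p + - \<kappa> * \<eta> * sfun p) = (%_. 0)" by (simp add: fun_eq_iff)
  finally have "f ?t (%p. \<theta> * sfun p) = f ?t (%_. 0)" unfolding \<theta>(1) .
  then have "(%p. \<theta> * sfun p) = (%_. 0)"
   using finj[of ?t "%p. \<theta> * sfun p" "%_. 0"] cs[of \<theta>] lin_closedD(1)[OF lin_closed_strip] top_level(3) by simp
  from fun_cong[OF this, of 1] have "\<theta> = 0" by (simp add: unit_fun_def)
  then have "g ?s ?z = zero (rep_space Y ?s)" using \<theta>(2) kerD[OF top_level(4) zc] by blast
  moreover have "g ?s ?z = \<eta> \<odot>\<^bsub>rep_space Y ?s\<^esub> g ?s x \<oplus>\<^bsub>rep_space Y ?s\<^esub> (- \<kappa>) \<odot>\<^bsub>rep_space Y ?s\<^esub> g ?s y"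
   using module_hom_add[OF rep_homD(1)[OF g top_level(4)] c]
    module_hom_smult[OF rep_homD(1)[OF g top_level(4)], of \<eta> x]
    module_hom_smult[OF rep_homD(1)[OF g top_level(4)], of "- \<kappa>" y] x(1) y(1) by simp
  ultimately have "(\<eta> \<odot>\<^bsub>rep_space Y ?s\<^esub> u A ?s k \<oplus>\<^bsub>rep_space Y ?s\<^esub> (- \<kappa>) \<odot>\<^bsub>rep_space Y ?s\<^esub> u A ?s k') (?s, k) =
    zero (rep_space Y ?s) (?s, k)"
   unfolding x(2) y(2) by simp
  then have eq: "\<eta> \<odot>\<^bsub>rep_space (I ?s) ?s\<^esub> e ?s \<oplus>\<^bsub>rep_space (I ?s) ?s\<^esub> (- \<kappa>) \<odot>\<^bsub>rep_space (I ?s) ?s\<^esub> zero (rep_space (I ?s) ?s) =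
    zero (rep_space (I ?s) ?s)"
   using s k by (simp add: Y_def u_def Fjk)
  interpret J: vectorspace class_ring "rep_space (I ?s) ?s"
   by (rule representation_vectorspace[OF _ top_level(4)]) (use TI[OF top_level(4)] in \<open>simp add: toda_rep_def\<close>)
  note e4 = e[OF top_level(4)]
  have "\<eta> \<odot>\<^bsub>rep_space (I ?s) ?s\<^esub> e ?s \<in> spc (I ?s) ?s" using J.smult_closed[of \<eta>] e4(1) by simp
  then have z: "\<eta> \<odot>\<^bsub>rep_space (I ?s) ?s\<^esub> e ?s = zero (rep_space (I ?s) ?s)"
   using eq J.smult_r_null[of "- \<kappa>"] by simp
  have "inverse \<eta> \<odot>\<^bsub>rep_space (I ?s) ?s\<^esub> (\<eta> \<odot>\<^bsub>rep_space (I ?s) ?s\<^esub> e ?s) = e ?s"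
   using J.smult_assoc1[of "inverse \<eta>" \<eta> "e ?s"] J.smult_one[of "e ?s"] e4(1) y(3)
   by (simp add: class_ring_simps)
  then show False using z J.smult_r_null[of "inverse \<eta>"] e4(2) by simp
 qed
 \<comment> \<open>With no second term, \<open>f\<close> would be onto the single summand
   \<open>I ?t\<close>. By injectivity the map of the model into this summand extends from
   \<open>emb\<close> to a map \<open>h\<close> on \<open>I0\<close>. The vector supported on the
   two letters is sent by \<open>h\<close> into the image of the model, where the combination of
   letters with coefficients \<open>l1\<close> and \<open>l2\<close> is zero; but that combination
   turns the vector into the socle vector, whose image under \<open>h\<close> is not zero.\<close>
 have "A ~= {}"
 proof
  assume A0: "A = {}"
  have surj: "x \<in> rep_image M f w" if "w \<in> {1..2*n}" "x \<in> spc X w" for x w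
  proof -
   have "g w x \<in> spc Y w" by (rule rep_homD(3)[OF g that])
   then have "g w x = zero (rep_space Y w)" by (simp add: Y_def A0 restrict_def)
   then show ?thesis using kerD[OF that] by blast
  qed
  let ?c = "%w m. f w m (?t, 0)"
  have "(%w y. y (?t, 0)) \<in> rep_hom ?Q (rep_sum B F) (F (?t, 0))"
   by (rule rep_hom_component[OF t0]) (rule RF, simp)
  then have ch: "?c \<in> rep_hom ?Q M (I ?t)"
   using rep_hom_compose[OF fh, of "%w y. y (?t, 0)" "I ?t"] by (simp add: X_def Fjk)
  have jM: "jacobian_module ?Q (tp n) M" "jacobian_module ?Q (tp n) I0"
   by (rule jacobian_module_model, rule jacobian_module_inj_rep)
  obtain h where h: "h \<in> rep_hom ?Q I0 (I ?t)"
   "\<forall>v\<in>verts ?Q. \<forall>x\<in>spc M v. h v (emb v x) = ?c v x"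
   using inj[OF top_level(3), unfolded injective_module_def, THEN conjunct2, rule_format, OF conjI[OF jM] emb_mono ch]
   by (rule bexE)
  obtain \<phi> where \<phi>: "\<phi> \<in> inj_space n ?t ?s"
   "l1 * \<phi> (to_nat [letter False top_level]) + l2 * \<phi> (to_nat [letter True top_level]) = 1"
   "\<forall>p :: toda_arrow list. 2 \<le> length p --> \<phi> (to_nat p) = 0" by (rule two_letters)
  have ht: "h ?s \<phi> \<in> spc (I ?t) ?s" using rep_homD(3)[OF h(1) top_level(4), of \<phi>] \<phi>(1) by simp
  have "(\<lambda>s\<in>{(?t, 0 :: nat)}. h ?s \<phi>) \<in> spc X ?s"
   unfolding X_def B1 rep_sum_simps by (rule restrict_PiE_iff[THEN iffD2]) (use ht in \<open>simp add: Fjk\<close>)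
  then obtain m where m: "m \<in> strip n i top_level" "(\<lambda>s\<in>{(?t, 0 :: nat)}. h ?s \<phi>) = f ?s m"
   using surj[OF top_level(4)] top_level by (auto simp: rep_image_def)
  have hm: "h ?s \<phi> = ?c ?s m" using fun_cong[OF m(2), of "(?t, 0)"] by simp
  let ?V = "rep_space (I ?t) ?t"
  interpret V: vectorspace class_ring ?V
   by (rule representation_vectorspace[OF _ top_level(3)]) (use TI[OF top_level(3)] in \<open>simp add: toda_rep_def\<close>)
  have ar: "letter y top_level \<in> arcs ?Q" for y using top_level(1,2) by simp
  have tt: "toda_tail (letter y top_level) = ?s" "toda_head (letter y top_level) = ?t" for y by simp_all
  let ?P = "%y. rep_map I0 (letter y top_level) \<phi>"
  have Pc: "?P y \<in> inj_space n ?t ?t" for y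
   using inj_rep_map_closed[OF ar[of y], of \<phi> ?t] \<phi>(1) by simp
  have 1: "h ?t (?P y) = rep_map (I ?t) (letter y top_level) (h ?s \<phi>)" for y
   using rep_homD(2)[OF h(1) ar[of y], of \<phi>] \<phi>(1) by simp
  have 2: "rep_map (I ?t) (letter y top_level) (h ?s \<phi>) = ?c ?t (mu (letter y top_level) m)" for y
   unfolding hm using rep_homD(2)[OF ch ar[of y], of m] m(1) top_level(1) by simp
  have cm: "?c ?t (%p. d * m p) = d \<odot>\<^bsub>?V\<^esub> ?c ?t m" for d
   using module_hom_smult[OF rep_homD(1)[OF ch top_level(3)], of d m] m(1) by simp
  have cc: "?c ?t m \<in> carrier ?V" using rep_homD(3)[OF ch top_level(3), of m] m(1) by simp
  have e1: "h ?t (?P False) = l2 \<odot>\<^bsub>?V\<^esub> ?c ?t m" "h ?t (?P True) = (- l1) \<odot>\<^bsub>?V\<^esub> ?c ?t m"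
   unfolding 1 2 model_map_letter cm[symmetric] by simp_all
  have "(%k. l1 * ?P False k + l2 * ?P True k) = inj_socle"
  proof (rule inj_space_eqI)
   show "(%k. l1 * ?P False k + l2 * ?P True k) \<in> inj_space n ?t ?t"
    by (intro lin_closedD(2)[OF lin_closed_inj_space] lin_closedD(3)[OF lin_closed_inj_space] Pc)
   show "inj_socle \<in> inj_space n ?t ?t" by (rule inj_socle_in[OF top_level(3)])
   fix p :: "toda_arrow list"
   show "l1 * ?P False (to_nat p) + l2 * ?P True (to_nat p) = inj_socle (to_nat p)"
    using \<phi>(2) \<phi>(3)[rule_format, of "letter False top_level # p"] \<phi>(3)[rule_format, of "letter True top_level # p"]
    by (cases p) auto
  qed
  moreover have "h ?t (%k. l1 * ?P False k + l2 * ?P True k) = l1 \<odot>\<^bsub>?V\<^esub> h ?t (?P False) \<oplus>\<^bsub>?V\<^esub> l2 \<odot>\<^bsub>?V\<^esub> h ?t (?P True)"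
   using module_hom_add[OF rep_homD(1)[OF h(1) top_level(3)], of "%k. l1 * ?P False k" "%k. l2 * ?P True k"]
    module_hom_smult[OF rep_homD(1)[OF h(1) top_level(3)], of l1 "?P False"]
    module_hom_smult[OF rep_homD(1)[OF h(1) top_level(3)], of l2 "?P True"]
    Pc lin_closedD(3)[OF lin_closed_inj_space Pc] by simp
  moreover have "l1 \<odot>\<^bsub>?V\<^esub> (l2 \<odot>\<^bsub>?V\<^esub> ?c ?t m) \<oplus>\<^bsub>?V\<^esub> l2 \<odot>\<^bsub>?V\<^esub> ((- l1) \<odot>\<^bsub>?V\<^esub> ?c ?t m) = zero ?V"
  proof -
   have "l1 \<odot>\<^bsub>?V\<^esub> (l2 \<odot>\<^bsub>?V\<^esub> ?c ?t m) \<oplus>\<^bsub>?V\<^esub> l2 \<odot>\<^bsub>?V\<^esub> ((- l1) \<odot>\<^bsub>?V\<^esub> ?c ?t m) =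
     (l1 * l2 + l2 * - l1) \<odot>\<^bsub>?V\<^esub> ?c ?t m"
    using V.smult_assoc1[of l1 l2 "?c ?t m"] V.smult_assoc1[of l2 "- l1" "?c ?t m"]
     V.smult_l_distr[of "l1 * l2" "l2 * - l1" "?c ?t m"] cc by (simp add: class_ring_simps)
   also have "... = zero ?V" using V.lmult_0[OF cc] by simp
   finally show ?thesis .
  qed
  ultimately have "h ?t inj_socle = zero ?V" unfolding e1 by simp
  then have z: "f ?t sfun (?t, 0) = zero ?V"
   using h(2)[rule_format, of ?t sfun] top_level(3) sfun_in emb_sfun by simp
  have "f ?t sfun \<in> spc X ?t" using rep_homD(3)[OF fh top_level(3), of sfun] sfun_in by simp
  then have "f ?t sfun \<in> extensional {(?t, 0)}" unfolding X_def B1 rep_sum_simps PiE_def by (rule IntD2)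
  then have "f ?t sfun = (\<lambda>s\<in>{(?t, 0)}. f ?t sfun (?t, 0))" by (rule extensional_singleton)
  also have "... = zero (rep_space X ?t)"
   unfolding z X_def B1 rep_sum_simps by (rule restrict_ext) (simp add: Fjk)
  finally have "f ?t sfun = f ?t (%_. 0)" using f0[OF top_level(3)] by simp
  then have "sfun = (%_. 0)" using finj[of ?t sfun "%_. 0"] sfun_in
    lin_closedD(1)[OF lin_closed_strip] top_level(3) by simp
  then show False using sfun_nonzero by simp
 qed
 then obtain j1 k1 where jk1: "(j1, k1) \<in> A" by auto
 have apos: "a ?s > 0" using At[OF jk1] jk1 by (auto simp: A_def)
 show "a v = (if v = ?s then 1 else 0)"
 proof (cases "v = ?s")
  case True
  have "a ?s = 1"
  proof (rule ccontr)
   assume "a ?s ~= 1"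
   then have "(?s, 1) \<in> A" "(?s, 0) \<in> A" using apos top_level(4) by (simp_all add: A_def)
   then show False using Ak[of 1 0] by simp
  qed
  then show ?thesis using True by simp
 next
  case False
  have "a v = 0"
  proof (rule ccontr)
   assume "a v ~= 0"
   then have "(v, 0) \<in> A" using v by (simp add: A_def)
   then show False using At[of v 0] False by simp
  qed
  then show ?thesis using False by simp
 qed
qed

text \<open>Existence and uniqueness of the multiplicities evaluate the definite description; both
  are transported between \<open>T\<close> and the model, uniqueness along the inverse
  isomorphism.\<close>

lemma neg_coind_iso:
 assumes h: "h \<in> rep_hom (tq n) T M" and T: "representation (tq n) T"
  and b: "!!v. v \<in> {1..2*n} ==> bij_betw (h v) (spc T v) (spc M v)"
 shows "neg_coind (tq n) (tp n) T =
  Poly_Mapping.single (2 * top_level - 1) 1 - Poly_Mapping.single (2 * top_level) 1"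
proof -
 let ?b = "%v :: nat. if v = 2 * top_level then 1 else 0 :: nat"
 let ?a = "%v :: nat. if v = 2 * top_level - 1 then 1 else 0 :: nat"
 let ?d = "Poly_Mapping.single (2 * top_level - 1) 1 - Poly_Mapping.single (2 * top_level) 1 :: nat \<Rightarrow>\<^sub>0 int"
 have sum: "(\<Sum>j\<in>verts (tq n). Poly_Mapping.single j (int (?a j) - int (?b j))) = ?d"
 proof -
  have ne: "2 * top_level - 1 ~= 2 * top_level" using top_level(1) by simp
  have "(\<Sum>j\<in>verts (tq n). Poly_Mapping.single j (int (?a j) - int (?b j))) =
    (\<Sum>j\<in>{2 * top_level - 1, 2 * top_level}. Poly_Mapping.single j (int (?a j) - int (?b j)))"
   by (rule sum.mono_neutral_right) (use top_level(3,4) in auto)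
  also have "... = ?d" using ne by (simp add: single_uminus)
  finally show ?thesis .
 qed
 show ?thesis unfolding neg_coind_def
 proof (rule the_equality)
  have "minimal_injective_copresentation (tq n) (tp n) T ?b ?a"
   by (rule minimal_injective_copresentation_iso[OF h b mic_model])
  then show "EX b a. minimal_injective_copresentation (tq n) (tp n) T b a &
    ?d = (\<Sum>j\<in>verts (tq n). Poly_Mapping.single j (int (a j) - int (b j)))"
   using sum by (intro exI[of _ ?b] exI[of _ ?a]) simp
 next
  fix d assume "EX b a. minimal_injective_copresentation (tq n) (tp n) T b a &
    d = (\<Sum>j\<in>verts (tq n). Poly_Mapping.single j (int (a j) - int (b j)))"
  then obtain b' a' where m: "minimal_injective_copresentation (tq n) (tp n) T b' a'"
   and d: "d = (\<Sum>j\<in>verts (tq n). Poly_Mapping.single j (int (a' j) - int (b' j)))" by (elim exE conjE)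
  obtain k where k: "k \<in> rep_hom (tq n) M T"
   "!!v. v \<in> {1..2*n} ==> bij_betw (k v) (spc M v) (spc T v)"
   using rep_iso_inverse[OF T representation_model h b] by blast
  have "mic b' a'" by (rule minimal_injective_copresentation_iso[OF k m])
  then have "d = (\<Sum>j\<in>verts (tq n). Poly_Mapping.single j (int (?a j) - int (?b j)))"
   unfolding d using mic_unique by (intro sum.cong refl) simp
  then show "d = ?d" using sum by simp
 qed
qed

end

section \<open>The Jacobian algebra acting on the model\<close>

abbreviation path_ring :: "nat => ((nat, toda_arrow) qpath => complex) ring" where
 "path_ring n \<equiv> complete_path_algebra (tq n)"

abbreviation derivative_ideal :: "nat => ((nat, toda_arrow) qpath => complex) set" where
 "derivative_ideal n \<equiv> genideal (path_ring n)
  (cyclic_derivative (tq n) (tp n) ` arcs (tq n))"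

abbreviation toda_ideal :: "nat => ((nat, toda_arrow) qpath => complex) set" where
 "toda_ideal n \<equiv> jacobian_ideal (tq n) (tp n)"

lemma path_ring_carrier_iff: "f \<in> carrier (path_ring n) <=> (ALL u p. f (u, p) ~= 0 --> (EX v. toda_awalk n u p v))"
 unfolding path_algebra_simps mem_Collect_eq split_paired_All qpaths_toda_iff by blast

lemma path_elem_closed: "toda_awalk n u p v ==> path_elem u p \<in> carrier (path_ring n)"
 by (auto simp: path_ring_carrier_iff path_elem_def split: if_splits)

lemma path_elem_mult:
 assumes "toda_awalk n u p w"
 shows "path_elem w q \<otimes>\<^bsub>path_ring n\<^esub> path_elem u p = path_elem u (p @ q)"
proof
 fix x :: "nat \<times> toda_arrow list"
 obtain u' r where x: "x = (u', r)" by (cases x)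
 show "(path_elem w q \<otimes>\<^bsub>path_ring n\<^esub> path_elem u p) x = path_elem u (p @ q) x"
 proof (cases "u' = u & r = p @ q")
  case True
  have "path_elem w q (qpath_end (tq n) u (take k r), drop k r) * path_elem u p (u, take k r) =
    (if k = length p then 1 else 0)" if "k \<le> length r" for k
  proof (cases "k = length p")
   case True
   then show ?thesis using \<open>u' = u & r = p @ q\<close> toda_awalk_end[OF assms] by (simp add: path_elem_def)
  next
   case False
   then have "length (take k r) ~= length p" using that by simp
   then have "take k r ~= p" by blast
   then show ?thesis using False by (simp add: path_elem_def)
  qed
  then have "(path_elem w q \<otimes>\<^bsub>path_ring n\<^esub> path_elem u p) x = (\<Sum>k\<le>length r. if k = length p then 1 else 0)"
   unfolding x path_mult_apply using True by (intro sum.cong) auto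
  then show ?thesis using True x by (simp add: path_elem_def)
 next
  case False
  have "path_elem w q (qpath_end (tq n) u' (take k r), drop k r) * path_elem u p (u', take k r) = 0" for k
   using False append_take_drop_id[of k r] by (auto simp: path_elem_def)
  then show ?thesis unfolding x path_mult_apply using False by (simp add: path_elem_def)
 qed
qed

lemma path_mult_linear:
 "(%x. s * f x - t * g x) \<otimes>\<^bsub>path_ring n\<^esub> h =
  (%x. s * (f \<otimes>\<^bsub>path_ring n\<^esub> h) x - t * (g \<otimes>\<^bsub>path_ring n\<^esub> h) x)"
 "h \<otimes>\<^bsub>path_ring n\<^esub> (%x. s * f x - t * g x) =
  (%x. s * (h \<otimes>\<^bsub>path_ring n\<^esub> f) x - t * (h \<otimes>\<^bsub>path_ring n\<^esub> g) x)"
 by (auto simp: fun_eq_iff path_mult_apply sum_subtractf sum_distrib_left algebra_simps)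

lemma path_mult_scale: "(%x. s * f x) \<otimes>\<^bsub>path_ring n\<^esub> h = (%x. s * (f \<otimes>\<^bsub>path_ring n\<^esub> h) x)"
 "h \<otimes>\<^bsub>path_ring n\<^esub> (%x. s * f x) = (%x. s * (h \<otimes>\<^bsub>path_ring n\<^esub> f) x)"
 using path_mult_linear(1)[where s = s and f = f and t = 0 and g = f]
  path_mult_linear(2)[where s = s and f = f and t = 0 and g = f] by simp_all

lemma path_mult_add: "(%x. f x + g x) \<otimes>\<^bsub>path_ring n\<^esub> h = (%x. (f \<otimes>\<^bsub>path_ring n\<^esub> h) x + (g \<otimes>\<^bsub>path_ring n\<^esub> h) x)"
 "h \<otimes>\<^bsub>path_ring n\<^esub> (%x. f x + g x) = (%x. (h \<otimes>\<^bsub>path_ring n\<^esub> f) x + (h \<otimes>\<^bsub>path_ring n\<^esub> g) x)"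
 using path_mult_linear(1)[where s = 1 and f = f and t = "-1" and g = g]
  path_mult_linear(2)[where s = 1 and f = f and t = "-1" and g = g] by simp_all

lemmas ring_path_ring = wf_digraph.ring_complete_path_algebra[OF wf_digraph_toda_quiver]

lemma ideal_derivative: "ideal (derivative_ideal n) (path_ring n)"
 using wf_digraph.cyclic_derivative_closed[OF wf_digraph_toda_quiver toda_potential_closed]
 by (intro ring.genideal_ideal[OF ring_path_ring]) blast

lemma ideal_toda: "ideal (toda_ideal n) (path_ring n)"
 by (rule wf_digraph.ideal_jacobian_ideal[OF wf_digraph_toda_quiver toda_potential_closed])

text \<open>A complex scalar acts as the corresponding multiple of the unit of the algebra, so
  ideals are linear subspaces.\<close>

lemma lin_closed_ideal:
 assumes I: "ideal I (path_ring n)"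
 shows "lin_closed I"
proof -
 interpret I: ideal I "path_ring n" by (rule I)
 note add = ideal.axioms(1)[OF I]
 have "(%x. c * f x) \<in> I" if f: "f \<in> I" for c f
 proof -
  have fc: "f \<in> carrier (path_ring n)" by (rule I.Icarr[OF f])
  have "(%x. c * \<one>\<^bsub>path_ring n\<^esub> x) \<in> carrier (path_ring n)"
   using I.one_closed by (auto simp: path_ring_carrier_iff)
  then have "(%x. c * \<one>\<^bsub>path_ring n\<^esub> x) \<otimes>\<^bsub>path_ring n\<^esub> f \<in> I" by (rule I.I_l_closed[OF f])
  then show ?thesis unfolding path_mult_scale I.l_one[OF fc] .
 qed
 moreover have "(%_. 0) \<in> I" using additive_subgroup.zero_closed[OF add] by (simp add: path_algebra_simps)
 moreover have "(%x. f x + g x) \<in> I" if "f \<in> I" "g \<in> I" for f g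
  using additive_subgroup.a_closed[OF add that] by (simp add: path_algebra_simps)
 ultimately show ?thesis by (simp add: lin_closed_def)
qed

lemma derivative_ideal_subset: "derivative_ideal n \<subseteq> toda_ideal n"
 using ideal.Icarr[OF ideal_derivative] by (auto simp: jacobian_ideal_def arrow_adic_closure_def)

text \<open>Congruence modulo a subspace becomes equality of cosets, the form in which compatible
  functions express the relations.\<close>

definition function_coset :: "('k => complex) set => ('k => complex) => ('k => complex) set" where
 "function_coset G f = {h. (%x. h x - f x) \<in> G}"

lemma function_coset_eq_iff:
 assumes "lin_closed G"
 shows "function_coset G f = function_coset G g <=> (%x. f x - g x) \<in> G"
proof
 assume "function_coset G f = function_coset G g"
 moreover have "f \<in> function_coset G f" using lin_closedD(1)[OF assms] by (simp add: function_coset_def)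
 ultimately show "(%x. f x - g x) \<in> G" by (simp add: function_coset_def)
next
 assume d: "(%x. f x - g x) \<in> G"
 have "(%x. h x - f x) \<in> G <=> (%x. h x - g x) \<in> G" for h
  using lin_closedD(2)[OF assms _ d, of "%x. h x - f x"] lin_closed_diff[OF assms _ d, of "%x. h x - g x" 1] by auto
 then show "function_coset G f = function_coset G g" by (simp add: function_coset_def)
qed

text \<open>A derivative multiplied by paths on both sides stays in the ideal, so taking classes of
  paths respects the relations. With this instance all path identities above hold in the
  algebra.\<close>

lemma compatible_coset:
 "compatible n u (%p. function_coset (derivative_ideal n) (path_elem u p))
  (function_coset (derivative_ideal n) (%_. 0))"
 unfolding compatible_def
proof (intro allI impI)
 fix al s p t q p1 p2 v
 assume al: "al \<in> arcs (tq n)" "toda_rel n al = ((s, p), (t, q))"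
  and p1: "toda_awalk n u p1 (toda_head al)" and p2: "toda_awalk n (toda_tail al) p2 v"
 interpret G: ideal "derivative_ideal n" "path_ring n" by (rule ideal_derivative)
 note r = toda_rel_facts[OF al]
 have "cyclic_derivative (tq n) (tp n) ` arcs (tq n) \<subseteq> carrier (path_ring n)"
  using wf_digraph.cyclic_derivative_closed[OF wf_digraph_toda_quiver toda_potential_closed] by blast
 then have "cyclic_derivative (tq n) (tp n) al \<in> derivative_ideal n"
  using ring.genideal_self[OF ring_path_ring] al(1) by blast
 then have "path_elem (toda_tail al) p2 \<otimes>\<^bsub>path_ring n\<^esub> (cyclic_derivative (tq n) (tp n) al
   \<otimes>\<^bsub>path_ring n\<^esub> path_elem u p1) \<in> derivative_ideal n"
  by (intro G.I_l_closed G.I_r_closed path_elem_closed[OF p1] path_elem_closed[OF p2])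
 then have d: "(%x. s * (path_elem (toda_tail al) p2 \<otimes>\<^bsub>path_ring n\<^esub> path_elem u (p1 @ p)) x -
   t * (path_elem (toda_tail al) p2 \<otimes>\<^bsub>path_ring n\<^esub> path_elem u (p1 @ q)) x) \<in> derivative_ideal n"
  unfolding cyclic_derivative_toda[OF al] path_mult_linear path_elem_mult[OF p1] .
 have e: "c * (path_elem (toda_tail al) p2 \<otimes>\<^bsub>path_ring n\<^esub> path_elem u (p1 @ p')) x = c * path_elem u (p1 @ p' @ p2) x"
  if "c ~= 0 ==> toda_awalk n (toda_head al) p' (toda_tail al)" for c p' x
 proof (cases "c = 0")
  case False
  then have "toda_awalk n u (p1 @ p') (toda_tail al)" using p1 that by (auto simp: toda_awalk_append_iff)
  then show ?thesis by (simp add: path_elem_mult)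
 qed simp
 have D: "(%x. s * path_elem u (p1 @ p @ p2) x - t * path_elem u (p1 @ q @ p2) x) \<in> derivative_ideal n"
 proof -
  have e1: "s * (path_elem (toda_tail al) p2 \<otimes>\<^bsub>path_ring n\<^esub> path_elem u (p1 @ p)) x = s * path_elem u (p1 @ p @ p2) x" for x
   by (rule e) (rule r(4))
  have e2: "t * (path_elem (toda_tail al) p2 \<otimes>\<^bsub>path_ring n\<^esub> path_elem u (p1 @ q)) x = t * path_elem u (p1 @ q @ p2) x" for x
   by (rule e) (rule r(5))
  show ?thesis using d unfolding e1 e2 .
 qed
 show "(if s = 0 then function_coset (derivative_ideal n) (%_. 0)
    else function_coset (derivative_ideal n) (path_elem u (p1 @ p @ p2))) =
   (if t = 0 then function_coset (derivative_ideal n) (%_. 0)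
    else function_coset (derivative_ideal n) (path_elem u (p1 @ q @ p2)))"
  using D r(1,2) lin_closedD(3)[OF lin_closed_ideal[OF ideal_derivative] D, of "-1"]
  by (auto simp: function_coset_eq_iff[OF lin_closed_ideal[OF ideal_derivative]])
qed

text \<open>All longer paths act as zero by \<open>compatible_long\<close>, so sums over this finite
  set replace infinite ones.\<close>

definition short :: "nat => nat => nat => toda_arrow list set" where
 "short n u w = {p. toda_awalk n u p w & length p < 2 * n}"

lemma finite_short: "finite (short n u w)"
 by (rule finite_subset[OF _ finite_short_paths[of n "2 * n"]])
  (auto simp: short_def pre_digraph.awalk_def)

lemma model_map_sum:
 "model_map n i l1 l2 al (%k. \<Sum>a\<in>A. c a * h a k) = (%k. \<Sum>a\<in>A. c a * model_map n i l1 l2 al (h a) k)"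
 by (cases al) (auto simp: fun_eq_iff sum_distrib_left mult_ac intro!: sum.cong)

lemma fold_model_map_sum:
 "fold (model_map n i l1 l2) q (%k. \<Sum>a\<in>A. c a * h a k) = (%k. \<Sum>a\<in>A. c a * fold (model_map n i l1 l2) q (h a) k)"
 by (induction q arbitrary: h) (simp_all add: model_map_sum)

lemma arrow_cases:
 obtains x j where "al = letter x j" | d j where "al = step d j"
proof (cases al)
 case (Arrow_a j) then show thesis using that(1)[of False j] by (simp add: letter_def)
next
 case (Arrow_b j) then show thesis using that(1)[of True j] by (simp add: letter_def)
next
 case (Arrow_l j) then show thesis using that(2)[of False j] by (simp add: step_def)
next
 case (Arrow_r j) then show thesis using that(2)[of True j] by (simp add: step_def)
qed

text \<open>The part of the completed path algebra cut out by the idempotent of \<open>w\<close> on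
  the left and that of \<open>v\<close> on the right.\<close>

definition hom_paths :: "nat => nat => nat => ((nat, toda_arrow) qpath => complex) set" where
 "hom_paths n v w = {f. ALL u p. f (u, p) ~= 0 --> u = v & toda_awalk n v p w}"

lemma lin_closed_hom_paths: "lin_closed (hom_paths n v w)"
 unfolding lin_closed_def hom_paths_def by (auto; metis add.right_neutral)

lemma hom_paths_closed: "f \<in> hom_paths n v w ==> f \<in> carrier (path_ring n)"
 by (auto simp: hom_paths_def path_ring_carrier_iff)

lemma path_elem_hom: "toda_awalk n u p v ==> path_elem u p \<in> hom_paths n u v"
 by (auto simp: hom_paths_def path_elem_def split: if_splits)

lemma hom_paths_mult:
 assumes f: "f \<in> hom_paths n v w" and g: "g \<in> hom_paths n u v"
 shows "f \<otimes>\<^bsub>path_ring n\<^esub> g \<in> hom_paths n u w"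
 unfolding hom_paths_def
proof (intro CollectI allI impI)
 fix u' r assume "(f \<otimes>\<^bsub>path_ring n\<^esub> g) (u', r) ~= 0"
 then obtain k where "f (qpath_end (tq n) u' (take k r), drop k r) * g (u', take k r) ~= 0"
  unfolding path_mult_apply by (meson sum.not_neutral_contains_not_neutral)
 then have "u' = u & toda_awalk n u (take k r) v" "toda_awalk n v (drop k r) w"
  using f g by (auto simp: hom_paths_def)
 then have "toda_awalk n u r w" "u' = u"
  using toda_awalk_append_iff[of n u "take k r" "drop k r" w] by auto
 then show "u' = u & toda_awalk n u r w" by simp
qed

text \<open>Each long path lies in the ideal of derivatives, hence so does every truncation of the
  series; the closure takes in their limit.\<close>

lemma long_in_toda_ideal:
 assumes f: "f \<in> hom_paths n u w" and long: "!!p. length p < 2 * n ==> f (u, p) = 0"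
 shows "f \<in> toda_ideal n"
 unfolding jacobian_ideal_def arrow_adic_closure_def
proof (intro CollectI conjI allI)
 show "f \<in> carrier (path_ring n)" by (rule hom_paths_closed[OF f])
 fix N
 let ?S = "{p. toda_awalk n u p w & length p < N & 2 * n \<le> length p}"
 have fin: "finite ?S"
  by (rule finite_subset[OF _ finite_short_paths[of n N]]) (auto simp: pre_digraph.awalk_def)
 note L = lin_closed_ideal[OF ideal_derivative]
 have "path_elem u p \<in> derivative_ideal n" if "p \<in> ?S" for p
  using compatible_long[OF compatible_coset, of n u p w] that
  by (simp add: function_coset_eq_iff[OF L])
 then have g: "(%x. \<Sum>p\<in>?S. f (u, p) * path_elem u p x) \<in> derivative_ideal n"
  by (intro lin_closed_sum[OF L fin] lin_closedD(3)[OF L])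
 have "f (u', p) = (\<Sum>r\<in>?S. f (u, r) * path_elem u r (u', p))" if "length p < N" for u' p
 proof -
  have "(\<Sum>r\<in>?S. f (u, r) * path_elem u r (u', p)) = (\<Sum>r\<in>?S. if r = p then (if u' = u then f (u, p) else 0) else 0)"
   by (intro sum.cong) (auto simp: path_elem_def)
  also have "... = (if p \<in> ?S then (if u' = u then f (u, p) else 0) else 0)" using fin by simp
  also have "... = f (u', p)"
  proof (cases "f (u', p) = 0")
   case False
   then have u: "u' = u & toda_awalk n u p w" using f by (auto simp: hom_paths_def)
   then have "~ length p < 2 * n" using False long[of p] by auto
   then show ?thesis using u that by simp
  qed auto
  finally show ?thesis by simp
 qed
 then show "\<exists>g\<in>derivative_ideal n. \<forall>u' p. length p < N --> f (u', p) = g (u', p)"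
  by (intro bexI[OF _ g]) blast
qed

context toda_data
begin

text \<open>The action of a formal series of paths on the model; the sum is finite because long
  paths act as zero.\<close>

definition act :: "nat => ((nat, toda_arrow) qpath => complex) => nat => univ => univ" where
 "act w f u x = (%k. \<Sum>p\<in>short n u w. f (u, p) * fold mu p x k)"

lemma fold_mu_closed: "toda_awalk n u p w ==> x \<in> strip n i (level u) ==> fold mu p x \<in> strip n i (level w)"
 using fold_rep_map_closed[OF representation_model] by simp

lemma fold_mu_long:
 "toda_awalk n u p w ==> x \<in> strip n i (level u) ==> 2 * n \<le> length p ==> fold mu p x = (%_. 0)"
 using toda_rep_long[OF toda_rep_model[of n i l1 l2], of x u p w] by simp

lemma fold_mu_zero: "fold mu q (%_. 0) = (%_. 0)"
 using fold_model_map_sum[of n i l1 l2 q "%_. 0" "%_ _. 0" "{}"] by simp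

lemma act_closed: "x \<in> strip n i (level u) ==> act w f u x \<in> strip n i (level w)"
 unfolding act_def
 by (intro lin_closed_sum[OF lin_closed_strip finite_short] lin_closedD(3)[OF lin_closed_strip])
  (auto simp: short_def intro: fold_mu_closed)

lemma act_zero: "act w f u (%_. 0) = (%_. 0)"
 by (simp add: act_def fold_mu_zero)

lemma act_lin:
 "act w (%x. f x + g x) u y = (%k. act w f u y k + act w g u y k)"
 "act w (%x. c * f x) u y = (%k. c * act w f u y k)"
 by (simp_all add: act_def fun_eq_iff sum.distrib sum_distrib_left algebra_simps)

text \<open>Both sides sum over composable pairs of paths. On the left the concatenation has to be
  short, on the right each piece; the extra pairs on the right have a long concatenation, which acts
  as zero.\<close>

lemma act_mult:
 assumes x: "x \<in> strip n i (level u)"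
 shows "act w (f \<otimes>\<^bsub>path_ring n\<^esub> g) u x = (%k. \<Sum>v\<in>{1..2*n}. act w f v (act v g u x) k)"
proof
 fix k
 let ?\<Phi> = "%(p, q). f (qpath_end (tq n) u p, q) * g (u, p) * fold mu (p @ q) x k"
 let ?D = "{(p, q). p @ q \<in> short n u w}"
 let ?E = "{(p, q). EX v. p \<in> short n u v & q \<in> short n v w}"
 let ?S = "Sigma {1..2*n} (%v. Sigma (short n v w) (%_. short n u v))"
 have V: "1 \<le> v" "v \<le> 2 * n" if "toda_awalk n u p v" for p v
  using toda_awalk_verts(2)[OF that] by simp_all
 have "act w (f \<otimes>\<^bsub>path_ring n\<^esub> g) u x k =
   (\<Sum>r\<in>short n u w. \<Sum>m\<le>length r. ?\<Phi> (take m r, drop m r))"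
  by (simp add: act_def path_mult_apply sum_distrib_right del: fold_append)
 also have "... = (\<Sum>(r, m)\<in>Sigma (short n u w) (%r. {..length r}). ?\<Phi> (take m r, drop m r))"
  by (rule sum.Sigma) (simp_all add: finite_short)
 also have "... = sum ?\<Phi> ?D"
  by (rule sum.reindex_bij_witness[where j = "%(r, m). (take m r, drop m r)" and i = "%(p, q). (p @ q, length p)"])
   auto
 also have "... = sum ?\<Phi> ?E"
 proof (rule sum.mono_neutral_left)
  have "?E \<subseteq> (\<Union>v\<in>{1..2*n}. short n u v \<times> short n v w)"
   by (auto simp: short_def dest: toda_awalk_verts(2))
  then show "finite ?E" by (rule finite_subset) (simp add: finite_short)
  show "?D \<subseteq> ?E" by (auto simp: short_def toda_awalk_append_iff)
  show "\<forall>z\<in>?E - ?D. ?\<Phi> z = 0"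
  proof
   fix z assume z: "z \<in> ?E - ?D"
   obtain p q where pq: "z = (p, q)" by (cases z)
   have "toda_awalk n u (p @ q) w" "2 * n \<le> length (p @ q)"
    using z pq by (auto simp: short_def toda_awalk_append_iff)
   then have "fold mu (p @ q) x = (%_. 0)" by (rule fold_mu_long[OF _ x])
   then show "?\<Phi> z = 0" unfolding pq by (simp del: fold_append)
  qed
 qed
 also have "... = (\<Sum>(v, q, p)\<in>?S. f (v, q) * g (u, p) * fold mu (p @ q) x k)"
  by (rule sum.reindex_bij_witness[where i = "%(v, q, p). (p, q)" and
     j = "%(p, q). (qpath_end (tq n) u p, q, p)"])
   (auto simp: short_def toda_awalk_end intro: V)
 also have "... = (\<Sum>v\<in>{1..2*n}. \<Sum>(q, p)\<in>Sigma (short n v w) (%_. short n u v).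
   f (v, q) * g (u, p) * fold mu (p @ q) x k)"
  by (subst sum.Sigma) (auto simp: finite_short)
 also have "... = (\<Sum>v\<in>{1..2*n}. \<Sum>q\<in>short n v w. \<Sum>p\<in>short n u v. f (v, q) * g (u, p) * fold mu (p @ q) x k)"
  by (intro sum.cong refl, subst sum.Sigma) (auto simp: finite_short)
 also have "... = (\<Sum>v\<in>{1..2*n}. act w f v (act v g u x) k)"
  by (simp add: act_def fold_model_map_sum sum_distrib_left mult.assoc)
 finally show "act w (f \<otimes>\<^bsub>path_ring n\<^esub> g) u x k = (\<Sum>v\<in>{1..2*n}. act w f v (act v g u x) k)" .
qed

definition "annihilator = {f \<in> carrier (path_ring n). ALL u w. \<forall>x\<in>strip n i (level u). act w f u x = (%_. 0)}"

lemma ideal_annihilator: "ideal annihilator (path_ring n)"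
proof (rule idealI[OF ring_path_ring])
 note R = ring_path_ring[of n]
 show "subgroup annihilator (add_monoid (path_ring n))"
 proof (rule wf_digraph.additive_subgroup_complete_path_algebraI[OF wf_digraph_toda_quiver])
  show "(%x. 0) \<in> annihilator" by (simp add: annihilator_def path_ring_carrier_iff act_def)
  show "(%x. f x + g x) \<in> annihilator" if "f \<in> annihilator" "g \<in> annihilator" for f g
  proof -
   have "(%x. f x + g x) \<in> carrier (path_ring n)"
    using that ring.ring_simprules(1)[OF R, of f g] by (simp add: annihilator_def path_algebra_simps)
   then show ?thesis using that by (simp add: annihilator_def act_lin)
  qed
  show "(%x. - f x) \<in> annihilator" if "f \<in> annihilator" for f
   using that act_lin(2)[of _ "-1" f] by (simp add: annihilator_def path_ring_carrier_iff)
 qed (simp add: annihilator_def)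
next
 fix a f assume a: "a \<in> annihilator" and f: "f \<in> carrier (path_ring n)"
 have ac: "a \<in> carrier (path_ring n)" and z: "!!u w x. x \<in> strip n i (level u) ==> act w a u x = (%_. 0)"
  using a by (auto simp: annihilator_def)
 show "f \<otimes>\<^bsub>path_ring n\<^esub> a \<in> annihilator"
  using ring.ring_simprules(5)[OF ring_path_ring f ac] by (simp add: annihilator_def act_mult z act_zero)
 show "a \<otimes>\<^bsub>path_ring n\<^esub> f \<in> annihilator"
  using ring.ring_simprules(5)[OF ring_path_ring ac f] by (simp add: annihilator_def act_mult z act_closed)
qed

lemma act_path:
 assumes "x \<in> strip n i (level u)"
 shows "act w (path_elem u' p) u x = (if u = u' & toda_awalk n u p w then fold mu p x else (%_. 0))"
proof (cases "u = u'")
 case True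
 have "act w (path_elem u' p) u x k = (\<Sum>r\<in>short n u w. if r = p then fold mu p x k else 0)" for k
  unfolding act_def using True by (intro sum.cong) (auto simp: path_elem_def)
 also have "... k = (if p \<in> short n u w then fold mu p x k else 0)" for k by (simp add: finite_short)
 finally show ?thesis using True fold_mu_long[OF _ assms, of p w] by (auto simp: short_def fun_eq_iff not_less)
next
 case False
 then show ?thesis by (simp add: act_def path_elem_def)
qed

lemma derivative_annihilates: "derivative_ideal n \<subseteq> annihilator"
proof (rule ring.genideal_minimal[OF ring_path_ring ideal_annihilator])
 show "cyclic_derivative (tq n) (tp n) ` arcs (tq n) \<subseteq> annihilator"
 proof clarify
  fix al assume al: "al \<in> arcs (tq n)"
  obtain s p t q where r: "toda_rel n al = ((s, p), (t, q))" by (metis surj_pair)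
  note rf = toda_rel_facts[OF al r]
  let ?d = "%x. s * path_elem (toda_head al) p x - t * path_elem (toda_head al) q x"
  have d: "cyclic_derivative (tq n) (tp n) al = ?d"
   by (rule cyclic_derivative_toda[OF al r])
  have "act w ?d u x = (%_. 0)" if x: "x \<in> strip n i (level u)" for u w x
  proof -
   have *: "act w ?d u x k = s * act w (path_elem (toda_head al) p) u x k - t * act w (path_elem (toda_head al) q) u x k" for k
    using act_lin(1)[of w "%x. s * path_elem (toda_head al) p x" "%x. - t * path_elem (toda_head al) q x" u x]
     act_lin(2)[of w s "path_elem (toda_head al) p" u x] act_lin(2)[of w "- t" "path_elem (toda_head al) q" u x] by simp
   show ?thesis
   proof (cases "u = toda_head al")
    case True
    have eq: "(if s = 0 then (%_. 0) else fold mu p x) = (if t = 0 then (%_. 0) else fold mu q x)"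
     using toda_rep_model[of n i l1 l2, unfolded toda_rep_def, THEN conjunct2, rule_format, OF al r, of x] x True
     by (simp split: if_splits)
    have w: "toda_awalk n u p w <=> w = toda_tail al" if "s ~= 0"
     using rf(4)[OF that] True toda_awalk_unique by blast
    have w': "toda_awalk n u q w <=> w = toda_tail al" if "t ~= 0"
     using rf(5)[OF that] True toda_awalk_unique by blast
    have "s * act w (path_elem (toda_head al) p) u x k = (if w = toda_tail al then (if s = 0 then (%_. 0) else fold mu p x) k else 0)" for k
     unfolding act_path[OF x] using rf(1) w True by (cases "s = 0") auto
    moreover have "t * act w (path_elem (toda_head al) q) u x k = (if w = toda_tail al then (if t = 0 then (%_. 0) else fold mu q x) k else 0)" for k
     unfolding act_path[OF x] using rf(2) w' True by (cases "t = 0") auto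
    ultimately show ?thesis unfolding fun_eq_iff * eq by simp
   next
    case False
    then show ?thesis unfolding fun_eq_iff * by (simp add: act_path[OF x])
   qed
  qed
  moreover have "?d \<in> carrier (path_ring n)"
   using wf_digraph.cyclic_derivative_closed[OF wf_digraph_toda_quiver toda_potential_closed, of al n] al d by simp
  ultimately show "cyclic_derivative (tq n) (tp n) al \<in> annihilator"
   unfolding d annihilator_def by blast
 qed
qed

text \<open>An element of the closure agrees with one of the ideal at all paths of length below
  \<open>2 * n\<close>, and only these coefficients enter the action.\<close>

lemma toda_ideal_annihilates:
 assumes f: "f \<in> toda_ideal n" and x: "x \<in> strip n i (level u)"
 shows "act w f u x = (%_. 0)"
proof -
 obtain g where g: "g \<in> derivative_ideal n" "!!u p. length p < 2 * n ==> f (u, p) = g (u, p)"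
  using f unfolding jacobian_ideal_def arrow_adic_closure_def by blast
 have "act w f u x = act w g u x" unfolding act_def using g(2) by (auto simp: short_def intro!: ext sum.cong)
 then show ?thesis using g(1) derivative_annihilates x by (auto simp: annihilator_def)
qed

abbreviation "src \<equiv> 2 * i - 1"
abbreviation "gen \<equiv> (unit_fun i :: univ)"

definition "zeta = (%x. l1 * arrow_elem (tq n) (Arrow_a i) x + l2 * arrow_elem (tq n) (Arrow_b i) x)"

text \<open>The homomorphism from the projective at \<open>src\<close> to the model that sends the
  generator to \<open>gen\<close>, the highest position of the strip at level \<open>i\<close>.
  \<open>kern\<close> holds the series that become zero in the cokernel; its equality with the
  kernel of \<open>rho\<close> identifies the two modules.\<close>

definition "rho w f = act w f src gen"

definition "kern w = {f \<in> hom_paths n src w. \<exists>g\<in>hom_paths n (2 * i) w. (%x. f x - (g \<otimes>\<^bsub>path_ring n\<^esub> zeta) x) \<in> toda_ideal n}"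

lemma zeta_eq: "zeta = (%x. l1 * path_elem src [letter False i] x - (- l2) * path_elem src [letter True i] x)"
 by (simp add: zeta_def arrow_elem_def letter_def)

lemma letter_path: "toda_awalk n src [letter y i] (2 * i)"
 using i by (intro awalk_letterI) (auto simp: toda_awalk_simps)

lemma zeta_hom: "zeta \<in> hom_paths n src (2 * i)"
 unfolding zeta_eq
 using lin_closed_diff[OF lin_closed_hom_paths lin_closedD(3)[OF lin_closed_hom_paths path_elem_hom[OF letter_path[of False]], of l1]
   path_elem_hom[OF letter_path[of True]], of "- l2"] by simp

lemma gen_in: "gen \<in> strip n i (level src)"
 using i by (auto intro!: stripI simp: unit_fun_def lo_def level_def split: if_splits)

lemma src_vert: "src \<in> {1..2*n}" "2 * i \<in> {1..2*n}" using i by auto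

lemma rho_lin: "rho w (%x. f x + g x) = (%k. rho w f k + rho w g k)" "rho w (%x. c * f x) = (%k. c * rho w f k)"
 by (simp_all add: rho_def act_lin)

lemma rho_closed: "rho w f \<in> strip n i (level w)"
 unfolding rho_def by (rule act_closed[OF gen_in])

lemma rho_path: "toda_awalk n src p w ==> rho w (path_elem src p) = fold mu p gen"
 unfolding rho_def by (simp add: act_path[OF gen_in])

lemma rho_zeta:
 shows "rho w (g \<otimes>\<^bsub>path_ring n\<^esub> zeta) = (%_. 0)"
proof -
 have "act v zeta src gen = (%_. 0)" for v
 proof -
  have "act v zeta src gen = (%k. l1 * act v (path_elem src [letter False i]) src gen k + l2 * act v (path_elem src [letter True i]) src gen k)"
   unfolding zeta_eq
   using act_lin(1)[of v "%x. l1 * path_elem src [letter False i] x" "%x. l2 * path_elem src [letter True i] x" src gen]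
   by (simp add: act_lin(2))
  moreover have "toda_awalk n src [letter y i] v <=> v = 2 * i" for y
   using letter_path toda_awalk_unique by blast
  ultimately show ?thesis by (cases "v = 2 * i") (simp_all add: act_path[OF gen_in] model_map_letter)
 qed
 then show ?thesis unfolding rho_def act_mult[OF gen_in] by (simp add: act_zero)
qed

lemma rho_kern:
 assumes "f \<in> kern w" shows "rho w f = (%_. 0)"
proof -
 obtain g where g: "(%x. f x - (g \<otimes>\<^bsub>path_ring n\<^esub> zeta) x) \<in> toda_ideal n"
  using assms by (auto simp: kern_def)
 have "rho w (%x. f x - (g \<otimes>\<^bsub>path_ring n\<^esub> zeta) x) = (%_. 0)"
  unfolding rho_def by (rule toda_ideal_annihilates[OF g gen_in])
 moreover have "rho w f = (%k. rho w (%x. f x - (g \<otimes>\<^bsub>path_ring n\<^esub> zeta) x) k + rho w (g \<otimes>\<^bsub>path_ring n\<^esub> zeta) k)"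
  unfolding rho_lin(1)[symmetric] by simp
 ultimately show ?thesis by (simp add: rho_zeta)
qed

lemma arrow_hom: "al \<in> arcs (tq n) ==> arrow_elem (tq n) al \<in> hom_paths n (toda_tail al) (toda_head al)"
 unfolding arrow_elem_def toda_quiver_simps
 by (rule path_elem_hom) (use arrow_verts in \<open>auto simp: toda_awalk_simps\<close>)

text \<open>\<open>act_mult\<close> resolves the product over the intermediate vertices, of which
  only the tail of the arrow contributes.\<close>

lemma rho_arrow:
 assumes al: "al \<in> arcs (tq n)" and f: "f \<in> hom_paths n src (toda_tail al)"
 shows "rho (toda_head al) (arrow_elem (tq n) al \<otimes>\<^bsub>path_ring n\<^esub> f) = mu al (rho (toda_tail al) f)"
proof -
 have aw: "toda_awalk n (toda_tail al) [al] (toda_head al)"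
  using arrow_verts[OF al] al by (auto simp: toda_awalk_simps)
 have z: "rho v f = (%_. 0)" if "v ~= toda_tail al" for v
 proof -
  have "f (src, p) = 0" if "p \<in> short n src v" for p
  proof (rule ccontr)
   assume nz: "f (src, p) ~= 0"
   have "toda_awalk n src p (toda_tail al)"
    by (rule f[unfolded hom_paths_def mem_Collect_eq, rule_format, OF nz, THEN conjunct2])
   moreover have "toda_awalk n src p v" using that by (simp add: short_def)
   ultimately have "v = toda_tail al" by (rule toda_awalk_unique[rotated])
   then show False using \<open>v ~= toda_tail al\<close> by contradiction
  qed
  then show ?thesis by (simp add: rho_def act_def)
 qed
 show ?thesis
 proof
  fix k
  have "rho (toda_head al) (arrow_elem (tq n) al \<otimes>\<^bsub>path_ring n\<^esub> f) k =
    (\<Sum>v\<in>{1..2*n}. act (toda_head al) (arrow_elem (tq n) al) v (rho v f) k)"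
   unfolding rho_def act_mult[OF gen_in] ..
  also have "... = (\<Sum>v\<in>{toda_tail al}. act (toda_head al) (arrow_elem (tq n) al) v (rho v f) k)"
   by (rule sum.mono_neutral_right) (use arrow_verts(1)[OF al] z in \<open>auto simp: act_zero\<close>)
  also have "... = mu al (rho (toda_tail al) f) k"
   using aw by (simp add: arrow_elem_def act_path[OF rho_closed])
  finally show "rho (toda_head al) (arrow_elem (tq n) al \<otimes>\<^bsub>path_ring n\<^esub> f) k =
    mu al (rho (toda_tail al) f) k" .
 qed
qed

lemma coef_nonzero: obtains \<kappa> where "(if \<kappa> then - l1 else l2) ~= 0"
 using l that[of True] that[of False] by (auto split: if_splits)

text \<open>From \<open>gen\<close>, steps down lead to position \<open>p\<close> at level
  \<open>p\<close>, and from there steps up keep the position. A letter acting by a nonzero scalar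
  is used in between and the scalar divided out.\<close>

lemma unit_in_image:
 assumes p: "lo n i j < p" "p \<le> i" "p \<le> j" "j \<le> n"
 shows "unit_fun p \<in> rho (2 * j - 1) ` hom_paths n src (2 * j - 1)" "unit_fun p \<in> rho (2 * j) ` hom_paths n src (2 * j)"
proof -
 let ?N = "%w. rho w ` hom_paths n src w"
 obtain \<kappa> where \<kappa>: "(if \<kappa> then - l1 else l2) ~= 0" by (rule coef_nonzero)
 let ?c = "if \<kappa> then - l1 else l2"
 have cl: "mu al \<phi> \<in> ?N (toda_head al)" if al: "al \<in> arcs (tq n)" and \<phi>: "\<phi> \<in> ?N (toda_tail al)" for al \<phi>
 proof -
  obtain f where f: "f \<in> hom_paths n src (toda_tail al)" "\<phi> = rho (toda_tail al) f" using \<phi> by blast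
  show ?thesis unfolding f(2) rho_arrow[OF al f(1), symmetric]
   by (rule imageI) (rule hom_paths_mult[OF arrow_hom[OF al] f(1)])
 qed
 have sc: "(%k. d * \<phi> k) \<in> ?N w" if \<phi>: "\<phi> \<in> ?N w" for d \<phi> w
 proof -
  obtain f where f: "f \<in> hom_paths n src w" "\<phi> = rho w f" using \<phi> by blast
  show ?thesis unfolding f(2) rho_lin(2)[symmetric] by (rule imageI) (rule lin_closedD(3)[OF lin_closed_hom_paths f(1)])
 qed
 have even: "unit_fun q \<in> ?N (2 * k)" if "unit_fun q \<in> ?N (2 * k - 1)" "1 \<le> k" "k \<le> n" for q k
 proof -
  have "mu (letter \<kappa> k) (unit_fun q) \<in> ?N (2 * k)" using cl[of "letter \<kappa> k" "unit_fun q"] that by simp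
  then have "(%x. inverse ?c * mu (letter \<kappa> k) (unit_fun q) x) \<in> ?N (2 * k)" by (rule sc)
  moreover have "(%x. inverse ?c * mu (letter \<kappa> k) (unit_fun q) x) = unit_fun q"
   using \<kappa> by (auto simp: model_map_letter fun_eq_iff)
  ultimately show ?thesis by simp
 qed
 have gen0: "gen \<in> ?N src"
 proof (rule image_eqI[of _ _ "path_elem src []"])
  have nil: "toda_awalk n src [] src" using src_vert by (simp add: toda_awalk_simps)
  show "gen = rho src (path_elem src [])" by (simp add: rho_path[OF nil])
  show "path_elem src [] \<in> hom_paths n src src" by (rule path_elem_hom[OF nil])
 qed
 have down: "unit_fun k \<in> ?N (2 * k - 1)" if "1 \<le> k" "k \<le> i" for k
  using that(2,1)
 proof (induction rule: inc_induct)
  case base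
  show ?case by (rule gen0)
 next
  case (step k)
  have "unit_fun (Suc k) \<in> ?N (2 * Suc k)" using step i by (intro even) auto
  then have "mu (step False (Suc k)) (unit_fun (Suc k)) \<in> ?N (2 * k - 1)"
   using cl[of "step False (Suc k)" "unit_fun (Suc k)"] step i toda_head_step[of "Suc k" False]
   by (simp add: can_step_def next_level_def)
  moreover have "mu (step False (Suc k)) (unit_fun (Suc k)) = unit_fun k"
   using step i by (auto simp: model_map_step unit_fun_def lo_def fun_eq_iff)
  ultimately show ?case by simp
 qed
 have up: "lo n i j < p ==> j \<le> n ==> unit_fun p \<in> ?N (2 * j - 1)" using p(3)
 proof (induction rule: dec_induct)
  case base
  then show ?case using down[of p] p by simp
 next
  case (step k)
  have lp: "lo n i (k + 1) < p" using step.prems by (simp add: Suc_eq_plus1)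
  have "lo n i k < p" using step.prems by (auto simp: lo_def)
  then have "unit_fun p \<in> ?N (2 * k)" using step p by (intro even) auto
  then have "mu (step True k) (unit_fun p) \<in> ?N (2 * Suc k - 1)"
   using cl[of "step True k" "unit_fun p"] step p toda_head_step[of k True]
   by (simp add: can_step_def next_level_def)
  moreover have "mu (step True k) (unit_fun p) = unit_fun p"
   using lp by (auto simp: model_map_step unit_fun_def fun_eq_iff)
  ultimately show ?case by simp
 qed
 show 1: "unit_fun p \<in> ?N (2 * j - 1)" using up p by simp
 show "unit_fun p \<in> ?N (2 * j)" using even[OF 1] p by simp
qed

lemma rho_surj:
 assumes w: "w \<in> {1..2*n}" and \<phi>: "\<phi> \<in> strip n i (level w)"
 obtains f where "f \<in> hom_paths n src w" "rho w f = \<phi>"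
proof -
 let ?S = "{lo n i (level w)<..min i (level w)}"
 have "\<exists>f\<in>hom_paths n src w. rho w f = unit_fun p" if "p \<in> ?S" for p
 proof (rule vertex_cases[OF w])
  fix j assume "w = 2 * j - 1" "1 \<le> j" "j \<le> n"
  then show ?thesis using unit_in_image(1)[of j p] that by force
 next
  fix j assume "w = 2 * j" "1 \<le> j" "j \<le> n"
  then show ?thesis using unit_in_image(2)[of j p] that by force
 qed
 then obtain F where F: "!!p. p \<in> ?S ==> F p \<in> hom_paths n src w" "!!p. p \<in> ?S ==> rho w (F p) = unit_fun p"
  by metis
 define f where "f = (%x. \<Sum>p\<in>?S. \<phi> p * F p x)"
 have fh: "f \<in> hom_paths n src w" unfolding f_def
  by (intro lin_closed_sum[OF lin_closed_hom_paths] lin_closedD(3)[OF lin_closed_hom_paths] F) auto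
 have "rho w f k = \<phi> k" for k
 proof -
  have "rho w f k = (\<Sum>r\<in>short n src w. \<Sum>p\<in>?S. \<phi> p * (F p (src, r) * fold mu r gen k))"
   by (simp add: rho_def act_def f_def sum_distrib_right mult.assoc)
  also have "... = (\<Sum>p\<in>?S. \<phi> p * rho w (F p) k)"
   by (subst sum.swap) (simp add: rho_def act_def sum_distrib_left)
  also have "... = (\<Sum>p\<in>?S. if p = k then \<phi> k else 0)"
   using F(2) by (intro sum.cong) (auto simp: unit_fun_def)
  also have "... = \<phi> k" using stripD[OF \<phi>, of k] by (cases "\<phi> k = 0") auto
  finally show ?thesis .
 qed
 then show thesis using that[OF fh] by blast
qed

end

section \<open>The kernel of the map from the projective to the model\<close>

context toda_data
begin

lemma lin_closed_kern: "lin_closed (kern w)"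
 unfolding lin_closed_def
proof (intro conjI ballI allI)
 note H = lin_closed_hom_paths and J = lin_closed_ideal[OF ideal_toda]
 have z: "(%_. 0 :: complex) \<otimes>\<^bsub>path_ring n\<^esub> zeta = (%_. 0)"
  using path_mult_scale(1)[where s = 0 and f = zeta and h = zeta] by simp
 show "(%_. 0) \<in> kern w" unfolding kern_def
  by (intro CollectI conjI bexI[of _ "%_. 0"]) (simp_all add: lin_closedD(1)[OF H] lin_closedD(1)[OF J] z)
 fix x assume x: "x \<in> kern w"
 then obtain g where g: "x \<in> hom_paths n src w" "g \<in> hom_paths n (2 * i) w"
  "(%t. x t - (g \<otimes>\<^bsub>path_ring n\<^esub> zeta) t) \<in> toda_ideal n" by (auto simp: kern_def)
 show "(%k. c * x k) \<in> kern w" for c unfolding kern_def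
 proof (intro CollectI conjI bexI[of _ "%k. c * g k"])
  show "(%t. c * x t - ((%k. c * g k) \<otimes>\<^bsub>path_ring n\<^esub> zeta) t) \<in> toda_ideal n"
   using lin_closedD(3)[OF J g(3), of c] by (simp add: path_mult_scale algebra_simps)
 qed (use g lin_closedD(3)[OF H] in auto)
 fix y assume "y \<in> kern w"
 then obtain h where h: "y \<in> hom_paths n src w" "h \<in> hom_paths n (2 * i) w"
  "(%t. y t - (h \<otimes>\<^bsub>path_ring n\<^esub> zeta) t) \<in> toda_ideal n" by (auto simp: kern_def)
 show "(%k. x k + y k) \<in> kern w" unfolding kern_def
 proof (intro CollectI conjI bexI[of _ "%k. g k + h k"])
  show "(%t. x t + y t - ((%k. g k + h k) \<otimes>\<^bsub>path_ring n\<^esub> zeta) t) \<in> toda_ideal n"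
   using lin_closedD(2)[OF J g(3) h(3)] by (simp add: path_mult_add algebra_simps)
 qed (use g h lin_closedD(2)[OF H] in auto)
qed

lemma kern_ideal: "f \<in> hom_paths n src w ==> f \<in> toda_ideal n ==> f \<in> kern w"
proof -
 assume f: "f \<in> hom_paths n src w" "f \<in> toda_ideal n"
 have z: "(%_. 0 :: complex) \<otimes>\<^bsub>path_ring n\<^esub> zeta = (%_. 0)"
  using path_mult_scale(1)[where s = 0 and f = zeta and h = zeta] by simp
 show ?thesis unfolding kern_def
  by (intro CollectI conjI bexI[of _ "%_. 0"]) (simp_all add: f z lin_closedD(1)[OF lin_closed_hom_paths])
qed

lemma kern_zeta: "g \<in> hom_paths n (2 * i) w ==> g \<otimes>\<^bsub>path_ring n\<^esub> zeta \<in> kern w"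
 unfolding kern_def using hom_paths_mult[OF _ zeta_hom] lin_closedD(1)[OF lin_closed_ideal[OF ideal_toda]]
 by (intro CollectI conjI bexI[of _ g]) auto

abbreviation "coset \<equiv> function_coset (derivative_ideal n)"
abbreviation "val \<equiv> (%y. if y then - l1 else l2)"

lemma coset_kern:
 assumes "coset (path_elem src p) = coset (path_elem src q)" "toda_awalk n src p w" "toda_awalk n src q w"
 shows "(%t. path_elem src p t - path_elem src q t) \<in> kern w"
proof (rule kern_ideal)
 show "(%t. path_elem src p t - path_elem src q t) \<in> hom_paths n src w"
  using lin_closed_diff[OF lin_closed_hom_paths path_elem_hom path_elem_hom, of n src p w q 1] assms(2,3) by simp
 show "(%t. path_elem src p t - path_elem src q t) \<in> toda_ideal n"
  using assms(1) derivative_ideal_subset by (auto simp: function_coset_eq_iff[OF lin_closed_ideal[OF ideal_derivative]])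
qed

text \<open>
 A letter that is not first moves to the front by the commutation relations, where the relation
 \<open>\<lambda>\<^sub>1 a\<^sub>i + \<lambda>\<^sub>2 b\<^sub>i = 0\<close> of the cokernel applies.
\<close>

lemma replace_letter:
 assumes "toda_awalk n src (q0 @ letter x j # q) w"
 shows "(%t. val y * path_elem src (q0 @ letter x j # q) t - val x * path_elem src (q0 @ letter y j # q) t) \<in> kern w"
 using assms
proof (induction "length q0" arbitrary: q0 j q rule: less_induct)
 case less
 note K = lin_closed_kern[of w]
 have j: "1 \<le> j" "j \<le> n" using less.prems by (auto simp: toda_awalk_append_iff toda_awalk_simps)
 from less.prems obtain w0 where q0: "toda_awalk n src q0 w0" and q: "toda_awalk n w0 (letter x j # q) w"
  by (auto simp: toda_awalk_append_iff)
 have w0: "w0 = 2 * j - 1" and q': "toda_awalk n (2 * j) q w" using q by (auto simp: toda_awalk_simps)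
 show ?case
 proof (cases q0 rule: rev_cases)
  case Nil
  then have "src = 2 * j - 1" using q0 w0 by (simp add: toda_awalk_simps)
  then have ji: "j = i" using i j by arith
  show ?thesis
  proof (cases "x = y")
   case True
   then show ?thesis using lin_closedD(1)[OF K] by simp
  next
   case False
   have g: "path_elem (2 * i) q \<in> hom_paths n (2 * i) w" using path_elem_hom[OF q'] ji by simp
   have e: "path_elem (2 * i) q \<otimes>\<^bsub>path_ring n\<^esub> zeta =
     (%t. l1 * path_elem src (letter False i # q) t - (- l2) * path_elem src (letter True i # q) t)"
    unfolding zeta_eq path_mult_linear path_elem_mult[OF letter_path] by simp
   show ?thesis using kern_zeta[OF g] lin_closedD(3)[OF K kern_zeta[OF g], of "-1"] False Nil ji
    unfolding e by (cases x; cases y) (simp_all add: algebra_simps)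
  qed
 next
  case (snoc q1 \<beta>)
  from q0 snoc w0 obtain w1 where q1: "toda_awalk n src q1 w1" and \<beta>: "\<beta> \<in> arcs (tq n)" "toda_tail \<beta> = w1" "toda_head \<beta> = 2 * j - 1"
   by (auto simp: toda_awalk_append_iff toda_awalk_simps)
  obtain d k where d: "\<beta> = step d k" "w1 = 2 * k" "1 \<le> k" "k \<le> n" "can_step n d k" "next_level d k = j"
  proof (rule arrow_cases[of \<beta>])
   fix x' k assume "\<beta> = letter x' k"
   then have "2 * k = 2 * j - 1" using \<beta>(3) by simp
   then have False using j by presburger
   then show thesis ..
  next
   fix d k assume b: "\<beta> = step d k"
   then have k: "1 \<le> k" "k \<le> n" "can_step n d k" "w1 = 2 * k" using \<beta> by auto
   have "2 * next_level d k - 1 = 2 * j - 1" using \<beta>(3) b toda_head_step[OF k(1), of d] by simp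
   moreover have "1 \<le> next_level d k" using next_level_range[OF k(3,1,2)] by simp
   ultimately have "next_level d k = j" using j by arith
   then show thesis using that b k by blast
  qed
  obtain q2 z where q2: "q1 = q2 @ [letter z k]" "toda_awalk n src q2 (2 * k - 1)"
  proof (cases q1 rule: rev_cases)
   case Nil
   then have "src = 2 * k" using q1 d(2) by (simp add: toda_awalk_simps)
   then have False using i by presburger
   then show thesis ..
  next
   case (snoc q2 \<gamma>)
   from q1 snoc d(2) obtain w2 where q2: "toda_awalk n src q2 w2" and \<gamma>: "\<gamma> \<in> arcs (tq n)" "toda_tail \<gamma> = w2" "toda_head \<gamma> = 2 * k"
    by (auto simp: toda_awalk_append_iff toda_awalk_simps)
   show thesis
   proof (rule arrow_cases[of \<gamma>])
    fix z k' assume "\<gamma> = letter z k'"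
    then show thesis using that[of q2 z] snoc q2 \<gamma> by simp
   next
    fix e k' assume g: "\<gamma> = step e k'"
    then have "2 * next_level e k' - 1 = 2 * k" using \<gamma> toda_head_step[of k' e] by simp
    then have False using d(3) by presburger
    then show thesis ..
   qed
  qed
  have q0': "q0 = q2 @ letter z k # step d k # []" using snoc q2(1) d(1) by simp
  have aw: "toda_awalk n src (q2 @ letter x' k # step d k # letter y' j # q) w" for x' y'
  proof -
   have "toda_awalk n (2 * j - 1) (letter y' j # q) w" by (rule awalk_letterI[OF j q'])
   then have "toda_awalk n (2 * k) (step d k # letter y' j # q) w"
    by (intro awalk_stepI[OF d(3,4,5)]) (simp add: d(6))
   then have "toda_awalk n (2 * k - 1) (letter x' k # step d k # letter y' j # q) w"
    by (rule awalk_letterI[OF d(3,4)])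
   then show ?thesis unfolding toda_awalk_append_iff using q2(2) by blast
  qed
  have comm: "coset (path_elem src (q2 @ letter x' k # step d k # letter y' j # q)) =
    coset (path_elem src (q2 @ letter y' k # step d k # letter x' j # q))" for x' y'
   using compatible_commute[OF compatible_coset d(3,4,5) q2(2), of q w x' y'] q' d(6) by simp
  let ?P = "%x' y'. path_elem src (q2 @ letter x' k # step d k # letter y' j # q)"
  have c: "(%t. ?P x' y' t - ?P y' x' t) \<in> kern w" for x' y'
   by (rule coset_kern[OF comm aw aw])
  have IH: "(%t. val y * ?P x z t - val x * ?P y z t) \<in> kern w"
   using less.hyps[of q2 k "step d k # letter z j # q"] aw q0' by simp
  have "(%t. (val y * ?P x z t - val x * ?P y z t) + (val y * (?P z x t - ?P x z t) + val x * (?P y z t - ?P z y t))) \<in> kern w"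
   by (intro lin_closedD(2)[OF K] lin_closedD(3)[OF K] IH c)
  then show ?thesis unfolding q0' by (simp add: algebra_simps)
 qed
qed

text \<open>With a letter \<open>y\<close> for which \<open>val y\<close> is nonzero, the results
  are paths to which \<open>compatible_eq\<close> applies.\<close>

definition "unify_letters y = map (%al. case al of Arrow_a j => letter y j | Arrow_b j => letter y j | \<beta> => \<beta>)"

lemma unify_letters_simps [simp]:
 "unify_letters y [] = []" "unify_letters y (letter x j # p) = letter y j # unify_letters y p"
 "unify_letters y (step d j # p) = step d j # unify_letters y p" "unify_letters y (p @ q) = unify_letters y p @ unify_letters y q"
 by (simp_all add: unify_letters_def letter_def step_def)

lemma toda_awalk_unify_letters: "toda_awalk n u (unify_letters y p) w <=> toda_awalk n u p w"
proof (induction p arbitrary: u)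
 case (Cons al p)
 show ?case using Cons by (cases al rule: arrow_cases) (auto simp: toda_awalk_simps)
qed simp

lemma steps_unify_letters [simp]: "steps d (unify_letters y p) = steps d p"
proof (induction p arbitrary: d)
 case (Cons al p)
 then show ?case by (cases al rule: arrow_cases) simp_all
qed simp

lemma letters_unify_letters: "letters (unify_letters y p) \<subseteq> {y}"
proof (induction p)
 case (Cons al p)
 then show ?case by (cases al rule: arrow_cases) simp_all
qed simp

lemma length_unify_letters [simp]: "length (unify_letters y p) = length p"
 by (simp add: unify_letters_def)

text \<open>The letters are replaced one at a time, from the last to the first; replacing
  \<open>x\<close> by \<open>y\<close> costs the scalar \<open>val x / val y\<close>.\<close>

lemma unify_letters_kern:
 assumes y: "val y ~= 0" and p: "toda_awalk n src (p @ q) w"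
 shows "EX c. (%t. path_elem src (p @ q) t - c * path_elem src (unify_letters y p @ q) t) \<in> kern w"
 using p
proof (induction p arbitrary: q rule: rev_induct)
 case Nil
 then show ?case using lin_closedD(1)[OF lin_closed_kern] by (intro exI[of _ 1]) simp
next
 case (snoc al p)
 note K = lin_closed_kern[of w]
 show ?case
 proof (rule arrow_cases[of al])
  fix d j assume "al = step d j"
  then show ?thesis using snoc.IH[of "al # q"] snoc.prems by simp
 next
  fix x j assume al: "al = letter x j"
  have 1: "(%t. val y * path_elem src (p @ letter x j # q) t - val x * path_elem src (p @ letter y j # q) t) \<in> kern w"
   by (rule replace_letter) (use snoc.prems al in simp)
  have "toda_awalk n src (p @ letter y j # q) w"
   using snoc.prems al by (auto simp: toda_awalk_append_iff toda_awalk_simps)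
  then obtain c where c: "(%t. path_elem src (p @ letter y j # q) t - c * path_elem src (unify_letters y p @ letter y j # q) t) \<in> kern w"
   using snoc.IH by blast
  have "(%t. inverse (val y) * (val y * path_elem src (p @ letter x j # q) t - val x * path_elem src (p @ letter y j # q) t) +
    (val x / val y) * (path_elem src (p @ letter y j # q) t - c * path_elem src (unify_letters y p @ letter y j # q) t)) \<in> kern w"
   by (intro lin_closedD(2)[OF K] lin_closedD(3)[OF K] 1 c)
  moreover have arith: "inverse a * (a * X - b * Y) + (b / a) * (Y - c * Z) = X - (b / a * c) * Z"
   if "a ~= 0" for a b c X Y Z :: complex
   using that by (simp add: field_simps)
  ultimately have "(%t. path_elem src (p @ letter x j # q) t - (val x / val y * c) * path_elem src (unify_letters y p @ letter y j # q) t) \<in> kern w"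
   by (simp only: arith[OF y])
  then show ?thesis using al by (intro exI[of _ "val x / val y * c"]) simp
 qed
qed

text \<open>Steps up keep the position and steps down lower it by one. The bounds on the numbers of
  steps keep the path clear of all cut-offs, and each letter contributes the nonzero scalar
  \<open>val y\<close>.\<close>

lemma fold_unified:
 assumes "val y ~= 0" "toda_awalk n src p w" "letters p \<subseteq> {y}" "steps True p \<le> n - i" "steps False p \<le> i - 1"
 shows "level w + steps False p = i + steps True p &
  (EX c. c ~= 0 & fold mu p gen = (%k. c * unit_fun (i - steps False p) k))"
 using assms(2-)
proof (induction p arbitrary: w rule: rev_induct)
 case Nil
 then have "w = src" by (simp add: toda_awalk_simps)
 then show ?case using i by (auto intro!: exI[of _ 1])
next
 case (snoc al p)
 from snoc.prems obtain w' where p: "toda_awalk n src p w'" and al: "al \<in> arcs (tq n)" "toda_tail al = w'" "toda_head al = w"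
  by (auto simp: toda_awalk_append_iff toda_awalk_simps)
 have "letters p \<subseteq> {y}" "steps True p \<le> n - i" "steps False p \<le> i - 1" using snoc.prems by simp_all
 from snoc.IH[OF p this] obtain c where IH: "level w' + steps False p = i + steps True p" and c: "c ~= 0"
  and f: "fold mu p gen = (%k. c * unit_fun (i - steps False p) k)" by blast
 show ?case
 proof (rule arrow_cases[of al])
  fix x j assume a: "al = letter x j"
  then have "x = y" "1 \<le> j" "level w = level w'" using snoc.prems al by auto
  then show ?thesis using a IH c f assms(1)
   by (auto simp: model_map_letter fun_eq_iff intro!: exI[of _ "val y * c"])
 next
  fix d j assume a: "al = step d j"
  then have j: "1 \<le> j" "j \<le> n" "can_step n d j" "w' = 2 * j" using al by auto
  have "1 \<le> next_level d j" using next_level_range[OF j(3,1,2)] by simp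
  then have lw: "level w = next_level d j" "level w' = j" using al(3) a j toda_head_step[OF j(1), of d] by auto
  show ?thesis
  proof (cases d)
   case True
   then have s: "steps True (p @ [al]) = steps True p + 1" "steps False (p @ [al]) = steps False p" using a by simp_all
   have "lo n i (j + 1) < i - steps False p"
    using snoc.prems(3,4) IH lw s i by (auto simp: lo_def)
   then have "mu al (fold mu p gen) = fold mu p gen"
    unfolding f a using True by (auto simp: model_map_step unit_fun_def fun_eq_iff)
   then show ?thesis using IH lw c f s True by (auto simp: next_level_def)
  next
   case False
   then have s: "steps True (p @ [al]) = steps True p" "steps False (p @ [al]) = steps False p + 1" using a by simp_all
   have "lo n i (j - 1) < i - (steps False p + 1)" "steps False p + 1 \<le> i - 1"
    using snoc.prems(3,4) IH lw s i by (auto simp: lo_def)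
   then have "mu al (fold mu p gen) = (%k. c * unit_fun (i - (steps False p + 1)) k)"
    unfolding f a using False by (auto simp: model_map_step unit_fun_def fun_eq_iff)
   then show ?thesis using IH lw c s False j by (auto simp: next_level_def can_step_def)
  qed
 qed
qed

text \<open>Modulo \<open>kern\<close> every path reduces to zero or to a multiple of one
  representative for its number of steps down. The representatives have images at distinct
  positions, so a combination with image zero has only zero coefficients.\<close>

lemma kern_rho:
 assumes f: "f \<in> hom_paths n src w" and r: "rho w f = (%_. 0)"
 shows "f \<in> kern w"
proof -
 obtain y where y: "val y ~= 0" using coef_nonzero by blast
 note K = lin_closed_kern[of w] and H = lin_closed_hom_paths
 let ?S = "short n src w" and ?N = "unify_letters y"
 \<comment> \<open>The numbers of steps that fit on either side of level \<open>i\<close>; all other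
   paths are null.\<close>
 define good where "good p <=> steps True p \<le> n - i & steps False p \<le> i - 1" for p
 define G where "G = {p \<in> ?S. good p}"
 \<comment> \<open>For a fixed end vertex the number of steps down determines that of steps up, so
   \<open>t\<close> alone indexes the representatives.\<close>
 define C where "C t = (SOME p. p \<in> G & steps False p = t)" for t
 have SP: "toda_awalk n src p w" if "p \<in> ?S" for p using that by (simp add: short_def)
 have finG: "finite G" by (simp add: G_def finite_short)
 have C: "C (steps False p) \<in> G & steps False (C (steps False p)) = steps False p" if "p \<in> G" for p
  unfolding C_def by (rule someI[of "%q. q \<in> G & steps False q = steps False p" p]) (use that in simp)
 have fold: "level w + steps False p = i + steps True p"
  "EX c. c ~= 0 & fold mu (?N p) gen = (%k. c * unit_fun (i - steps False p) k)" if "p \<in> G" for p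
  using fold_unified[OF y, of "?N p" w] that letters_unify_letters[of y p]
  by (auto simp: G_def good_def toda_awalk_unify_letters SP)
 have "ALL p. EX c. p \<in> ?S --> (%t. path_elem src p t - c * path_elem src (?N p) t) \<in> kern w"
 proof
  fix p show "EX c. p \<in> ?S --> (%t. path_elem src p t - c * path_elem src (?N p) t) \<in> kern w"
   using unify_letters_kern[OF y, of p "[]" w] SP[of p] by (cases "p \<in> ?S") simp_all
 qed
 from choice[OF this] obtain c where
  c0: "ALL p. p \<in> ?S --> (%t. path_elem src p t - c p * path_elem src (?N p) t) \<in> kern w" by (rule exE)
 have c: "(%t. path_elem src p t - c p * path_elem src (?N p) t) \<in> kern w" if "p \<in> ?S" for p
  by (rule c0[rule_format, OF that])
 let ?D = "%p. path_elem src (?N (C (steps False p)))"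
 have red: "(%t. path_elem src p t - (if good p then c p else 0) * ?D p t) \<in> kern w" if p: "p \<in> ?S" for p
 proof (cases "good p")
  case True
  then have pG: "p \<in> G" using p by (simp add: G_def)
  have CG: "C (steps False p) \<in> G" "steps False (C (steps False p)) = steps False p" using C[OF pG] by simp_all
  have CS: "C (steps False p) \<in> ?S" using CG by (simp add: G_def)
  have aw: "toda_awalk n src (?N p) w" "toda_awalk n src (?N (C (steps False p))) w"
   using SP[OF p] SP[OF CS] by (simp_all add: toda_awalk_unify_letters)
  have st: "steps d (?N p) = steps d (?N (C (steps False p)))" for d
   using fold(1)[OF pG] fold(1)[OF CG(1)] CG(2) by (cases d) simp_all
  have "coset (path_elem src (?N p)) = coset (?D p)"
   by (rule compatible_eq[OF compatible_coset aw letters_unify_letters letters_unify_letters st])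
  from coset_kern[OF this aw] have "(%t. path_elem src (?N p) t - ?D p t) \<in> kern w" .
  then have "(%t. (path_elem src p t - c p * path_elem src (?N p) t) + c p * (path_elem src (?N p) t - ?D p t)) \<in> kern w"
   by (intro lin_closedD(2)[OF K] lin_closedD(3)[OF K] c[OF p])
  then show ?thesis using True by (simp add: algebra_simps)
 next
  case False
  have aw: "toda_awalk n src (?N p) w" using SP[OF p] by (simp add: toda_awalk_unify_letters)
  have lev: "level src = i" using i by simp
  have "EX d. room n d (level src) < steps d (?N p)"
  proof (cases "steps True p \<le> n - i")
   case True
   then have "i - 1 < steps False p" using False by (simp add: good_def)
   then show ?thesis unfolding lev by (intro exI[of _ False]) (simp add: room_def)
  next
   case f: False
   then show ?thesis unfolding lev by (intro exI[of _ True]) (simp add: room_def)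
  qed
  then obtain d where "room n d (level src) < steps d (?N p)" by blast
  then have "coset (path_elem src (?N p)) = coset (%_. 0)" by (rule compatible_null[OF compatible_coset aw])
  then have "path_elem src (?N p) \<in> derivative_ideal n"
   by (simp add: function_coset_eq_iff[OF lin_closed_ideal[OF ideal_derivative]])
  then have "path_elem src (?N p) \<in> kern w"
   using derivative_ideal_subset by (intro kern_ideal path_elem_hom[OF aw]) blast
  then have "(%t. (path_elem src p t - c p * path_elem src (?N p) t) + c p * path_elem src (?N p) t) \<in> kern w"
   by (intro lin_closedD(2)[OF K] lin_closedD(3)[OF K] c[OF p])
  then show ?thesis using False by simp
 qed
 \<comment> \<open>The part of \<open>f\<close> on short paths; the rest lies in the closed
   ideal.\<close>
 define f0 where "f0 = (%x. \<Sum>p\<in>?S. f (src, p) * path_elem src p x)"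
 define a where "a t = (\<Sum>p\<in>{p \<in> G. steps False p = t}. f (src, p) * c p)" for t
 define h where "h = (%x. \<Sum>t\<in>steps False ` G. a t * path_elem src (?N (C t)) x)"
 have f0h: "f0 \<in> hom_paths n src w" unfolding f0_def
  by (intro lin_closed_sum[OF H finite_short] lin_closedD(3)[OF H] path_elem_hom SP)
 have 1: "(%x. f x - f0 x) \<in> kern w"
 proof (rule kern_ideal)
  show fh: "(%x. f x - f0 x) \<in> hom_paths n src w" using lin_closed_diff[OF H f f0h, of 1] by simp
  show "(%x. f x - f0 x) \<in> toda_ideal n"
  proof (rule long_in_toda_ideal[OF fh])
   fix p :: "toda_arrow list" assume len: "length p < 2 * n"
   have "f0 (src, p) = (\<Sum>r\<in>?S. if r = p then f (src, p) else 0)"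
    unfolding f0_def by (intro sum.cong) (auto simp: path_elem_def)
   also have "... = (if p \<in> ?S then f (src, p) else 0)" by (simp add: finite_short)
   also have "... = f (src, p)" using f len by (auto simp: short_def hom_paths_def)
   finally show "f (src, p) - f0 (src, p) = 0" by simp
  qed
 qed
 \<comment> \<open>The reductions of all short paths are added up; grouping by the number of steps
   down then produces \<open>h\<close>.\<close>
 have "(%x. \<Sum>p\<in>?S. f (src, p) * (path_elem src p x - (if good p then c p else 0) * ?D p x)) \<in> kern w"
  by (intro lin_closed_sum[OF K finite_short] lin_closedD(3)[OF K] red)
 moreover have "(\<Sum>p\<in>?S. f (src, p) * (path_elem src p x - (if good p then c p else 0) * ?D p x)) = f0 x - h x" for x
 proof -
  have "(\<Sum>p\<in>?S. f (src, p) * (if good p then c p else 0) * ?D p x) = (\<Sum>p\<in>G. f (src, p) * c p * ?D p x)"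
   unfolding G_def by (rule sum.mono_neutral_cong_right) (auto simp: finite_short)
  also have "... = (\<Sum>t\<in>steps False ` G. \<Sum>p\<in>{p \<in> G. steps False p = t}. f (src, p) * c p * ?D p x)"
   by (rule sum.image_gen[OF finG])
  also have "... = h x" unfolding h_def a_def sum_distrib_right
   by (intro sum.cong refl) simp
  finally have eq: "(\<Sum>p\<in>?S. f (src, p) * (if good p then c p else 0) * ?D p x) = h x" .
  have "(\<Sum>p\<in>?S. f (src, p) * (path_elem src p x - (if good p then c p else 0) * ?D p x)) =
    (\<Sum>p\<in>?S. f (src, p) * path_elem src p x - f (src, p) * (if good p then c p else 0) * ?D p x)"
   by (intro sum.cong refl) (simp only: right_diff_distrib mult.assoc)
  then show ?thesis unfolding sum_subtractf eq f0_def .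
 qed
 ultimately have 2: "(%x. f0 x - h x) \<in> kern w" by simp
 have 3: "(%x. f x - h x) \<in> kern w"
  using lin_closedD(2)[OF K 1 2] by simp
 have r0: "rho w h k = 0" for k
 proof -
  have "rho w f = (%k. rho w (%x. f x - h x) k + rho w h k)"
   unfolding rho_lin(1)[symmetric] by simp
  then show ?thesis using r rho_kern[OF 3] by (simp add: fun_eq_iff)
 qed
 have rh: "rho w h k = (\<Sum>t\<in>steps False ` G. a t * fold mu (?N (C t)) gen k)" for k
 proof -
  have "rho w h k = (\<Sum>r\<in>?S. \<Sum>t\<in>steps False ` G. a t * (path_elem src (?N (C t)) (src, r) * fold mu r gen k))"
   by (simp add: rho_def act_def h_def sum_distrib_right mult.assoc)
  also have "... = (\<Sum>t\<in>steps False ` G. a t * rho w (path_elem src (?N (C t))) k)"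
   by (subst sum.swap) (simp add: rho_def act_def sum_distrib_left)
  also have "... = (\<Sum>t\<in>steps False ` G. a t * fold mu (?N (C t)) gen k)"
  proof (intro sum.cong refl)
   fix t assume "t \<in> steps False ` G"
   then have "C t \<in> ?S" using C by (auto simp: G_def)
   then show "a t * rho w (path_elem src (?N (C t))) k = a t * fold mu (?N (C t)) gen k"
    using rho_path[of "?N (C t)" w] SP by (simp add: toda_awalk_unify_letters)
  qed
  finally show ?thesis .
 qed
 have "a t = 0" if t: "t \<in> steps False ` G" for t
 proof -
  have tG: "C s \<in> G & steps False (C s) = s & s \<le> i - 1" if "s \<in> steps False ` G" for s
   using C that by (auto simp: G_def good_def)
  have F: "EX c. c ~= 0 & fold mu (?N (C s)) gen = (%k. c * unit_fun (i - s) k)" if "s \<in> steps False ` G" for s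
   using fold(2)[of "C s"] tG[OF that] by auto
  \<comment> \<open>Evaluation at position \<open>i - t\<close> isolates the term of
    \<open>t\<close>. Since no number of steps down exceeds \<open>i - 1\<close>, different numbers
    give different positions.\<close>
  have "0 = (\<Sum>s\<in>steps False ` G. a s * fold mu (?N (C s)) gen (i - t))"
   using r0[of "i - t"] rh[of "i - t"] by simp
  also have "... = (\<Sum>s\<in>steps False ` G. if s = t then a t * fold mu (?N (C t)) gen (i - t) else 0)"
  proof (intro sum.cong refl)
   fix s assume s: "s \<in> steps False ` G"
   have "i - s ~= i - t" if "s ~= t" using tG[OF s] tG[OF t] that i by arith
   then show "a s * fold mu (?N (C s)) gen (i - t) = (if s = t then a t * fold mu (?N (C t)) gen (i - t) else 0)"
    using F[OF s] by (auto simp: unit_fun_def)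
  qed
  also have "... = a t * fold mu (?N (C t)) gen (i - t)" using t finG by simp
  finally show ?thesis using F[OF t] by (auto simp: unit_fun_def)
 qed
 then have "h = (%_. 0)" by (simp add: h_def)
 then show ?thesis using 3 by simp
qed

end

section \<open>The module of the theorem as a space of cosets\<close>

text \<open>The axioms pass along the surjection \<open>\<pi>\<close> from a space of functions.
  This serves for the quotient, whose elements are sets of classes.\<close>

lemma vectorspace_fun_image:
 fixes W :: "(complex, 'b) module" and \<pi> :: "('k => complex) => 'b"
 assumes A: "lin_closed A" and c: "carrier W = \<pi> ` A" and z: "zero W = \<pi> (%_. 0)"
  and add: "!!x y. x \<in> A ==> y \<in> A ==> \<pi> x \<oplus>\<^bsub>W\<^esub> \<pi> y = \<pi> (%k. x k + y k)"
  and sm: "!!d x. x \<in> A ==> d \<odot>\<^bsub>W\<^esub> \<pi> x = \<pi> (%k. d * x k)"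
 shows "vectorspace class_ring W"
proof (rule vs_criteria)
 note L = lin_closedD[OF A]
 show "field (class_ring :: complex ring)" by (rule class_field)
 show "\<zero>\<^bsub>W\<^esub> \<in> carrier W" using L(1) by (simp add: c z)
 show "\<forall>v\<in>carrier W. \<exists>w\<in>carrier W. v \<oplus>\<^bsub>W\<^esub> w = \<zero>\<^bsub>W\<^esub>"
 proof
  fix v assume "v \<in> carrier W"
  then obtain x where x: "x \<in> A" "v = \<pi> x" by (auto simp: c)
  have m: "(%k. -1 * x k) \<in> A" by (rule L(3)[OF x(1)])
  show "\<exists>w\<in>carrier W. v \<oplus>\<^bsub>W\<^esub> w = \<zero>\<^bsub>W\<^esub>"
   using add[OF x(1) m] m by (intro bexI[of _ "\<pi> (%k. -1 * x k)"]) (simp_all add: c z x(2))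
 qed
qed (use lin_closedD[OF A] in \<open>auto simp: c z add sm class_ring_simps algebra_simps intro!: imageI\<close>)

lemma jacobian_class_eq: "jacobian_class (tq n) (tp n) f = function_coset (toda_ideal n) f"
proof (intro equalityI subsetI)
 fix h assume "h \<in> jacobian_class (tq n) (tp n) f"
 then obtain a where "a \<in> toda_ideal n" "h = (%x. a x + f x)"
  by (auto simp: jacobian_class_def a_r_coset_def' path_algebra_simps)
 then show "h \<in> function_coset (toda_ideal n) f" by (simp add: function_coset_def)
next
 fix h assume "h \<in> function_coset (toda_ideal n) f"
 then have a: "(%x. h x - f x) \<in> toda_ideal n" by (simp add: function_coset_def)
 show "h \<in> jacobian_class (tq n) (tp n) f"
  unfolding jacobian_class_def a_r_coset_def' path_algebra_simps by (rule UN_I[OF a]) simp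
qed

abbreviation "toda_class n \<equiv> jacobian_class (tq n) (tp n)"

lemma toda_class_eq_iff: "toda_class n f = toda_class n g <=> (%x. f x - g x) \<in> toda_ideal n"
 unfolding jacobian_class_eq by (rule function_coset_eq_iff[OF lin_closed_ideal[OF ideal_toda]])

lemma toda_class_mult:
 "f \<in> carrier (path_ring n) ==> g \<in> carrier (path_ring n) ==>
  toda_class n f \<otimes>\<^bsub>toda_algebra n\<^esub> toda_class n g = toda_class n (f \<otimes>\<^bsub>path_ring n\<^esub> g)"
 unfolding jacobian_algebra_def FactRing_def jacobian_class_def
 using ideal.rcoset_mult_add[OF ideal_toda] by simp

lemma toda_class_add: "toda_class n f \<oplus>\<^bsub>toda_algebra n\<^esub> toda_class n g = toda_class n (%x. f x + g x)"
proof -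
 note L = lin_closed_ideal[OF ideal_toda[of n]]
 have "toda_class n f \<oplus>\<^bsub>toda_algebra n\<^esub> toda_class n g = toda_class n f <+>\<^bsub>path_ring n\<^esub> toda_class n g"
  by (simp add: jacobian_algebra_def FactRing_def)
 also have "... = toda_class n (%x. f x + g x)"
  unfolding jacobian_class_eq set_add_def' path_algebra_simps
 proof (intro equalityI subsetI)
  fix u assume "u \<in> (\<Union>h\<in>function_coset (toda_ideal n) f. \<Union>k\<in>function_coset (toda_ideal n) g. {%x. h x + k x})"
  then obtain h k where hk: "(%x. h x - f x) \<in> toda_ideal n" "(%x. k x - g x) \<in> toda_ideal n" "u = (%x. h x + k x)"
   by (auto simp: function_coset_def)
  from lin_closedD(2)[OF L hk(1,2)] show "u \<in> function_coset (toda_ideal n) (%x. f x + g x)"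
   by (simp add: function_coset_def hk(3) algebra_simps)
 next
  fix u assume "u \<in> function_coset (toda_ideal n) (%x. f x + g x)"
  then have u: "(%x. u x - g x) \<in> function_coset (toda_ideal n) f" by (simp add: function_coset_def algebra_simps)
  have g: "g \<in> function_coset (toda_ideal n) g" using lin_closedD(1)[OF L] by (simp add: function_coset_def)
  show "u \<in> (\<Union>h\<in>function_coset (toda_ideal n) f. \<Union>k\<in>function_coset (toda_ideal n) g. {%x. h x + k x})"
   by (rule UN_I[OF u], rule UN_I[OF g]) simp
 qed
 finally show ?thesis .
qed

lemma toda_algebra_carrier: "carrier (toda_algebra n) = toda_class n ` carrier (path_ring n)"
 by (auto simp: jacobian_algebra_def FactRing_def A_RCOSETS_def' jacobian_class_def)

lemma mult_vertex_right: "(f \<otimes>\<^bsub>path_ring n\<^esub> vertex_elem v) (u, r) = (if u = v then f (u, r) else 0)"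
proof -
 have "f (qpath_end (tq n) u (take k r), drop k r) * vertex_elem v (u, take k r) =
   (if k = 0 then (if u = v then f (u, r) else 0) else 0)" if "k \<le> length r" for k
  using that by (auto simp: vertex_elem_def path_elem_def pre_digraph.awalk_verts.simps)
 then have "(f \<otimes>\<^bsub>path_ring n\<^esub> vertex_elem v) (u, r) = (\<Sum>k\<le>length r. if k = 0 then (if u = v then f (u, r) else 0) else 0)"
  unfolding path_mult_apply by (intro sum.cong) auto
 then show ?thesis by simp
qed

lemma mult_vertex_left: "(vertex_elem w \<otimes>\<^bsub>path_ring n\<^esub> f) (u, r) = (if qpath_end (tq n) u r = w then f (u, r) else 0)"
proof -
 have "vertex_elem w (qpath_end (tq n) u (take k r), drop k r) * f (u, take k r) =
   (if k = length r then (if qpath_end (tq n) u r = w then f (u, r) else 0) else 0)" if "k \<le> length r" for k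
  using that by (auto simp: vertex_elem_def path_elem_def)
 then have "(vertex_elem w \<otimes>\<^bsub>path_ring n\<^esub> f) (u, r) =
   (\<Sum>k\<le>length r. if k = length r then (if qpath_end (tq n) u r = w then f (u, r) else 0) else 0)"
  unfolding path_mult_apply by (intro sum.cong) auto
 then show ?thesis by simp
qed

lemma vertex_elem_closed: "v \<in> {1..2*n} ==> vertex_elem v \<in> carrier (path_ring n)"
 unfolding vertex_elem_def by (rule path_elem_closed[of _ _ _ v]) (simp add: toda_awalk_simps)

text \<open>Multiplying by vertex elements on both sides cuts a series down to its paths from
  \<open>v\<close> to \<open>w\<close>, so the classes have representatives in
  \<open>hom_paths\<close>.\<close>

lemma projective_carrier:
 assumes v: "v \<in> {1..2*n}" and w: "w \<in> {1..2*n}"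
 shows "spc (toda_projective n v) w = toda_class n ` hom_paths n v w"
proof -
 note R = ring_path_ring[of n]
 have e: "toda_class n (vertex_elem w) \<otimes>\<^bsub>toda_algebra n\<^esub> toda_class n f \<otimes>\<^bsub>toda_algebra n\<^esub> toda_class n (vertex_elem v) =
   toda_class n (vertex_elem w \<otimes>\<^bsub>path_ring n\<^esub> f \<otimes>\<^bsub>path_ring n\<^esub> vertex_elem v)" if f: "f \<in> carrier (path_ring n)" for f
  using ring.ring_simprules(5)[OF R vertex_elem_closed[OF w] f]
  by (simp add: toda_class_mult f vertex_elem_closed[OF v] vertex_elem_closed[OF w])
 have a: "(vertex_elem w \<otimes>\<^bsub>path_ring n\<^esub> f \<otimes>\<^bsub>path_ring n\<^esub> vertex_elem v) (u, r) =
   (if u = v & qpath_end (tq n) u r = w then f (u, r) else 0)" for f u r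
  by (simp add: mult_vertex_right mult_vertex_left)
 have h: "vertex_elem w \<otimes>\<^bsub>path_ring n\<^esub> f \<otimes>\<^bsub>path_ring n\<^esub> vertex_elem v \<in> hom_paths n v w"
  if "f \<in> carrier (path_ring n)" for f
  unfolding hom_paths_def mem_Collect_eq a
 proof (intro allI impI)
  fix u p assume "(if u = v & qpath_end (tq n) u p = w then f (u, p) else 0) ~= 0"
  then have u: "u = v" "qpath_end (tq n) u p = w" "f (u, p) ~= 0" by (auto split: if_splits)
  then obtain x where x: "toda_awalk n u p x" using \<open>f \<in> carrier (path_ring n)\<close> unfolding path_ring_carrier_iff by blast
  then have "x = w" using toda_awalk_end[OF x] u(2) by simp
  then show "u = v & toda_awalk n v p w" using x u(1) by simp
 qed
 have h': "vertex_elem w \<otimes>\<^bsub>path_ring n\<^esub> f \<otimes>\<^bsub>path_ring n\<^esub> vertex_elem v = f" if "f \<in> hom_paths n v w" for f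
 proof
  fix x :: "nat \<times> toda_arrow list"
  obtain u r where x: "x = (u, r)" by (cases x)
  have "f (u, r) ~= 0 ==> u = v & qpath_end (tq n) u r = w"
   using that toda_awalk_end[of n v r w] by (auto simp: hom_paths_def)
  then show "(vertex_elem w \<otimes>\<^bsub>path_ring n\<^esub> f \<otimes>\<^bsub>path_ring n\<^esub> vertex_elem v) x = f x"
   unfolding x a by auto
 qed
 have "spc (toda_projective n v) w =
   (%f. toda_class n (vertex_elem w) \<otimes>\<^bsub>toda_algebra n\<^esub> toda_class n f \<otimes>\<^bsub>toda_algebra n\<^esub> toda_class n (vertex_elem v)) ` carrier (path_ring n)"
  by (auto simp: projective_rep_def Let_def toda_algebra_carrier)
 also have "... = (%f. toda_class n (vertex_elem w \<otimes>\<^bsub>path_ring n\<^esub> f \<otimes>\<^bsub>path_ring n\<^esub> vertex_elem v)) ` carrier (path_ring n)"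
  by (rule image_cong[OF refl e])
 also have "... = toda_class n ` hom_paths n v w"
 proof (intro equalityI subsetI)
  fix X assume "X \<in> toda_class n ` hom_paths n v w"
  then obtain f where f: "f \<in> hom_paths n v w" "X = toda_class n f" by (rule imageE)
  show "X \<in> (%f. toda_class n (vertex_elem w \<otimes>\<^bsub>path_ring n\<^esub> f \<otimes>\<^bsub>path_ring n\<^esub> vertex_elem v)) ` carrier (path_ring n)"
   by (rule image_eqI[of _ _ f]) (simp_all add: f h' hom_paths_closed[OF f(1)])
 qed (use h in auto)
 finally show ?thesis .
qed

lemma projective_simps:
 "X \<oplus>\<^bsub>rep_space (toda_projective n v) w\<^esub> Y = X \<oplus>\<^bsub>toda_algebra n\<^esub> Y"
 "f \<in> carrier (path_ring n) ==> c \<odot>\<^bsub>rep_space (toda_projective n v) w\<^esub> toda_class n f = toda_class n (%x. c * f x)"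
 "f \<in> carrier (path_ring n) ==> al \<in> arcs (tq n) ==> rep_map (toda_projective n v) al (toda_class n f) =
  toda_class n (arrow_elem (tq n) al \<otimes>\<^bsub>path_ring n\<^esub> f)"
proof -
 note R = ring_path_ring[of n]
 show "X \<oplus>\<^bsub>rep_space (toda_projective n v) w\<^esub> Y = X \<oplus>\<^bsub>toda_algebra n\<^esub> Y"
  by (simp add: projective_rep_def Let_def)
 assume f: "f \<in> carrier (path_ring n)"
 have "(%x. c * \<one>\<^bsub>path_ring n\<^esub> x) \<in> carrier (path_ring n)"
  using ring.ring_simprules(6)[OF R] by (auto simp: path_ring_carrier_iff)
 then show "c \<odot>\<^bsub>rep_space (toda_projective n v) w\<^esub> toda_class n f = toda_class n (%x. c * f x)"
  by (simp add: projective_rep_def Let_def toda_class_mult f path_mult_scale ring.ring_simprules(12)[OF R f])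
 assume al: "al \<in> arcs (tq n)"
 have "arrow_elem (tq n) al \<in> carrier (path_ring n)"
  unfolding arrow_elem_def toda_quiver_simps
  by (rule path_elem_closed[of _ _ _ "toda_head al"]) (use al arrow_verts in \<open>auto simp: toda_awalk_simps\<close>)
 then show "rep_map (toda_projective n v) al (toda_class n f) =
  toda_class n (arrow_elem (tq n) al \<otimes>\<^bsub>path_ring n\<^esub> f)"
  by (simp add: projective_rep_def Let_def toda_class_mult f)
qed

context toda_data
begin

abbreviation "T \<equiv> toda_module n i l1 l2"

text \<open>\<open>lift w g f\<close> is the class of \<open>f\<close> plus the product of
  \<open>g\<close> and \<open>zeta\<close>; letting \<open>g\<close> vary gives the coset
  \<open>proj w f\<close> of the quotient, as a set of classes.\<close>

definition "lift w g f = toda_class n (%x. (g \<otimes>\<^bsub>path_ring n\<^esub> zeta) x + f x)"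
definition "proj w f = (%g. lift w g f) ` hom_paths n (2 * i) w"

lemma lift_add: "lift w g f \<oplus>\<^bsub>toda_algebra n\<^esub> lift w g' f' = lift w (%x. g x + g' x) (%x. f x + f' x)"
 unfolding lift_def toda_class_add path_mult_add by (simp add: algebra_simps)

lemma lift_closed: "g \<in> hom_paths n (2 * i) w ==> f \<in> hom_paths n src w ==>
  (%x. (g \<otimes>\<^bsub>path_ring n\<^esub> zeta) x + f x) \<in> hom_paths n src w"
 by (intro lin_closedD(2)[OF lin_closed_hom_paths] hom_paths_mult[OF _ zeta_hom])

lemma zero_zeta: "(%_. 0) \<otimes>\<^bsub>path_ring n\<^esub> zeta = (%_. 0)"
 using path_mult_scale(1)[where s = 0 and f = zeta and h = zeta] by simp

lemma class_lift: "toda_class n f = lift w (%_. 0) f"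
 by (simp add: lift_def zero_zeta)

lemma image_zeta:
 assumes w: "w \<in> {1..2*n}"
 shows "rep_image (toda_projective n (2 * i)) (%v X. X \<otimes>\<^bsub>toda_algebra n\<^esub> toda_linear_form n i l1 l2) w = proj w (%_. 0)"
proof -
 have z: "toda_linear_form n i l1 l2 = toda_class n zeta" by (simp add: toda_linear_form_def zeta_def)
 have "toda_class n g \<otimes>\<^bsub>toda_algebra n\<^esub> toda_class n zeta = lift w g (%_. 0)" if "g \<in> hom_paths n (2 * i) w" for g
  using hom_paths_closed[OF that] hom_paths_closed[OF zeta_hom] by (simp add: toda_class_mult lift_def)
 then show ?thesis
  unfolding rep_image_def projective_carrier[OF src_vert(2) w] z proj_def image_image by (intro image_cong refl)
qed

lemma proj_eq_iff:
 assumes f: "f \<in> hom_paths n src w" and f': "f' \<in> hom_paths n src w"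
 shows "proj w f = proj w f' <=> (%x. f x - f' x) \<in> kern w"
proof
 note H = lin_closed_hom_paths
 have d: "(%x. f x - f' x) \<in> hom_paths n src w" using lin_closed_diff[OF H f f', of 1] by simp
 {
  assume "proj w f = proj w f'"
  moreover have "lift w (%_. 0) f \<in> proj w f" unfolding proj_def by (rule imageI) (rule lin_closedD(1)[OF H])
  ultimately obtain g where g: "g \<in> hom_paths n (2 * i) w" "lift w (%_. 0) f = lift w g f'" by (auto simp: proj_def)
  then have "(%x. f x - ((g \<otimes>\<^bsub>path_ring n\<^esub> zeta) x + f' x)) \<in> toda_ideal n"
   unfolding lift_def toda_class_eq_iff zero_zeta by simp
  then show "(%x. f x - f' x) \<in> kern w" unfolding kern_def using d g(1)
   by (intro CollectI conjI bexI[of _ g]) (simp_all add: algebra_simps)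
 next
  assume "(%x. f x - f' x) \<in> kern w"
  then obtain g where g: "g \<in> hom_paths n (2 * i) w" "(%x. f x - f' x - (g \<otimes>\<^bsub>path_ring n\<^esub> zeta) x) \<in> toda_ideal n"
   by (auto simp: kern_def)
  have e: "lift w h f = lift w (%x. h x + g x) f'" for h
   unfolding lift_def toda_class_eq_iff path_mult_add using g(2) by (simp add: algebra_simps)
  have e': "lift w h f' = lift w (%x. h x - 1 * g x) f" for h
   unfolding e by simp
  show "proj w f = proj w f'"
  proof (intro equalityI subsetI)
   fix X assume "X \<in> proj w f"
   then obtain h where h: "h \<in> hom_paths n (2 * i) w" "X = lift w h f" by (auto simp: proj_def)
   show "X \<in> proj w f'" unfolding proj_def h(2) e by (rule imageI) (rule lin_closedD(2)[OF H h(1) g(1)])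
  next
   fix X assume "X \<in> proj w f'"
   then obtain h where h: "h \<in> hom_paths n (2 * i) w" "X = lift w h f'" by (auto simp: proj_def)
   show "X \<in> proj w f" unfolding proj_def h(2) e' by (rule imageI) (rule lin_closed_diff[OF H h(1) g(1)])
  qed
 }
qed

lemma proj_coset:
 "w \<in> {1..2*n} ==> proj w (%_. 0) +>\<^bsub>rep_space (toda_projective n src) w\<^esub> toda_class n f = proj w f"
 unfolding a_r_coset_def' proj_def projective_simps class_lift[of f w] by (auto simp: lift_add)

lemma proj_add:
 "set_add (rep_space (toda_projective n src) w) (proj w f) (proj w f') = proj w (%x. f x + f' x)"
proof -
 note H = lin_closed_hom_paths[of n "2 * i" w]
 have "set_add (rep_space (toda_projective n src) w) (proj w f) (proj w f') =
   (\<Union>g\<in>hom_paths n (2 * i) w. \<Union>g'\<in>hom_paths n (2 * i) w. {lift w (%x. g x + g' x) (%x. f x + f' x)})"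
  unfolding set_add_def' proj_def by (simp add: projective_simps(1) lift_add)
 also have "... = proj w (%x. f x + f' x)"
 proof (intro equalityI subsetI)
  fix X assume "X \<in> (\<Union>g\<in>hom_paths n (2 * i) w. \<Union>g'\<in>hom_paths n (2 * i) w. {lift w (%x. g x + g' x) (%x. f x + f' x)})"
  then obtain g g' where g: "g \<in> hom_paths n (2 * i) w" "g' \<in> hom_paths n (2 * i) w"
   "X = lift w (%x. g x + g' x) (%x. f x + f' x)" by auto
  show "X \<in> proj w (%x. f x + f' x)" unfolding proj_def g(3) by (rule imageI) (rule lin_closedD(2)[OF H g(1,2)])
 next
  fix X assume "X \<in> proj w (%x. f x + f' x)"
  then obtain g where g: "g \<in> hom_paths n (2 * i) w" "X = lift w g (%x. f x + f' x)" by (auto simp: proj_def)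
  show "X \<in> (\<Union>g\<in>hom_paths n (2 * i) w. \<Union>g'\<in>hom_paths n (2 * i) w. {lift w (%x. g x + g' x) (%x. f x + f' x)})"
   by (rule UN_I[OF g(1)], rule UN_I[OF lin_closedD(1)[OF H]]) (simp add: g(2))
 qed
 finally show ?thesis .
qed

text \<open>The image of a coset may be too small to be a coset, as for multiplication by 0, so the
  quotient adds the zero coset to it. Here \<open>G\<close> describes the image inside the first
  argument of \<open>lift\<close>, and the sum fills up that argument.\<close>

lemma proj_image:
 assumes c: "!!g. g \<in> hom_paths n (2 * i) v ==> F (lift v g f) = lift w (G g) f'"
  "!!g. g \<in> hom_paths n (2 * i) v ==> G g \<in> hom_paths n (2 * i) w" and w: "w \<in> {1..2*n}"
 shows "set_add (rep_space (toda_projective n src) w) (proj w (%_. 0)) (F ` proj v f) = proj w f'"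
proof -
 note H = lin_closed_hom_paths
 have F: "F ` proj v f = (%g. lift w (G g) f') ` hom_paths n (2 * i) v"
  unfolding proj_def image_image by (rule image_cong[OF refl c(1)])
 have "set_add (rep_space (toda_projective n src) w) (proj w (%_. 0)) (F ` proj v f) =
   (\<Union>g\<in>hom_paths n (2 * i) w. \<Union>g'\<in>hom_paths n (2 * i) v. {lift w (%x. g x + G g' x) f'})"
  unfolding set_add_def' F unfolding proj_def by (simp add: projective_simps(1) lift_add)
 also have "... = proj w f'"
 proof (intro equalityI subsetI)
  fix X assume "X \<in> (\<Union>g\<in>hom_paths n (2 * i) w. \<Union>g'\<in>hom_paths n (2 * i) v. {lift w (%x. g x + G g' x) f'})"
  then obtain g g' where g: "g \<in> hom_paths n (2 * i) w" "g' \<in> hom_paths n (2 * i) v"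
   "X = lift w (%x. g x + G g' x) f'" by auto
  show "X \<in> proj w f'" unfolding proj_def g(3) by (rule imageI) (rule lin_closedD(2)[OF H g(1) c(2)[OF g(2)]])
 next
  fix X assume "X \<in> proj w f'"
  then obtain g where g: "g \<in> hom_paths n (2 * i) w" "X = lift w g f'" by (auto simp: proj_def)
  have z: "(%_. 0) \<in> hom_paths n (2 * i) v" by (rule lin_closedD(1)[OF H])
  have "(%x. g x - 1 * G (%_. 0) x) \<in> hom_paths n (2 * i) w" by (rule lin_closed_diff[OF H g(1) c(2)[OF z]])
  then show "X \<in> (\<Union>g\<in>hom_paths n (2 * i) w. \<Union>g'\<in>hom_paths n (2 * i) v. {lift w (%x. g x + G g' x) f'})"
   by (rule UN_I, intro UN_I[OF z]) (simp add: g(2))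
 qed
 finally show ?thesis .
qed

text \<open>This expresses the operations of the quotient through representatives, so that later
  proofs handle only series of paths.\<close>

lemma toda_module_simps:
 assumes w: "w \<in> {1..2*n}"
 shows "spc T w = proj w ` hom_paths n src w"
  and "zero (rep_space T w) = proj w (%_. 0)"
  and "proj w f \<oplus>\<^bsub>rep_space T w\<^esub> proj w f' = proj w (%x. f x + f' x)"
  and "f \<in> hom_paths n src w ==> c \<odot>\<^bsub>rep_space T w\<^esub> proj w f = proj w (%x. c * f x)"
proof -
 let ?P = "toda_projective n src"
 have U: "rep_image (toda_projective n (2 * i)) (%v X. X \<otimes>\<^bsub>toda_algebra n\<^esub> toda_linear_form n i l1 l2) w = proj w (%_. 0)"
  by (rule image_zeta[OF w])
 show "spc T w = proj w ` hom_paths n src w"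
  unfolding toda_module_def rep_cokernel_def quotient_rep_def
  by (simp add: U A_RCOSETS_def' projective_carrier[OF src_vert(1) w] proj_coset[OF w] image_image UNION_singleton_eq_range)
 show "zero (rep_space T w) = proj w (%_. 0)"
  unfolding toda_module_def rep_cokernel_def quotient_rep_def by (simp add: U)
 show "proj w f \<oplus>\<^bsub>rep_space T w\<^esub> proj w f' = proj w (%x. f x + f' x)"
  unfolding toda_module_def rep_cokernel_def quotient_rep_def by (simp add: proj_add)
 assume f: "f \<in> hom_paths n src w"
 have "c \<odot>\<^bsub>rep_space T w\<^esub> proj w f =
   set_add (rep_space ?P w) (proj w (%_. 0)) ((%x. c \<odot>\<^bsub>rep_space ?P w\<^esub> x) ` proj w f)"
  unfolding toda_module_def rep_cokernel_def quotient_rep_def by (simp add: U)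
 also have "... = proj w (%x. c * f x)"
 proof (rule proj_image[where G = "%g x. c * g x", OF _ _ w])
  fix g assume g: "g \<in> hom_paths n (2 * i) w"
  show "c \<odot>\<^bsub>rep_space ?P w\<^esub> lift w g f = lift w (%x. c * g x) (%x. c * f x)"
   unfolding lift_def using projective_simps(2)[OF hom_paths_closed[OF lift_closed[OF g f]]]
   by (simp add: path_mult_scale algebra_simps)
  show "(%x. c * g x) \<in> hom_paths n (2 * i) w" by (rule lin_closedD(3)[OF lin_closed_hom_paths g])
 qed
 finally show "c \<odot>\<^bsub>rep_space T w\<^esub> proj w f = proj w (%x. c * f x)" .
qed

lemma toda_module_map:
 assumes al: "al \<in> arcs (tq n)" and f: "f \<in> hom_paths n src (toda_tail al)"
 shows "rep_map T al (proj (toda_tail al) f) = proj (toda_head al) (arrow_elem (tq n) al \<otimes>\<^bsub>path_ring n\<^esub> f)"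
proof -
 let ?P = "toda_projective n src" and ?A = "arrow_elem (tq n) al"
 note w = arrow_verts[OF al]
 have "rep_map T al (proj (toda_tail al) f) =
   set_add (rep_space ?P (toda_head al)) (proj (toda_head al) (%_. 0)) (rep_map ?P al ` proj (toda_tail al) f)"
  unfolding toda_module_def rep_cokernel_def quotient_rep_def by (simp add: image_zeta[OF w(2)])
 also have "... = proj (toda_head al) (?A \<otimes>\<^bsub>path_ring n\<^esub> f)"
 proof (rule proj_image[where G = "%g. ?A \<otimes>\<^bsub>path_ring n\<^esub> g", OF _ _ w(2)])
  fix g assume g: "g \<in> hom_paths n (2 * i) (toda_tail al)"
  show "rep_map ?P al (lift (toda_tail al) g f) = lift (toda_head al) (?A \<otimes>\<^bsub>path_ring n\<^esub> g) (?A \<otimes>\<^bsub>path_ring n\<^esub> f)"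
   unfolding lift_def projective_simps(3)[OF hom_paths_closed[OF lift_closed[OF g f]] al] path_mult_add path_mult_assoc ..
  show "?A \<otimes>\<^bsub>path_ring n\<^esub> g \<in> hom_paths n (2 * i) (toda_head al)" by (rule hom_paths_mult[OF arrow_hom[OF al] g])
 qed
 finally show ?thesis .
qed

lemma representation_toda_module: "representation (tq n) T"
 unfolding representation_def toda_quiver_simps
proof (intro conjI ballI)
 fix v assume v: "v \<in> {1..2*n}"
 show "vectorspace class_ring (rep_space T v)"
  by (rule vectorspace_fun_image[OF lin_closed_hom_paths[of n src v] toda_module_simps(1,2,3,4)[OF v]])
next
 fix al assume al: "al \<in> arcs (tq n)"
 note w = arrow_verts[OF al] and H = lin_closed_hom_paths
 have h: "arrow_elem (tq n) al \<otimes>\<^bsub>path_ring n\<^esub> f \<in> hom_paths n src (toda_head al)"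
  if "f \<in> hom_paths n src (toda_tail al)" for f by (rule hom_paths_mult[OF arrow_hom[OF al] that])
 show "rep_map T al \<in> module_hom class_ring (rep_space T (toda_tail al)) (rep_space T (toda_head al))"
  unfolding module_hom_def toda_module_simps(1)[OF w(1)] toda_module_simps(1)[OF w(2)]
  by (auto simp: toda_module_map[OF al] toda_module_simps(3,4)[OF w(1)] toda_module_simps(3,4)[OF w(2)]
    lin_closedD[OF H] h path_mult_add path_mult_scale intro!: imageI)
qed

text \<open>A coset is sent to the value of \<open>rho\<close> at a representative chosen by
  \<open>SOME\<close>. \<open>rho_kern\<close> gives independence of the choice,
  \<open>kern_rho\<close> injectivity and \<open>rho_surj\<close> surjectivity.\<close>

theorem toda_module_iso:
 obtains h where "h \<in> rep_hom (tq n) T M"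
  "!!v. v \<in> {1..2*n} ==> bij_betw (h v) (spc T v) (spc M v)"
proof -
 define h where "h w X = rho w (SOME f. f \<in> hom_paths n src w & proj w f = X)" for w X
 note H = lin_closed_hom_paths
 have hp: "h w (proj w f) = rho w f" if f: "f \<in> hom_paths n src w" for w f
 proof -
  define f' where "f' = (SOME f'. f' \<in> hom_paths n src w & proj w f' = proj w f)"
  have f': "f' \<in> hom_paths n src w & proj w f' = proj w f"
   unfolding f'_def by (rule someI[of _ f]) (simp add: f)
  then have "(%x. f' x - f x) \<in> kern w" using proj_eq_iff[of f' w f] f by simp
  then have "rho w (%x. f' x - f x) = (%_. 0)" by (rule rho_kern)
  moreover have "rho w f' = (%k. rho w (%x. f' x - f x) k + rho w f k)" unfolding rho_lin(1)[symmetric] by simp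
  ultimately show ?thesis by (simp add: h_def f'_def)
 qed
 have "bij_betw (h v) (spc T v) (spc M v)" if v: "v \<in> {1..2*n}" for v
  unfolding bij_betw_def
 proof
  show "inj_on (h v) (spc T v)"
  proof (rule inj_onI)
   fix X Y assume "X \<in> spc T v" "Y \<in> spc T v" and e: "h v X = h v Y"
   then obtain f g where fg: "f \<in> hom_paths n src v" "g \<in> hom_paths n src v" "X = proj v f" "Y = proj v g"
    by (auto simp: toda_module_simps(1)[OF v])
   have d: "(%x. f x - g x) \<in> hom_paths n src v" using lin_closed_diff[OF H fg(1,2), of 1] by simp
   have "rho v f = (%k. rho v (%x. f x - g x) k + rho v g k)" unfolding rho_lin(1)[symmetric] by simp
   then have "rho v (%x. f x - g x) = (%_. 0)" using e fg by (auto simp: hp fun_eq_iff)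
   then have "(%x. f x - g x) \<in> kern v" by (rule kern_rho[OF d])
   then show "X = Y" using proj_eq_iff[OF fg(1,2)] fg(3,4) by simp
  qed
  show "h v ` spc T v = spc M v"
  proof (intro equalityI subsetI)
   fix \<phi> assume "\<phi> \<in> spc M v"
   then have "\<phi> \<in> strip n i (level v)" by simp
   then obtain f where f: "f \<in> hom_paths n src v" "rho v f = \<phi>" by (rule rho_surj[OF v])
   show "\<phi> \<in> h v ` spc T v" unfolding toda_module_simps(1)[OF v]
    by (intro image_eqI[of _ _ "proj v f"] imageI) (simp_all add: hp f)
  qed (auto simp: toda_module_simps(1)[OF v] hp rho_closed)
 qed
 moreover have "h \<in> rep_hom (tq n) T M"
  unfolding rep_hom_def toda_quiver_simps
 proof (intro CollectI conjI ballI)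
  fix v assume v: "v \<in> {1..2*n}"
  show "h v \<in> module_hom class_ring (rep_space T v) (rep_space M v)"
   unfolding module_hom_def toda_module_simps(1)[OF v]
   by (auto simp: toda_module_simps(3,4)[OF v] hp rho_closed rho_lin lin_closedD[OF H])
 next
  fix al X assume al: "al \<in> arcs (tq n)" and "X \<in> spc T (toda_tail al)"
  then obtain f where f: "f \<in> hom_paths n src (toda_tail al)" "X = proj (toda_tail al) f"
   using arrow_verts(1)[OF al] by (auto simp: toda_module_simps(1))
  show "h (toda_head al) (rep_map T al X) = rep_map M al (h (toda_tail al) X)"
   unfolding f(2) toda_module_map[OF al f(1)] hp[OF f(1)] hp[OF hom_paths_mult[OF arrow_hom[OF al] f(1)]]
   by (simp add: rho_arrow[OF al f(1)])
 qed
 ultimately show thesis using that by blast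
qed

end


section \<open>Submodules of the model and the cluster character\<close>

text \<open>The truncated shift is one nilpotent Jordan block, so its invariant subspaces form a
  chain. The shift of a vector with highest position \<open>p\<close> has highest position
  \<open>p - 1\<close>; by induction it yields all lower unit functions, and subtracting these from
  the vector leaves a multiple of the one at \<open>p\<close>.\<close>

lemma shift_closed_flag:
 fixes U :: "univ set"
 assumes L: "lin_closed U" and sub: "!!\<phi> k. \<phi> \<in> U ==> \<phi> k ~= 0 ==> a < k & k \<le> b"
  and sh: "!!\<phi>. \<phi> \<in> U ==> (%p. if a < p then \<phi> (p + 1) else 0) \<in> U" and ab: "a \<le> b"
 obtains N where "a \<le> N" "N \<le> b" "U = {\<phi>. ALL k. \<phi> k ~= 0 --> k \<in> {a<..N}}"
proof -
 have span: "\<psi> \<in> U" if s: "!!k. \<psi> k ~= 0 ==> k \<in> {a<..p}" and u: "!!q. q \<in> {a<..p} ==> unit_fun q \<in> U" for \<psi> p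
 proof -
  have "(%k. \<Sum>q\<in>{a<..p}. \<psi> q * unit_fun q k) \<in> U"
   by (intro lin_closed_sum[OF L] lin_closedD(3)[OF L] u) auto
  moreover have "(\<Sum>q\<in>{a<..p}. \<psi> q * unit_fun q k) = \<psi> k" for k
  proof -
   have "(\<Sum>q\<in>{a<..p}. \<psi> q * unit_fun q k) = (\<Sum>q\<in>{a<..p}. if q = k then \<psi> k else 0)"
    by (intro sum.cong) (auto simp: unit_fun_def)
   also have "... = (if k \<in> {a<..p} then \<psi> k else 0)" by simp
   also have "... = \<psi> k" using s[of k] by auto
   finally show ?thesis .
  qed
  ultimately show ?thesis by simp
 qed
 have units: "unit_fun q \<in> U"
  if "\<phi> \<in> U" "\<phi> p ~= 0" "!!k. p < k ==> \<phi> k = 0" "q \<in> {a<..p}" for p \<phi> q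
  using that
 proof (induction p arbitrary: \<phi> q)
  case 0
  then show ?case by simp
 next
  case (Suc p)
  have ap: "a < Suc p" using sub[OF Suc.prems(1,2)] by simp
  have low: "unit_fun r \<in> U" if r: "r \<in> {a<..p}" for r
  proof (rule Suc.IH[OF sh[OF Suc.prems(1)] _ _ r])
   show "(if a < p then \<phi> (p + 1) else 0) ~= 0" using r Suc.prems(2) by (simp add: Suc_eq_plus1)
   show "(if a < k then \<phi> (k + 1) else 0) = 0" if "p < k" for k using Suc.prems(3)[of "k + 1"] that by simp
  qed
  have "(%k. \<phi> k - 1 * (if k \<le> p then \<phi> k else 0)) \<in> U"
  proof (rule lin_closed_diff[OF L Suc.prems(1)], rule span[of _ p])
   show "k \<in> {a<..p}" if "(if k \<le> p then \<phi> k else 0) ~= 0" for k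
    using that sub[OF Suc.prems(1), of k] by (auto split: if_splits)
  qed (rule low)
  then have "(%k. inverse (\<phi> (Suc p)) * (\<phi> k - 1 * (if k \<le> p then \<phi> k else 0))) \<in> U"
   by (rule lin_closedD(3)[OF L])
  moreover have "(%k. inverse (\<phi> (Suc p)) * (\<phi> k - 1 * (if k \<le> p then \<phi> k else 0))) = unit_fun (Suc p)"
  proof
   fix k
   have "k \<le> p \<or> k = Suc p \<or> Suc p < k" by arith
   then show "inverse (\<phi> (Suc p)) * (\<phi> k - 1 * (if k \<le> p then \<phi> k else 0)) = unit_fun (Suc p) k"
    using Suc.prems(2,3) by (auto simp: unit_fun_def)
  qed
  ultimately have top: "unit_fun (Suc p) \<in> U" by simp
  show ?case
  proof (cases "q = Suc p")
   case True
   then show ?thesis using top by simp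
  next
   case False
   then show ?thesis using low[of q] Suc.prems(4) by simp
  qed
 qed
 define P where "P = {p. \<exists>\<phi>\<in>U. \<phi> p ~= 0}"
 have Pb: "P \<subseteq> {a<..b}" using sub by (auto simp: P_def)
 show thesis
 proof (cases "P = {}")
  case True
  have "U = {%_. 0}"
  proof (intro equalityI subsetI)
   fix \<phi> assume "\<phi> \<in> U"
   then have "\<phi> k = 0" for k using True by (auto simp: P_def)
   then show "\<phi> \<in> {%_. 0}" by auto
  qed (use lin_closedD(1)[OF L] in simp)
  then show thesis using that[of a] ab by (simp add: fun_eq_iff set_eq_iff)
 next
  case False
  have fP: "finite P" using Pb finite_subset by blast
  define N where "N = Max P"
  have N: "N \<in> P" "!!p. p \<in> P ==> p \<le> N" using fP False by (simp_all add: N_def)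
  obtain \<phi> where \<phi>: "\<phi> \<in> U" "\<phi> N ~= 0" using N(1) by (auto simp: P_def)
  have u: "unit_fun q \<in> U" if "q \<in> {a<..N}" for q
  proof (rule units[OF \<phi> _ that])
   fix k assume "N < k"
   then have "k \<notin> P" using N(2)[of k] by auto
   then show "\<phi> k = 0" using \<phi>(1) by (auto simp: P_def)
  qed
  have "U = {\<phi>. ALL k. \<phi> k ~= 0 --> k \<in> {a<..N}}"
  proof (intro equalityI subsetI)
   fix \<psi> assume \<psi>: "\<psi> \<in> U"
   have "k \<in> {a<..N}" if "\<psi> k ~= 0" for k
   proof -
    have "k \<in> P" using \<psi> that by (auto simp: P_def)
    then show ?thesis using N(2)[of k] Pb by auto
   qed
   then show "\<psi> \<in> {\<phi>. ALL k. \<phi> k ~= 0 --> k \<in> {a<..N}}" by simp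
  next
   fix \<psi> :: univ assume "\<psi> \<in> {\<phi>. ALL k. \<phi> k ~= 0 --> k \<in> {a<..N}}"
   then have s: "k \<in> {a<..N}" if "\<psi> k ~= 0" for k using that by simp
   show "\<psi> \<in> U" by (rule span[OF s u])
  qed
  then show thesis using that[of N] N(1) Pb by auto
 qed
qed

lemma grassmannian_image:
 fixes V :: "(complex, 'a) module" and W :: "(complex, 'b) module"
 assumes V: "vectorspace class_ring V" and W: "vectorspace class_ring W" and T: "T \<in> module_hom class_ring V W"
  and inj: "inj_on T (carrier V)" and S: "S \<in> grassmannian V k"
 shows "T ` S \<in> grassmannian W k"
proof -
 have sub: "VectorSpace.subspace class_ring S V" and fd: "vectorspace.fin_dim class_ring (V\<lparr>carrier := S\<rparr>)"
  and d: "vectorspace.dim class_ring (V\<lparr>carrier := S\<rparr>) = k"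
  using S by (simp_all add: grassmannian_def)
 have subW: "VectorSpace.subspace class_ring (T ` S) W" by (rule subspace_image[OF V W T sub])
 have vS: "vectorspace class_ring (V\<lparr>carrier := S\<rparr>)" by (rule vectorspace.subspace_is_vs[OF V sub])
 have vT: "vectorspace class_ring (W\<lparr>carrier := T ` S\<rparr>)" by (rule vectorspace.subspace_is_vs[OF W subW])
 have SV: "S \<subseteq> carrier V" using sub by (simp add: VectorSpace.subspace_def submodule_def)
 have "T \<in> module_hom class_ring (V\<lparr>carrier := S\<rparr>) (W\<lparr>carrier := T ` S\<rparr>)"
  using T SV by (auto simp: module_hom_def subset_iff)
 moreover have "bij_betw T (carrier (V\<lparr>carrier := S\<rparr>)) (carrier (W\<lparr>carrier := T ` S\<rparr>))"
  using inj_on_subset[OF inj SV] by (simp add: bij_betw_def)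
 ultimately show ?thesis
  using linear_bij_dim[OF vS vT _ _ fd] subW d by (simp add: grassmannian_def)
qed

lemma subrep_cong:
 assumes s: "subrep (tq n) X U" and e: "!!v. v \<in> {1..2*n} ==> U v = U' v"
 shows "subrep (tq n) X U'"
 unfolding subrep_def toda_quiver_simps
proof (intro conjI ballI)
 fix v assume "v \<in> {1..2*n}"
 then show "VectorSpace.subspace class_ring (U' v) (rep_space X v)"
  using s e[of v, symmetric] by (simp add: subrep_def)
next
 fix al assume al: "al \<in> arcs (tq n)"
 then show "rep_map X al ` U' (toda_tail al) \<subseteq> U' (toda_head al)"
  using s e[OF arrow_verts(1)[OF al], symmetric] e[OF arrow_verts(2)[OF al], symmetric] by (simp add: subrep_def)
qed

context toda_data
begin

definition flag :: "nat => nat => univ set" where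
 "flag w d = {\<phi>. ALL k. \<phi> k ~= 0 --> k \<in> {lo n i (level w)<..lo n i (level w) + d}}"

lemma flagD: "\<phi> \<in> flag w d ==> \<phi> k ~= 0 ==> lo n i (level w) < k & k \<le> lo n i (level w) + d"
 by (simp add: flag_def)

lemma flagI: "(!!k. \<phi> k ~= 0 ==> lo n i (level w) < k & k \<le> lo n i (level w) + d) ==> \<phi> \<in> flag w d"
 by (simp add: flag_def)

lemma unit_in_flag: "unit_fun k \<in> flag w d <=> lo n i (level w) < k & k \<le> lo n i (level w) + d"
 by (auto simp: flag_def unit_fun_def)

lemma lin_closed_flag: "lin_closed (flag w d)"
 unfolding lin_closed_def
proof (intro conjI ballI allI)
 show "(%k. x k + y k) \<in> flag w d" if "x \<in> flag w d" "y \<in> flag w d" for x y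
 proof (rule flagI)
  fix k assume "x k + y k ~= 0"
  then have "x k ~= 0 \<or> y k ~= 0" by auto
  then show "lo n i (level w) < k & k \<le> lo n i (level w) + d" using flagD that by blast
 qed
 show "(%k. c * x k) \<in> flag w d" if "x \<in> flag w d" for c x
  by (rule flagI) (use flagD[OF that] in auto)
qed (simp add: flag_def)

lemma dim_flag:
 "vectorspace.fin_dim class_ring (fun_space (flag w d))" "vectorspace.dim class_ring (fun_space (flag w d)) = d"
 using dim_fun_space_support[of "{lo n i (level w)<..lo n i (level w) + d}"] by (simp_all add: flag_def)

lemma flag_subset_strip: "lo n i (level w) + d \<le> i ==> lo n i (level w) + d \<le> level w ==> flag w d \<subseteq> strip n i (level w)"
 by (auto intro!: stripI dest!: flagD)

text \<open>A step down, a letter and the step up again act as the truncated shift times the scalar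
  of the letter, which is chosen nonzero. One more letter, before or after, closes the circuit at
  the given vertex. At level 1 there is no step down, but the strip has a single position and the
  shift is zero.\<close>

lemma subrep_model_shift:
 assumes U: "subrep (tq n) M U" and w: "w \<in> {1..2*n}" and \<phi>: "\<phi> \<in> U w"
 shows "(%p. if lo n i (level w) < p then \<phi> (p + 1) else 0) \<in> U w"
proof -
 obtain y where y: "val y ~= 0" using coef_nonzero by blast
 have arr: "mu al \<psi> \<in> U (toda_head al)" if "al \<in> arcs (tq n)" "\<psi> \<in> U (toda_tail al)" for al \<psi>
  using U that by (auto simp: subrep_def)
 have sub: "U v \<subseteq> strip n i (level v)" "lin_closed (U v)" if "v \<in> {1..2*n}" for v
  using U that by (auto simp: subrep_def subspace_fun_space_iff[OF lin_closed_strip])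
 have low: "lo n i 1 = 0" using i by (simp add: lo_def)
 have one: "\<psi> (p + 1) = 0" if "\<psi> \<in> strip n i 1" "0 < p" for \<psi> p
  using stripD[OF that(1), of "p + 1"] that(2) by auto
 \<comment> \<open>The round trip through level \<open>j - 1\<close>, from the even to the odd
   vertex of level \<open>j\<close>.\<close>
 have down: "(%p. if lo n i j < p then val y * \<psi> (p + 1) else 0) \<in> U (2 * j - 1)"
  if j: "2 \<le> j" "j \<le> n" and \<psi>: "\<psi> \<in> U (2 * j)" for j \<psi>
 proof -
  have jj: "1 \<le> j - 1" "j - 1 \<le> n" "j - 1 < n" using j by auto
  have "mu (step False j) \<psi> \<in> U (2 * (j - 1) - 1)"
   using arr[of "step False j" \<psi>] j \<psi> toda_head_step[of j False] by (simp add: can_step_def next_level_def)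
  then have "mu (letter y (j - 1)) (mu (step False j) \<psi>) \<in> U (2 * (j - 1))"
   using arr[of "letter y (j - 1)"] j jj by simp
  then have "mu (step True (j - 1)) (mu (letter y (j - 1)) (mu (step False j) \<psi>)) \<in> U (2 * j - 1)"
   using arr[of "step True (j - 1)"] j jj toda_head_step[of "j - 1" True] by (simp add: can_step_def next_level_def)
  moreover have "mu (step True (j - 1)) (mu (letter y (j - 1)) (mu (step False j) \<psi>)) =
    (%p. if lo n i j < p then val y * \<psi> (p + 1) else 0)"
   using j by (auto simp: model_map_step model_map_letter fun_eq_iff lo_def)
  ultimately show ?thesis by simp
 qed
 show ?thesis
 proof (rule vertex_cases[OF w])
  fix j assume wj: "w = 2 * j - 1" and j: "1 \<le> j" "j \<le> n"
  have lw: "level w = j" using wj j by simp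
  show ?thesis
  proof (cases "j = 1")
   case True
   have "(%p. if lo n i (level w) < p then \<phi> (p + 1) else 0) = (%_. 0)"
    using one[of \<phi>] sub(1)[OF w] \<phi> low unfolding lw True by (auto simp: fun_eq_iff)
   then show ?thesis using lin_closedD(1)[OF sub(2)[OF w]] by simp
  next
   case False
   have "mu (letter y j) \<phi> \<in> U (2 * j)" using arr[of "letter y j" \<phi>] \<phi> wj j by simp
   then have "(%p. if lo n i j < p then val y * mu (letter y j) \<phi> (p + 1) else 0) \<in> U w"
    using down[of j] j False wj by simp
   then have "(%p. inverse (val y * val y) * (if lo n i j < p then val y * mu (letter y j) \<phi> (p + 1) else 0)) \<in> U w"
    by (rule lin_closedD(3)[OF sub(2)[OF w]])
   moreover have "(%p. inverse (val y * val y) * (if lo n i j < p then val y * mu (letter y j) \<phi> (p + 1) else 0)) =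
     (%p. if lo n i (level w) < p then \<phi> (p + 1) else 0)"
    unfolding lw using y by (auto simp: model_map_letter fun_eq_iff field_simps)
   ultimately show ?thesis by simp
  qed
 next
  fix j assume wj: "w = 2 * j" and j: "1 \<le> j" "j \<le> n"
  have lw: "level w = j" using wj by simp
  show ?thesis
  proof (cases "j = 1")
   case True
   have "(%p. if lo n i (level w) < p then \<phi> (p + 1) else 0) = (%_. 0)"
    using one[of \<phi>] sub(1)[OF w] \<phi> low unfolding lw True by (auto simp: fun_eq_iff)
   then show ?thesis using lin_closedD(1)[OF sub(2)[OF w]] by simp
  next
   case False
   have "(%p. if lo n i j < p then val y * \<phi> (p + 1) else 0) \<in> U (2 * j - 1)"
    using down[of j \<phi>] j False wj \<phi> by simp
   then have "mu (letter y j) (%p. if lo n i j < p then val y * \<phi> (p + 1) else 0) \<in> U w"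
    using arr[of "letter y j"] wj j by simp
   then have "(%p. inverse (val y * val y) * mu (letter y j) (%p. if lo n i j < p then val y * \<phi> (p + 1) else 0) p) \<in> U w"
    by (rule lin_closedD(3)[OF sub(2)[OF w]])
   moreover have "(%p. inverse (val y * val y) * mu (letter y j) (%p. if lo n i j < p then val y * \<phi> (p + 1) else 0) p) =
     (%p. if lo n i (level w) < p then \<phi> (p + 1) else 0)"
    unfolding lw using y by (auto simp: model_map_letter fun_eq_iff field_simps)
   ultimately show ?thesis by simp
  qed
 qed
qed

lemma subrep_model_flag:
 assumes U: "subrep (tq n) M U" and w: "w \<in> {1..2*n}" and g: "U w \<in> grassmannian (rep_space M w) d"
 shows "U w = flag w d & lo n i (level w) + d \<le> i & lo n i (level w) + d \<le> level w"
proof -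
 let ?a = "lo n i (level w)"
 have sub: "U w \<subseteq> strip n i (level w)" "lin_closed (U w)"
  using U w by (auto simp: subrep_def subspace_fun_space_iff[OF lin_closed_strip])
 have "level w \<le> n" "1 \<le> level w" using w by (auto simp: level_def)
 then have ab: "?a \<le> min i (level w)" using i by (auto simp: lo_def)
 obtain N where N: "?a \<le> N" "N \<le> min i (level w)" "U w = {\<phi>. ALL k. \<phi> k ~= 0 --> k \<in> {?a<..N}}"
 proof (rule shift_closed_flag[OF sub(2) _ subrep_model_shift[OF U w] ab])
  show "?a < k & k \<le> min i (level w)" if "\<phi> \<in> U w" "\<phi> k ~= 0" for \<phi> k
   using stripD[of \<phi> n i "level w" k] sub(1) that by auto
 qed blast
 have f: "U w = flag w (N - ?a)" using N(1) unfolding N(3) flag_def by simp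
 have "d = N - ?a" using g dim_flag(2)[of w "N - ?a"] by (simp add: grassmannian_def f)
 then show ?thesis using f N by simp
qed

text \<open>Each inequality between dimensions is tested on the unit function at the highest
  position of a flag, whose image under the arrow must stay in the next flag.\<close>

lemma flag_admissible:
 assumes s: "subrep (tq n) M (%w. flag w (e w))"
  and b: "!!w. w \<in> {1..2*n} ==> lo n i (level w) + e w \<le> i & lo n i (level w) + e w \<le> level w"
 shows "admissible n i e"
 unfolding admissible_def
proof (intro allI impI)
 fix m assume m: "1 \<le> m & m \<le> n"
 obtain y where y: "val y ~= 0" using coef_nonzero by blast
 have arr: "mu al \<psi> \<in> flag (toda_head al) (e (toda_head al))" if "al \<in> arcs (tq n)" "\<psi> \<in> flag (toda_tail al) (e (toda_tail al))" for al \<psi>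
  using s that by (auto simp: subrep_def)
 have 1: "e (2 * m - 1) \<le> e (2 * m)"
 proof (cases "e (2 * m - 1) = 0")
  case False
  let ?N = "lo n i m + e (2 * m - 1)"
  have "mu (letter y m) (unit_fun ?N) \<in> flag (2 * m) (e (2 * m))"
   using arr[of "letter y m" "unit_fun ?N"] m False by (simp add: unit_in_flag)
  moreover have "mu (letter y m) (unit_fun ?N) ?N ~= 0" using y by (simp add: model_map_letter unit_fun_def)
  ultimately have "?N \<le> lo n i (level (2 * m)) + e (2 * m)" using flagD by blast
  then show ?thesis by simp
 qed simp
 have 2: "lo n i m + e (2 * m) \<le> i" "lo n i m + e (2 * m) \<le> m" using b[of "2 * m"] m by simp_all
 have 3: "lo n i m + e (2 * m) \<le> lo n i (m + 1) + e (2 * m + 1)" if mn: "m < n"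
 proof (rule ccontr)
  let ?N = "lo n i m + e (2 * m)"
  assume "~ ?N \<le> lo n i (m + 1) + e (2 * m + 1)"
  then have N: "lo n i (m + 1) + e (2 * m + 1) < ?N" by simp
  have "lo n i m \<le> lo n i (m + 1)" by (simp add: lo_def)
  then have "unit_fun ?N \<in> flag (2 * m) (e (2 * m))" using N by (simp add: unit_in_flag)
  moreover have "2 * next_level True m - 1 = 2 * m + 1" by (simp add: next_level_def)
  ultimately have "mu (step True m) (unit_fun ?N) \<in> flag (2 * m + 1) (e (2 * m + 1))"
   using arr[of "step True m" "unit_fun ?N"] m mn toda_head_step[of m True] by (simp add: can_step_def)
  moreover have "mu (step True m) (unit_fun ?N) ?N ~= 0" using N by (simp add: model_map_step unit_fun_def)
  ultimately have "?N \<le> lo n i (level (2 * m + 1)) + e (2 * m + 1)" using flagD by blast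
  then show False using N by (simp add: level_odd)
 qed
 have 4: "lo n i (m + 1) + e (2 * m + 2) \<le> lo n i m + e (2 * m - 1) + 1" if mn: "m < n"
 proof (rule ccontr)
  let ?N = "lo n i (m + 1) + e (2 * m + 2)"
  assume "~ ?N \<le> lo n i m + e (2 * m - 1) + 1"
  then have N: "lo n i m + e (2 * m - 1) + 1 < ?N" by simp
  have e2: "2 * (m + 1) = 2 * m + 2" by simp
  have "lo n i (m + 1) \<le> lo n i m + 1" by (simp add: lo_def)
  moreover have "level (2 * m + 2) = m + 1" by (simp add: level_def)
  ultimately have "unit_fun ?N \<in> flag (2 * (m + 1)) (e (2 * (m + 1)))" using N unfolding unit_in_flag e2 by simp
  moreover have "next_level False (m + 1) = m" by (simp add: next_level_def)
  ultimately have "mu (step False (m + 1)) (unit_fun ?N) \<in> flag (2 * m - 1) (e (2 * m - 1))"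
   using arr[of "step False (m + 1)" "unit_fun ?N"] m mn toda_head_step[of "m + 1" False] by (simp add: can_step_def)
  moreover have "mu (step False (m + 1)) (unit_fun ?N) (?N - 1) ~= 0" using N by (simp add: model_map_step unit_fun_def)
  ultimately have "?N - 1 \<le> lo n i (level (2 * m - 1)) + e (2 * m - 1)" using flagD by blast
  then show False using N m by simp
 qed
 show "e (2 * m - 1) \<le> e (2 * m) & lo n i m + e (2 * m) \<le> i & lo n i m + e (2 * m) \<le> m &
  (m < n --> lo n i m + e (2 * m) \<le> lo n i (m + 1) + e (2 * m + 1) &
    lo n i (m + 1) + e (2 * m + 2) \<le> lo n i m + e (2 * m - 1) + 1)"
  using 1 2 3 4 by blast
qed

lemma admissible_flag:
 assumes a: "admissible n i e"
 shows "subrep (tq n) M (%w. flag w (e w))"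
 unfolding subrep_def toda_quiver_simps
proof (intro conjI ballI)
 have adm: "e (2 * m - 1) \<le> e (2 * m)" "lo n i m + e (2 * m) \<le> i" "lo n i m + e (2 * m) \<le> m"
   "m < n ==> lo n i m + e (2 * m) \<le> lo n i (m + 1) + e (2 * m + 1)"
   "m < n ==> lo n i (m + 1) + e (2 * m + 2) \<le> lo n i m + e (2 * m - 1) + 1"
  if "1 \<le> m" "m \<le> n" for m using a that unfolding admissible_def by blast+
 {
  fix w assume w: "w \<in> {1..2*n}"
  have "lo n i (level w) + e w \<le> i & lo n i (level w) + e w \<le> level w"
  proof (rule vertex_cases[OF w])
   fix j assume "w = 2 * j - 1" "1 \<le> j" "j \<le> n"
   then show ?thesis using adm(1,2,3)[of j] by simp
  next
   fix j assume "w = 2 * j" "1 \<le> j" "j \<le> n"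
   then show ?thesis using adm(2,3)[of j] by simp
  qed
  then show "VectorSpace.subspace class_ring (flag w (e w)) (rep_space M w)"
   using flag_subset_strip[of w "e w"] by (simp add: subspace_fun_space_iff[OF lin_closed_strip] lin_closed_flag)
 next
  fix al assume al: "al \<in> arcs (tq n)"
  show "rep_map M al ` flag (toda_tail al) (e (toda_tail al)) \<subseteq> flag (toda_head al) (e (toda_head al))"
  proof (rule image_subsetI)
   fix \<psi> assume \<psi>: "\<psi> \<in> flag (toda_tail al) (e (toda_tail al))"
   show "rep_map M al \<psi> \<in> flag (toda_head al) (e (toda_head al))"
   proof (rule arrow_cases[of al])
    fix x j assume l: "al = letter x j"
    then have j: "1 \<le> j" "j \<le> n" using al by simp_all
    show ?thesis
    proof (rule flagI)
     fix k assume "rep_map M al \<psi> k ~= 0"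
     then have "\<psi> k ~= 0" using l by (simp add: model_map_letter)
     then show "lo n i (level (toda_head al)) < k & k \<le> lo n i (level (toda_head al)) + e (toda_head al)"
      using flagD[OF \<psi>, of k] l j adm(1)[OF j] by simp
    qed
   next
    fix d j assume s: "al = step d j"
    then have j: "1 \<le> j" "j \<le> n" "can_step n d j" using al by simp_all
    have h: "toda_head al = 2 * next_level d j - 1" using s toda_head_step[OF j(1)] by simp
    have nl: "1 \<le> next_level d j" using next_level_range[OF j(3,1,2)] by simp
    have lh: "level (toda_head al) = next_level d j" using h nl by simp
    have lt: "toda_tail al = 2 * j" "level (toda_tail al) = j" using s by simp_all
    show ?thesis
    proof (rule flagI)
     fix k assume k: "rep_map M al \<psi> k ~= 0"
     show "lo n i (level (toda_head al)) < k & k \<le> lo n i (level (toda_head al)) + e (toda_head al)"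
     proof (cases d)
      case True
      have "lo n i (j + 1) < k" "\<psi> k ~= 0" using k s True by (auto simp: model_map_step split: if_splits)
      moreover have nj: "2 * next_level d j - 1 = 2 * j + 1" "next_level d j = j + 1" and "j < n"
       using True j(3) by (auto simp: next_level_def can_step_def)
      ultimately show ?thesis using flagD[OF \<psi>, of k] lt adm(4)[OF j(1,2)] unfolding lh unfolding h unfolding nj(1) unfolding nj(2) by simp
     next
      case False
      have 1: "lo n i (j - 1) < k" "\<psi> (k + 1) ~= 0" using k s False by (auto simp: model_map_step split: if_splits)
      have 2: "next_level d j = j - 1" "1 \<le> j - 1" "j - 1 < n" "j - 1 + 1 = j" "2 * (j - 1) + 2 = 2 * j"
       using False j by (auto simp: next_level_def can_step_def)
      show ?thesis using flagD[OF \<psi>, of "k + 1"] 1 lt adm(5)[of "j - 1"] 2 unfolding lh unfolding h by simp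
     qed
    qed
   qed
  qed
 }
qed

text \<open>Carried over to the model, a submodule is a flag at every vertex and thus determined by
  its dimension vector. So a nonempty Grassmannian is a single point.\<close>

lemma toda_module_grassmannian:
 assumes e: "e \<in> {1..2*n} \<rightarrow>\<^sub>E UNIV"
 shows "quiver_grassmannian (tq n) T e ~= {} <=> admissible n i e"
  and "admissible n i e ==> euler_characteristic (quiver_grassmannian_topology (tq n) T e) = 1"
proof -
 let ?Q = "toda_quiver n"
 obtain h where h: "h \<in> rep_hom ?Q T M"
  and hb: "!!v. v \<in> {1..2*n} ==> bij_betw (h v) (spc T v) (spc M v)"
  using toda_module_iso by blast
 obtain k where k: "k \<in> rep_hom ?Q M T"
  and kb: "!!v. v \<in> {1..2*n} ==> bij_betw (k v) (spc M v) (spc T v)"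
  using rep_iso_inverse[OF representation_toda_module representation_model h hb] by blast
 note RT = representation_toda_module and RM = representation_model[of n i l1 l2]
 note VT = representation_vectorspace[OF RT] and VM = representation_vectorspace[OF RM]
 have img: "h v ` U v = flag v (e v) & lo n i (level v) + e v \<le> i & lo n i (level v) + e v \<le> level v"
  if U: "U \<in> quiver_grassmannian ?Q T e" and v: "v \<in> {1..2*n}" for U v
 proof -
  have s: "subrep ?Q M (%v. h v ` U v)"
   by (rule subrep_image[OF RT RM h]) (use U in \<open>simp add: quiver_grassmannian_def\<close>)
  have "U v \<in> grassmannian (rep_space T v) (e v)" using U v by (auto simp: quiver_grassmannian_def)
  then have "h v ` U v \<in> grassmannian (rep_space M v) (e v)"
   using hb[OF v] by (intro grassmannian_image[OF VT[OF v] VM[OF v] rep_homD(1)[OF h v]]) (auto simp: bij_betw_def)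
  from subrep_model_flag[OF s v this] show ?thesis .
 qed
 have adm: "admissible n i e" if U: "U \<in> quiver_grassmannian ?Q T e" for U
 proof (rule flag_admissible)
  have s: "subrep ?Q M (%v. h v ` U v)"
   by (rule subrep_image[OF RT RM h]) (use U in \<open>simp add: quiver_grassmannian_def\<close>)
  show "subrep ?Q M (%w. flag w (e w))"
   by (rule subrep_cong[OF s]) (use img[OF U] in blast)
 qed (use img[OF U] in blast)
 have ne: "quiver_grassmannian ?Q T e ~= {}" if a: "admissible n i e"
 proof -
  let ?U = "\<lambda>v\<in>{1..2*n}. k v ` flag v (e v)"
  note s = admissible_flag[OF a]
  have "subrep ?Q T ?U"
   by (rule subrep_cong[OF subrep_image[OF RM RT k s]]) simp
  moreover have "?U v \<in> grassmannian (rep_space T v) (e v)" if v: "v \<in> {1..2*n}" for v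
  proof -
   have "flag v (e v) \<in> grassmannian (rep_space M v) (e v)"
    using s v dim_flag[of v "e v"] by (simp add: grassmannian_def subrep_def)
   then have "k v ` flag v (e v) \<in> grassmannian (rep_space T v) (e v)"
    using kb[OF v] by (intro grassmannian_image[OF VM[OF v] VT[OF v] rep_homD(1)[OF k v]]) (auto simp: bij_betw_def)
   then show ?thesis using v by simp
  qed
  ultimately have "?U \<in> quiver_grassmannian ?Q T e" by (simp add: quiver_grassmannian_def)
  then show ?thesis by blast
 qed
 show "quiver_grassmannian ?Q T e ~= {} <=> admissible n i e" using adm ne by blast
 assume a: "admissible n i e"
 obtain U where U: "U \<in> quiver_grassmannian ?Q T e" using ne[OF a] by blast
 have "U' = U" if U': "U' \<in> quiver_grassmannian ?Q T e" for U'
 proof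
  fix v
  show "U' v = U v"
  proof (cases "v \<in> {1..2*n}")
   case True
   have c: "X v \<subseteq> spc T v" if "X \<in> quiver_grassmannian ?Q T e" for X
   proof -
    have "X v \<in> grassmannian (rep_space T v) (e v)" using that True by (auto simp: quiver_grassmannian_def)
    then show ?thesis by (simp add: grassmannian_def VectorSpace.subspace_def submodule_def)
   qed
   have "h v ` U' v = h v ` U v" using img[OF U' True] img[OF U True] by simp
   then show ?thesis using inj_on_image_eq_iff[OF bij_betw_imp_inj_on[OF hb[OF True]] c[OF U'] c[OF U]] by simp
  next
   case False
   then show ?thesis using U U' by (auto simp: quiver_grassmannian_def PiE_def extensional_def)
  qed
 qed
 then have "quiver_grassmannian ?Q T e = {U}" using U by blast
 then have "topspace (quiver_grassmannian_topology ?Q T e) = {U}"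
  using topspace_quiver_grassmannian[of ?Q T e] VT by simp
 then show "euler_characteristic (quiver_grassmannian_topology ?Q T e) = 1" by (rule euler_characteristic_point)
qed

lemma cluster_character_toda_module:
 "cluster_character (tq n) (tp n) T =
  laurent_monomial (Poly_Mapping.single (2 * top_level - 1) 1 - Poly_Mapping.single (2 * top_level) 1) *
  (\<Sum>e\<in>{e \<in> {1..2*n} \<rightarrow>\<^sub>E UNIV. admissible n i e}. \<Prod>j\<in>{1..2*n}. y_variable (tq n) j ^ e j)"
proof -
 obtain h where h: "h \<in> rep_hom (tq n) T M"
  and hb: "!!v. v \<in> {1..2*n} ==> bij_betw (h v) (spc T v) (spc M v)"
  using toda_module_iso by blast
 have "neg_coind (tq n) (tp n) T =
   Poly_Mapping.single (2 * top_level - 1) 1 - Poly_Mapping.single (2 * top_level) 1"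
  by (rule neg_coind_iso[OF h representation_toda_module hb])
 moreover have "{e \<in> verts (tq n) \<rightarrow>\<^sub>E UNIV. quiver_grassmannian (tq n) T e ~= {}} =
   {e \<in> {1..2*n} \<rightarrow>\<^sub>E UNIV. admissible n i e}"
  unfolding toda_quiver_simps by (intro Collect_cong conj_cong refl toda_module_grassmannian(1))
 moreover have "(\<Sum>e\<in>{e \<in> {1..2*n} \<rightarrow>\<^sub>E UNIV. admissible n i e}.
    of_int (euler_characteristic (quiver_grassmannian_topology (tq n) T e)) *
    (\<Prod>j\<in>{1..2*n}. y_variable (tq n) j ^ e j)) =
   (\<Sum>e\<in>{e \<in> {1..2*n} \<rightarrow>\<^sub>E UNIV. admissible n i e}. \<Prod>j\<in>{1..2*n}. y_variable (tq n) j ^ e j)"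
  by (intro sum.cong refl) (simp add: toda_module_grassmannian(2))
 ultimately show ?thesis unfolding cluster_character_def by (simp only: toda_quiver_simps)
qed

end

lemma prod_levels:
 fixes f :: "nat => 'a :: comm_monoid_mult"
 shows "(\<Prod>j\<in>{1..2*n}. f j) = (\<Prod>m=1..n. f (2 * m - 1) * f (2 * m))"
proof (induction n)
 case (Suc n)
 have "{1..2 * Suc n} = insert (2 * n + 1) (insert (2 * n + 2) {1..2 * n})" by auto
 then have "(\<Prod>j\<in>{1..2 * Suc n}. f j) = f (2 * n + 1) * (f (2 * n + 2) * (\<Prod>j\<in>{1..2*n}. f j))" by simp
 moreover have "2 * Suc n - 1 = 2 * n + 1" "2 * Suc n = 2 * n + 2" by simp_all
 ultimately show ?case using Suc by (simp add: mult_ac)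
qed simp

theorem theorem2p14:
  fixes n i :: nat and l1 l2 :: complex
  assumes "1 \<le> n" and "1 \<le> i" and "i \<le> n" and "(l1, l2) \<noteq> (0, 0)"
  shows "toda_hamiltonian n i =
    cluster_character (toda_quiver n) (toda_potential n) (toda_module n i l1 l2)"
proof -
  interpret toda_data n i l1 l2 by unfold_locales (rule assms)+
  let ?y = "y_variable (toda_quiver n)"
  have "toda_hamiltonian n i = toda_prefactor n ^ i *
      ((\<Prod>m=1..n. (?y (2 * m - 1) * ?y (2 * m)) ^ lo n i m) *
       (\<Sum>e\<in>{e \<in> {1..2*n} \<rightarrow>\<^sub>E UNIV. admissible n i e}. \<Prod>m=1..n. ?y (2 * m - 1) ^ e (2 * m - 1) * ?y (2 * m) ^ e (2 * m)))"
    unfolding toda_hamiltonian_def trace_exterior_power_toda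
    by (subst toda_weight_sum[where Y = "\<lambda>m. ?y (2 * m - 1)" and Z = "\<lambda>m. ?y (2 * m)", OF assms(2,3)]) (rule refl)
  \<comment> \<open>The coindex monomial is expanded back into the power of the prefactor and the
    powers with exponents \<open>lo\<close>, the factors split off from the trace.\<close>
  also have "\<dots> = cluster_character (toda_quiver n) (toda_potential n) (toda_module n i l1 l2)"
    unfolding cluster_character_toda_module prefactor_identity[OF assms(2,3), symmetric] prod_levels mult.assoc ..
  finally show ?thesis .
qed

end
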